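(* Let $\mathcal V$ be a conformal Poisson vertex superalgebra (PVA) over a field $\mathbb F$ of characteristic $0$ which, as a differential superalgebra, is a superalgebra of differential polynomials in finitely many even or odd variables with positive (rational, or real if $\mathbb R\subset\mathbb F$) conformal weights. Let $M$ be a conformal $\mathcal V$-module which is finitely generated as a module over the differential superalgebra $\mathcal V$. Then $\dim H^n_{\mathrm{PV}}(\mathcal V,M)<\infty$ for all $n\ge0$.
   Context: $\mathbb F$ is a field of characteristic $0$. All superspaces are over $\mathbb F$, with parity $p$; $\bar p=1-p$ is the opposite parity. Formulas with signs are for parity-homogeneous elements. LCA: a Lie conformal superalgebra is a superspace $R$ with an even endomorphism $\partial$ and a parity-preserving bilinear map $R\otimes R\to R[\lambda]$, $a\otimes b\mapsto[a_\lambda b]$ ($\lambda$ even), with $[\partial a_\lambda b]=-\lambda[a_\lambda b]$, $[a_\lambda\partial b]=(\lambda+\partial)[a_\lambda b]$, $[a_\lambda b]=-(-1)^{p(a)p(b)}[b_{-\lambda-\partial}a]$ ($\partial$ acting from the left on coefficients), $[a_\lambda[b_\mu c]]-(-1)^{p(a)p(b)}[b_\mu[a_\lambda c]]=[[a_\lambda b]_{\lambda+\mu}c]$. An LCA module is a superspace $M$ with an even endomorphism $\partial$ and a parity-preserving bilinear map $R\otimes M\to M[\lambda]$, $a\otimes m\mapsto a_\lambda m$, with $(\partial a)_\lambda m=-\lambda a_\lambda m$, $a_\lambda(\partial m)=(\lambda+\partial)(a_\lambda m)$, $a_\lambda(b_\mu m)-(-1)^{p(a)p(b)}b_\mu(a_\lambda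 m)=[a_\lambda b]_{\lambda+\mu}m$. PVA: a commutative (in the super sense) associative unital superalgebra $\mathcal V$ with an even derivation $\partial$ and an LCA $\lambda$-bracket satisfying $[a_\lambda bc]=[a_\lambda b]c+(-1)^{p(b)p(c)}[a_\lambda c]b$. A PVA module $M$ is a module over the differential superalgebra $\mathcal V$ and over the LCA $\mathcal V$ (same $\partial$) with $a_\lambda(bm)=[a_\lambda b]m+(-1)^{p(a)p(b)}b(a_\lambda m)$ and $(ab)_\lambda m=(e^{\partial\partial_\lambda}a)(b_\lambda m)+(-1)^{p(a)p(b)}(e^{\partial\partial_\lambda}b)(a_\lambda m)$, where $(e^{\partial\partial_\lambda}a)P(\lambda)=\sum_{k\ge0}\frac1{k!}(\partial^ka)\frac{d^kP}{d\lambda^k}$. Variational PVA complex: $C^n_{\mathrm{PV}}(\mathcal V,M)$, $n\ge0$, is the superspace of linear maps $Y:\mathcal V^{\otimes n}\to M[\lambda_1,\dots,\lambda_n]/\langle\partial+\lambda_1+\cdots+\lambda_n\rangle$ ($\langle\Phi\rangle$ = image of $\Phi$), with parity $\bar p(Y)$ given by $\bar p(Y(a_1\otimes\cdots\otimes a_n))=\bar p(Y)+\sum\bar p(a_i)$, satisfying: sesquilinearity $Y_{\lambda_1,\dots,\lambda_n}(\cdots\otimes\partial a_i\otimes\cdots)=-\lambda_iY_{\lambda_1,\dots,\lambda_n}(\cdots\otimes a_i\otimes\cdots)$; symmetry: $Y$ is multiplied by $(-1)^{\bar p(a_i)\bar p(a_{i+1})}$ when $a_i,a_{i+1}$ and $\lambda_i,\lambda_{i+1}$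 are simultaneously interchanged; Leibniz rules $Y(\cdots\otimes b_ic_i\otimes\cdots)=(-1)^{p(b_i)s_i}(e^{\partial\partial_{\lambda_i}}b_i)Y(\cdots\otimes c_i\otimes\cdots)+(-1)^{p(c_i)(p(b_i)+s_i)}(e^{\partial\partial_{\lambda_i}}c_i)Y(\cdots\otimes b_i\otimes\cdots)$, $s_i=\bar p(Y)+\bar p(a_1)+\dots+\bar p(a_{i-1})$. In particular $C^0_{\mathrm{PV}}=M/\partial M$. The differential $d:C^n_{\mathrm{PV}}\to C^{n+1}_{\mathrm{PV}}$, $d^2=0$, is $$(dY)_{\lambda_0,\dots,\lambda_n}(a_0\otimes\cdots\otimes a_n)=\sum_{i=0}^n(-1)^{\gamma_i}{a_i}_{\lambda_i}Y_{\lambda_0,\overset{i}{\check\dots},\lambda_n}(a_0\otimes\overset{i}{\check\cdots}\otimes a_n)+\sum_{i<j}(-1)^{\gamma_{ij}}Y_{\lambda_i+\lambda_j,\lambda_0,\overset{i}{\check\dots}\overset{j}{\check\dots},\lambda_n}([{a_i}_{\lambda_i}a_j]\otimes a_0\otimes\overset{i}{\check\cdots}\overset{j}{\check\cdots}\otimes a_n),$$ with $\check{}$ meaning omission, $\gamma_i=\bar p(a_i)(\bar p(Y)+\bar p(a_0)+\dots+\bar p(a_{i-1})+1)+1$, $\gamma_{ij}=\bar p(Y)+\bar p(a_i)(\bar p(a_0)+\dots+\bar p(a_{i-1})+1)+\bar p(a_j)(\bar p(a_0)+\overset{i}{\check\dots}+\bar p(a_{j-1}))$. $H^n_{\mathrm{PV}}(\mathcal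 V,M)=\ker(d|_{C^n_{\mathrm{PV}}})/d(C^{n-1}_{\mathrm{PV}})$. Superalgebra of differential polynomials in variables $u_1,\dots,u_N$: the free supercommutative unital superalgebra on variables $u_i^{(k)}$ ($1\le i\le N$, $k\ge0$, $u_i^{(k)}$ of the parity of $u_i$) with $\partial u_i^{(k)}=u_i^{(k+1)}$. Conformal: $\mathcal V$ is conformal if it is endowed with an even element $L$ (Virasoro element) such that $[L_\lambda L]=(\partial+2\lambda)L+\frac c{12}\lambda^3$ for some $c\in\mathbb F$, $L_{(0)}:=[L_\lambda\,\cdot\,]|_{\lambda=0}=\partial$, and $L_{(1)}:=\frac d{d\lambda}[L_\lambda\,\cdot\,]|_{\lambda=0}$ is diagonalizable on $\mathcal V$. An element $a$ has conformal weight $\Delta(a)\in\mathbb F$ if $L_{(1)}a=\Delta(a)a$; the hypothesis on the variables means each variable $u_i$ is an $L_{(1)}$-eigenvector with positive eigenvalue. A $\mathcal V$-module $M$ is conformal if $(L_\lambda\,\cdot\,)|_{\lambda=0}=\partial$ on $M$ and $\frac d{d\lambda}(L_\lambda\,\cdot\,)|_{\lambda=0}$ is diagonalizable on $M$. $M$ is finitely generated over the differential superalgebra $\mathcal V$ if there are $m_1,\dots,m_r\in M$ such that the elements $\partial^km_j$ span $M$ as a module over the algebra $\mathcal V$. *)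

theory Defs
  imports
    Complex_Main
    "HOL-Library.Z2"
    "HOL-Library.Poly_Mapping"
    "HOL-Computational_Algebra.Polynomial"
begin

section \<open>Superspaces\<close>

text \<open>
  Parities are elements of the two-element field \<^typ>\<open>bit\<close>; thus the opposite parity
  \<open>1 - p\<close> is \<open>p + 1\<close>, and the exponents of signs are computed modulo 2.
\<close>

definition psign :: "bit \<Rightarrow> 'a::ab_group_add \<Rightarrow> 'a" where
  "psign p x = (if p = 0 then x else - x)"

locale superspace = vector_space scale
  for scale :: "'f::field_char_0 \<Rightarrow> 'v::ab_group_add \<Rightarrow> 'v" +
  fixes part :: "bit \<Rightarrow> 'v set"
  assumes subspace_part: "subspace (part p)"
    and decomposition: "\<exists>!x. x \<in> part 0 \<and> v - x \<in> part 1"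
begin

definition component :: "bit \<Rightarrow> 'v \<Rightarrow> 'v" where
  "component p v = (THE x. x \<in> part p \<and> v - x \<in> part (p + 1))"

definition even_endo :: "('v \<Rightarrow> 'v) \<Rightarrow> bool" where
  "even_endo D \<longleftrightarrow> (\<forall>x y. D (x + y) = D x + D y) \<and> (\<forall>r x. D (scale r x) = scale r (D x))
     \<and> (\<forall>p. \<forall>x\<in>part p. D x \<in> part p)"

end


section \<open>Lie conformal superalgebras and their modules\<close>

text \<open>
  An element of \<open>R[\<lambda>]\<close> is an element of \<^typ>\<open>'v poly\<close>; multiplication by \<open>\<lambda>\<close> is
  \<open>pCons 0\<close>. The next operator is \<open>\<lambda> + D\<close>, with \<open>D\<close> acting on coefficients.
\<close>

definition lam_plus :: "('m::ab_group_add \<Rightarrow> 'm) \<Rightarrow> 'm poly \<Rightarrow> 'm poly" where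
  "lam_plus D P = pCons 0 P + map_poly D P"

text \<open>The substitution \<open>\<lambda> := - \<lambda> - D\<close>, with \<open>D\<close> acting from the left on the coefficients.\<close>

definition subst_skew :: "('m::ab_group_add \<Rightarrow> 'm) \<Rightarrow> 'm poly \<Rightarrow> 'm poly" where
  "subst_skew D P = (\<Sum>k\<le>degree P. ((\<lambda>Q. - lam_plus D Q) ^^ k) [:coeff P k:])"

text \<open>
  The (Jacobi) identities involve \<open>\<lambda>\<close> and \<open>\<mu>\<close> and are stated as equality of the coefficients
  of \<open>\<lambda>\<^sup>i \<mu>\<^sup>j\<close>; on the right-hand side \<open>(\<lambda> + \<mu>)\<^sup>l\<close> is expanded by the binomial theorem.
\<close>

locale lca = superspace scale part
  for scale :: "'f::field_char_0 \<Rightarrow> 'v::ab_group_add \<Rightarrow> 'v" and part :: "bit \<Rightarrow> 'v set" +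
  fixes D :: "'v \<Rightarrow> 'v" and br :: "'v \<Rightarrow> 'v \<Rightarrow> 'v poly"
  assumes D_even: "even_endo D"
    and br_add_left: "br (a + b) c = br a c + br b c"
    and br_add_right: "br a (b + c) = br a b + br a c"
    and br_scale_left: "br (scale r a) b = map_poly (scale r) (br a b)"
    and br_scale_right: "br a (scale r b) = map_poly (scale r) (br a b)"
    and br_part: "\<lbrakk>a \<in> part p; b \<in> part q\<rbrakk> \<Longrightarrow> coeff (br a b) k \<in> part (p + q)"
    and br_D_left: "br (D a) b = - pCons 0 (br a b)"
    and br_D_right: "br a (D b) = lam_plus D (br a b)"
    and br_skew: "\<lbrakk>a \<in> part p; b \<in> part q\<rbrakk> \<Longrightarrow> br a b = - psign (p * q) (subst_skew D (br b a))"
    and br_jacobi: "\<lbrakk>a \<in> part p; b \<in> part q\<rbrakk> \<Longrightarrow>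
        coeff (br a (coeff (br b c) j)) i - psign (p * q) (coeff (br b (coeff (br a c) i)) j)
        = (\<Sum>k\<le>i. scale (of_nat ((i - k + j) choose j))
                       (coeff (br (coeff (br a b) k) c) (i - k + j)))"

locale lca_module = lca scale part D br + M: superspace scaleM partM
  for scale :: "'f::field_char_0 \<Rightarrow> 'v::ab_group_add \<Rightarrow> 'v" and part :: "bit \<Rightarrow> 'v set"
    and D :: "'v \<Rightarrow> 'v" and br :: "'v \<Rightarrow> 'v \<Rightarrow> 'v poly"
    and scaleM :: "'f \<Rightarrow> 'm::ab_group_add \<Rightarrow> 'm" and partM :: "bit \<Rightarrow> 'm set" +
  fixes DM :: "'m \<Rightarrow> 'm" and act :: "'v \<Rightarrow> 'm \<Rightarrow> 'm poly"
  assumes DM_even: "M.even_endo DM"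
    and act_add_left: "act (a + b) m = act a m + act b m"
    and act_add_right: "act a (m + m') = act a m + act a m'"
    and act_scale_left: "act (scale r a) m = map_poly (scaleM r) (act a m)"
    and act_scale_right: "act a (scaleM r m) = map_poly (scaleM r) (act a m)"
    and act_part: "\<lbrakk>a \<in> part p; m \<in> partM q\<rbrakk> \<Longrightarrow> coeff (act a m) k \<in> partM (p + q)"
    and act_D_left: "act (D a) m = - pCons 0 (act a m)"
    and act_D_right: "act a (DM m) = lam_plus DM (act a m)"
    and act_jacobi: "\<lbrakk>a \<in> part p; b \<in> part q\<rbrakk> \<Longrightarrow>
        coeff (act a (coeff (act b m) j)) i - psign (p * q) (coeff (act b (coeff (act a m) i)) j)
        = (\<Sum>k\<le>i. scaleM (of_nat ((i - k + j) choose j))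
                       (coeff (act (coeff (br a b) k) m) (i - k + j)))"


section \<open>Poisson vertex superalgebras\<close>

locale pva = lca scale part D br
  for scale :: "'f::field_char_0 \<Rightarrow> 'v::ring_1 \<Rightarrow> 'v" and part :: "bit \<Rightarrow> 'v set"
    and D :: "'v \<Rightarrow> 'v" and br :: "'v \<Rightarrow> 'v \<Rightarrow> 'v poly" +
  assumes scale_mult_left: "scale r (a * b) = scale r a * b"
    and scale_mult_right: "scale r (a * b) = a * scale r b"
    and one_part: "1 \<in> part 0"
    and mult_part: "\<lbrakk>a \<in> part p; b \<in> part q\<rbrakk> \<Longrightarrow> a * b \<in> part (p + q)"
    and mult_supercomm: "\<lbrakk>a \<in> part p; b \<in> part q\<rbrakk> \<Longrightarrow> a * b = psign (p * q) (b * a)"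
    and D_mult: "D (a * b) = D a * b + a * D b"
    and br_leibniz: "\<lbrakk>b \<in> part q; c \<in> part s\<rbrakk> \<Longrightarrow>
        br a (b * c) = map_poly (\<lambda>x. x * c) (br a b) + psign (q * s) (map_poly (\<lambda>x. x * b) (br a c))"
begin

text \<open>
  Freeness is stated by presentation: the free supercommutative superalgebra on the variables
  \<open>(i, k)\<close>, \<open>i < N\<close>, standing for \<open>u\<^sub>i\<^sup>(\<^sup>k\<^sup>)\<close>, is the free associative algebra (with the words in the
  variables as basis) modulo the two-sided ideal generated by all
  \<open>x y - (- 1)\<^bsup>p(x) p(y)\<^esup> y x\<close>, and evaluation \<open>(i, k) \<mapsto> D\<^sup>k u\<^sub>i\<close> must induce an isomorphism of
  this quotient onto the given superalgebra.
\<close>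

definition free_eval :: "(nat \<Rightarrow> 'v) \<Rightarrow> ((nat \<times> nat) list \<Rightarrow>\<^sub>0 'f) \<Rightarrow> 'v" where
  "free_eval u f = (\<Sum>w\<in>Poly_Mapping.keys f.
     scale (Poly_Mapping.lookup f w) (prod_list (map (\<lambda>(i, k). (D ^^ k) (u i)) w)))"

definition differential_polynomials :: "nat \<Rightarrow> (nat \<Rightarrow> bit) \<Rightarrow> (nat \<Rightarrow> 'v) \<Rightarrow> bool" where
  "differential_polynomials N par u \<longleftrightarrow>
     (\<forall>i<N. u i \<in> part (par i)) \<and>
     (let X = {..<N} \<times> UNIV;
          free = {f. \<forall>w\<in>Poly_Mapping.keys f. set w \<subseteq> X};
          relations = {Poly_Mapping.single (v @ [x, y] @ w) 1
                         - psign (par (fst x) * par (fst y)) (Poly_Mapping.single (v @ [y, x] @ w) 1)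
                       | v x y w. set v \<subseteq> X \<and> x \<in> X \<and> y \<in> X \<and> set w \<subseteq> X}
      in free_eval u ` free = UNIV \<and>
         {f \<in> free. free_eval u f = 0} = module.span (\<lambda>r. Poly_Mapping.map ((*) r)) relations)"

definition virasoro_element :: "'v \<Rightarrow> bool" where
  "virasoro_element L \<longleftrightarrow> L \<in> part 0 \<and>
     (\<exists>c. br L L = [: D L, scale 2 L, 0, scale (c / 12) 1 :]) \<and>
     (\<forall>a. coeff (br L a) 0 = D a) \<and>
     span {a. \<exists>\<Delta>. coeff (br L a) 1 = scale \<Delta> a} = UNIV"

definition has_conformal_weight :: "'v \<Rightarrow> 'v \<Rightarrow> 'f \<Rightarrow> bool" where
  "has_conformal_weight L a \<Delta> \<longleftrightarrow> coeff (br L a) 1 = scale \<Delta> a"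

end

text \<open>
  Positivity of scalars in a field of characteristic 0: all of them are positive rationals, or they
  are positive reals for some realisation of the reals as a subfield.
\<close>

definition positive_scalars :: "'f::field_char_0 set \<Rightarrow> bool" where
  "positive_scalars S \<longleftrightarrow>
     (\<forall>x\<in>S. \<exists>r::rat. r > 0 \<and> x = of_rat r) \<or>
     (\<exists>\<iota>::real \<Rightarrow> 'f. \<iota> 1 = 1 \<and> (\<forall>r s. \<iota> (r + s) = \<iota> r + \<iota> s) \<and> (\<forall>r s. \<iota> (r * s) = \<iota> r * \<iota> s)
        \<and> (\<forall>x\<in>S. \<exists>r>0. x = \<iota> r))"

type_synonym 'a mpoly = "(nat \<Rightarrow>\<^sub>0 nat) \<Rightarrow>\<^sub>0 'a"
type_synonym ('v, 'm) cochain = "'v list \<Rightarrow> 'm mpoly set"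

locale pva_module = pva scale part D br + lca_module scale part D br scaleM partM DM act
  for scale :: "'f::field_char_0 \<Rightarrow> 'v::ring_1 \<Rightarrow> 'v" and part :: "bit \<Rightarrow> 'v set"
    and D :: "'v \<Rightarrow> 'v" and br :: "'v \<Rightarrow> 'v \<Rightarrow> 'v poly"
    and scaleM :: "'f \<Rightarrow> 'm::ab_group_add \<Rightarrow> 'm" and partM :: "bit \<Rightarrow> 'm set"
    and DM :: "'m \<Rightarrow> 'm" and act :: "'v \<Rightarrow> 'm \<Rightarrow> 'm poly" +
  fixes dot :: "'v \<Rightarrow> 'm \<Rightarrow> 'm"
  assumes dot_add_left: "dot (a + b) m = dot a m + dot b m"
    and dot_add_right: "dot a (m + m') = dot a m + dot a m'"
    and dot_scale_left: "dot (scale r a) m = scaleM r (dot a m)"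
    and dot_scale_right: "dot a (scaleM r m) = scaleM r (dot a m)"
    and dot_part: "\<lbrakk>a \<in> part p; m \<in> partM q\<rbrakk> \<Longrightarrow> dot a m \<in> partM (p + q)"
    and dot_one: "dot 1 m = m"
    and dot_mult: "dot (a * b) m = dot a (dot b m)"
    and dot_D: "DM (dot a m) = dot (D a) m + dot a (DM m)"
    and act_dot: "\<lbrakk>a \<in> part p; b \<in> part q\<rbrakk> \<Longrightarrow>
        act a (dot b m) = (\<Sum>k\<le>degree (br a b). monom (dot (coeff (br a b) k) m) k)
                          + psign (p * q) (map_poly (dot b) (act a m))"
    and act_mult: "\<lbrakk>a \<in> part p; b \<in> part q\<rbrakk> \<Longrightarrow>
        (let exp_D = (\<lambda>a P. \<Sum>j\<le>degree P. \<Sum>k\<le>j.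
               monom (scaleM (of_nat (j choose k)) (dot ((D ^^ k) a) (coeff P j))) (j - k))
         in act (a * b) m = exp_D a (act b m) + psign (p * q) (exp_D b (act a m)))"
         \<comment> \<open>\<open>exp_D a P\<close> is \<open>(e\<^bsup>\<partial>\<partial>\<^sub>\<lambda>\<^esup> a) P\<close>, since \<open>1/k! d\<^sup>k/d\<lambda>\<^sup>k \<lambda>\<^sup>j = (j choose k) \<lambda>\<^bsup>j-k\<^esup>\<close>\<close>
begin

definition conformal_module :: "'v \<Rightarrow> bool" where
  "conformal_module L \<longleftrightarrow>
     (\<forall>m. coeff (act L m) 0 = DM m) \<and>
     M.span {m. \<exists>\<Delta>. coeff (act L m) 1 = scaleM \<Delta> m} = UNIV"

definition differentially_finitely_generated :: bool where
  "differentially_finitely_generated \<longleftrightarrow>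
     (\<exists>r (g :: nat \<Rightarrow> 'm). \<forall>m. \<exists>K (a :: nat \<Rightarrow> nat \<Rightarrow> 'v).
        m = (\<Sum>j<r. \<Sum>k\<le>K. dot (a j k) ((DM ^^ k) (g j))))"


section \<open>Polynomials in several variables with coefficients in the module\<close>

text \<open>
  Polynomials with coefficients in \<open>M\<close> are finitely supported maps on exponents. Variables
  and tensor factors are numbered from 0, so a cochain with \<open>n\<close> arguments takes values in
  \<open>M[\<lambda>\<^sub>0, \<dots>, \<lambda>\<^sub>n\<^sub>-\<^sub>1] / (DM + \<lambda>\<^sub>0 + \<dots> + \<lambda>\<^sub>n\<^sub>-\<^sub>1)\<close>.
\<close>

definition smul :: "'f mpoly \<Rightarrow> 'm mpoly \<Rightarrow> 'm mpoly" where
  "smul f P = (\<Sum>s\<in>Poly_Mapping.keys f. \<Sum>t\<in>Poly_Mapping.keys P.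
     Poly_Mapping.single (s + t) (scaleM (Poly_Mapping.lookup f s) (Poly_Mapping.lookup P t)))"

definition lam :: "nat \<Rightarrow> 'f mpoly" where
  "lam i = Poly_Mapping.single (Poly_Mapping.single i 1) 1"

text \<open>\<open>subst \<sigma> P\<close> substitutes \<open>\<sigma> j\<close> for the variable \<open>\<lambda>\<^sub>j\<close>, for all \<open>j\<close>.\<close>

definition subst :: "(nat \<Rightarrow> 'f mpoly) \<Rightarrow> 'm mpoly \<Rightarrow> 'm mpoly" where
  "subst \<sigma> P = (\<Sum>e\<in>Poly_Mapping.keys P.
     smul (\<Prod>j\<in>Poly_Mapping.keys e. \<sigma> j ^ Poly_Mapping.lookup e j)
          (Poly_Mapping.single 0 (Poly_Mapping.lookup P e)))"

text \<open>\<open>exp_dot i b P\<close> is \<open>(e\<^bsup>\<partial>\<partial>\<^sub>\<lambda>\<^esup> b) P\<close> and \<open>lam_act i a P\<close> is \<open>a\<^sub>\<lambda> P\<close>, both for \<open>\<lambda> = \<lambda>\<^sub>i\<close>.\<close>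

definition exp_dot :: "nat \<Rightarrow> 'v \<Rightarrow> 'm mpoly \<Rightarrow> 'm mpoly" where
  "exp_dot i b P = (\<Sum>e\<in>Poly_Mapping.keys P. \<Sum>k\<le>Poly_Mapping.lookup e i.
     Poly_Mapping.single (e - Poly_Mapping.single i k)
       (scaleM (of_nat (Poly_Mapping.lookup e i choose k))
         (dot ((D ^^ k) b) (Poly_Mapping.lookup P e))))"

definition lam_act :: "nat \<Rightarrow> 'v \<Rightarrow> 'm mpoly \<Rightarrow> 'm mpoly" where
  "lam_act i a P = (\<Sum>e\<in>Poly_Mapping.keys P. \<Sum>k\<le>degree (act a (Poly_Mapping.lookup P e)).
     Poly_Mapping.single (e + Poly_Mapping.single i k) (coeff (act a (Poly_Mapping.lookup P e)) k))"

definition lampoly :: "nat \<Rightarrow> 'm mpoly set" where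
  "lampoly n = {P. \<forall>e\<in>Poly_Mapping.keys P. Poly_Mapping.keys e \<subseteq> {..<n}}"

definition total :: "nat \<Rightarrow> 'm mpoly \<Rightarrow> 'm mpoly" where
  "total n P = Poly_Mapping.map DM P + (\<Sum>i<n. smul (lam i) P)"

text \<open>
  Elements of the quotient are cosets. An operation on the quotient is the class of the
  operation applied to a chosen representative \<open>rep\<close>; all operations used below preserve the
  images of \<^const>\<open>total\<close>, so the choice is immaterial.
\<close>

definition cls :: "nat \<Rightarrow> 'm mpoly \<Rightarrow> 'm mpoly set" where
  "cls n P = {Q \<in> lampoly n. Q - P \<in> total n ` lampoly n}"

definition quot :: "nat \<Rightarrow> 'm mpoly set set" where
  "quot n = cls n ` lampoly n"

definition rep :: "'m mpoly set \<Rightarrow> 'm mpoly" where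
  "rep A = (SOME P. P \<in> A)"


section \<open>The variational complex\<close>

text \<open>
  A linear map on the \<open>n\<close>-th tensor power is given as a multilinear function on lists of length
  \<open>n\<close>, with the dummy value \<open>{}\<close> on all other lists. The superspace of cochains is the direct sum
  of its homogeneous parts \<open>cochains n q\<close>, where \<open>q\<close> is the opposite parity \<open>pbar\<close> of the cochain;
  \<open>ps\<close> are parities \<open>p\<close> of arguments, hence \<open>ps ! j + 1\<close> are the opposite parities.
\<close>

abbreviation homogeneous :: "'v list \<Rightarrow> bit list \<Rightarrow> bool" where
  "homogeneous as ps \<equiv> list_all2 (\<lambda>a p. a \<in> part p) as ps"

definition multilinear :: "nat \<Rightarrow> ('v, 'm) cochain \<Rightarrow> bool" where
  "multilinear n Y \<longleftrightarrow> (\<forall>as i. length as = n \<and> i < n \<longrightarrow>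
     (\<forall>a b. Y (as[i := a + b]) = cls n (rep (Y (as[i := a])) + rep (Y (as[i := b])))) \<and>
     (\<forall>r a. Y (as[i := scale r a]) = cls n (Poly_Mapping.map (scaleM r) (rep (Y (as[i := a]))))))"

text \<open>
  \<open>pbar(Y(as)) = q + \<Sum> pbar(a\<^sub>j)\<close>; the final \<open>+ 1\<close> converts \<open>pbar\<close> of the value to \<open>p\<close>.
\<close>

definition has_parity :: "nat \<Rightarrow> bit \<Rightarrow> ('v, 'm) cochain \<Rightarrow> bool" where
  "has_parity n q Y \<longleftrightarrow> (\<forall>as ps. length as = n \<and> homogeneous as ps \<longrightarrow>
     (\<exists>P\<in>Y as. \<forall>e. Poly_Mapping.lookup P e \<in> partM (q + (\<Sum>j<n. ps ! j + 1) + 1)))"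

definition sesquilinear :: "nat \<Rightarrow> ('v, 'm) cochain \<Rightarrow> bool" where
  "sesquilinear n Y \<longleftrightarrow> (\<forall>as i. length as = n \<and> i < n \<longrightarrow>
     Y (as[i := D (as ! i)]) = cls n (- smul (lam i) (rep (Y as))))"

definition super_symmetric :: "nat \<Rightarrow> ('v, 'm) cochain \<Rightarrow> bool" where
  "super_symmetric n Y \<longleftrightarrow> (\<forall>as ps i. length as = n \<and> homogeneous as ps \<and> Suc i < n \<longrightarrow>
     cls n (subst (lam \<circ> id(i := Suc i, Suc i := i))
              (rep (Y (as[i := as ! Suc i, Suc i := as ! i]))))
     = cls n (psign ((ps ! i + 1) * (ps ! Suc i + 1)) (rep (Y as))))"

definition leibniz :: "nat \<Rightarrow> bit \<Rightarrow> ('v, 'm) cochain \<Rightarrow> bool" where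
  "leibniz n q Y \<longleftrightarrow> (\<forall>as ps i b c pb pc.
     length as = n \<and> homogeneous as ps \<and> i < n \<and> b \<in> part pb \<and> c \<in> part pc \<longrightarrow>
     (let s = q + (\<Sum>j<i. ps ! j + 1) in
      Y (as[i := b * c]) =
        cls n (psign (pb * s) (exp_dot i b (rep (Y (as[i := c]))))
             + psign (pc * (pb + s)) (exp_dot i c (rep (Y (as[i := b])))))))"

definition cochains :: "nat \<Rightarrow> bit \<Rightarrow> ('v, 'm) cochain set" where
  "cochains n q = {Y. (\<forall>as. if length as = n then Y as \<in> quot n else Y as = {}) \<and>
     multilinear n Y \<and> has_parity n q Y \<and> sesquilinear n Y \<and> super_symmetric n Y \<and> leibniz n q Y}"

definition del :: "nat \<Rightarrow> 'b list \<Rightarrow> 'b list" where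
  "del i xs = take i xs @ drop (Suc i) xs"

text \<open>\<open>del i xs ! l = xs ! skip i l\<close>\<close>

definition skip :: "nat \<Rightarrow> nat \<Rightarrow> nat" where
  "skip i l = (if l < i then l else Suc l)"

text \<open>
  \<open>diff_formula n q Y as ps\<close> is the expression for \<open>dY\<close>, \<open>Y\<close> being an \<open>n\<close>-cochain of parity \<open>q\<close>, on
  homogeneous arguments \<open>as = [a\<^sub>0, \<dots>, a\<^sub>n]\<close> of parities \<open>ps\<close>; here
  \<open>Y([a\<^sub>i \<^sub>\<lambda> a\<^sub>j] \<otimes> \<dots>) = \<Sum>\<^sub>k \<lambda>\<^sub>i\<^sup>k Y(c\<^sub>k \<otimes> \<dots>)\<close>, where \<open>c\<^sub>k\<close> is the \<open>k\<close>-th coefficient of the bracket.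
\<close>

definition diff_formula :: "nat \<Rightarrow> bit \<Rightarrow> ('v, 'm) cochain \<Rightarrow> 'v list \<Rightarrow> bit list \<Rightarrow> 'm mpoly" where
  "diff_formula n q Y as ps =
     (let pb = (\<lambda>j. ps ! j + 1);
          \<gamma> = (\<lambda>i. pb i * (q + (\<Sum>l<i. pb l) + 1) + 1);
          \<gamma>' = (\<lambda>i j. q + pb i * ((\<Sum>l<i. pb l) + 1) + pb j * (\<Sum>l\<in>{..<j} - {i}. pb l))
      in (\<Sum>i\<le>n. psign (\<gamma> i)
            (lam_act i (as ! i) (subst (lam \<circ> skip i) (rep (Y (del i as))))))
       + (\<Sum>j\<le>n. \<Sum>i<j. psign (\<gamma>' i j)
            (\<Sum>k\<le>degree (br (as ! i) (as ! j)).
               smul (lam i ^ k)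
                 (subst (case_nat (lam i + lam j) (lam \<circ> skip j \<circ> skip i))
                   (rep (Y (coeff (br (as ! i) (as ! j)) k # del i (del j as))))))))"

text \<open>For arbitrary arguments, \<open>dY\<close> is extended multilinearly from the homogeneous ones.\<close>

definition differential :: "nat \<Rightarrow> bit \<Rightarrow> ('v, 'm) cochain \<Rightarrow> ('v, 'm) cochain" where
  "differential n q Y = (\<lambda>as. if length as = Suc n
     then cls (Suc n) (\<Sum>ps\<in>{ps. length ps = Suc n}. diff_formula n q Y (map2 component ps as) ps)
     else {})"

text \<open>The linear structure on cochains is pointwise.\<close>

definition lincomb :: "nat \<Rightarrow> (('v, 'm) cochain \<Rightarrow> 'f) \<Rightarrow> ('v, 'm) cochain set \<Rightarrow> ('v, 'm) cochain" where
  "lincomb n c S = (\<lambda>as. if length as = n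
     then cls n (\<Sum>Y\<in>S. Poly_Mapping.map (scaleM (c Y)) (rep (Y as))) else {})"

definition cochain_add :: "nat \<Rightarrow> ('v, 'm) cochain \<Rightarrow> ('v, 'm) cochain \<Rightarrow> ('v, 'm) cochain" where
  "cochain_add n Y Z = (\<lambda>as. if length as = n then cls n (rep (Y as) + rep (Z as)) else {})"

definition cochain_zero :: "nat \<Rightarrow> ('v, 'm) cochain" where
  "cochain_zero n = (\<lambda>as. if length as = n then cls n 0 else {})"

definition cocycles :: "nat \<Rightarrow> bit \<Rightarrow> ('v, 'm) cochain set" where
  "cocycles n q = {Y \<in> cochains n q. differential n q Y = cochain_zero (Suc n)}"

definition coboundaries :: "nat \<Rightarrow> bit \<Rightarrow> ('v, 'm) cochain set" where
  "coboundaries n q = (case n of 0 \<Rightarrow> {cochain_zero 0}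
     | Suc m \<Rightarrow> differential m (q + 1) ` cochains m (q + 1))"

text \<open>
  The differential is odd, so the cohomology is the direct sum of the quotients
  \<open>cocycles n q / coboundaries n q\<close>, \<open>q = 0, 1\<close>. It is finite-dimensional iff both of them are
  spanned by finitely many classes.
\<close>

definition finite_dim_cohomology :: "nat \<Rightarrow> bool" where
  "finite_dim_cohomology n \<longleftrightarrow>
     (\<forall>q. \<exists>S. finite S \<and> S \<subseteq> cocycles n q \<and>
        (\<forall>Y\<in>cocycles n q. \<exists>c. \<exists>B\<in>coboundaries n q. Y = cochain_add n (lincomb n c S) B))"

end

end

theory Submission
  imports Defs "HOL-Library.Function_Algebras"
begin

text \<open>
  Cochains are represented by functions with values in \<open>M[\<lambda>\<^sub>0, \<dots>, \<lambda>\<^sub>n\<^sub>-\<^sub>1]\<close>; the basic complex is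
  the one in which the axioms hold as equalities there, not only modulo \<open>\<partial> + \<Lambda>\<close>, where
  \<open>\<Lambda> = \<lambda>\<^sub>0 + \<dots> + \<lambda>\<^sub>n\<^sub>-\<^sub>1\<close>. Let \<open>T\<close> be the operator on cochains induced by \<open>L\<^sub>(\<^sub>1\<^sub>)\<close>. The
  action of \<open>L\<close> on a cocycle \<open>Y\<close>, with \<open>\<lambda>\<close> replaced by \<open>- \<partial> - \<Lambda>\<close>, commutes with the differential,
  is a well-defined element of the basic complex and is divisible by \<open>\<partial> + \<Lambda>\<close>; the quotient is a
  basic cocycle which lifts \<open>(1 - T) Y\<close>. On the basic complex, the derivative at \<open>\<lambda>\<^sub>0 = 0\<close> of the
  contraction with \<open>L\<close> is a homotopy between \<open>T\<close> and \<open>0\<close> up to sign (Cartan's formula). Hence \<open>T (T - 1)\<close> kills the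
  cohomology, and every class has a representative whose values on generators lie in the sum of the
  weight spaces for the eigenvalues \<open>0\<close> and \<open>1\<close> of \<open>T\<close>. A cochain is determined by these values, and the weight
  spaces are finite-dimensional because the variables have positive weights.
\<close>

text \<open>The homotopy cannot be built on the variational complex itself: the derivative at
  \<open>\<lambda>\<^sub>0 = 0\<close> sends \<open>(\<partial> + \<Lambda>) F\<close> to
  \<open>\<partial> + \<Lambda>\<close> (in the remaining variables) of the derivative of
  \<open>F\<close>, plus the value of \<open>F\<close> at \<open>\<lambda>\<^sub>0 = 0\<close>, so
  it does not pass to the quotient. Hence the detour through the basic complex. The way into it is
  the spectral parameter \<open>\<lambda>\<close> of \<open>L\<close>: acting with \<open>L\<close>
  turns congruences modulo \<open>\<partial> + \<Lambda>\<close> into congruences modulo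
  \<open>\<partial> + \<Lambda> + \<lambda>\<close>, and the substitution
  \<open>\<lambda> = - \<partial> - \<Lambda>\<close> turns these into equalities. Since
  \<open>L\<^sub>(\<^sub>0\<^sub>) = \<partial>\<close>, the action on \<open>Y\<close> expands as
  \<open>(\<partial> + \<Lambda>) Y + \<lambda> T Y\<close> plus terms divisible by the square of
  \<open>\<lambda>\<close>; the substitution leaves \<open>\<partial> + \<Lambda>\<close> times
  \<open>Y - T Y\<close> modulo the image of \<open>\<partial> + \<Lambda>\<close>. This is the
  origin of \<open>1 - T\<close>, and the eigenvalue 1 reflects that
  \<open>\<partial> + \<Lambda>\<close> itself has weight 1. Unique division by
  \<open>\<partial> + \<Lambda>\<close> needs at least one variable, so degree 0 is treated
  separately.\<close>

section \<open>Signs, additive maps and finitely supported functions\<close>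

lemma psign_0 [simp]: "psign p 0 = 0" and psign_zero [simp]: "psign 0 x = x"
  and psign_one: "psign 1 x = - x"
  by (auto simp: psign_def)

lemma additive_psign [intro!]: "additive (psign p)"
  by standard (auto simp: psign_def)

lemma psign_psign: "psign p (psign q x) = psign (p + q) x"
  by (cases p; cases q) (auto simp: psign_def)

lemma psign_self [simp]: "psign p (psign p x) = x"
  by (cases p) (auto simp: psign_def)

lemma additive_comp: "additive f \<Longrightarrow> additive g \<Longrightarrow> additive (\<lambda>x. f (g x))"
  by (simp add: additive_def)

lemma additive_add: "additive f \<Longrightarrow> additive g \<Longrightarrow> additive (\<lambda>x. f x + g x)"
  by (simp add: additive_def algebra_simps)

lemma additive_diff: "additive f \<Longrightarrow> additive g \<Longrightarrow> additive (\<lambda>x. f x - g x)"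
  by (simp add: additive_def algebra_simps)

lemma additive_uminus: "additive f \<Longrightarrow> additive (\<lambda>x. - f x)"
  by (simp add: additive_def algebra_simps)

lemma additive_sum: "(\<And>i. i \<in> A \<Longrightarrow> additive (f i)) \<Longrightarrow> additive (\<lambda>x. \<Sum>i\<in>A. f i x)"
  by (simp add: additive_def sum.distrib)

lemma additive_id: "additive (\<lambda>x. x)"
  by (simp add: additive_def)

lemma additive_psign_commute: "additive f \<Longrightarrow> f (psign p x) = psign p (f x)"
  by (simp add: psign_def additive.minus)

lemma poly_mapping_eq_sum_single:
  "P = (\<Sum>e\<in>Poly_Mapping.keys P. Poly_Mapping.single e (Poly_Mapping.lookup P e))"
  by (rule poly_mapping_eqI)
    (auto simp: lookup_sum lookup_single when_def in_keys_iff)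

lemma sum_keys_superset:
  assumes "finite A" "Poly_Mapping.keys P \<subseteq> A" "\<And>e. F e 0 = 0"
  shows "(\<Sum>e\<in>Poly_Mapping.keys P. F e (Poly_Mapping.lookup P e)) = (\<Sum>e\<in>A. F e (Poly_Mapping.lookup P e))"
  by (rule sum.mono_neutral_left) (use assms in \<open>auto simp: in_keys_iff\<close>)

lemma additive_sum_keys:
  assumes "\<And>e. additive (F e)"
  shows "additive (\<lambda>P. \<Sum>e\<in>Poly_Mapping.keys P. F e (Poly_Mapping.lookup P e))"
proof (rule additive.intro)
  fix P Q :: "'a \<Rightarrow>\<^sub>0 'b"
  let ?A = "Poly_Mapping.keys P \<union> Poly_Mapping.keys Q"
  have 0: "F e 0 = 0" for e
    using assms by (rule additive.zero)
  have "(\<Sum>e\<in>Poly_Mapping.keys R. F e (Poly_Mapping.lookup R e)) = (\<Sum>e\<in>?A. F e (Poly_Mapping.lookup R e))"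
    if "R \<in> {P, Q, P + Q}" for R
    by (rule sum_keys_superset) (use that 0 keys_add[of P Q] in auto)
  from this[of P] this[of Q] this[of "P + Q"]
  show "(\<Sum>e\<in>Poly_Mapping.keys (P + Q). F e (Poly_Mapping.lookup (P + Q) e))
    = (\<Sum>e\<in>Poly_Mapping.keys P. F e (Poly_Mapping.lookup P e))
      + (\<Sum>e\<in>Poly_Mapping.keys Q. F e (Poly_Mapping.lookup Q e))"
    by (simp add: lookup_add additive.add[OF assms] sum.distrib)
qed

text \<open>Every finitely supported map is a sum of monomials, so identities between additive
  operators need only be checked on one monomial.\<close>

lemma additive_eqI:
  fixes f g :: "('a \<Rightarrow>\<^sub>0 'b::ab_group_add) \<Rightarrow> 'c::ab_group_add"
  assumes "additive f" "additive g" "\<And>e m. f (Poly_Mapping.single e m) = g (Poly_Mapping.single e m)"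
  shows "f P = g P"
proof -
  have "f P = (\<Sum>e\<in>Poly_Mapping.keys P. f (Poly_Mapping.single e (Poly_Mapping.lookup P e)))"
    by (subst (1) poly_mapping_eq_sum_single[of P]) (rule additive.sum[OF assms(1)])
  also have "\<dots> = (\<Sum>e\<in>Poly_Mapping.keys P. g (Poly_Mapping.single e (Poly_Mapping.lookup P e)))"
    by (simp add: assms(3))
  also have "\<dots> = g P"
    by (subst (3) poly_mapping_eq_sum_single[of P]) (rule additive.sum[OF assms(2), symmetric])
  finally show ?thesis .
qed

lemma additive_map:
  fixes f :: "'b::ab_group_add \<Rightarrow> 'c::ab_group_add"
  assumes "additive f" shows "additive (Poly_Mapping.map f :: ('a \<Rightarrow>\<^sub>0 'b) \<Rightarrow> _)"
  by standard (rule poly_mapping_eqI,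
    auto simp: lookup_add Poly_Mapping.map.rep_eq when_def additive.add[OF assms] additive.zero[OF assms]
      add_eq_0_iff additive.minus[OF assms])

lemma lookup_map: "f 0 = 0 \<Longrightarrow> Poly_Mapping.lookup (Poly_Mapping.map f P) e = f (Poly_Mapping.lookup P e)"
  by (simp add: Poly_Mapping.map.rep_eq when_def)

lemma exponent_induct [case_names zero step]:
  fixes e :: "nat \<Rightarrow>\<^sub>0 nat"
  assumes "Q 0" "\<And>e i. Q e \<Longrightarrow> i \<in> Poly_Mapping.keys (e + Poly_Mapping.single i (Suc 0)) \<Longrightarrow> Q (e + Poly_Mapping.single i (Suc 0))"
  shows "Q e"
proof (induction "\<Sum>i\<in>Poly_Mapping.keys e. Poly_Mapping.lookup e i" arbitrary: e rule: less_induct)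
  case less
  show ?case
  proof (cases "e = 0")
    case False
    then obtain i where i: "i \<in> Poly_Mapping.keys e"
      by (metis ex_in_conv keys_eq_empty poly_mapping_eqI lookup_zero not_in_keys_iff_lookup_eq_zero)
    define e' where "e' = e - Poly_Mapping.single i (Suc 0)"
    have e: "e = e' + Poly_Mapping.single i (Suc 0)"
      unfolding e'_def using i
      by (intro poly_mapping_eqI) (auto simp: lookup_add lookup_minus lookup_single when_def in_keys_iff)
    have "(\<Sum>i\<in>Poly_Mapping.keys e'. Poly_Mapping.lookup e' i) = (\<Sum>i\<in>Poly_Mapping.keys e. Poly_Mapping.lookup e' i)"
      by (rule sum.mono_neutral_left) (auto simp: e'_def lookup_minus in_keys_iff)
    also have "\<dots> < (\<Sum>i\<in>Poly_Mapping.keys e. Poly_Mapping.lookup e i)"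
      by (rule sum_strict_mono2[where b = i] | rule sum_strict_mono_ex1)
        (use i in \<open>auto simp: e lookup_add lookup_single when_def\<close>)
    finally show ?thesis
      using less assms(2) i e by metis
  qed (simp add: assms)
qed

text \<open>Characteristic 0 is what separates the powers of 2;
  \<open>vanishing_coefficients\<close> divides by their differences.\<close>

lemma two_power_inject: "k \<noteq> l \<Longrightarrow> (2::'f::field_char_0) ^ k \<noteq> 2 ^ l"
  by (metis of_nat_eq_iff of_nat_numeral of_nat_power power_inject_exp one_less_numeral_iff semiring_norm(76))

text \<open>Replacing \<open>t\<close> by \<open>2 t\<close> and subtracting a multiple kills the top coefficient.\<close>

lemma degree_bound_family: "\<exists>B. \<forall>k\<le>(K::nat). degree (f k :: 'b::zero poly) \<le> B"
proof -
  have "finite ((\<lambda>k. degree (f k)) ` {..K})" by simp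
  then show ?thesis unfolding finite_nat_set_iff_bounded_le by auto
qed

section \<open>Finiteness of spanning sets, exponents and words of bounded weight\<close>

text \<open>A maximal independent subset of \<open>K\<close> has at most as many elements as
  \<open>G\<close>. Here \<open>K\<close> may be any subset, so the lemma applies directly to the
  families of generator values realised by cocycles.\<close>

lemma (in vector_space) finite_spanning_subset:
  assumes "finite G" "K \<subseteq> span G"
  obtains B where "finite B" "B \<subseteq> K" "K \<subseteq> span B"
proof -
  obtain B where B: "B \<subseteq> K" "independent B" "K \<subseteq> span B"
    using maximal_independent_subset[of K] by blast
  then have "finite B" using independent_span_bound[OF assms(1) B(2)] assms(2) by blast
  with B that show thesis by blast
qed

lemma bounded_lists_finite:
  fixes N K R :: nat
  shows "finite {w :: (nat \<times> nat) list. length w \<le> R \<and> set w \<subseteq> {..<N} \<times> {..K}}"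
  using finite_lists_length_le[of "{..<N} \<times> {..K}" R] by (simp add: conj_commute)

lemma bounded_exponents_finite:
  "finite {e :: nat \<Rightarrow>\<^sub>0 nat. Poly_Mapping.keys e \<subseteq> {..<n} \<and> (\<Sum>i<n. Poly_Mapping.lookup e i) \<le> K}"
proof (rule inj_on_finite[where B = "{xs. set xs \<subseteq> {..K} \<and> length xs = n}"])
  let ?f = "\<lambda>e :: nat \<Rightarrow>\<^sub>0 nat. map (Poly_Mapping.lookup e) [0..<n]"
  show "inj_on ?f {e. Poly_Mapping.keys e \<subseteq> {..<n} \<and> (\<Sum>i<n. Poly_Mapping.lookup e i) \<le> K}"
  proof (rule inj_onI, rule poly_mapping_eqI)
    fix e e' :: "nat \<Rightarrow>\<^sub>0 nat" and i
    assume e: "e \<in> {e. Poly_Mapping.keys e \<subseteq> {..<n} \<and> (\<Sum>i<n. Poly_Mapping.lookup e i) \<le> K}"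
      "e' \<in> {e. Poly_Mapping.keys e \<subseteq> {..<n} \<and> (\<Sum>i<n. Poly_Mapping.lookup e i) \<le> K}" and eq: "?f e = ?f e'"
    show "Poly_Mapping.lookup e i = Poly_Mapping.lookup e' i"
    proof (cases "i < n")
      case True
      then show ?thesis using eq by simp
    next
      case False
      then have "i \<notin> Poly_Mapping.keys e" "i \<notin> Poly_Mapping.keys e'" using e by auto
      then show ?thesis by (simp add: in_keys_iff)
    qed
  qed
  show "?f ` {e. Poly_Mapping.keys e \<subseteq> {..<n} \<and> (\<Sum>i<n. Poly_Mapping.lookup e i) \<le> K} \<subseteq> {xs. set xs \<subseteq> {..K} \<and> length xs = n}"
  proof clarsimp
    fix e :: "nat \<Rightarrow>\<^sub>0 nat" and i assume "(\<Sum>i<n. Poly_Mapping.lookup e i) \<le> K" "i < n"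
    then show "Poly_Mapping.lookup e i \<le> K"
      using member_le_sum[of i "{..<n}" "Poly_Mapping.lookup e"] by simp
  qed
  show "finite {xs :: nat list. set xs \<subseteq> {..K} \<and> length xs = n}"
    by (rule finite_lists_length_eq) simp
qed

text \<open>The conformal weight of a word whose letters are the \<open>k\<close>-th derivatives of
  \<open>u i\<close>, as each derivative raises the weight by 1. It is computed both with weights in
  the field of scalars and with weights in an ordered field.\<close>

definition wsum :: "(nat \<Rightarrow> 'a::semiring_1) \<Rightarrow> (nat \<times> nat) list \<Rightarrow> 'a" where
  "wsum \<omega> w = sum_list (map (\<lambda>(i, k). \<omega> i + of_nat k) w)"

text \<open>Positivity of the weights enters only here.\<close>

lemma finite_weight:
  fixes \<omega> :: "nat \<Rightarrow> 'k::archimedean_field" and \<phi> :: "'k \<Rightarrow> 'f::field_char_0"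
  assumes \<phi>: "\<And>x y. \<phi> (x + y) = \<phi> x + \<phi> y" "\<phi> 1 = 1" "inj \<phi>"
    and \<omega>: "\<And>i. i < N \<Longrightarrow> \<omega> i > 0" and \<Delta>: "\<And>i. i < N \<Longrightarrow> \<Delta> i = \<phi> (\<omega> i)"
  shows "finite {(e, w, k). Poly_Mapping.keys e \<subseteq> {..<n} \<and> set w \<subseteq> {..<N} \<times> UNIV \<and>
    of_nat ((\<Sum>i<n. Poly_Mapping.lookup e i) + n + k) + wsum \<Delta> w = s}"
    (is "finite ?A")
proof (cases "?A = {}")
  case False
  have \<phi>0: "\<phi> 0 = 0" using \<phi>(1)[of 0 0] by simp
  have \<phi>n: "\<phi> (of_nat k) = of_nat k" for k
    by (induction k) (simp_all add: \<phi> \<phi>0)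
  have \<phi>w: "wsum \<Delta> w = \<phi> (wsum \<omega> w)" if "set w \<subseteq> {..<N} \<times> UNIV" for w
    using that by (induction w) (auto simp: wsum_def \<phi> \<phi>0 \<phi>n \<Delta>)
  \<comment> \<open>The weight measured in the ordered field. As \<open>\<phi>\<close> is additive
    and injective, the equation with \<open>s\<close> forces \<open>\<rho>\<close> to be constant on
    the set, with value \<open>r\<close>.\<close>
  define \<rho> where "\<rho> = (\<lambda>(e, w, k). of_nat ((\<Sum>i<n. Poly_Mapping.lookup e i) + n + k) + wsum \<omega> w :: 'k)"
  obtain x where x: "x \<in> ?A" using False by blast
  define r where "r = \<rho> x"
  have s: "s = \<phi> (\<rho> y)" if "y \<in> ?A" for y
    using that by (auto simp: \<rho>_def \<phi>(1) \<phi>n \<phi>w simp del: of_nat_add of_nat_sum)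
  have \<rho>r: "\<rho> y = r" if "y \<in> ?A" for y
    using s[OF that] s[OF x] \<phi>(3) by (simp add: r_def inj_def)
  \<comment> \<open>A positive lower bound for the weights of all letters; inserting 1 keeps the
    minimum defined when \<open>N = 0\<close>.\<close>
  define \<epsilon> where "\<epsilon> = Min (insert 1 (\<omega> ` {..<N}))"
  have \<epsilon>: "\<epsilon> > 0" "\<And>i. i < N \<Longrightarrow> \<epsilon> \<le> \<omega> i"
    using \<omega> by (auto simp: \<epsilon>_def)
  have wlen: "of_nat (length w) * \<epsilon> \<le> wsum \<omega> w" and wmem: "\<And>i k. (i, k) \<in> set w \<Longrightarrow> of_nat k \<le> wsum \<omega> w"
    if "set w \<subseteq> {..<N} \<times> UNIV" for w
  proof -
    have *: "of_nat (length w) * \<epsilon> \<le> wsum \<omega> w \<and> 0 \<le> wsum \<omega> w \<and> (\<forall>(i, k)\<in>set w. of_nat k \<le> wsum \<omega> w)"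
      using that
    proof (induction w)
      case Nil
      then show ?case by (simp add: wsum_def)
    next
      case (Cons a w)
      obtain i k where a: "a = (i, k)" "i < N" using Cons.prems by (cases a) auto
      have IH: "of_nat (length w) * \<epsilon> \<le> wsum \<omega> w" "0 \<le> wsum \<omega> w" "\<And>i k. (i, k) \<in> set w \<Longrightarrow> of_nat k \<le> wsum \<omega> w"
        using Cons by auto
      have W: "wsum \<omega> (a # w) = \<omega> i + of_nat k + wsum \<omega> w" by (simp add: a wsum_def)
      have pos: "\<omega> i + of_nat k \<ge> \<epsilon>" "\<omega> i > 0" using \<epsilon>(2)[OF a(2)] \<omega>[OF a(2)] by (simp_all add: add_increasing2)
      have "of_nat (length (a # w)) * \<epsilon> \<le> wsum \<omega> (a # w)"
        unfolding W using IH(1) pos(1) by (simp add: distrib_right)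
      moreover have "0 \<le> wsum \<omega> (a # w)" unfolding W using IH(2) pos \<epsilon>(1) by linarith
      moreover have "of_nat k' \<le> wsum \<omega> (a # w)" if "(i', k') \<in> set (a # w)" for i' k'
      proof (cases "(i', k') = a")
        case True
        then show ?thesis unfolding W using a IH(2) pos(2) by simp
      next
        case False
        then have "of_nat k' \<le> wsum \<omega> w" using that IH(3) by auto
        also have "\<dots> \<le> wsum \<omega> (a # w)" unfolding W using pos \<epsilon>(1) by linarith
        finally show ?thesis .
      qed
      ultimately show ?case by blast
    qed
    then show "of_nat (length w) * \<epsilon> \<le> wsum \<omega> w" "\<And>i k. (i, k) \<in> set w \<Longrightarrow> of_nat k \<le> wsum \<omega> w" by blast+
  qed
  \<comment> \<open>\<open>K\<close> bounds the exponents and the orders of derivatives;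
    \<open>K'\<close> bounds the number of letters, each of weight at least
    \<open>\<epsilon>\<close>.\<close>
  obtain K where K: "r \<le> of_nat K" using real_arch_simple by blast
  obtain K' where K': "r / \<epsilon> \<le> of_nat K'" using real_arch_simple by blast
  let ?B = "{e. Poly_Mapping.keys e \<subseteq> {..<n} \<and> (\<Sum>i<n. Poly_Mapping.lookup e i) \<le> K}
     \<times> {w :: (nat \<times> nat) list. length w \<le> K' \<and> set w \<subseteq> {..<N} \<times> {..K}} \<times> {..K}"
  have "?A \<subseteq> ?B"
  proof
    fix y assume y: "y \<in> ?A"
    obtain e w k where yy: "y = (e, w, k)" by (cases y)
    have e: "Poly_Mapping.keys e \<subseteq> {..<n}" and w: "set w \<subseteq> {..<N} \<times> UNIV" using y yy by auto
    define c where "c = (\<Sum>i<n. Poly_Mapping.lookup e i) + n + k"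
    have sum: "of_nat c + wsum \<omega> w = r" using \<rho>r[OF y] by (simp add: yy \<rho>_def c_def)
    have w0: "0 \<le> wsum \<omega> w" using order_trans[OF _ wlen[OF w]] \<epsilon>(1) by simp
    have "of_nat c \<le> r" using sum w0 by linarith
    then have "(of_nat c :: 'k) \<le> of_nat K" using K by (rule order_trans)
    then have c: "c \<le> K" by simp
    have wr: "wsum \<omega> w \<le> r" using sum of_nat_0_le_iff[of c] by (metis le_add_same_cancel2)
    have "of_nat (length w) \<le> r / \<epsilon>"
      using order_trans[OF wlen[OF w] wr] \<epsilon>(1) by (simp add: pos_le_divide_eq)
    then have "(of_nat (length w) :: 'k) \<le> of_nat K'" using K' by (rule order_trans)
    then have "length w \<le> K'" by simp
    moreover have "set w \<subseteq> {..<N} \<times> {..K}"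
    proof
      fix a assume a: "a \<in> set w"
      obtain i k' where ik: "a = (i, k')" by (cases a)
      have "(of_nat k' :: 'k) \<le> of_nat K" using wmem[OF w, of i k'] a ik wr K by (metis order_trans)
      then show "a \<in> {..<N} \<times> {..K}" using a ik w by auto
    qed
    ultimately show "y \<in> ?B" using e c unfolding yy c_def by simp
  qed
  then show ?thesis
    by (rule finite_subset) (intro finite_cartesian_product bounded_exponents_finite bounded_lists_finite finite_atMost)
next
  case True
  show ?thesis unfolding True by simp
qed

section \<open>Superspaces: values of polynomials at scalars, homogeneous components\<close>

context superspace
begin

text \<open>Evaluation at all scalars turns coefficientwise identities, such as the Jacobi identity,
  into identities between linear operators.\<close>

definition pev :: "'f \<Rightarrow> 'v poly \<Rightarrow> 'v" where
  "pev t p = (\<Sum>k\<le>degree p. scale (t ^ k) (coeff p k))"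

lemma pev_bound: "degree p \<le> K \<Longrightarrow> pev t p = (\<Sum>k\<le>K. scale (t ^ k) (coeff p k))"
  unfolding pev_def by (rule sum.mono_neutral_left) (auto simp: coeff_eq_0)

lemma pev_add: "pev t (p + q) = pev t p + pev t q"
proof -
  let ?K = "max (degree p) (degree q)"
  show ?thesis
    using pev_bound[of p ?K t] pev_bound[of q ?K t] pev_bound[of "p + q" ?K t]
    by (simp add: degree_add_le scale_right_distrib sum.distrib)
qed

lemma additive_pev: "additive (pev t)"
  by standard (rule pev_add)

lemma pev_map_poly_scale: "pev t (map_poly (scale r) p) = scale r (pev t p)"
  by (subst pev_bound[where K = "degree p"])
    (simp_all add: map_poly_degree_leq coeff_map_poly pev_def scale_sum_right mult.commute)

lemma component_unique:
  assumes "x \<in> part p" "v - x \<in> part (p + 1)" "y \<in> part p" "v - y \<in> part (p + 1)"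
  shows "x = y"
proof -
  have u: "a = b" if "a \<in> part 0" "v - a \<in> part 1" "b \<in> part 0" "v - b \<in> part 1" for a b
    using decomposition[of v] that by blast
  show ?thesis
    using u[of x y] u[of "v - x" "v - y"] assms by (cases p) auto
qed

lemma component_eqI: "x \<in> part p \<Longrightarrow> v - x \<in> part (p + 1) \<Longrightarrow> component p v = x"
  unfolding component_def by (rule the_equality) (auto intro: component_unique)

lemma component_in_part: "component p v \<in> part p" and component_rest: "v - component p v \<in> part (p + 1)"
proof -
  obtain x where x: "x \<in> part 0" "v - x \<in> part 1" using decomposition[of v] by blast
  show "component p v \<in> part p" "v - component p v \<in> part (p + 1)"
    using x component_eqI[of x 0 v] component_eqI[of "v - x" 1 v] by (cases p; simp)+
qed

lemma component_same: "a \<in> part p \<Longrightarrow> component p a = a"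
  by (rule component_eqI) (simp_all add: subspace_0[OF subspace_part])

lemma component_other: "a \<in> part p \<Longrightarrow> p \<noteq> r \<Longrightarrow> component r a = 0"
  by (rule component_eqI) (cases p; cases r; simp add: subspace_0[OF subspace_part])+

lemma component_sum: "component 0 a + component 1 a = a"
proof -
  have "component 1 a = a - component 0 a"
    using component_in_part[of 0 a] component_rest[of a 0] by (intro component_eqI) simp_all
  then show ?thesis by simp
qed

text \<open>Induction on \<open>K\<close>: passing from \<open>f(t)\<close> to
  \<open>f(2 t) - 2^(K+1) f(t)\<close> removes the term of degree \<open>K + 1\<close> and
  multiplies each lower one by the nonzero scalar \<open>2^k - 2^(K+1)\<close>.\<close>

lemma vanishing_coefficients:
  fixes c :: "nat \<Rightarrow> 'v"
  assumes "\<And>t. (\<Sum>k\<le>K. scale (t ^ k) (c k)) = 0" "k \<le> K"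
  shows "c k = 0"
  using assms
proof (induction K arbitrary: c k)
  case 0
  then show ?case by (auto dest: meta_spec[of _ 1])
next
  case (Suc K)
  have c: "c k = 0" if "k \<le> K" for k
  proof -
    have "(\<Sum>k\<le>K. scale (t ^ k) (scale (2 ^ k - 2 ^ Suc K) (c k))) = 0" for t
    proof -
      have "(\<Sum>k\<le>Suc K. scale (t ^ k) (scale (2 ^ k - 2 ^ Suc K) (c k)))
        = (\<Sum>k\<le>Suc K. scale ((2 * t) ^ k) (c k)) - scale (2 ^ Suc K) (\<Sum>k\<le>Suc K. scale (t ^ k) (c k))"
        unfolding scale_sum_right sum_subtractf[symmetric]
        by (rule sum.cong) (auto simp: algebra_simps power_mult_distrib scale_left_diff_distrib simp del: power_Suc)
      also have "\<dots> = 0"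
        unfolding Suc.prems(1) by simp
      finally show ?thesis
        by simp
    qed
    then have "scale (2 ^ k - 2 ^ Suc K) (c k) = 0"
      using that by (rule Suc.IH)
    then show ?thesis
      using two_power_inject[of k "Suc K"] that by auto
  qed
  show ?case
  proof (cases "k = Suc K")
    case True
    have "(\<Sum>k\<le>Suc K. scale (1 ^ k) (c k)) = 0"
      by (rule Suc.prems)
    then show ?thesis
      using c True by simp
  qed (use c Suc.prems in auto)
qed

text \<open>With \<open>N = i - k + j\<close>, the monomial \<open>s^i t^j\<close> is the part of
  \<open>s^k (s + t)^N\<close> with \<open>j\<close> factors \<open>t\<close>. The bounds
  \<open>I\<close> and \<open>J\<close> only have to be large enough to contain every nonzero
  term.\<close>

lemma binomial_rearrange:
  fixes c :: "nat \<Rightarrow> nat \<Rightarrow> 'v"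
  assumes c: "\<And>k N. k > K \<or> N > M \<Longrightarrow> c k N = 0" and I: "K + M \<le> I" and J: "M \<le> J"
  shows "(\<Sum>i\<le>I. \<Sum>j\<le>J. scale (s ^ i * t ^ j) (\<Sum>k\<le>i. scale (of_nat ((i - k + j) choose j)) (c k (i - k + j))))
    = (\<Sum>k\<le>K. scale (s ^ k) (\<Sum>N\<le>M. scale ((s + t) ^ N) (c k N)))"
proof -
  define f where "f = (\<lambda>(k, N, j). scale (s ^ (k + N - j) * t ^ j * of_nat (N choose j)) (c k N))"
  have "(\<Sum>i\<le>I. \<Sum>j\<le>J. scale (s ^ i * t ^ j) (\<Sum>k\<le>i. scale (of_nat ((i - k + j) choose j)) (c k (i - k + j))))
    = (\<Sum>i\<le>I. \<Sum>j\<le>J. \<Sum>k\<le>i. f (k, i - k + j, j))"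
    by (auto simp: f_def scale_sum_right intro!: sum.cong)
  also have "\<dots> = (\<Sum>(i, j, k)\<in>(SIGMA i:{..I}. SIGMA j:{..J}. {..i}). f (k, i - k + j, j))"
  proof -
    define g where "g = (\<lambda>i j k. f (k, i - k + j, j))"
    have g: "f (k, i - k + j, j) = g i j k" for i j k by (simp add: g_def)
    show ?thesis
      unfolding g by (simp add: sum.Sigma)
  qed
  also have "\<dots> = (\<Sum>x\<in>(SIGMA k:{..K}. SIGMA N:{..M}. {..N}). f x)"
  \<comment> \<open>The triple \<open>(i, j, k)\<close> corresponds to \<open>(k, N, j)\<close>; the
    discarded triples are those with \<open>k > K\<close> or \<open>N > M\<close>, where the
    coefficient is zero.\<close>
  proof (rule sum.reindex_bij_witness_not_neutral[where
      S' = "{x \<in> (SIGMA i:{..I}. SIGMA j:{..J}. {..i}). (case x of (i, j, k) \<Rightarrow> k > K \<or> i - k + j > M)}" and T' = "{}"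
      and i = "\<lambda>(k, N, j). (k + N - j, j, k)" and j = "\<lambda>(i, j, k). (k, i - k + j, j)"], goal_cases)
    case (8 b)
    then show ?case by auto
  qed (use I J c in \<open>auto simp: f_def\<close>)
  also have "\<dots> = (\<Sum>k\<le>K. \<Sum>N\<le>M. \<Sum>j\<le>N. f (k, N, j))"
    by (simp add: sum.Sigma)
  also have "\<dots> = (\<Sum>k\<le>K. scale (s ^ k) (\<Sum>N\<le>M. scale ((s + t) ^ N) (c k N)))"
  proof (intro sum.cong refl)
    fix k
    have "(\<Sum>j\<le>N. f (k, N, j)) = scale (s ^ k) (scale ((s + t) ^ N) (c k N))" for N
    proof -
      have "(\<Sum>j\<le>N. f (k, N, j)) = (\<Sum>j\<le>N. scale (s ^ k) (scale (of_nat (N choose j) * t ^ j * s ^ (N - j)) (c k N)))"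
        by (auto simp: f_def mult_ac simp flip: power_add intro!: sum.cong)
      also have "\<dots> = scale (s ^ k) (scale ((s + t) ^ N) (c k N))"
        by (simp only: scale_sum_right[symmetric] scale_sum_left[symmetric] binomial_ring[symmetric] add.commute[of s t])
      finally show ?thesis .
    qed
    then show "(\<Sum>N\<le>M. \<Sum>j\<le>N. f (k, N, j)) = scale (s ^ k) (\<Sum>N\<le>M. scale ((s + t) ^ N) (c k N))"
      by (simp only: scale_sum_right)
  qed
  finally show ?thesis .
qed

text \<open>Common form of the Jacobi identities for the bracket and for a module: \<open>A\<close>
  and \<open>B\<close> are the actions of two elements, and \<open>C k\<close> is the action of the
  \<open>k\<close>-th coefficient of their bracket. The coefficient identities are multiplied by
  \<open>s^i t^j\<close> and summed.\<close>

lemma jacobi_scalars: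
  assumes A: "additive A" "\<And>r x. A (scale r x) = map_poly (scale r) (A x)"
    and B: "additive B" "\<And>r x. B (scale r x) = map_poly (scale r) (B x)"
    and C: "\<And>k. k > K \<Longrightarrow> C k = 0"
    and jacobi: "\<And>i j. coeff (A (coeff p j)) i - coeff (B (coeff r i)) j
      = (\<Sum>k\<le>i. scale (of_nat ((i - k + j) choose j)) (coeff (C k) (i - k + j)))"
  shows "pev s (A (pev t p)) - pev t (B (pev s r)) = (\<Sum>k\<le>K. scale (s ^ k) (pev (s + t) (C k)))"
proof -
  note add = additive.sum[OF additive_comp[OF additive_pev A(1)]] additive.sum[OF additive_comp[OF additive_pev B(1)]]
  obtain M where M: "\<And>k. k \<le> K \<Longrightarrow> degree (C k) \<le> M"
    using degree_bound_family[of K C] by blast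
  \<comment> \<open>The bounds are chosen in turn: \<open>J\<close> dominates the degrees of
    \<open>C\<close> and \<open>p\<close>; \<open>I\<close> those of the \<open>A\<close>-values and
    of \<open>r\<close>, and the bound \<open>K + M\<close> of \<open>binomial_rearrange\<close>;
    \<open>J'\<close> those of the \<open>B\<close>-values.\<close>
  define J where "J = max M (degree p)"
  obtain I1 where I1: "\<And>j. j \<le> J \<Longrightarrow> degree (A (coeff p j)) \<le> I1"
    using degree_bound_family[of J "\<lambda>j. A (coeff p j)"] by blast
  define I where "I = max (max I1 (K + M)) (degree r)"
  obtain J1 where J1: "\<And>i. i \<le> I \<Longrightarrow> degree (B (coeff r i)) \<le> J1"
    using degree_bound_family[of I "\<lambda>i. B (coeff r i)"] by blast
  define J' where "J' = max J J1"
  have c: "coeff (C k) N = 0" if "k > K \<or> N > M" for k N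
    using that M[of k] C[of k] by (cases "k > K") (auto simp: coeff_eq_0)
  have I1': "degree (A (coeff p j)) \<le> I" for j
    by (cases "j \<le> J") (use I1[of j] in \<open>auto simp: I_def J_def coeff_eq_0 additive.zero[OF A(1)]\<close>)
  have "pev s (A (pev t p)) = (\<Sum>j\<le>J'. \<Sum>i\<le>I. scale (s ^ i * t ^ j) (coeff (A (coeff p j)) i))"
    by (subst (2) pev_bound[where K = J'])
      (simp_all add: J'_def J_def add A(2) pev_map_poly_scale pev_bound[OF I1'] scale_sum_right mult.commute)
  then have L1: "pev s (A (pev t p)) = (\<Sum>i\<le>I. \<Sum>j\<le>J'. scale (s ^ i * t ^ j) (coeff (A (coeff p j)) i))"
    by (subst sum.swap)
  have J1': "degree (B (coeff r i)) \<le> J'" if "i \<le> I" for i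
    using J1[OF that] by (simp add: J'_def)
  have "degree r \<le> I"
    by (simp add: I_def)
  then have "pev t (B (pev s r)) = (\<Sum>i\<le>I. scale (s ^ i) (pev t (B (coeff r i))))"
    by (simp add: pev_bound[of r I s] add B(2) pev_map_poly_scale)
  also have "\<dots> = (\<Sum>i\<le>I. \<Sum>j\<le>J'. scale (s ^ i * t ^ j) (coeff (B (coeff r i)) j))"
    by (intro sum.cong refl) (simp add: pev_bound[OF J1'] scale_sum_right)
  finally have L2: "pev t (B (pev s r)) = (\<Sum>i\<le>I. \<Sum>j\<le>J'. scale (s ^ i * t ^ j) (coeff (B (coeff r i)) j))" .
  have "pev s (A (pev t p)) - pev t (B (pev s r))
    = (\<Sum>i\<le>I. \<Sum>j\<le>J'. scale (s ^ i * t ^ j) (\<Sum>k\<le>i. scale (of_nat ((i - k + j) choose j)) (coeff (C k) (i - k + j))))"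
    unfolding L1 L2 jacobi[symmetric] by (simp add: sum_subtractf scale_right_diff_distrib)
  also have "\<dots> = (\<Sum>k\<le>K. scale (s ^ k) (\<Sum>N\<le>M. scale ((s + t) ^ N) (coeff (C k) N)))"
    by (rule binomial_rearrange) (use c in \<open>auto simp: I_def J'_def J_def\<close>)
  also have "\<dots> = (\<Sum>k\<le>K. scale (s ^ k) (pev (s + t) (C k)))"
    by (intro sum.cong refl) (simp add: pev_bound[OF M])
  finally show ?thesis .
qed

end

section \<open>Polynomials with coefficients in \<open>M\<close> as a module over scalar
  polynomials\<close>

context pva_module
begin

abbreviation const :: "'m \<Rightarrow> 'm mpoly" where "const \<equiv> Poly_Mapping.single 0"
abbreviation var :: "nat \<Rightarrow> nat \<Rightarrow>\<^sub>0 nat" where "var i \<equiv> Poly_Mapping.single i (Suc 0)"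

lemma additive_scaleM: "additive (scaleM r)"
  by standard (rule M.scale_right_distrib)

lemma additive_scaleM_left: "additive (\<lambda>r. scaleM r m)"
  by standard (rule M.scale_left_distrib)

lemma additive_DM: "additive DM"
  using DM_even by (simp add: M.even_endo_def additive_def)

lemma additive_D: "additive D"
  using D_even by (simp add: even_endo_def additive_def)

lemma additive_dot: "additive (dot a)"
  by standard (rule dot_add_right)

lemma additive_dot_left: "additive (\<lambda>a. dot a m)"
  by standard (rule dot_add_left)

lemma additive_act: "additive (act a)" and additive_act_left: "additive (\<lambda>a. act a m)"
  by (simp_all add: additive_def act_add_right act_add_left)

lemma additive_br: "additive (br a)" and additive_br_left: "additive (\<lambda>a. br a b)"
  by (simp_all add: additive_def br_add_right br_add_left)

lemma additive_single: "additive (Poly_Mapping.single e :: 'm \<Rightarrow> 'm mpoly)"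
  by standard (rule single_add)

lemma additive_coeff: "additive (\<lambda>p. coeff p k)"
  by standard simp

lemma additive_smul: "additive (smul f)"
  unfolding smul_def[abs_def]
  by (subst sum.swap)
    (intro additive_sum_keys additive_sum additive_comp[OF additive_single] additive_scaleM)

lemma additive_smul_left: "additive (\<lambda>f. smul f P)"
  unfolding smul_def[abs_def]
  by (intro additive_sum_keys additive_sum additive_comp[OF additive_single] additive_scaleM_left)

lemma smul_single:
  "smul (Poly_Mapping.single s c) (Poly_Mapping.single t m) = Poly_Mapping.single (s + t) (scaleM c m)"
  by (simp add: smul_def)

lemma smul_mult: "smul (f * g) P = smul f (smul g P)"
proof (rule additive_eqI[where P = P])
  fix e m
  show "smul (f * g) (Poly_Mapping.single e m) = smul f (smul g (Poly_Mapping.single e m))"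
  proof (rule additive_eqI[where P = f])
    fix e' c
    show "smul (Poly_Mapping.single e' c * g) (Poly_Mapping.single e m)
      = smul (Poly_Mapping.single e' c) (smul g (Poly_Mapping.single e m))"
      by (rule additive_eqI[where P = g];
          (simp add: smul_single mult_single add.assoc; fail)?)
        (auto simp: additive_def algebra_simps additive.add[OF additive_smul] additive.add[OF additive_smul_left])
  qed (auto simp: additive_def algebra_simps additive.add[OF additive_smul] additive.add[OF additive_smul_left])
qed (auto simp: additive_def additive.add[OF additive_smul])

lemma smul_one: "smul 1 P = P"
  by (rule additive_eqI[where P = P]) (auto simp: additive_smul additive_id smul_single simp flip: single_one)

sublocale mp: module smul
  by unfold_locales (simp_all add: smul_one smul_mult[symmetric] additive.add[OF additive_smul] additive.add[OF additive_smul_left])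

abbreviation Sc :: "'f \<Rightarrow> 'm mpoly \<Rightarrow> 'm mpoly" where "Sc r \<equiv> Poly_Mapping.map (scaleM r)"

lemma Sc_eq_smul: "Sc r P = smul (Poly_Mapping.single 0 r) P"
  by (rule additive_eqI[where P = P])
    (auto simp: additive_map additive_scaleM additive_smul smul_single)

section \<open>Polynomials with coefficients in the module\<close>

declare mp.scale_scale [simp del]

lemma smul_lam_single: "smul (lam i) (Poly_Mapping.single e m) = Poly_Mapping.single (e + var i) m"
  by (simp add: lam_def smul_single add.commute)

text \<open>Constants, sums and multiplication by variables generate all polynomials. An operator is
  therefore known from its value on constants and its commutation with each \<open>lam i\<close>,
  which is the form of the rules stated for each operator below.\<close>

lemma mpoly_induct [case_names const add lam]:
  assumes "\<And>m. Q (const m)" "\<And>F G. Q F \<Longrightarrow> Q G \<Longrightarrow> Q (F + G)" "\<And>i F. Q F \<Longrightarrow> Q (smul (lam i) F)"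
  shows "Q P"
proof -
  have *: "Q (Poly_Mapping.single e m)" for e m
    by (induction e rule: exponent_induct) (use assms smul_lam_single in \<open>auto simp flip: smul_lam_single\<close>)
  have "Q (\<Sum>e\<in>A. Poly_Mapping.single e (Poly_Mapping.lookup P e))" if "finite A" for A
    using that
  proof (induction A)
    case empty
    show ?case using assms(1)[of 0] by simp
  qed (use * assms in auto)
  from this[of "Poly_Mapping.keys P"] show ?thesis
    by (simp flip: poly_mapping_eq_sum_single)
qed

lemma lampoly_zero [intro]: "0 \<in> lampoly n"
  by (simp add: lampoly_def)

lemma lampoly_add: "F \<in> lampoly n \<Longrightarrow> G \<in> lampoly n \<Longrightarrow> F + G \<in> lampoly n"
  using keys_add[of F G] unfolding lampoly_def by blast

lemma lampoly_sum: "(\<And>i. i \<in> A \<Longrightarrow> F i \<in> lampoly n) \<Longrightarrow> (\<Sum>i\<in>A. F i) \<in> lampoly n"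
  by (induction A rule: infinite_finite_induct) (auto intro: lampoly_add)

lemma lampoly_single: "Poly_Mapping.keys e \<subseteq> {..<n} \<Longrightarrow> Poly_Mapping.single e m \<in> lampoly n"
  by (simp add: lampoly_def)

lemma lampoly_const: "const m \<in> lampoly n"
  by (simp add: lampoly_single)

lemma lampoly_additive:
  assumes "additive \<phi>" "\<And>e m. Poly_Mapping.keys e \<subseteq> {..<n} \<Longrightarrow> \<phi> (Poly_Mapping.single e m) \<in> lampoly k" "P \<in> lampoly n"
  shows "\<phi> P \<in> lampoly k"
proof -
  have "\<phi> P = (\<Sum>e\<in>Poly_Mapping.keys P. \<phi> (Poly_Mapping.single e (Poly_Mapping.lookup P e)))"
    by (subst (1) poly_mapping_eq_sum_single[of P]) (rule additive.sum[OF assms(1)])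
  also have "\<dots> \<in> lampoly k"
    by (rule lampoly_sum, rule assms(2)) (use assms(3) in \<open>auto simp: lampoly_def\<close>)
  finally show ?thesis .
qed

lemma lampoly_uminus: "F \<in> lampoly n \<Longrightarrow> - F \<in> lampoly n"
  by (simp add: lampoly_def)

lemma lampoly_diff: "F \<in> lampoly n \<Longrightarrow> G \<in> lampoly n \<Longrightarrow> F - G \<in> lampoly n"
  using lampoly_add[OF _ lampoly_uminus, of F n G] by simp

lemma lampoly_mono: "n \<le> k \<Longrightarrow> P \<in> lampoly n \<Longrightarrow> P \<in> lampoly k"
  unfolding lampoly_def by fastforce

lemma keys_add_nat: "Poly_Mapping.keys (e + e' :: nat \<Rightarrow>\<^sub>0 nat) = Poly_Mapping.keys e \<union> Poly_Mapping.keys e'"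
  by (auto simp: in_keys_iff lookup_add)

lemma lampoly_lam: "i < n \<Longrightarrow> P \<in> lampoly n \<Longrightarrow> smul (lam i) P \<in> lampoly n"
  by (rule lampoly_additive[OF additive_smul, where n = n])
    (auto simp: smul_lam_single lampoly_single keys_add_nat)

lemma lampoly_lam_power: "i < n \<Longrightarrow> P \<in> lampoly n \<Longrightarrow> smul (lam i ^ k) P \<in> lampoly n"
  by (induction k) (auto simp: smul_one smul_mult lampoly_lam)

lemma lampoly_Sc: "P \<in> lampoly n \<Longrightarrow> Sc r P \<in> lampoly n"
  by (rule lampoly_additive[OF additive_map[OF additive_scaleM], where n = n])
    (auto simp: lampoly_single)

lemma lampoly_induct [consumes 1, case_names const add lam]:
  assumes P: "P \<in> lampoly n" and const: "\<And>m. Q (const m)"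
    and add: "\<And>F G. F \<in> lampoly n \<Longrightarrow> G \<in> lampoly n \<Longrightarrow> Q F \<Longrightarrow> Q G \<Longrightarrow> Q (F + G)"
    and lam: "\<And>i F. i < n \<Longrightarrow> F \<in> lampoly n \<Longrightarrow> Q F \<Longrightarrow> Q (smul (lam i) F)"
  shows "Q P"
proof -
  have *: "Poly_Mapping.keys e \<subseteq> {..<n} \<Longrightarrow> Q (Poly_Mapping.single e m)" for e m
  proof (induction e rule: exponent_induct)
    case (step e i)
    then show ?case
      using lam[of i "Poly_Mapping.single e m"]
      by (auto simp: smul_lam_single keys_add_nat lampoly_single)
  qed (rule const)
  have "Q (\<Sum>e\<in>A. Poly_Mapping.single e (Poly_Mapping.lookup P e)) \<and> (\<Sum>e\<in>A. Poly_Mapping.single e (Poly_Mapping.lookup P e)) \<in> lampoly n"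
    if "finite A" "A \<subseteq> Poly_Mapping.keys P" for A
    using that
  proof (induction A)
    case empty
    show ?case using const[of 0] by (simp add: lampoly_zero)
  next
    case (insert e A)
    then have "Poly_Mapping.keys e \<subseteq> {..<n}"
      using P by (auto simp: lampoly_def)
    with insert * show ?case
      by (auto intro!: add lampoly_add lampoly_single)
  qed
  from this[of "Poly_Mapping.keys P"] show ?thesis
    by (simp flip: poly_mapping_eq_sum_single)
qed

section \<open>Substitution of a scalar polynomial for the spectral parameter of a bracket\<close>

text \<open>The meaning of \<open>Y([a\<^sub>\<lambda> b], ...)\<close> with
  \<open>\<lambda> := f\<close>: the map \<open>F\<close> is applied to the coefficients of the
  bracket \<open>p\<close> and the powers of \<open>\<lambda>\<close> are pulled out.\<close>

definition psum :: "('b::zero \<Rightarrow> 'm mpoly) \<Rightarrow> 'f mpoly \<Rightarrow> 'b poly \<Rightarrow> 'm mpoly" where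
  "psum F f p = (\<Sum>k\<le>degree p. smul (f ^ k) (F (coeff p k)))"

lemma psum_bound:
  assumes "F 0 = 0" "degree p \<le> K"
  shows "psum F f p = (\<Sum>k\<le>K. smul (f ^ k) (F (coeff p k)))"
  unfolding psum_def
  by (rule sum.mono_neutral_left) (use assms in \<open>auto simp: coeff_eq_0\<close>)

lemma psum_add:
  assumes "additive F"
  shows "psum F f (p + q) = psum F f p + psum F f q"
proof -
  let ?K = "max (degree p) (degree q)"
  have *: "degree r \<le> ?K \<Longrightarrow> psum F f r = (\<Sum>k\<le>?K. smul (f ^ k) (F (coeff r k)))" for r
    by (rule psum_bound) (simp_all add: additive.zero[OF assms])
  show ?thesis
    by (subst (1 2 3) *) (auto simp: degree_add_le additive.add[OF assms] sum.distrib
      additive.add[OF additive_smul])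
qed

lemma additive_psum: "additive F \<Longrightarrow> additive (psum F f)"
  by (rule additive.intro) (rule psum_add)

lemma psum_zero_fun: "psum (\<lambda>c. 0) f p = 0"
  by (simp add: psum_def)

lemma psum_add_fun: "psum (\<lambda>c. F c + G c) f p = psum F f p + psum G f p"
  by (simp add: psum_def sum.distrib additive.add[OF additive_smul])

lemma psum_additive:
  assumes "additive \<phi>" "\<And>P. \<phi> (smul f P) = smul f' (\<phi> P)"
  shows "\<phi> (psum F f p) = psum (\<lambda>c. \<phi> (F c)) f' p"
proof -
  have "\<phi> (smul (f ^ k) P) = smul (f' ^ k) (\<phi> P)" for k P
    by (induction k) (auto simp: smul_one smul_mult assms(2))
  then show ?thesis
    by (simp add: psum_def additive.sum[OF assms(1)])
qed

lemma psum_map_poly: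
  assumes "additive F" "additive g"
  shows "psum F f (map_poly g p) = psum (\<lambda>c. F (g c)) f p"
proof -
  have g0: "g 0 = 0" by (rule additive.zero[OF assms(2)])
  show ?thesis
    by (subst psum_bound[where K = "degree p"])
      (simp_all add: additive.zero[OF assms(1)] map_poly_degree_leq psum_def coeff_map_poly g0)
qed

lemma psum_pCons:
  assumes "additive F"
  shows "psum F f (pCons 0 p) = smul f (psum F f p)"
proof -
  have "psum F f (pCons 0 p) = (\<Sum>k\<le>Suc (degree p). smul (f ^ k) (F (coeff (pCons 0 p) k)))"
    by (rule psum_bound) (simp_all add: additive.zero[OF assms] degree_pCons_le)
  also have "\<dots> = smul f (psum F f p)"
    by (subst sum.atMost_Suc_shift) (simp add: additive.zero[OF assms] smul_mult psum_def
      additive.sum[OF additive_smul])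
  finally show ?thesis .
qed

lemma psum_lam_plus:
  assumes "additive F"
  shows "psum F f (lam_plus D p) = smul f (psum F f p) + psum (\<lambda>c. F (D c)) f p"
  by (simp add: lam_plus_def psum_add psum_pCons psum_map_poly assms additive_D)

lemma psum_lam_plus_DM:
  assumes "additive F"
  shows "psum F f (lam_plus DM p) = smul f (psum F f p) + psum (\<lambda>c. F (DM c)) f p"
  by (simp add: lam_plus_def psum_add psum_pCons psum_map_poly assms additive_DM)

lemma lampoly_psum:
  "i < n \<Longrightarrow> (\<And>k. F (coeff p k) \<in> lampoly n) \<Longrightarrow> psum F (lam i) p \<in> lampoly n"
  unfolding psum_def by (intro lampoly_sum lampoly_lam_power) auto

section \<open>The operator \<open>\<partial> + \<Lambda>\<close>, substitutions, and the action of
  an element\<close>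

abbreviation DMm :: "'m mpoly \<Rightarrow> 'm mpoly" where "DMm \<equiv> Poly_Mapping.map DM"

lemma additive_DMm: "additive DMm"
  by (intro additive_map additive_DM)

lemma DMm_lam: "DMm (smul (lam i) P) = smul (lam i) (DMm P)"
  by (rule additive_eqI[where P = P])
    (auto simp: additive_comp[OF additive_DMm additive_smul] additive_comp[OF additive_smul additive_DMm]
      smul_lam_single additive.zero[OF additive_DM])

lemma DMm_const: "DMm (const m) = const (DM m)"
  by (simp add: additive.zero[OF additive_DM])

lemma lampoly_DMm: "P \<in> lampoly n \<Longrightarrow> DMm P \<in> lampoly n"
  by (rule lampoly_additive[OF additive_DMm, where n = n])
    (auto simp: lampoly_single additive.zero[OF additive_DM])

lemma total_def': "total n P = DMm P + smul (\<Sum>i<n. lam i) P"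
  by (simp add: total_def additive.sum[OF additive_smul_left])

lemma additive_total: "additive (total n)"
  unfolding total_def'[abs_def]
  by (intro additive_add additive_DMm additive_smul)

lemma total_Suc: "total (Suc n) P = total n P + smul (lam n) P"
  by (simp add: total_def)

lemma lampoly_total: "n \<le> k \<Longrightarrow> P \<in> lampoly k \<Longrightarrow> total n P \<in> lampoly k"
  unfolding total_def by (intro lampoly_add lampoly_sum lampoly_DMm lampoly_lam) auto

lemma total_lam: "total n (smul (lam i) P) = smul (lam i) (total n P)"
  by (simp add: total_def' DMm_lam additive.add[OF additive_smul] mp.scale_left_commute[of "lam i"])

lemma additive_subst: "additive (subst \<sigma>)"
  unfolding subst_def[abs_def]
  by (intro additive_sum_keys additive_comp[OF additive_smul] additive_single)

lemma subst_const: "subst \<sigma> (const m) = const m"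
  by (simp add: subst_def smul_one)

lemma subst_single:
  assumes "finite A" "Poly_Mapping.keys e \<subseteq> A"
  shows "subst \<sigma> (Poly_Mapping.single e m) = smul (\<Prod>j\<in>A. \<sigma> j ^ Poly_Mapping.lookup e j) (const m)"
proof -
  have "(\<Prod>j\<in>Poly_Mapping.keys e. \<sigma> j ^ Poly_Mapping.lookup e j) = (\<Prod>j\<in>A. \<sigma> j ^ Poly_Mapping.lookup e j)"
    by (rule prod.mono_neutral_left) (use assms in \<open>auto simp: in_keys_iff\<close>)
  then show ?thesis by (simp add: subst_def)
qed

lemma subst_lam: "subst \<sigma> (smul (lam i) P) = smul (\<sigma> i) (subst \<sigma> P)"
proof (rule additive_eqI[where P = P])
  fix e :: "nat \<Rightarrow>\<^sub>0 nat" and m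
  let ?A = "insert i (Poly_Mapping.keys e)"
  have "(\<Prod>j\<in>?A. \<sigma> j ^ Poly_Mapping.lookup (e + var i) j)
    = (\<Prod>j\<in>?A. \<sigma> j ^ Poly_Mapping.lookup e j * (if j = i then \<sigma> i else 1))"
    by (rule prod.cong) (auto simp: lookup_add lookup_single when_def)
  also have "\<dots> = (\<Prod>j\<in>?A. \<sigma> j ^ Poly_Mapping.lookup e j) * \<sigma> i"
    using prod.delta[of ?A i "\<lambda>_. \<sigma> i"] by (simp add: prod.distrib del: prod.insert)
  finally show "subst \<sigma> (smul (lam i) (Poly_Mapping.single e m)) = smul (\<sigma> i) (subst \<sigma> (Poly_Mapping.single e m))"
    by (subst smul_lam_single, subst (1 2) subst_single[where A = ?A])
      (auto simp: keys_add_nat mult.commute smul_mult)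
qed (auto intro: additive_comp additive_subst additive_smul)

lemma lam_power: "lam i ^ k = Poly_Mapping.single (Poly_Mapping.single i k) 1"
  by (induction k) (auto simp: lam_def mult_single simp flip: single_add)

lemma lam_act_alt: "lam_act i a P = (\<Sum>e\<in>Poly_Mapping.keys P.
    smul (Poly_Mapping.single e 1) (psum const (lam i) (act a (Poly_Mapping.lookup P e))))"
  unfolding lam_act_def psum_def
  by (simp add: additive.sum[OF additive_smul] lam_power smul_single)

lemma additive_lam_act: "additive (lam_act i a)"
  unfolding lam_act_alt[abs_def]
  by (intro additive_sum_keys additive_comp[OF additive_smul] additive_comp[OF additive_psum]
     additive_single additive_act)

lemma lam_act_single: "lam_act i a (Poly_Mapping.single e m) = smul (Poly_Mapping.single e 1) (psum const (lam i) (act a m))"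
  by (simp add: lam_act_alt additive.zero[OF additive_act] psum_def)

lemma lam_act_const: "lam_act i a (const m) = psum const (lam i) (act a m)"
  by (simp add: lam_act_single smul_one)

lemma lam_act_lam: "lam_act i a (smul (lam j) P) = smul (lam j) (lam_act i a P)"
proof (rule additive_eqI[where P = P])
  fix e :: "nat \<Rightarrow>\<^sub>0 nat" and m
  have "Poly_Mapping.single (e + var j) (1::'f) = lam j * Poly_Mapping.single e 1"
    by (simp add: lam_def mult_single add.commute)
  then show "lam_act i a (smul (lam j) (Poly_Mapping.single e m)) = smul (lam j) (lam_act i a (Poly_Mapping.single e m))"
    unfolding smul_lam_single lam_act_single by (simp add: smul_mult)
qed (auto intro: additive_comp additive_lam_act additive_smul)

lemma lam_act_DMm: "lam_act i a (DMm P) = DMm (lam_act i a P) + smul (lam i) (lam_act i a P)"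
proof (induction P rule: mpoly_induct)
  case (const m)
  have "psum (\<lambda>c. const (DM c)) (lam i) (act a m) = DMm (psum const (lam i) (act a m))"
    by (subst psum_additive[OF additive_DMm]) (simp_all add: DMm_lam DMm_const)
  then show ?case
    by (simp add: DMm_const lam_act_const act_D_right psum_lam_plus_DM additive_single)
qed (auto simp: DMm_lam lam_act_lam additive.add[OF additive_smul] additive.add[OF additive_lam_act]
   additive.add[OF additive_DMm] mp.scale_left_commute)

lemma lampoly_lam_act: "i < n \<Longrightarrow> P \<in> lampoly n \<Longrightarrow> lam_act i a P \<in> lampoly n"
proof -
  assume i: "i < n"
  assume "P \<in> lampoly n"
  then show "lam_act i a P \<in> lampoly n"
    by (induction rule: lampoly_induct)
      (use i in \<open>auto simp: lam_act_const lam_act_lam additive.add[OF additive_lam_act]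
        intro: lampoly_add lampoly_lam lampoly_psum lampoly_const\<close>)
qed

lemma lampoly_subst:
  assumes "P \<in> lampoly n" "\<And>i F. i < n \<Longrightarrow> F \<in> lampoly k \<Longrightarrow> smul (\<sigma> i) F \<in> lampoly k"
  shows "subst \<sigma> P \<in> lampoly k"
  using assms(1)
  by (induction rule: lampoly_induct)
    (auto simp: subst_const subst_lam additive.add[OF additive_subst] lampoly_const lampoly_add assms(2))

lemma subst_DMm:
  assumes "\<And>i F. DMm (smul (\<sigma> i) F) = smul (\<sigma> i) (DMm F)"
  shows "subst \<sigma> (DMm P) = DMm (subst \<sigma> P)"
  by (induction P rule: mpoly_induct)
    (auto simp: subst_const subst_lam additive.add[OF additive_subst] additive.add[OF additive_DMm] DMm_lam DMm_const assms)

section \<open>Evaluation of polynomials in several variables at scalars\<close>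

text \<open>After substitution of constants only the exponent 0 is left, so the coefficient there is
  the value. Polynomials are determined by their values (\<open>ev_eqI\<close>), which allows
  identities mixing several spectral parameters to be proved pointwise.\<close>

definition ev :: "(nat \<Rightarrow> 'f) \<Rightarrow> 'm mpoly \<Rightarrow> 'm" where
  "ev x P = Poly_Mapping.lookup (subst (\<lambda>i. Poly_Mapping.single 0 (x i)) P) 0"

lemma additive_ev: "additive (ev x)"
  by (simp add: ev_def additive_def additive.add[OF additive_subst] lookup_add)

lemma ev_const: "ev x (const m) = m"
  by (simp add: ev_def subst_const)

lemma ev_lam: "ev x (smul (lam i) P) = scaleM (x i) (ev x P)"
  by (simp add: ev_def subst_lam lookup_map flip: Sc_eq_smul)

lemma ev_lam_power: "ev x (smul (lam i ^ k) P) = scaleM (x i ^ k) (ev x P)"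
  by (induction k) (simp_all add: smul_mult ev_lam)

lemma ev_psum:
  assumes "\<And>P. ev x (smul f P) = scaleM c (ev x P)"
  shows "ev x (psum F f p) = (\<Sum>k\<le>degree p. scaleM (c ^ k) (ev x (F (coeff p k))))"
proof -
  have "ev x (smul (f ^ k) P) = scaleM (c ^ k) (ev x P)" for k P
    by (induction k) (simp_all add: smul_mult assms)
  then show ?thesis
    by (simp add: psum_def additive.sum[OF additive_ev])
qed

definition actx :: "'f \<Rightarrow> 'v \<Rightarrow> 'm \<Rightarrow> 'm" where "actx t a m = M.pev t (act a m)"
definition brx :: "'f \<Rightarrow> 'v \<Rightarrow> 'v \<Rightarrow> 'v" where "brx t a b = pev t (br a b)"

lemma additive_actx: "additive (actx t a)" and additive_actx_left: "additive (\<lambda>a. actx t a m)"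
  by (simp_all add: actx_def additive_def act_add_left act_add_right M.pev_add)

lemma additive_brx: "additive (brx t a)" and additive_brx_left: "additive (\<lambda>a. brx t a b)"
  by (simp_all add: brx_def additive_def br_add_left br_add_right pev_add)

lemma actx_scale: "actx t a (scaleM r m) = scaleM r (actx t a m)" "actx t (scale r a) m = scaleM r (actx t a m)"
  by (simp_all add: actx_def act_scale_left act_scale_right M.pev_map_poly_scale)

lemma brx_scale: "brx t a (scale r m) = scale r (brx t a m)" "brx t (scale r a) b = scale r (brx t a b)"
  by (simp_all add: brx_def br_scale_left br_scale_right pev_map_poly_scale)

lemma ev_lam_act: "ev x (lam_act i a P) = actx (x i) a (ev x P)"
proof (induction P rule: mpoly_induct)
  case (const m)
  then show ?case
    by (simp add: lam_act_const ev_psum[OF ev_lam] ev_const actx_def M.pev_def)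
qed (simp_all add: additive.add[OF additive_lam_act] additive.add[OF additive_ev] additive.add[OF additive_actx]
  lam_act_lam ev_lam actx_scale)

lemma ev_subst:
  assumes "\<And>i P. ev x (smul (\<sigma> i) P) = scaleM (y i) (ev x P)"
  shows "ev x (subst \<sigma> P) = ev y P"
  by (induction P rule: mpoly_induct)
    (simp_all add: subst_const ev_const additive.add[OF additive_subst] additive.add[OF additive_ev] subst_lam ev_lam assms)

lemma ev_cong:
  assumes "P \<in> lampoly n" "\<And>i. i < n \<Longrightarrow> x i = y i"
  shows "ev x P = ev y P"
  using assms(1)
  by (induction rule: lampoly_induct)
    (simp_all add: ev_const additive.add[OF additive_ev] ev_lam assms(2))

text \<open>The requirement \<open>R k = 0\<close> beyond \<open>K\<close> lets two expansions in
  powers of the last variable be padded to a common length before they are added.\<close>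

lemma lampoly_Suc_expand:
  assumes "P \<in> lampoly (Suc n)"
  shows "\<exists>K R. (\<forall>k. R k \<in> lampoly n) \<and> (\<forall>k>K. R k = 0) \<and> P = (\<Sum>k\<le>K. smul (lam n ^ k) (R k))"
  using assms
proof (induction rule: lampoly_induct)
  case (const m)
  show ?case
    by (rule exI[of _ 0], rule exI[of _ "\<lambda>k. if k = 0 then const m else 0"]) (simp add: lampoly_const lampoly_zero)
next
  case (add F G)
  then obtain K R K' R' where R: "\<forall>k. R k \<in> lampoly n" "\<forall>k>K. R k = 0" "F = (\<Sum>k\<le>K. smul (lam n ^ k) (R k))"
     "\<forall>k. R' k \<in> lampoly n" "\<forall>k>K'. R' k = 0" "G = (\<Sum>k\<le>K'. smul (lam n ^ k) (R' k))" by blast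
  have "F = (\<Sum>k\<le>max K K'. smul (lam n ^ k) (R k))"
    unfolding R(3) by (rule sum.mono_neutral_left) (use R in auto)
  moreover have "G = (\<Sum>k\<le>max K K'. smul (lam n ^ k) (R' k))"
    unfolding R(6) by (rule sum.mono_neutral_left) (use R in auto)
  ultimately have "F + G = (\<Sum>k\<le>max K K'. smul (lam n ^ k) (R k + R' k))"
    by (simp add: sum.distrib mp.scale_right_distrib)
  then show ?case
    using R by (intro exI[of _ "max K K'"] exI[of _ "\<lambda>k. R k + R' k"]) (auto intro: lampoly_add)
next
  case (lam i F)
  then obtain K R where R: "\<forall>k. R k \<in> lampoly n" "\<forall>k>K. R k = 0" "F = (\<Sum>k\<le>K. smul (lam n ^ k) (R k))" by blast
  show ?case
  proof (cases "i = n")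
    case True
    have "smul (lam i) F = (\<Sum>k\<le>Suc K. smul (lam n ^ k) (case k of 0 \<Rightarrow> 0 | Suc k \<Rightarrow> R k))"
      by (subst sum.atMost_Suc_shift) (simp add: R(3) True smul_mult mp.scale_sum_right)
    then show ?thesis
      using R by (intro exI[of _ "Suc K"] exI[of _ "\<lambda>k. case k of 0 \<Rightarrow> 0 | Suc k \<Rightarrow> R k"])
        (auto split: nat.splits simp: lampoly_zero)
  next
    case False
    have "smul (lam i) F = (\<Sum>k\<le>K. smul (lam n ^ k) (smul (lam i) (R k)))"
      by (simp add: R(3) mp.scale_sum_right mp.scale_left_commute)
    then show ?thesis
      using R lam False by (intro exI[of _ K] exI[of _ "\<lambda>k. smul (lam i) (R k)"]) (auto intro: lampoly_lam)
  qed
qed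

lemma lampoly_0: "P \<in> lampoly 0 \<Longrightarrow> \<exists>m. P = const m"
  by (induction rule: lampoly_induct) (auto simp: single_add[symmetric])

lemma ex_lampoly: "\<exists>n. P \<in> lampoly n"
proof (induction P rule: mpoly_induct)
  case (add F G)
  then obtain n k where "F \<in> lampoly n" "G \<in> lampoly k" by blast
  then have "F + G \<in> lampoly (max n k)"
    by (intro lampoly_add) (auto intro: lampoly_mono[rotated])
  then show ?case by blast
next
  case (lam i F)
  then obtain n where "F \<in> lampoly n" by blast
  then have "smul (lam i) F \<in> lampoly (max n (Suc i))"
    by (intro lampoly_lam) (auto intro: lampoly_mono[rotated])
  then show ?case by blast
qed (auto intro: lampoly_const)

text \<open>Induction on the number of variables: with the values of the others fixed,
  \<open>P\<close> is a polynomial in the last scalar, whose coefficients vanish by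
  \<open>M.vanishing_coefficients\<close>.\<close>

lemma ev_zero_imp: 
  assumes "\<And>x. ev x P = 0" shows "P = 0"
proof -
  have "P = 0" if "P \<in> lampoly n" for n
    using that assms
  proof (induction n arbitrary: P)
    case 0
    then show ?case using lampoly_0[of P] by (auto simp: ev_const)
  next
    case (Suc n)
    then obtain K R where R: "\<forall>k. R k \<in> lampoly n" "P = (\<Sum>k\<le>K. smul (lam n ^ k) (R k))"
      using lampoly_Suc_expand by blast
    have "ev x (R k) = 0" if "k \<le> K" for k x
    proof (rule M.vanishing_coefficients[where c = "\<lambda>k. ev x (R k)" and K = K])
      fix t
      have "(\<Sum>k\<le>K. scaleM (t ^ k) (ev x (R k))) = (\<Sum>k\<le>K. scaleM (t ^ k) (ev (x(n := t)) (R k)))"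
        by (rule sum.cong) (auto intro!: arg_cong[where f = "scaleM _"] ev_cong[where n = n] simp: R)
      also have "\<dots> = ev (x(n := t)) P"
        by (simp add: R(2) additive.sum[OF additive_ev] ev_lam_power)
      finally show "(\<Sum>k\<le>K. scaleM (t ^ k) (ev x (R k))) = 0"
        by (simp add: Suc.prems)
    qed (use that in auto)
    then have "R k = 0" if "k \<le> K" for k
      using Suc.IH[of "R k"] R(1) that by blast
    then show ?case by (simp add: R(2))
  qed
  then show ?thesis using ex_lampoly by blast
qed

lemma ev_eqI: "(\<And>x. ev x P = ev x Q) \<Longrightarrow> P = Q"
  using ev_zero_imp[of "P - Q"] by (simp add: additive.diff[OF additive_ev])

section \<open>Elimination of the last variable\<close>

text \<open>Substitutes \<open>- \<partial> - \<lambda>\<^sub>0 - ... -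
  \<lambda>\<^sub>n\<^sub>-\<^sub>1\<close> for \<open>\<lambda>\<^sub>n\<close>; as
  \<open>\<partial>\<close> acts on the coefficients, this is not an instance of
  \<open>subst\<close>. It kills the image of \<open>total (Suc n)\<close> and fixes polynomials in
  the first \<open>n\<close> variables, hence identifies the quotient in \<open>n + 1\<close>
  variables with honest polynomials in \<open>n\<close> variables.\<close>

definition elim :: "nat \<Rightarrow> 'm mpoly \<Rightarrow> 'm mpoly" where
  "elim n P = (\<Sum>e\<in>Poly_Mapping.keys P. ((\<lambda>Q. - total n Q) ^^ Poly_Mapping.lookup e n)
     (Poly_Mapping.single (e - Poly_Mapping.single n (Poly_Mapping.lookup e n)) (Poly_Mapping.lookup P e)))"

lemma additive_funpow: "additive (f :: 'b::ab_group_add \<Rightarrow> 'b) \<Longrightarrow> additive (f ^^ k)"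
  by (induction k) (auto simp: additive_def)

lemma additive_elim: "additive (elim n)"
  unfolding elim_def[abs_def]
  by (intro additive_sum_keys additive_comp[OF additive_funpow] additive_single additive_uminus additive_total)

lemma elim_single: "elim n (Poly_Mapping.single e m) = ((\<lambda>Q. - total n Q) ^^ Poly_Mapping.lookup e n)
     (Poly_Mapping.single (e - Poly_Mapping.single n (Poly_Mapping.lookup e n)) m)"
  using additive.zero[OF additive_funpow[OF additive_uminus[OF additive_total]]] by (simp add: elim_def)

lemma elim_const: "elim n (const m) = const m"
  by (simp add: elim_single)

lemma elim_lam_same: "elim n (smul (lam n) P) = - total n (elim n P)"
proof (rule additive_eqI[where P = P])
  fix e :: "nat \<Rightarrow>\<^sub>0 nat" and m
  have "e + var n - Poly_Mapping.single n (Suc (Poly_Mapping.lookup e n)) = e - Poly_Mapping.single n (Poly_Mapping.lookup e n)"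
    by (rule poly_mapping_eqI) (auto simp: lookup_minus lookup_add lookup_single when_def)
  then show "elim n (smul (lam n) (Poly_Mapping.single e m)) = - total n (elim n (Poly_Mapping.single e m))"
    by (simp add: smul_lam_single elim_single lookup_add)
qed (intro additive_comp[OF additive_elim additive_smul] additive_uminus additive_comp[OF additive_total additive_elim])+

lemma elim_lam:
  assumes "i \<noteq> n"
  shows "elim n (smul (lam i) P) = smul (lam i) (elim n P)"
proof (rule additive_eqI[where P = P])
  fix e :: "nat \<Rightarrow>\<^sub>0 nat" and m
  have *: "((\<lambda>Q. - total n Q) ^^ k) (smul (lam i) F) = smul (lam i) (((\<lambda>Q. - total n Q) ^^ k) F)" for k F
    by (induction k) (simp_all add: total_lam)
  have "e + var i - Poly_Mapping.single n (Poly_Mapping.lookup e n) = e - Poly_Mapping.single n (Poly_Mapping.lookup e n) + var i"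
    by (rule poly_mapping_eqI) (use assms in \<open>auto simp: lookup_minus lookup_add lookup_single when_def\<close>)
  then show "elim n (smul (lam i) (Poly_Mapping.single e m)) = smul (lam i) (elim n (Poly_Mapping.single e m))"
    using assms by (simp add: smul_lam_single elim_single lookup_add lookup_single flip: *)
qed (intro additive_comp[OF additive_elim additive_smul] additive_comp[OF additive_smul additive_elim])+

lemma elim_lampoly: "P \<in> lampoly n \<Longrightarrow> elim n P = P"
  by (induction rule: lampoly_induct) (auto simp: elim_const additive.add[OF additive_elim] elim_lam)

lemma lampoly_elim: "P \<in> lampoly (Suc n) \<Longrightarrow> elim n P \<in> lampoly n"
proof (induction rule: lampoly_induct)
  case (lam i F)
  then show ?case
    by (cases "i = n") (auto simp: elim_lam_same elim_lam lampoly_uminus lampoly_total lampoly_lam)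
qed (auto simp: elim_const additive.add[OF additive_elim] lampoly_const lampoly_add)

lemma elim_DMm: "elim n (DMm P) = DMm (elim n P)"
proof (induction P rule: mpoly_induct)
  case (lam i F)
  have "total n (DMm Q) = DMm (total n Q)" for Q
    by (simp add: total_def additive.add[OF additive_DMm] additive.sum[OF additive_DMm] DMm_lam)
  with lam show ?case
    by (cases "i = n") (simp_all add: DMm_lam elim_lam_same elim_lam additive.minus[OF additive_DMm])
qed (simp_all add: DMm_const elim_const additive.add[OF additive_DMm] additive.add[OF additive_elim])

lemma elim_total: "elim n (total n P) = total n (elim n P)"
  by (simp add: total_def additive.add[OF additive_elim] additive.sum[OF additive_elim] elim_DMm elim_lam)

lemma elim_total_Suc: "elim n (total (Suc n) P) = 0"
  by (simp add: total_Suc additive.add[OF additive_elim] elim_total elim_lam_same)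

text \<open>The operator carries eliminated variable to eliminated variable and intertwines the
  substituted operators \<open>total n\<close> and \<open>total k\<close>, so it respects the
  substitution; the proof is by induction on the power of \<open>lam n\<close>.\<close>

lemma elim_commute:
  assumes "additive \<phi>" "\<And>F. F \<in> lampoly (Suc n) \<Longrightarrow> \<phi> (smul (lam n) F) = smul (lam k) (\<phi> F)"
    "\<And>F. F \<in> lampoly n \<Longrightarrow> \<phi> F \<in> lampoly k" "\<And>F. F \<in> lampoly n \<Longrightarrow> \<phi> (total n F) = total k (\<phi> F)"
    and P: "P \<in> lampoly (Suc n)"
  shows "elim k (\<phi> P) = \<phi> (elim n P)"
proof -
  obtain K R where R: "\<forall>k. R k \<in> lampoly n" "P = (\<Sum>k\<le>K. smul (lam n ^ k) (R k))"
    using lampoly_Suc_expand[OF P] by blast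
  have *: "elim k (\<phi> (smul (lam n ^ j) (R j))) = \<phi> (elim n (smul (lam n ^ j) (R j)))" for j
  proof -
    define F where "F = R j"
    have F: "F \<in> lampoly n" using R by (simp add: F_def)
    have "smul (lam n ^ i) F \<in> lampoly (Suc n) \<and> elim n (smul (lam n ^ i) F) \<in> lampoly n
      \<and> elim k (\<phi> (smul (lam n ^ i) F)) = \<phi> (elim n (smul (lam n ^ i) F))" for i
    proof (induction i)
      case 0
      then show ?case
        using F assms by (simp add: elim_lampoly lampoly_mono[of n "Suc n"])
    next
      case (Suc i)
      then show ?case
        by (simp add: smul_mult lampoly_lam elim_lam_same assms lampoly_uminus lampoly_total additive.minus[OF assms(1)])
    qed
    then show ?thesis unfolding F_def by blast
  qed
  show ?thesis
    by (simp add: R(2) additive.sum[OF assms(1)] additive.sum[OF additive_elim] *)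
qed

section \<open>The operators \<open>exp_dot\<close> of the Leibniz rule\<close>

lemma D_one: "D 1 = 0"
  using D_mult[of 1 1] by simp

lemma D_part: "a \<in> part p \<Longrightarrow> D a \<in> part p"
  using D_even by (simp add: even_endo_def)

lemma D_pow_add: "(D ^^ k) (a + b) = (D ^^ k) a + (D ^^ k) b"
  by (induction k) (simp_all add: additive.add[OF additive_D])

lemma additive_exp_dot: "additive (exp_dot i b)"
  unfolding exp_dot_def[abs_def]
  by (intro additive_sum_keys additive_sum additive_comp[OF additive_single]
     additive_comp[OF additive_scaleM] additive_dot)

lemma exp_dot_single: "exp_dot i b (Poly_Mapping.single e m) = (\<Sum>k\<le>Poly_Mapping.lookup e i.
     Poly_Mapping.single (e - Poly_Mapping.single i k)
       (scaleM (of_nat (Poly_Mapping.lookup e i choose k)) (dot ((D ^^ k) b) m)))"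
  by (simp add: exp_dot_def additive.zero[OF additive_dot])

lemma additive_exp_dot_left: "additive (\<lambda>b. exp_dot i b P)"
  unfolding exp_dot_def[abs_def]
  by (rule additive_sum, rule additive_sum, rule additive_comp[OF additive_single], rule additive_comp[OF additive_scaleM])
    (simp add: additive_def D_pow_add dot_add_left)

lemma exp_dot_const: "exp_dot i b (const m) = const (dot b m)"
  by (simp add: exp_dot_single)

lemma exp_dot_lam:
  assumes "j \<noteq> i"
  shows "exp_dot i b (smul (lam j) P) = smul (lam j) (exp_dot i b P)"
proof (rule additive_eqI[where P = P])
  fix e :: "nat \<Rightarrow>\<^sub>0 nat" and m
  have "e + var j - Poly_Mapping.single i k = e - Poly_Mapping.single i k + var j" for k
    by (rule poly_mapping_eqI) (use assms in \<open>auto simp: lookup_minus lookup_add lookup_single when_def\<close>)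
  then show "exp_dot i b (smul (lam j) (Poly_Mapping.single e m)) = smul (lam j) (exp_dot i b (Poly_Mapping.single e m))"
    using assms by (simp add: smul_lam_single exp_dot_single lookup_add lookup_single additive.sum[OF additive_smul])
qed (intro additive_comp[OF additive_exp_dot additive_smul] additive_comp[OF additive_smul additive_exp_dot])+

text \<open>The commutator of \<open>d/d\<lambda>\<close> with \<open>\<lambda>\<close> is 1, so
  moving the exponential past \<open>\<lambda>\<close> applies \<open>\<partial>\<close> to
  \<open>b\<close> once. On monomials this is Pascal's rule for the binomial coefficients.\<close>

lemma exp_dot_lam_same:
  "exp_dot i b (smul (lam i) P) = smul (lam i) (exp_dot i b P) + exp_dot i (D b) P"
proof (rule additive_eqI[where P = P])
  fix e :: "nat \<Rightarrow>\<^sub>0 nat" and m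
  let ?n = "Poly_Mapping.lookup e i"
  have e1: "e + var i - Poly_Mapping.single i (Suc k) = e - Poly_Mapping.single i k" for k
    by (rule poly_mapping_eqI) (auto simp: lookup_minus lookup_add lookup_single when_def)
  have e2: "e - Poly_Mapping.single i k + var i = e + var i - Poly_Mapping.single i k" if "k \<le> ?n" for k
    by (rule poly_mapping_eqI) (use that in \<open>auto simp: lookup_minus lookup_add lookup_single when_def\<close>)
  let ?t = "\<lambda>k r. Poly_Mapping.single (e + var i - Poly_Mapping.single i k) (scaleM (of_nat r) (dot ((D ^^ k) b) m))"
  have add: "?t k (r + s) = ?t k r + ?t k s" for k r s
    by (simp add: M.scale_left_distrib single_add)
  have "exp_dot i b (smul (lam i) (Poly_Mapping.single e m)) = (\<Sum>k\<le>Suc ?n. ?t k (Suc ?n choose k))"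
    by (simp add: smul_lam_single exp_dot_single lookup_add)
  also have "\<dots> = ?t 0 1 + (\<Sum>k\<le>?n. ?t (Suc k) (?n choose Suc k)) + (\<Sum>k\<le>?n. ?t (Suc k) (?n choose k))"
    by (subst sum.atMost_Suc_shift)
      (simp only: binomial_Suc_Suc add sum.distrib binomial_n_0, simp add: add_ac)
  also have "?t 0 1 + (\<Sum>k\<le>?n. ?t (Suc k) (?n choose Suc k)) = (\<Sum>k\<le>Suc ?n. ?t k (?n choose k))"
    by (simp only: sum.atMost_Suc_shift[of _ ?n] binomial_n_0)
  also have "\<dots> = (\<Sum>k\<le>?n. ?t k (?n choose k))"
  proof -
    have "?n choose Suc ?n = 0" by (rule binomial_eq_0) simp
    then have "?t (Suc ?n) (?n choose Suc ?n) = 0" by (simp only: of_nat_0 M.scale_zero_left single_zero)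
    then show ?thesis by (simp only: sum.atMost_Suc add_0_right)
  qed
  also have "\<dots> = smul (lam i) (exp_dot i b (Poly_Mapping.single e m))"
    by (auto simp: exp_dot_single additive.sum[OF additive_smul] smul_lam_single e2 intro!: sum.cong)
  also have "(\<Sum>k\<le>?n. ?t (Suc k) (?n choose k)) = exp_dot i (D b) (Poly_Mapping.single e m)"
    by (simp add: exp_dot_single e1 funpow_swap1)
  finally show "exp_dot i b (smul (lam i) (Poly_Mapping.single e m))
    = smul (lam i) (exp_dot i b (Poly_Mapping.single e m)) + exp_dot i (D b) (Poly_Mapping.single e m)" .
qed (intro additive_comp[OF additive_exp_dot additive_smul] additive_comp[OF additive_smul additive_exp_dot] additive_add additive_exp_dot)+

lemma exp_dot_DMm: "exp_dot i b (DMm P) + exp_dot i (D b) P = DMm (exp_dot i b P)"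
proof (induction P arbitrary: b rule: mpoly_induct)
  case (const m)
  then show ?case by (simp add: DMm_const exp_dot_const dot_D add.commute flip: single_add)
next
  case (add F G)
  then show ?case
    by (simp add: additive.add[OF additive_DMm] additive.add[OF additive_exp_dot] add_ac flip: add)
next
  case (lam j F)
  then show ?case
    by (cases "j = i") (simp_all add: DMm_lam exp_dot_lam exp_dot_lam_same additive.add[OF additive_DMm]
      mp.scale_right_distrib add_ac flip: lam)
qed

text \<open>Moving past \<open>\<lambda>\<^sub>i\<close> adds a term with \<open>D b\<close>, moving
  past \<open>\<partial>\<close> subtracts the same term (\<open>exp_dot_DMm\<close>). The two
  cancel, so the operator acts on the quotient.\<close>

lemma exp_dot_total:
  assumes "i < n" shows "exp_dot i b (total n P) = total n (exp_dot i b P)"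
proof -
  have "exp_dot i b (\<Sum>j<n. smul (lam j) P)
     = (\<Sum>j<n. smul (lam j) (exp_dot i b P) + (if j = i then exp_dot i (D b) P else 0))"
    by (auto simp: additive.sum[OF additive_exp_dot] exp_dot_lam exp_dot_lam_same intro!: sum.cong)
  also have "\<dots> = (\<Sum>j<n. smul (lam j) (exp_dot i b P)) + exp_dot i (D b) P"
    using assms by (simp add: sum.distrib)
  finally show ?thesis
    by (simp add: total_def additive.add[OF additive_exp_dot] add_ac flip: exp_dot_DMm)
qed

lemma lampoly_exp_dot: "P \<in> lampoly n \<Longrightarrow> i < n \<Longrightarrow> exp_dot i b P \<in> lampoly n"
proof (induction arbitrary: b rule: lampoly_induct)
  case (lam j F)
  then show ?case
    by (cases "j = i") (auto simp: exp_dot_lam exp_dot_lam_same intro!: lampoly_add lampoly_lam)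
qed (auto simp: exp_dot_const additive.add[OF additive_exp_dot] lampoly_const lampoly_add)

lemma exp_dot_one: "exp_dot i 1 P = P"
  by (induction P rule: mpoly_induct)
   (auto simp: exp_dot_const additive.add[OF additive_exp_dot] dot_one exp_dot_lam_same D_one exp_dot_lam
     additive.zero[OF additive_exp_dot_left] split: if_splits intro: exp_dot_lam[THEN trans],
     metis (no_types) D_one additive.zero[OF additive_exp_dot_left] add.right_neutral exp_dot_lam exp_dot_lam_same)

lemma subst_exp_dot:
  assumes "\<And>j b F. j \<noteq> i \<Longrightarrow> exp_dot i' b (smul (\<sigma> j) F) = smul (\<sigma> j) (exp_dot i' b F)"
    "\<And>b F. exp_dot i' b (smul (\<sigma> i) F) = smul (\<sigma> i) (exp_dot i' b F) + exp_dot i' (D b) F"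
  shows "subst \<sigma> (exp_dot i b F) = exp_dot i' b (subst \<sigma> F)"
proof (induction F arbitrary: b rule: mpoly_induct)
  case (lam j F)
  then show ?case
    by (cases "j = i") (simp_all add: exp_dot_lam exp_dot_lam_same subst_lam assms additive.add[OF additive_subst])
qed (simp_all add: subst_const exp_dot_const additive.add[OF additive_subst] additive.add[OF additive_exp_dot])

section \<open>The shift of a variable by the spectral parameter of \<open>L\<close>\<close>

text \<open>An argument \<open>[L\<^sub>\<lambda> a\<^sub>i]\<close> of a cochain carries the
  variable \<open>\<lambda>\<^sub>i + \<lambda>\<close>. Throughout, the parameter of
  \<open>L\<close> is \<open>lam n\<close>, the first variable that an \<open>n\<close>-cochain
  leaves free.\<close>

definition sh :: "nat \<Rightarrow> nat \<Rightarrow> 'm mpoly \<Rightarrow> 'm mpoly" where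
  "sh n i = subst (lam(i := lam i + lam n))"

lemma additive_sh: "additive (sh n i)"
  by (simp add: sh_def additive_subst)

lemma sh_const: "sh n i (const m) = const m"
  by (simp add: sh_def subst_const)

lemma sh_lam: "j \<noteq> i \<Longrightarrow> sh n i (smul (lam j) P) = smul (lam j) (sh n i P)"
  "sh n i (smul (lam i) P) = smul (lam i) (sh n i P) + smul (lam n) (sh n i P)"
  by (simp_all add: sh_def subst_lam mp.scale_left_distrib)

lemma sh_DMm: "sh n i (DMm P) = DMm (sh n i P)"
  unfolding sh_def by (rule subst_DMm) (simp add: DMm_lam mp.scale_left_distrib additive.add[OF additive_DMm])

lemma sh_total:
  assumes "i < n" shows "sh n i (total n P) = total (Suc n) (sh n i P)"
proof -
  have "sh n i (\<Sum>j<n. smul (lam j) P) = (\<Sum>j<n. smul (lam j) (sh n i P) + (if j = i then smul (lam n) (sh n i P) else 0))"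
    by (auto simp: additive.sum[OF additive_sh] sh_lam intro!: sum.cong)
  also have "\<dots> = (\<Sum>j<n. smul (lam j) (sh n i P)) + smul (lam n) (sh n i P)"
    using assms by (simp add: sum.distrib)
  finally show ?thesis
    by (simp add: total_def additive.add[OF additive_sh] sh_DMm add_ac)
qed

lemma lampoly_sh: "P \<in> lampoly n \<Longrightarrow> i < n \<Longrightarrow> sh n i P \<in> lampoly (Suc n)"
  unfolding sh_def
  by (erule lampoly_subst) (auto simp: mp.scale_left_distrib intro!: lampoly_lam lampoly_add)

lemma sh_exp_dot: "i \<noteq> n \<Longrightarrow> sh n l (exp_dot i b F) = exp_dot i b (sh n l F)"
  unfolding sh_def
  by (rule subst_exp_dot)
    (auto simp: exp_dot_lam exp_dot_lam_same mp.scale_left_distrib additive.add[OF additive_exp_dot] add_ac)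

lemma psum_const_monom: "psum const f (monom c k) = smul (f ^ k) (const c)"
proof (cases "c = 0")
  case False
  then have "psum const f (monom c k) = (\<Sum>j\<le>k. if j = k then smul (f ^ k) (const c) else 0)"
    unfolding psum_def degree_monom_eq[OF False] by (intro sum.cong) auto
  then show ?thesis by simp
qed (simp add: psum_def)

text \<open>By induction on \<open>F\<close>. Moving \<open>b\<close> past
  \<open>\<lambda>\<^sub>i\<close> creates \<open>\<partial> b\<close>, and
  \<open>[L\<^sub>\<lambda> \<partial> b] = (\<lambda> + \<partial>) [L\<^sub>\<lambda> b]\<close>;
  the summand \<open>\<lambda>\<close> is what replaces \<open>\<lambda>\<^sub>i\<close> by
  \<open>\<lambda>\<^sub>i + \<lambda>\<^sub>n\<close> in the bracket term.\<close>

lemma lam_act_exp_dot: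
  assumes L: "L \<in> part 0" and b: "b \<in> part p" and i: "i \<noteq> n"
  shows "lam_act n L (exp_dot i b F) = exp_dot i b (lam_act n L F)
    + psum (\<lambda>\<beta>. sh n i (exp_dot i \<beta> F)) (lam n) (br L b)"
  using b
proof (induction F arbitrary: b rule: mpoly_induct)
  case (const m)
  have "exp_dot i b (psum const (lam n) (act L m)) = psum (\<lambda>c. exp_dot i b (const c)) (lam n) (act L m)"
    by (rule psum_additive[OF additive_exp_dot]) (use i in \<open>simp add: exp_dot_lam\<close>)
  moreover have "psum const (lam n) (map_poly (dot b) (act L m)) = psum (\<lambda>c. const (dot b c)) (lam n) (act L m)"
    by (rule psum_map_poly[OF additive_single additive_dot])
  moreover have "psum const (lam n) (\<Sum>k\<le>degree (br L b). monom (dot (coeff (br L b) k) m) k)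
     = psum (\<lambda>\<beta>. const (dot \<beta> m)) (lam n) (br L b)"
    by (simp add: additive.sum[OF additive_psum[OF additive_single]] psum_const_monom) (simp add: psum_def)
  ultimately show ?case
    using act_dot[OF L const] by (simp add: exp_dot_const lam_act_const sh_const psum_add[OF additive_single] add_ac)
next
  case (add F G)
  then show ?case
    by (simp add: additive.add[OF additive_lam_act] additive.add[OF additive_exp_dot] additive.add[OF additive_sh]
      psum_add_fun algebra_simps)
next
  case (lam j F)
  have *: "smul f (psum H g p) = psum (\<lambda>c. smul f (H c)) g p" for f g H and p :: "'v poly"
    by (rule psum_additive[OF additive_smul]) (rule mp.scale_left_commute)
  show ?case
  proof (cases "j = i")
    case False
    then show ?thesis
      using i by (simp add: exp_dot_lam lam_act_lam lam sh_lam mp.scale_right_distrib *)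
  next
    case True
    have "br L (D b) = lam_plus D (br L b)" by (rule br_D_right)
    moreover have "additive (\<lambda>\<beta>. sh n i (exp_dot i \<beta> F))"
      by (rule additive_comp[OF additive_sh additive_exp_dot_left])
    ultimately show ?thesis
      using True by (simp add: exp_dot_lam_same additive.add[OF additive_lam_act] lam_act_lam lam D_part
        additive.add[OF additive_sh] sh_lam mp.scale_right_distrib * psum_add_fun psum_lam_plus algebra_simps)
  qed
qed

section \<open>Derivatives and first-order expansions in the parameter of \<open>L\<close>\<close>

definition der :: "nat \<Rightarrow> 'm mpoly \<Rightarrow> 'm mpoly" where
  "der i P = (\<Sum>e\<in>Poly_Mapping.keys P.
     Poly_Mapping.single (e - var i) (scaleM (of_nat (Poly_Mapping.lookup e i)) (Poly_Mapping.lookup P e)))"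

lemma additive_der: "additive (der i)"
  unfolding der_def[abs_def]
  by (intro additive_sum_keys additive_comp[OF additive_single] additive_scaleM)

lemma der_single: "der i (Poly_Mapping.single e m) = Poly_Mapping.single (e - var i) (scaleM (of_nat (Poly_Mapping.lookup e i)) m)"
  by (simp add: der_def)

lemma der_const: "der i (const m) = 0"
  by (simp add: der_single)

lemma der_lam_same: "der i (smul (lam i) P) = P + smul (lam i) (der i P)"
proof (rule additive_eqI[where P = P])
  fix e :: "nat \<Rightarrow>\<^sub>0 nat" and m
  have "Poly_Mapping.single (e - var i + var i) (scaleM (of_nat (Poly_Mapping.lookup e i)) m)
    = Poly_Mapping.single e (scaleM (of_nat (Poly_Mapping.lookup e i)) m)"
  proof (cases "Poly_Mapping.lookup e i = 0")
    case False
    then have "e - var i + var i = e"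
      by (intro poly_mapping_eqI) (auto simp: lookup_minus lookup_add lookup_single when_def)
    then show ?thesis by simp
  qed simp
  then show "der i (smul (lam i) (Poly_Mapping.single e m)) = Poly_Mapping.single e m + smul (lam i) (der i (Poly_Mapping.single e m))"
    by (simp add: smul_lam_single der_single lookup_add M.scale_left_distrib single_add)
qed (intro additive_comp[OF additive_der additive_smul] additive_comp[OF additive_smul additive_der] additive_add additive_id)+

lemma der_lam:
  assumes "j \<noteq> i" shows "der i (smul (lam j) P) = smul (lam j) (der i P)"
proof (rule additive_eqI[where P = P])
  fix e :: "nat \<Rightarrow>\<^sub>0 nat" and m
  have "e + var j - var i = e - var i + var j"
    by (rule poly_mapping_eqI) (use assms in \<open>auto simp: lookup_minus lookup_add lookup_single when_def\<close>)
  then show "der i (smul (lam j) (Poly_Mapping.single e m)) = smul (lam j) (der i (Poly_Mapping.single e m))"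
    using assms by (simp add: smul_lam_single der_single lookup_add lookup_single)
qed (intro additive_comp[OF additive_der additive_smul] additive_comp[OF additive_smul additive_der])+

lemma lampoly_der: "P \<in> lampoly n \<Longrightarrow> der i P \<in> lampoly n"
proof (induction rule: lampoly_induct)
  case (lam j F)
  then show ?case
    by (cases "j = i") (auto simp: der_lam der_lam_same intro!: lampoly_add lampoly_lam)
qed (auto simp: der_const additive.add[OF additive_der] lampoly_add lampoly_zero)

lemma der_DMm: "der i (DMm P) = DMm (der i P)"
proof (induction P rule: mpoly_induct)
  case (lam j F)
  then show ?case
    by (cases "j = i") (auto simp: der_lam der_lam_same DMm_lam additive.add[OF additive_DMm])
qed (auto simp: DMm_const der_const additive.add[OF additive_DMm] additive.add[OF additive_der] additive.zero[OF additive_DMm])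

lemma der_exp_dot: "j \<noteq> i \<Longrightarrow> der j (exp_dot i b P) = exp_dot i b (der j P)"
proof (induction P arbitrary: b rule: mpoly_induct)
  case (lam l F)
  then show ?case
    by (cases "l = i"; cases "l = j") (auto simp: der_lam der_lam_same exp_dot_lam exp_dot_lam_same
       additive.add[OF additive_der] additive.add[OF additive_exp_dot])
qed (auto simp: exp_dot_const der_const additive.add[OF additive_exp_dot] additive.add[OF additive_der] additive.zero[OF additive_exp_dot])

text \<open>The remainder only has to be divisible by the square of \<open>lam n\<close>:
  elimination turns \<open>lam n\<close> into \<open>- total n\<close>, one factor is divided out,
  and what is left of the remainder lies in the image of \<open>total n\<close>.\<close>

lemma sh_Taylor:
  assumes "F \<in> lampoly n" "i < n"
  shows "\<exists>G\<in>lampoly (Suc n). sh n i F = F + smul (lam n) (der i F) + smul (lam n) (smul (lam n) G)"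
  using assms
proof (induction rule: lampoly_induct)
  case (const m)
  then show ?case by (intro bexI[of _ 0]) (auto simp: sh_const der_const lampoly_zero)
next
  case (add F F')
  then obtain G G' where G: "G \<in> lampoly (Suc n)" "sh n i F = F + smul (lam n) (der i F) + smul (lam n) (smul (lam n) G)"
    "G' \<in> lampoly (Suc n)" "sh n i F' = F' + smul (lam n) (der i F') + smul (lam n) (smul (lam n) G')" by blast
  show ?case
    by (rule bexI[of _ "G + G'"])
      (use G in \<open>auto simp: additive.add[OF additive_sh] additive.add[OF additive_der] mp.scale_right_distrib add_ac lampoly_add\<close>)
next
  case (lam j F)
  then obtain G where G: "G \<in> lampoly (Suc n)" "sh n i F = F + smul (lam n) (der i F) + smul (lam n) (smul (lam n) G)" by blast
  show ?case
  proof (cases "j = i")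
    case True
    show ?thesis
      by (rule bexI[of _ "smul (lam i) G + der i F + smul (lam n) G"])
        (use G lam True in \<open>auto simp: sh_lam der_lam_same mp.scale_right_distrib mp.scale_left_commute[of "lam n" "lam i"] add_ac
           intro!: lampoly_add lampoly_lam lampoly_der intro: lampoly_mono[of n]\<close>)
  next
    case False
    show ?thesis
      by (rule bexI[of _ "smul (lam j) G"])
        (use G lam False in \<open>auto simp: sh_lam der_lam mp.scale_right_distrib mp.scale_left_commute[of "lam n" "lam j"] intro!: lampoly_lam\<close>)
  qed
qed

text \<open>\<open>modes k a\<close> is \<open>a\<^sub>(\<^sub>k\<^sub>) / k!\<close>, applied to the coefficients of a polynomial.\<close>

definition modes :: "nat \<Rightarrow> 'v \<Rightarrow> 'm mpoly \<Rightarrow> 'm mpoly" where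
  "modes k a = Poly_Mapping.map (\<lambda>m. coeff (act a m) k)"

lemma additive_coeff_act: "additive (\<lambda>m. coeff (act a m) k)"
  by (rule additive_comp[OF additive_coeff additive_act])

lemma additive_modes: "additive (modes k a)"
  unfolding modes_def by (rule additive_map[OF additive_coeff_act])

lemma modes_single: "modes k a (Poly_Mapping.single e m) = Poly_Mapping.single e (coeff (act a m) k)"
  by (simp add: modes_def additive.zero[OF additive_coeff_act])

lemma modes_lam: "modes k a (smul (lam i) P) = smul (lam i) (modes k a P)"
  by (rule additive_eqI[where P = P])
    (auto simp: smul_lam_single modes_single additive_comp[OF additive_modes additive_smul] additive_comp[OF additive_smul additive_modes])

lemma lampoly_modes: "P \<in> lampoly n \<Longrightarrow> modes k a P \<in> lampoly n"
  by (induction rule: lampoly_induct) (auto simp: modes_single modes_lam additive.add[OF additive_modes] intro: lampoly_const lampoly_add lampoly_lam)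

lemma lam_act_Taylor:
  assumes "F \<in> lampoly n"
  shows "\<exists>G\<in>lampoly (Suc n). lam_act n a F = modes 0 a F + smul (lam n) (modes 1 a F) + smul (lam n) (smul (lam n) G)"
  using assms
proof (induction rule: lampoly_induct)
  case (const m)
  define p where "p = act a m"
  obtain q c d where q: "p = pCons c (pCons d q)" by (metis pCons_cases)
  have "psum const (lam n) p = psum const (lam n) [:c:] + psum const (lam n) (pCons 0 [:d:]) + psum const (lam n) (pCons 0 (pCons 0 q))"
    unfolding q by (simp flip: psum_add[OF additive_single])
  also have "\<dots> = const c + smul (lam n) (const d) + smul (lam n) (smul (lam n) (psum const (lam n) q))"
    by (simp add: psum_pCons[OF additive_single]) (simp add: psum_def smul_one)
  finally show ?case
    by (intro bexI[of _ "psum const (lam n) q"])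
      (auto simp: lam_act_const modes_single p_def[symmetric] q intro!: lampoly_psum lampoly_const)
next
  case (add F F')
  then obtain G G' where G: "G \<in> lampoly (Suc n)" "lam_act n a F = modes 0 a F + smul (lam n) (modes 1 a F) + smul (lam n) (smul (lam n) G)"
    "G' \<in> lampoly (Suc n)" "lam_act n a F' = modes 0 a F' + smul (lam n) (modes 1 a F') + smul (lam n) (smul (lam n) G')" by blast
  show ?case
    by (rule bexI[of _ "G + G'"])
      (use G in \<open>auto simp: additive.add[OF additive_lam_act] additive.add[OF additive_modes] mp.scale_right_distrib add_ac lampoly_add\<close>)
next
  case (lam j F)
  then obtain G where G: "G \<in> lampoly (Suc n)" "lam_act n a F = modes 0 a F + smul (lam n) (modes 1 a F) + smul (lam n) (smul (lam n) G)" by blast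
  show ?case
    by (rule bexI[of _ "smul (lam j) G"])
      (use G lam in \<open>auto simp: lam_act_lam modes_lam mp.scale_right_distrib mp.scale_left_commute[of "lam n" "lam j"] intro!: lampoly_lam\<close>)
qed

section \<open>The cochain axioms\<close>

definition cong :: "nat \<Rightarrow> 'm mpoly \<Rightarrow> 'm mpoly \<Rightarrow> bool" where
  "cong n P Q \<longleftrightarrow> (\<exists>R\<in>lampoly n. P - Q = total n R)"

lemma cong_refl [intro!, simp]: "cong n P P"
  unfolding cong_def by (rule bexI[of _ 0]) (auto simp: additive.zero[OF additive_total] lampoly_zero)

text \<open>An operator carrying \<open>total n\<close> to \<open>total k\<close> acts on the
  quotients. The number of variables may change, as it does under the action of \<open>L\<close> and
  under the differential.\<close>

lemma cong_additive:
  assumes "cong n P Q" "additive \<phi>" "\<And>F. F \<in> lampoly n \<Longrightarrow> \<phi> F \<in> lampoly k"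
    "\<And>F. F \<in> lampoly n \<Longrightarrow> \<phi> (total n F) = total k (\<phi> F)"
  shows "cong k (\<phi> P) (\<phi> Q)"
proof -
  from assms(1) obtain R where R: "R \<in> lampoly n" "P - Q = total n R"
    by (auto simp: cong_def)
  then have "\<phi> P - \<phi> Q = total k (\<phi> R)"
    by (simp add: assms(4) flip: additive.diff[OF assms(2)])
  then show ?thesis
    using R assms(3) unfolding cong_def by blast
qed

lemma cong_uminus: "cong n P Q \<Longrightarrow> cong n (- P) (- Q)"
  by (rule cong_additive[where \<phi> = uminus])
    (auto simp: additive_def lampoly_uminus additive.minus[OF additive_total])

lemma cong_sym: "cong n P Q \<Longrightarrow> cong n Q P"
  unfolding cong_def by (metis additive.minus[OF additive_total] lampoly_uminus minus_diff_eq)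

lemma cong_add: "cong n P Q \<Longrightarrow> cong n P' Q' \<Longrightarrow> cong n (P + P') (Q + Q')"
  unfolding cong_def
  by (metis add_diff_add additive.add[OF additive_total] lampoly_add)

lemma cong_diff: "cong n P Q \<Longrightarrow> cong n P' Q' \<Longrightarrow> cong n (P - P') (Q - Q')"
  using cong_add[OF _ cong_uminus, of n P Q P' Q'] by simp

lemma cong_trans [trans]: "cong n P Q \<Longrightarrow> cong n Q S \<Longrightarrow> cong n P S"
  using cong_add[of n P Q Q S] unfolding cong_def by simp

lemma cong_eq_trans [trans]: "cong n P Q \<Longrightarrow> Q = S \<Longrightarrow> cong n P S" "P = Q \<Longrightarrow> cong n Q S \<Longrightarrow> cong n P S"
  by simp_all

lemma cong_sum: "(\<And>i. i \<in> A \<Longrightarrow> cong n (F i) (G i)) \<Longrightarrow> cong n (\<Sum>i\<in>A. F i) (\<Sum>i\<in>A. G i)"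
  by (induction A rule: infinite_finite_induct) (auto intro: cong_add)

lemma cong_psign: "cong n P Q \<Longrightarrow> cong n (psign p P) (psign p Q)"
  by (auto simp: psign_def cong_uminus)

lemma cong_lam: "cong n P Q \<Longrightarrow> i < n \<Longrightarrow> cong n (smul (lam i) P) (smul (lam i) Q)"
  by (erule cong_additive) (auto simp: additive_smul total_lam lampoly_lam)

lemma total_Sc: "total n (Sc r P) = Sc r (total n P)"
proof -
  have "DMm (Sc r P) = Sc r (DMm P)"
    by (rule additive_eqI[where P = P], rule additive_comp[OF additive_DMm additive_map[OF additive_scaleM]],
       rule additive_comp[OF additive_map[OF additive_scaleM] additive_DMm])
     (use DM_even in \<open>simp add: M.even_endo_def additive.zero[OF additive_DM]\<close>)
  then show ?thesis
    by (simp add: total_def' additive.add[OF additive_map[OF additive_scaleM]])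
     (simp add: Sc_eq_smul mp.scale_left_commute[of "\<Sum>i<n. lam i"])
qed

lemma cong_Sc: "cong n P Q \<Longrightarrow> cong n (Sc r P) (Sc r Q)"
  by (erule cong_additive) (auto simp: additive_map additive_scaleM total_Sc lampoly_Sc)

lemma cong_exp_dot: "cong n P Q \<Longrightarrow> i < n \<Longrightarrow> cong n (exp_dot i b P) (exp_dot i b Q)"
  by (erule cong_additive) (auto simp: additive_exp_dot exp_dot_total lampoly_exp_dot)

abbreviation (input) sw :: "nat \<Rightarrow> nat \<Rightarrow> nat" where "sw i \<equiv> id(i := Suc i, Suc i := i)"

lemma lam_comp_rename: "DMm (smul ((lam \<circ> f) i) F) = smul ((lam \<circ> f) i) (DMm F)"
  by (simp add: DMm_lam)

lemma bij_sw: "Suc i < n \<Longrightarrow> bij_betw (sw i) {..<n} {..<n}"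
  by (rule bij_betw_byWitness[where f' = "sw i"]) auto

lemma subst_rename_total:
  assumes "bij_betw f {..<n} {..<n}"
  shows "subst (lam \<circ> f) (total n F) = total n (subst (lam \<circ> f) F)"
proof -
  have "(\<Sum>i<n. smul (lam (f i)) (subst (lam \<circ> f) F)) = (\<Sum>i<n. smul (lam i) (subst (lam \<circ> f) F))"
    by (rule sum.reindex_bij_betw[OF assms])
  moreover have "subst (lam \<circ> f) (DMm F) = DMm (subst (lam \<circ> f) F)"
    by (rule subst_DMm) (rule lam_comp_rename)
  ultimately show ?thesis
    by (simp add: total_def additive.add[OF additive_subst] additive.sum[OF additive_subst] subst_lam)
qed

lemma lampoly_rename: "F \<in> lampoly n \<Longrightarrow> (\<And>i. i < n \<Longrightarrow> f i < k) \<Longrightarrow> subst (lam \<circ> f) F \<in> lampoly k"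
  by (erule lampoly_subst) (auto intro: lampoly_lam)

lemma lampoly_sw: "F \<in> lampoly k \<Longrightarrow> Suc i < k \<Longrightarrow> subst (lam \<circ> sw i) F \<in> lampoly k"
  by (rule lampoly_rename[where n = k]) (auto split: if_splits)

lemma cong_sw: "cong n P Q \<Longrightarrow> Suc i < n \<Longrightarrow> cong n (subst (lam \<circ> sw i) P) (subst (lam \<circ> sw i) Q)"
  by (rule cong_additive[where \<phi> = "subst (lam \<circ> sw i)", OF _ additive_subst lampoly_sw])
    (auto simp del: fun_upd_apply intro!: subst_rename_total bij_sw)

lemma cls_iff: "Q \<in> cls n P \<longleftrightarrow> Q \<in> lampoly n \<and> cong n Q P"
  by (auto simp: cls_def cong_def)

lemma cls_eq_iff: "P \<in> lampoly n \<Longrightarrow> cls n P = cls n Q \<longleftrightarrow> cong n P Q"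
  by (auto simp: set_eq_iff cls_iff intro: cong_trans cong_sym)

lemma rep_cls: assumes "P \<in> lampoly n" shows "rep (cls n P) \<in> lampoly n" "cong n (rep (cls n P)) P"
proof -
  have "P \<in> cls n P" using assms by (simp add: cls_iff)
  then have "rep (cls n P) \<in> cls n P"
    unfolding rep_def by (rule someI[where P = "\<lambda>Q. Q \<in> cls n P"])
  then show "rep (cls n P) \<in> lampoly n" "cong n (rep (cls n P)) P"
    by (simp_all add: cls_iff)
qed

lemma cls_rep: assumes "A \<in> quot n" shows "cls n (rep A) = A" "rep A \<in> lampoly n"
proof -
  obtain P where P: "P \<in> lampoly n" "A = cls n P" using assms by (auto simp: quot_def)
  show "rep A \<in> lampoly n" using P rep_cls by simp
  show "cls n (rep A) = A" unfolding P(2) using P rep_cls cls_eq_iff[OF rep_cls(1)] by blast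
qed

lemmas lampoly_rep = cls_rep(2)

lemma cls_in_quot: "P \<in> lampoly n \<Longrightarrow> cls n P \<in> quot n"
  by (simp add: quot_def)

section \<open>The axioms on representatives, and their translation to cosets\<close>

definition hp :: "bit \<Rightarrow> 'm mpoly \<Rightarrow> bool" where
  "hp r P \<longleftrightarrow> (\<forall>e. Poly_Mapping.lookup P e \<in> partM r)"

text \<open>
  The cochain axioms for a function \<open>P\<close> on lists of length \<open>n\<close> with values in \<open>M[\<lambda>\<^sub>0, \<dots>, \<lambda>\<^sub>k\<^sub>-\<^sub>1]\<close>,
  relative to a relation \<open>R\<close>: equality gives the basic complex, congruence modulo the image of
  \<^const>\<open>total\<close> the variational (reduced) complex.
\<close>

definition ax_val :: "nat \<Rightarrow> nat \<Rightarrow> ('v list \<Rightarrow> 'm mpoly) \<Rightarrow> bool" where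
  "ax_val n k P \<longleftrightarrow> (\<forall>as. length as = n \<longrightarrow> P as \<in> lampoly k)"

definition ax_lin :: "('m mpoly \<Rightarrow> 'm mpoly \<Rightarrow> bool) \<Rightarrow> nat \<Rightarrow> ('v list \<Rightarrow> 'm mpoly) \<Rightarrow> bool" where
  "ax_lin R n P \<longleftrightarrow> (\<forall>as i a b. length as = n \<and> i < n \<longrightarrow> R (P (as[i := a + b])) (P (as[i := a]) + P (as[i := b])))
     \<and> (\<forall>as i r a. length as = n \<and> i < n \<longrightarrow> R (P (as[i := scale r a])) (Sc r (P (as[i := a]))))"

definition ax_par :: "('m mpoly \<Rightarrow> 'm mpoly \<Rightarrow> bool) \<Rightarrow> nat \<Rightarrow> nat \<Rightarrow> bit \<Rightarrow> ('v list \<Rightarrow> 'm mpoly) \<Rightarrow> bool" where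
  "ax_par R n k q P \<longleftrightarrow> (\<forall>as ps. length as = n \<and> homogeneous as ps \<longrightarrow>
     (\<exists>Q\<in>lampoly k. R Q (P as) \<and> hp (q + (\<Sum>j<n. ps ! j + 1) + 1) Q))"

definition ax_ses :: "('m mpoly \<Rightarrow> 'm mpoly \<Rightarrow> bool) \<Rightarrow> nat \<Rightarrow> ('v list \<Rightarrow> 'm mpoly) \<Rightarrow> bool" where
  "ax_ses R n P \<longleftrightarrow> (\<forall>as i. length as = n \<and> i < n \<longrightarrow> R (P (as[i := D (as ! i)])) (- smul (lam i) (P as)))"

definition ax_sym :: "('m mpoly \<Rightarrow> 'm mpoly \<Rightarrow> bool) \<Rightarrow> nat \<Rightarrow> ('v list \<Rightarrow> 'm mpoly) \<Rightarrow> bool" where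
  "ax_sym R n P \<longleftrightarrow> (\<forall>as ps i. length as = n \<and> homogeneous as ps \<and> Suc i < n \<longrightarrow>
     R (subst (lam \<circ> sw i) (P (as[i := as ! Suc i, Suc i := as ! i])))
       (psign ((ps ! i + 1) * (ps ! Suc i + 1)) (P as)))"

definition ax_lbz :: "('m mpoly \<Rightarrow> 'm mpoly \<Rightarrow> bool) \<Rightarrow> nat \<Rightarrow> bit \<Rightarrow> ('v list \<Rightarrow> 'm mpoly) \<Rightarrow> bool" where
  "ax_lbz R n q P \<longleftrightarrow> (\<forall>as ps i b c pb pc s.
     length as = n \<and> homogeneous as ps \<and> i < n \<and> b \<in> part pb \<and> c \<in> part pc \<and> s = q + (\<Sum>j<i. ps ! j + 1) \<longrightarrow>
      R (P (as[i := b * c])) (psign (pb * s) (exp_dot i b (P (as[i := c])))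
             + psign (pc * (pb + s)) (exp_dot i c (P (as[i := b])))))"

definition ax :: "('m mpoly \<Rightarrow> 'm mpoly \<Rightarrow> bool) \<Rightarrow> nat \<Rightarrow> nat \<Rightarrow> bit \<Rightarrow> ('v list \<Rightarrow> 'm mpoly) \<Rightarrow> bool" where
  "ax R n k q P \<longleftrightarrow> ax_val n k P \<and> ax_lin R n P \<and> ax_par R n k q P \<and> ax_ses R n P \<and> ax_sym R n P \<and> ax_lbz R n q P"

lemma axD:
  assumes "ax R n k q P"
  shows "ax_val n k P" "ax_lin R n P" "ax_par R n k q P" "ax_ses R n P" "ax_sym R n P" "ax_lbz R n q P"
  using assms by (simp_all add: ax_def)

lemma ax_valD: "ax_val n k P \<Longrightarrow> length as = n \<Longrightarrow> P as \<in> lampoly k"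
  by (simp add: ax_val_def)

lemma ax_linD:
  assumes "ax_lin R n P" "length as = n" "i < n"
  shows "R (P (as[i := a + b])) (P (as[i := a]) + P (as[i := b]))" "R (P (as[i := scale r a])) (Sc r (P (as[i := a])))"
  using assms by (simp_all add: ax_lin_def)

lemma ax_parD:
  assumes "ax_par R n k q P" "length as = n" "homogeneous as ps"
  obtains Q where "Q \<in> lampoly k" "R Q (P as)" "hp (q + (\<Sum>j<n. ps ! j + 1) + 1) Q"
  using assms unfolding ax_par_def by blast

lemma ax_sesD: "ax_ses R n P \<Longrightarrow> length as = n \<Longrightarrow> i < n \<Longrightarrow> R (P (as[i := D (as ! i)])) (- smul (lam i) (P as))"
  by (simp add: ax_ses_def)

lemma ax_symD:
  assumes "ax_sym R n P" "length as = n" "homogeneous as ps" "Suc i < n"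
  shows "R (subst (lam \<circ> sw i) (P (as[i := as ! Suc i, Suc i := as ! i])))
       (psign ((ps ! i + 1) * (ps ! Suc i + 1)) (P as))"
  using assms(1)[unfolded ax_sym_def, rule_format, of as ps i] assms(2-) by blast

lemma ax_lbzD:
  assumes "ax_lbz R n q P" "length as = n" "homogeneous as ps" "i < n" "b \<in> part pb" "c \<in> part pc"
    "s = q + (\<Sum>j<i. ps ! j + 1)"
  shows "R (P (as[i := b * c])) (psign (pb * s) (exp_dot i b (P (as[i := c])))
             + psign (pc * (pb + s)) (exp_dot i c (P (as[i := b]))))"
  using assms(1)[unfolded ax_lbz_def, rule_format, of as ps i b pb c pc s] assms(2-) by blast

definition coset :: "nat \<Rightarrow> ('v list \<Rightarrow> 'm mpoly) \<Rightarrow> ('v, 'm) cochain" where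
  "coset n P = (\<lambda>as. if length as = n then cls n (P as) else {})"

lemma coset_cong: "(\<And>as. length as = n \<Longrightarrow> P as \<in> lampoly n \<and> cong n (P as) (Q as)) \<Longrightarrow> coset n P = coset n Q"
  by (rule ext) (simp add: coset_def cls_eq_iff)

text \<open>All operators occurring in the axioms respect congruence, so representatives may be
  exchanged freely.\<close>

lemma ax_cong:
  assumes P: "ax (cong n) n n q P" and *: "\<And>as. length as = n \<Longrightarrow> Q as \<in> lampoly n \<and> cong n (P as) (Q as)"
  shows "ax (cong n) n n q Q"
proof -
  have C: "cong n (Q as) (P as)" "cong n (P as) (Q as)" if "length as = n" for as
    using *[OF that] cong_sym by blast+
  note P = axD[OF P]
  show ?thesis
    unfolding ax_def ax_val_def ax_lin_def ax_par_def ax_ses_def ax_sym_def ax_lbz_def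
  proof (intro conjI allI impI)
    fix as :: "'v list" assume "length as = n" then show "Q as \<in> lampoly n" using * by blast
  next
    fix as :: "'v list" and i a b assume A: "length as = n \<and> i < n"
    have "cong n (Q (as[i := a + b])) (P (as[i := a + b]))" using A by (simp add: C)
    also have "cong n (P (as[i := a + b])) (P (as[i := a]) + P (as[i := b]))" using A by (intro ax_linD[OF P(2)]) auto
    also have "cong n \<dots> (Q (as[i := a]) + Q (as[i := b]))" using A by (intro cong_add C) auto
    finally show "cong n (Q (as[i := a + b])) (Q (as[i := a]) + Q (as[i := b]))" .
  next
    fix as :: "'v list" and i r a assume A: "length as = n \<and> i < n"
    have "cong n (Q (as[i := scale r a])) (P (as[i := scale r a]))" using A by (simp add: C)
    also have "cong n (P (as[i := scale r a])) (Sc r (P (as[i := a])))" using A by (intro ax_linD[OF P(2)]) auto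
    also have "cong n \<dots> (Sc r (Q (as[i := a])))" using A by (intro cong_Sc C) auto
    finally show "cong n (Q (as[i := scale r a])) (Sc r (Q (as[i := a])))" .
  next
    fix as :: "'v list" and ps assume A: "length as = n \<and> homogeneous as ps"
    from A obtain F where "F \<in> lampoly n" "cong n F (P as)" "hp (q + (\<Sum>j<n. ps ! j + 1) + 1) F" using ax_parD[OF P(3)] by blast
    with A C(2)[of as] show "\<exists>F\<in>lampoly n. cong n F (Q as) \<and> hp (q + (\<Sum>j<n. ps ! j + 1) + 1) F"
      using cong_trans by blast
  next
    fix as :: "'v list" and i assume A: "length as = n \<and> i < n"
    have "cong n (Q (as[i := D (as ! i)])) (P (as[i := D (as ! i)]))" using A by (simp add: C)
    also have "cong n (P (as[i := D (as ! i)])) (- smul (lam i) (P as))" using A by (intro ax_sesD[OF P(4)]) auto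
    also have "cong n \<dots> (- smul (lam i) (Q as))" using A by (intro cong_uminus cong_lam C) auto
    finally show "cong n (Q (as[i := D (as ! i)])) (- smul (lam i) (Q as))" .
  next
    fix as :: "'v list" and ps i assume A: "length as = n \<and> homogeneous as ps \<and> Suc i < n"
    let ?as = "as[i := as ! Suc i, Suc i := as ! i]"
    have "cong n (subst (lam \<circ> sw i) (Q ?as)) (subst (lam \<circ> sw i) (P ?as))" using A by (intro cong_sw C) auto
    also have "cong n (subst (lam \<circ> sw i) (P ?as)) (psign ((ps ! i + 1) * (ps ! Suc i + 1)) (P as))" using A by (intro ax_symD[OF P(5)]) auto
    also have "cong n \<dots> (psign ((ps ! i + 1) * (ps ! Suc i + 1)) (Q as))" using A by (intro cong_psign C) auto
    finally show "cong n (subst (lam \<circ> sw i) (Q ?as)) (psign ((ps ! i + 1) * (ps ! Suc i + 1)) (Q as))" .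
  next
    fix as :: "'v list" and ps i b c pb pc s
    assume A: "length as = n \<and> homogeneous as ps \<and> i < n \<and> b \<in> part pb \<and> c \<in> part pc \<and> s = q + (\<Sum>j<i. ps ! j + 1)"
    have "cong n (Q (as[i := b * c])) (P (as[i := b * c]))" using A by (simp add: C)
    also have "cong n (P (as[i := b * c])) (psign (pb * s) (exp_dot i b (P (as[i := c])))
             + psign (pc * (pb + s)) (exp_dot i c (P (as[i := b]))))" using A by (intro ax_lbzD[OF P(6)]) auto
    also have "cong n \<dots> (psign (pb * s) (exp_dot i b (Q (as[i := c])))
             + psign (pc * (pb + s)) (exp_dot i c (Q (as[i := b]))))"
      using A by (intro cong_psign cong_add cong_exp_dot C) auto
    finally show "cong n (Q (as[i := b * c])) (psign (pb * s) (exp_dot i b (Q (as[i := c])))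
             + psign (pc * (pb + s)) (exp_dot i c (Q (as[i := b]))))" .
  qed
qed

text \<open>From cosets to polynomials. The chosen representatives satisfy the axioms only up to
  congruence, which is why \<open>ax\<close> is parametrised by a relation.\<close>

lemma cochains_rep:
  assumes "Y \<in> cochains n q"
  shows "ax (cong n) n n q (\<lambda>as. rep (Y as))" "coset n (\<lambda>as. rep (Y as)) = Y"
proof -
  have quot: "length as = n \<Longrightarrow> Y as \<in> quot n" and emp: "length as \<noteq> n \<Longrightarrow> Y as = {}" for as
    using assms by (auto simp: cochains_def split: if_splits)
  note rl = lampoly_rep[OF quot]
  have Y: "Y as = cls n F \<longleftrightarrow> cong n (rep (Y as)) F" if "length as = n" for as F
    using cls_rep(1)[OF quot[OF that]] cls_eq_iff[OF rl[OF that], of F] by simp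
  have *: "cls n F = cls n G \<longleftrightarrow> cong n F G" if "F \<in> lampoly n" for F G
    using cls_eq_iff that by blast
  have mem: "F \<in> Y as \<Longrightarrow> length as = n \<Longrightarrow> F \<in> lampoly n \<and> cong n F (rep (Y as))" for F as
    using cls_rep(1)[OF quot, of as] cls_iff by metis
  show "ax (cong n) n n q (\<lambda>as. rep (Y as))"
    unfolding ax_def
  proof (intro conjI)
    show "ax_val n n (\<lambda>as. rep (Y as))" by (simp add: ax_val_def rl)
    show "ax_lin (cong n) n (\<lambda>as. rep (Y as))"
      using assms by (simp add: cochains_def multilinear_def ax_lin_def Y)
    show "ax_par (cong n) n n q (\<lambda>as. rep (Y as))"
      unfolding ax_par_def
    proof (intro allI impI)
      fix as :: "'v list" and ps assume A: "length as = n \<and> homogeneous as ps"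
      then obtain F where "F \<in> Y as" "\<forall>e. Poly_Mapping.lookup F e \<in> partM (q + (\<Sum>j<n. ps ! j + 1) + 1)"
        using assms unfolding cochains_def has_parity_def by blast
      then show "\<exists>F\<in>lampoly n. cong n F (rep (Y as)) \<and> hp (q + (\<Sum>j<n. ps ! j + 1) + 1) F"
        using mem[of F as] A unfolding hp_def by blast
    qed
    show "ax_ses (cong n) n (\<lambda>as. rep (Y as))"
      using assms by (simp add: cochains_def sesquilinear_def ax_ses_def Y)
    show "ax_sym (cong n) n (\<lambda>as. rep (Y as))"
      using assms by (simp add: cochains_def super_symmetric_def ax_sym_def * lampoly_sw rl)
    show "ax_lbz (cong n) n q (\<lambda>as. rep (Y as))"
      using assms by (simp add: cochains_def leibniz_def ax_lbz_def Y Let_def)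
  qed
  show "coset n (\<lambda>as. rep (Y as)) = Y"
    by (rule ext) (simp add: coset_def cls_rep(1) quot emp)
qed

lemma coset_cochains:
  assumes "ax (cong n) n n q P"
  shows "coset n P \<in> cochains n q"
proof -
  have val: "P as \<in> lampoly n" if "length as = n" for as
    using assms that by (simp add: ax_def ax_val_def)
  define Y where "Y = coset n P"
  have Yc: "Y as = cls n (P as)" if "length as = n" for as
    using that by (simp add: Y_def coset_def)
  have rl: "rep (Y as) \<in> lampoly n" "cong n (rep (Y as)) (P as)" if "length as = n" for as
    using rep_cls[OF val[OF that]] by (simp_all add: Yc that)
  have "ax (cong n) n n q (\<lambda>as. rep (Y as))"
    by (rule ax_cong[OF assms]) (use rl cong_sym in blast)
  note P = this[unfolded ax_def]
  have quot: "Y as \<in> quot n" if "length as = n" for as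
    using that by (simp add: Yc cls_in_quot val)
  have Y: "Y as = cls n F \<longleftrightarrow> cong n (rep (Y as)) F" if "length as = n" for as F
    using cls_rep(1)[OF quot[OF that]] cls_eq_iff[OF rl(1)[OF that], of F] by simp
  have *: "cls n F = cls n G \<longleftrightarrow> cong n F G" if "F \<in> lampoly n" for F G
    using cls_eq_iff that by blast
  have mem: "F \<in> Y as \<longleftrightarrow> F \<in> lampoly n \<and> cong n F (rep (Y as))" if "length as = n" for F as
    using cls_rep(1)[OF quot, of as] cls_iff that by metis
  have "Y \<in> cochains n q"
    unfolding cochains_def mem_Collect_eq
  proof (intro conjI)
    show "\<forall>as. if length as = n then Y as \<in> quot n else Y as = {}"
      using quot by (auto simp: Y_def coset_def)
    show "multilinear n Y"
      using P by (simp add: multilinear_def ax_lin_def Y)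
    show "has_parity n q Y"
      unfolding has_parity_def
    proof (intro allI impI)
      fix as :: "'v list" and ps assume A: "length as = n \<and> homogeneous as ps"
      then obtain F where "F \<in> lampoly n" "cong n F (rep (Y as))" "hp (q + (\<Sum>j<n. ps ! j + 1) + 1) F"
        using ax_parD[OF axD(3)] P by (metis (no_types, lifting) ax_par_def)
      then show "\<exists>F\<in>Y as. \<forall>e. Poly_Mapping.lookup F e \<in> partM (q + (\<Sum>j<n. ps ! j + 1) + 1)"
        using mem A unfolding hp_def by blast
    qed
    show "sesquilinear n Y"
      using P by (simp add: sesquilinear_def ax_ses_def Y)
    show "super_symmetric n Y"
      using P by (simp add: super_symmetric_def ax_sym_def * lampoly_sw rl)
    show "leibniz n q Y"
      using P by (simp add: leibniz_def ax_lbz_def Y Let_def)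
  qed
  then show ?thesis by (simp add: Y_def)
qed

section \<open>The action of the Virasoro element on cochains\<close>

lemma hp_zero: "hp r 0" using M.subspace_0[OF M.subspace_part] by (simp add: hp_def)

lemma hp_add: "hp r P \<Longrightarrow> hp r Q \<Longrightarrow> hp r (P + Q)"
  by (simp add: hp_def lookup_add M.subspace_add[OF M.subspace_part])

lemma hp_uminus: "hp r P \<Longrightarrow> hp r (- P)"
  by (simp add: hp_def M.subspace_neg[OF M.subspace_part])

lemma hp_diff: "hp r P \<Longrightarrow> hp r Q \<Longrightarrow> hp r (P - Q)"
  by (simp add: hp_def lookup_minus M.subspace_diff[OF M.subspace_part])

lemma hp_sum: "(\<And>i. i \<in> A \<Longrightarrow> hp r (F i)) \<Longrightarrow> hp r (\<Sum>i\<in>A. F i)"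
  by (induction A rule: infinite_finite_induct) (auto intro: hp_add hp_zero)

lemma hp_single: "m \<in> partM r \<Longrightarrow> hp r (Poly_Mapping.single e m)"
  by (simp add: hp_def lookup_single when_def M.subspace_0[OF M.subspace_part])

lemma hp_additive:
  assumes "additive \<phi>" "\<And>e m. m \<in> partM r \<Longrightarrow> hp s (\<phi> (Poly_Mapping.single e m))" "hp r P"
  shows "hp s (\<phi> P)"
proof -
  have "\<phi> P = (\<Sum>e\<in>Poly_Mapping.keys P. \<phi> (Poly_Mapping.single e (Poly_Mapping.lookup P e)))"
    by (subst (1) poly_mapping_eq_sum_single[of P]) (rule additive.sum[OF assms(1)])
  also have "hp s \<dots>"
    by (rule hp_sum, rule assms(2)) (use assms(3) in \<open>simp add: hp_def\<close>)
  finally show ?thesis .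
qed

lemma hp_smul: "hp r P \<Longrightarrow> hp r (smul f P)"
proof (rule hp_additive[OF additive_smul])
  fix e m assume m: "m \<in> partM r"
  have "smul f (Poly_Mapping.single e m)
    = (\<Sum>s\<in>Poly_Mapping.keys f. smul (Poly_Mapping.single s (Poly_Mapping.lookup f s)) (Poly_Mapping.single e m))"
    by (subst (1) poly_mapping_eq_sum_single[of f]) (rule additive.sum[OF additive_smul_left])
  also have "hp r \<dots>"
    by (rule hp_sum) (auto simp: smul_single intro!: hp_single M.subspace_scale[OF M.subspace_part] m)
  finally show "hp r (smul f (Poly_Mapping.single e m))" .
qed

lemma hp_subst: "hp r P \<Longrightarrow> hp r (subst \<sigma> P)"
  by (erule hp_additive[OF additive_subst, rotated]) (simp only: subst_single[OF finite_keys subset_refl] hp_smul hp_single)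

lemma hp_psum: "(\<And>k. hp r (F (coeff p k))) \<Longrightarrow> hp r (psum F f p)"
  unfolding psum_def by (intro hp_sum hp_smul)

lemma hp_lam_act: "a \<in> part p \<Longrightarrow> hp r P \<Longrightarrow> hp (p + r) (lam_act i a P)"
  by (erule hp_additive[OF additive_lam_act, rotated])
    (unfold lam_act_single, intro hp_smul hp_psum hp_single act_part)

lemma hp_DMm: "hp r P \<Longrightarrow> hp r (DMm P)"
  by (erule hp_additive[OF additive_DMm, rotated])
    (use DM_even in \<open>auto simp: M.even_endo_def additive.zero[OF additive_DM] intro!: hp_single\<close>)

lemma hp_total: "hp r P \<Longrightarrow> hp r (total n P)"
  unfolding total_def' by (intro hp_add hp_smul hp_DMm)

lemma hp_elim: "hp r P \<Longrightarrow> hp r (elim n P)"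
proof (erule hp_additive[OF additive_elim, rotated])
  fix e m assume "m \<in> partM r"
  moreover have "hp r F \<Longrightarrow> hp r (((\<lambda>Q. - total n Q) ^^ k) F)" for k F
    by (induction k) (auto intro: hp_uminus hp_total)
  ultimately show "hp r (elim n (Poly_Mapping.single e m))"
    by (simp add: elim_single hp_single)
qed

text \<open>By \<open>a\<^sub>\<lambda> \<partial> = (\<lambda> + \<partial>)
  a\<^sub>\<lambda>\<close>, acting in the new variable \<open>lam n\<close> carries
  \<open>total n\<close> to \<open>total (Suc n)\<close>.\<close>

lemma cong_lam_act: "cong n P Q \<Longrightarrow> cong (Suc n) (lam_act n a P) (lam_act n a Q)"
  by (erule cong_additive)
    (auto simp: additive_lam_act total_def additive.add[OF additive_lam_act] additive.sum[OF additive_lam_act]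
      lam_act_lam lam_act_DMm add_ac intro!: lampoly_lam_act intro: lampoly_mono[of n])

lemma cong_sh: "cong n P Q \<Longrightarrow> i < n \<Longrightarrow> cong (Suc n) (sh n i P) (sh n i Q)"
  by (erule cong_additive) (auto simp: additive_sh lampoly_sh sh_total)

lemma cong_lam_power: "cong n P Q \<Longrightarrow> i < n \<Longrightarrow> cong n (smul (lam i ^ k) P) (smul (lam i ^ k) Q)"
  by (induction k) (auto simp: smul_mult intro: cong_lam)

lemma cong_psum: "i < n \<Longrightarrow> (\<And>k. cong n (F (coeff p k)) (G (coeff p k))) \<Longrightarrow> cong n (psum F (lam i) p) (psum G (lam i) p)"
  unfolding psum_def by (intro cong_sum cong_lam_power)

lemma psum_smul: "psum (\<lambda>c. smul f (H c)) g p = smul f (psum H g p)"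
  by (rule psum_additive[OF additive_smul, symmetric]) (rule mp.scale_left_commute)

lemma psum_uminus: "psum (\<lambda>c. - H c) g p = - psum H g p"
  by (simp add: psum_def sum_negf)

lemma psum_psign: "psum (\<lambda>c. psign r (H c)) g p = psign r (psum H g p)"
  by (cases r) (simp_all add: psign_def psum_uminus)

lemma psum_exp_dot: "i \<noteq> j \<Longrightarrow> psum (\<lambda>c. exp_dot i b (H c)) (lam j) p = exp_dot i b (psum H (lam j) p)"
  by (rule psum_additive[OF additive_exp_dot, symmetric]) (simp add: exp_dot_lam)

section \<open>The Lie derivative along \<open>L\<close>\<close>

text \<open>The usual Lie derivative: \<open>L\<close> acts on the value, minus the sum over the
  arguments of the cochain with \<open>a\<^sub>i\<close> replaced by its bracket with
  \<open>L\<close>. There are no signs because \<open>L\<close> is even.\<close>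

definition theta :: "'v \<Rightarrow> nat \<Rightarrow> ('v list \<Rightarrow> 'm mpoly) \<Rightarrow> 'v list \<Rightarrow> 'm mpoly" where
  "theta L n P as = lam_act n L (P as)
     - (\<Sum>i<n. psum (\<lambda>c. sh n i (P (as[i := c]))) (lam n) (br L (as ! i)))"

lemma theta_val: "ax_val n n P \<Longrightarrow> ax_val n (Suc n) (theta L n P)"
  unfolding ax_val_def theta_def
  by (intro allI impI lampoly_diff lampoly_sum lampoly_psum lampoly_sh lampoly_lam_act)
    (auto intro: lampoly_mono[of n])

lemma lin_additive:
  assumes "ax_lin (=) n P" "length as = n" "i < n"
  shows "additive (\<lambda>c. P (as[i := c]))"
  using ax_linD[OF assms] by (simp add: additive_def)

lemma Sc_smul: "Sc r (smul f P) = smul f (Sc r P)"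
  by (simp add: Sc_eq_smul mp.scale_left_commute)

lemma additive_Sc: "additive (Sc r)"
  by (intro additive_map additive_scaleM)

lemma lam_act_Sc: "lam_act i a (Sc r P) = Sc r (lam_act i a P)"
proof (induction P rule: mpoly_induct)
  case (const m)
  have "psum (\<lambda>c. const (scaleM r c)) (lam i) (act a m) = Sc r (psum const (lam i) (act a m))"
    by (subst psum_additive[OF additive_Sc Sc_smul]) simp
  then show ?case
    by (simp add: lam_act_const act_scale_right psum_map_poly[OF additive_single additive_scaleM])
qed (simp_all add: additive.add[OF additive_Sc] additive.add[OF additive_lam_act] Sc_smul lam_act_lam)

lemma subst_Sc: "subst \<sigma> (Sc r P) = Sc r (subst \<sigma> P)"
  by (induction P rule: mpoly_induct)
    (simp_all add: additive.add[OF additive_Sc] additive.add[OF additive_subst] Sc_smul subst_lam subst_const)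

lemma additive_scale: "additive (scale r)"
  by standard (rule scale_right_distrib)

text \<open>Linearity is assumed as equality, so that summation along the coefficients of a bracket
  is additive in the bracket. Representatives with this property are supplied by
  \<open>canonical_rep\<close>.\<close>

lemma theta_lin:
  assumes P: "ax_lin (=) n P"
  shows "ax_lin (=) n (theta L n P)"
proof -
  have "additive (\<lambda>a. theta L n P (as[i := a])) \<and> (\<forall>r a. theta L n P (as[i := scale r a]) = Sc r (theta L n P (as[i := a])))"
    if as: "length as = n" and i: "i < n" for as i
  proof -
    define T where "T = (\<lambda>l a. psum (\<lambda>c. sh n l (P (as[i := a, l := c]))) (lam n) (br L (as[i := a] ! l)))"
    have T: "additive (T l) \<and> (\<forall>r a. T l (scale r a) = Sc r (T l a))" if l: "l < n" for l
    proof (cases "l = i")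
      case True
      let ?F = "\<lambda>c. sh n i (P (as[i := c]))"
      have add: "additive ?F"
        by (rule additive_comp[OF additive_sh lin_additive[OF P as i]])
      have TT: "T l a = psum ?F (lam n) (br L a)" for a
        using as i True by (simp add: T_def)
      have "additive (T l)"
        unfolding TT by (rule additive_comp[OF additive_psum[OF add] additive_br])
      moreover have "T l (scale r a) = Sc r (T l a)" for r a
      proof -
        have "T l (scale r a) = psum (\<lambda>c. ?F (scale r c)) (lam n) (br L a)"
          unfolding TT br_scale_right by (rule psum_map_poly[OF add additive_scale])
        also have "\<dots> = psum (\<lambda>c. Sc r (?F c)) (lam n) (br L a)"
          using ax_linD(2)[OF P as i] by (simp add: sh_def subst_Sc)
        also have "\<dots> = Sc r (T l a)"
          unfolding TT by (rule psum_additive[OF additive_Sc Sc_smul, symmetric])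
        finally show ?thesis .
      qed
      ultimately show ?thesis by blast
    next
      case False
      have TT: "T l a = psum (\<lambda>c. sh n l (P (as[l := c, i := a]))) (lam n) (br L (as ! l))" for a
        using False by (simp add: T_def list_update_swap)
      have as': "length (as[l := c]) = n" for c using as by simp
      have "additive (T l)"
        unfolding TT psum_def
        by (intro additive_sum additive_comp[OF additive_smul] additive_comp[OF additive_sh] lin_additive[OF P as' i])
      moreover have "T l (scale r a) = Sc r (T l a)" for r a
      proof -
        have "T l (scale r a) = psum (\<lambda>c. Sc r (sh n l (P (as[l := c, i := a])))) (lam n) (br L (as ! l))"
          unfolding TT using ax_linD(2)[OF P as' i] by (simp add: sh_def subst_Sc)
        also have "\<dots> = Sc r (T l a)"
          unfolding TT by (rule psum_additive[OF additive_Sc Sc_smul, symmetric])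
        finally show ?thesis .
      qed
      ultimately show ?thesis by blast
    qed
    have th: "theta L n P (as[i := a]) = lam_act n L (P (as[i := a])) - (\<Sum>l<n. T l a)" for a
      by (simp add: theta_def T_def)
    have "additive (\<lambda>a. theta L n P (as[i := a]))"
      unfolding th using T
      by (intro additive_diff additive_sum additive_comp[OF additive_lam_act] lin_additive[OF P as i]) auto
    moreover have "theta L n P (as[i := scale r a]) = Sc r (theta L n P (as[i := a]))" for r a
      using T ax_linD(2)[OF P as i, of r a]
      by (simp add: th additive.diff[OF additive_Sc] additive.sum[OF additive_Sc] lam_act_Sc)
    ultimately show ?thesis by blast
  qed
  then show ?thesis
    by (auto simp: ax_lin_def additive_def)
qed

lemma homogeneous_update: "homogeneous as ps \<Longrightarrow> a \<in> part (ps ! i) \<Longrightarrow> homogeneous (as[i := a]) ps"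
  by (cases "i < length ps") (auto simp: list_all2_conv_all_nth nth_list_update)

lemma homogeneous_nth: "homogeneous as ps \<Longrightarrow> i < length as \<Longrightarrow> as ! i \<in> part (ps ! i)"
  by (simp add: list_all2_conv_all_nth)

lemma br_even_part: "L \<in> part 0 \<Longrightarrow> a \<in> part p \<Longrightarrow> coeff (br L a) k \<in> part p"
  using br_part[of L 0 a p k] by (simp only: add_0)

lemma homogeneous_br: "L \<in> part 0 \<Longrightarrow> homogeneous as ps \<Longrightarrow> i < length as \<Longrightarrow> homogeneous (as[i := coeff (br L (as ! i)) k]) ps"
  by (intro homogeneous_update br_even_part homogeneous_nth)

lemma theta_par:
  assumes L: "L \<in> part 0" and P: "ax_par (cong n) n n q P"
  shows "ax_par (cong (Suc n)) n (Suc n) q (theta L n P)"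
  unfolding ax_par_def
proof (intro allI impI, elim conjE)
  fix as :: "'v list" and ps assume as: "length as = n" "homogeneous as ps"
  define r where "r = q + (\<Sum>j<n. ps ! j + 1) + 1"
  \<comment> \<open>Homogeneous representatives of all the values that occur are chosen at once; the
    Lie derivative of this choice is homogeneous and congruent to the given one.\<close>
  define P' where "P' = (\<lambda>as. SOME Q. Q \<in> lampoly n \<and> cong n Q (P as) \<and> hp r Q)"
  have P': "P' bs \<in> lampoly n \<and> cong n (P' bs) (P bs) \<and> hp r (P' bs)" if bs: "length bs = n" "homogeneous bs ps" for bs
  proof -
    obtain Q where "Q \<in> lampoly n" "cong n Q (P bs)" "hp r Q"
      unfolding r_def by (rule ax_parD[OF P bs])
    then show ?thesis
      unfolding P'_def by (intro someI[where P = "\<lambda>Q. Q \<in> lampoly n \<and> cong n Q (P bs) \<and> hp r Q"]) blast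
  qed
  have upd: "P' bs \<in> lampoly n \<and> cong n (P' bs) (P bs) \<and> hp r (P' bs)"
    if "bs = as[i := coeff (br L (as ! i)) k]" "i < n" for bs i k
    by (rule P') (use as that L in \<open>auto intro: homogeneous_br\<close>)
  have "theta L n P' as \<in> lampoly (Suc n)"
    unfolding theta_def
    by (intro lampoly_diff lampoly_sum lampoly_psum lampoly_sh lampoly_lam_act lampoly_mono[of n "Suc n" "P' as"])
      (use P'[OF as] upd in auto)
  moreover have "cong (Suc n) (theta L n P' as) (theta L n P as)"
    unfolding theta_def
    by (intro cong_diff cong_lam_act cong_sum cong_psum cong_sh) (use P'[OF as] upd in auto)
  moreover have "hp r (theta L n P' as)"
    unfolding theta_def sh_def using hp_lam_act[OF L, of r "P' as" n, unfolded add_0]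
    by (intro hp_diff hp_sum hp_psum hp_subst) (use P'[OF as] upd in auto)
  ultimately show "\<exists>Q\<in>lampoly (Suc n). cong (Suc n) Q (theta L n P as) \<and> hp (q + (\<Sum>j<n. ps ! j + 1) + 1) Q"
    unfolding r_def by blast
qed

lemma cong_neg_lam_sh:
  assumes "cong n F (- smul (lam i) G)" "l < n"
  shows "cong (Suc n) (sh n l F) (- sh n l (smul (lam i) G))"
  using cong_sh[OF assms] by (simp add: additive.minus[OF additive_sh])

text \<open>In the summand \<open>l = i\<close> the variable is
  \<open>\<lambda>\<^sub>i + \<lambda>\<close>, and the extra \<open>\<lambda>\<close> is
  compensated by \<open>[L\<^sub>\<lambda> \<partial> a] = (\<lambda> + \<partial>)
  [L\<^sub>\<lambda> a]\<close>. In all other summands \<open>\<lambda>\<^sub>i\<close> is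
  unaffected.\<close>

lemma theta_ses:
  assumes val: "ax_val n n P" and lin: "ax_lin (=) n P" and P: "ax_ses (cong n) n P"
  shows "ax_ses (cong (Suc n)) n (theta L n P)"
  unfolding ax_ses_def
proof (intro allI impI, elim conjE)
  fix as :: "'v list" and i assume as: "length as = n" and i: "i < n"
  let ?bs = "as[i := D (as ! i)]"
  define T where "T = (\<lambda>bs l. psum (\<lambda>c. sh n l (P (bs[l := c]))) (lam n) (br L (bs ! l)))"
  have T: "cong (Suc n) (T ?bs l) (- smul (lam i) (T as l))" if l: "l < n" for l
  proof (cases "l = i")
    case False
    have "cong (Suc n) (psum (\<lambda>c. sh n l (P (?bs[l := c]))) (lam n) (br L (as ! l)))
      (psum (\<lambda>c. - smul (lam i) (sh n l (P (as[l := c])))) (lam n) (br L (as ! l)))"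
    proof (rule cong_psum)
      fix k
      let ?cs = "as[l := coeff (br L (as ! l)) k]"
      have "?bs[l := coeff (br L (as ! l)) k] = ?cs[i := D (?cs ! i)]"
        using False by (simp add: list_update_swap)
      then show "cong (Suc n) (sh n l (P (?bs[l := coeff (br L (as ! l)) k]))) (- smul (lam i) (sh n l (P ?cs)))"
        using cong_neg_lam_sh[OF ax_sesD[OF P, of ?cs i] l] as i False by (simp add: sh_lam)
    qed simp
    then show ?thesis
      using False by (simp add: T_def psum_uminus psum_smul)
  next
    case True
    define F where "F = (\<lambda>c. sh n i (P (as[i := c])))"
    have add: "additive F"
      unfolding F_def by (rule additive_comp[OF additive_sh lin_additive[OF lin as i]])
    have T: "T as l = psum F (lam n) (br L (as ! i))" "T ?bs l = psum F (lam n) (br L (D (as ! i)))"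
      using as i True by (simp_all add: T_def F_def)
    have "cong (Suc n) (psum (\<lambda>c. F (D c)) (lam n) (br L (as ! i)))
        (psum (\<lambda>c. - (smul (lam i) (F c) + smul (lam n) (F c))) (lam n) (br L (as ! i)))"
    proof (rule cong_psum)
      fix k
      let ?c = "coeff (br L (as ! i)) k"
      have "cong n (P (as[i := D ?c])) (- smul (lam i) (P (as[i := ?c])))"
        using ax_sesD[OF P, of "as[i := ?c]" i] as i by simp
      from cong_neg_lam_sh[OF this i]
      show "cong (Suc n) (F (D ?c)) (- (smul (lam i) (F ?c) + smul (lam n) (F ?c)))"
        by (simp add: F_def sh_lam)
    qed simp
    from cong_add[OF cong_refl[of "Suc n" "smul (lam n) (psum F (lam n) (br L (as ! i)))"] this]
    show ?thesis
      unfolding T br_D_right psum_lam_plus[OF add] psum_uminus psum_add_fun psum_smul by simp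
  qed
  have "cong (Suc n) (lam_act n L (P ?bs)) (- smul (lam i) (lam_act n L (P as)))"
    using cong_lam_act[OF ax_sesD[OF P as i]]
    by (simp add: additive.minus[OF additive_lam_act] lam_act_lam)
  from cong_diff[OF this cong_sum[of "{..<n}" "Suc n", OF T]]
  show "cong (Suc n) (theta L n P ?bs) (- smul (lam i) (theta L n P as))"
    by (simp add: theta_def T_def mp.scale_right_diff_distrib sum_negf mp.scale_sum_right)
qed

lemma subst_lam_act:
  assumes "\<And>F. lam_act j a (smul (\<sigma> i) F) = smul (\<sigma> i) (lam_act j a F)" "\<sigma> i = lam j"
    "\<And>i F. lam_act j a (smul (\<sigma> i) F) = smul (\<sigma> i) (lam_act j a F)"
  shows "subst \<sigma> (lam_act i a F) = lam_act j a (subst \<sigma> F)"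
proof (induction F rule: mpoly_induct)
  case (const m)
  have "subst \<sigma> (psum const (lam i) (act a m)) = psum (\<lambda>c. subst \<sigma> (const c)) (lam j) (act a m)"
    by (rule psum_additive[OF additive_subst]) (simp add: subst_lam assms)
  then show ?case by (simp add: lam_act_const subst_const)
qed (simp_all add: additive.add[OF additive_subst] additive.add[OF additive_lam_act] lam_act_lam subst_lam assms)

lemma sw_sh:
  assumes "Suc i < n"
  shows "subst (lam \<circ> sw i) (sh n l F) = sh n (sw i l) (subst (lam \<circ> sw i) F)"
proof (induction F rule: mpoly_induct)
  case (lam j F)
  have inj: "sw i j = sw i l \<longleftrightarrow> j = l" by auto
  have n: "sw i n = n" using assms by simp
  define s where "s = sw i"
  define \<sigma> where "\<sigma> = lam \<circ> s"
  have \<sigma>: "\<sigma> j = lam (s j)" for j by (simp add: \<sigma>_def)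
  show ?case
    using lam inj n unfolding s_def[symmetric] \<sigma>_def[symmetric]
    by (cases "j = l") (simp_all add: sh_lam additive.add[OF additive_subst] subst_lam \<sigma>)
qed (simp_all add: sh_const subst_const additive.add[OF additive_subst] additive.add[OF additive_sh])

text \<open>The interchange permutes the summands of the Lie derivative by \<open>s\<close>.
  Brackets with the even element \<open>L\<close> do not change parities, so the sign is the same in
  each of them.\<close>

lemma theta_sym:
  assumes L: "L \<in> part 0" and P: "ax_sym (cong n) n P"
  shows "ax_sym (cong (Suc n)) n (theta L n P)"
  unfolding ax_sym_def
proof (intro allI impI, elim conjE)
  fix as :: "'v list" and ps i
  assume as: "length as = n" and hom: "homogeneous as ps" and i: "Suc i < n"
  define s where "s = sw i"
  define w where "w = (\<lambda>bs::'v list. bs[i := bs ! Suc i, Suc i := bs ! i])"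
  define \<epsilon> where "\<epsilon> = (ps ! i + 1) * (ps ! Suc i + 1)"
  define T where "T = (\<lambda>bs l. psum (\<lambda>c. sh n l (P (bs[l := c]))) (lam n) (br L (bs ! l)))"
  have s: "s (s l) = l" "s n = n" "s l < n \<longleftrightarrow> l < n" for l using i by (auto simp: s_def)
  have w: "w bs ! l = bs ! s l" "(w bs)[l := c] = w (bs[s l := c])" if "length bs = n" for bs l c
    using that i by (auto simp: w_def s_def list_update_swap nth_list_update intro!: nth_equalityI split: if_splits)
  have P': "cong n (subst (lam \<circ> s) (P (w bs))) (psign \<epsilon> (P bs))" if "length bs = n" "homogeneous bs ps" for bs
    using ax_symD[OF P that i] by (simp only: s_def w_def \<epsilon>_def)
  have T: "cong (Suc n) (subst (lam \<circ> s) (T (w as) (s l))) (psign \<epsilon> (T as l))" if l: "l < n" for l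
  proof -
    have "subst (lam \<circ> s) (T (w as) (s l))
      = psum (\<lambda>c. subst (lam \<circ> s) (sh n (s l) (P (w (as[l := c]))))) (lam n) (br L (as ! l))"
      unfolding T_def w[OF as] s(1)
      by (rule psum_additive[OF additive_subst]) (simp add: subst_lam s)
    also have "\<dots> = psum (\<lambda>c. sh n l (subst (lam \<circ> s) (P (w (as[l := c]))))) (lam n) (br L (as ! l))"
      using sw_sh[OF i, of "s l"] by (simp only: s_def[symmetric] s(1))
    also have "cong (Suc n) \<dots> (psum (\<lambda>c. sh n l (psign \<epsilon> (P (as[l := c])))) (lam n) (br L (as ! l)))"
      using as hom l by (intro cong_psum cong_sh P' homogeneous_br L) auto
    also have "\<dots> = psign \<epsilon> (T as l)"
      by (simp add: T_def additive_psign_commute[OF additive_sh] psum_psign)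
    finally show ?thesis .
  qed
  have "subst (lam \<circ> s) (theta L n P (w as))
    = subst (lam \<circ> s) (lam_act n L (P (w as))) - (\<Sum>l<n. subst (lam \<circ> s) (T (w as) l))"
    by (simp add: theta_def T_def additive.diff[OF additive_subst] additive.sum[OF additive_subst])
  also have "subst (lam \<circ> s) (lam_act n L (P (w as))) = lam_act n L (subst (lam \<circ> s) (P (w as)))"
    by (rule subst_lam_act) (simp_all add: lam_act_lam s)
  also have "(\<Sum>l<n. subst (lam \<circ> s) (T (w as) l)) = (\<Sum>l<n. subst (lam \<circ> s) (T (w as) (s l)))"
    by (rule sum.reindex_bij_witness[of _ s s]) (auto simp: s)
  finally have eq: "subst (lam \<circ> s) (theta L n P (w as))
     = lam_act n L (subst (lam \<circ> s) (P (w as))) - (\<Sum>l<n. subst (lam \<circ> s) (T (w as) (s l)))" .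
  have "cong (Suc n) (subst (lam \<circ> s) (theta L n P (w as)))
      (lam_act n L (psign \<epsilon> (P as)) - (\<Sum>l<n. psign \<epsilon> (T as l)))"
    unfolding eq by (intro cong_diff cong_lam_act cong_sum T P' as hom) simp
  also have "\<dots> = psign \<epsilon> (theta L n P as)"
    by (simp add: theta_def T_def additive_psign_commute[OF additive_lam_act] additive.diff[OF additive_psign] additive.sum[OF additive_psign])
  finally show "cong (Suc n) (subst (lam \<circ> sw i) (theta L n P (as[i := as ! Suc i, Suc i := as ! i])))
     (psign ((ps ! i + 1) * (ps ! Suc i + 1)) (theta L n P as))"
    by (simp only: s_def w_def \<epsilon>_def)
qed

text \<open>The cross terms \<open>X\<close> and \<open>Z\<close>, in which the bracket of
  \<open>L\<close> with one factor multiplies the value at the other factor, arise twice: from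
  \<open>L\<close> acting on a product (\<open>lam_act_exp_dot\<close>) and from the Leibniz rule
  for the bracket in the argument \<open>i\<close>. They cancel.\<close>

lemma theta_lbz:
  assumes L: "L \<in> part 0" and lin: "ax_lin (=) n P" and P: "ax_lbz (cong n) n q P"
  shows "ax_lbz (cong (Suc n)) n q (theta L n P)"
  unfolding ax_lbz_def
proof (intro allI impI, elim conjE)
  fix as :: "'v list" and ps i b c pb pc s
  assume as: "length as = n" and hom: "homogeneous as ps" and i: "i < n"
    and b: "b \<in> part pb" and c: "c \<in> part pc" and s: "s = q + (\<Sum>j<i. ps ! j + 1)"
  define A where "A = (\<lambda>x. P (as[i := x]))"
  define T where "T = (\<lambda>x l. psum (\<lambda>d. sh n l (P (as[i := x, l := d]))) (lam n) (br L (as[i := x] ! l)))"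
  let ?b = "psign (pb * s)" and ?c = "psign (pc * (pb + s))"
  define X where "X = psum (\<lambda>\<beta>. sh n i (exp_dot i \<beta> (A c))) (lam n) (br L b)"
  define Z where "Z = psum (\<lambda>\<beta>. sh n i (exp_dot i \<beta> (A b))) (lam n) (br L c)"
  have LA: "cong n (A (\<beta> * \<gamma>)) (psign (p1 * s) (exp_dot i \<beta> (A \<gamma>)) + psign (p2 * (p1 + s)) (exp_dot i \<gamma> (A \<beta>)))"
    if "\<beta> \<in> part p1" "\<gamma> \<in> part p2" for \<beta> \<gamma> p1 p2
    unfolding A_def by (rule ax_lbzD[OF P as hom i that s])
  have "cong (Suc n) (lam_act n L (A (b * c))) (lam_act n L (?b (exp_dot i b (A c)) + ?c (exp_dot i c (A b))))"
    by (intro cong_lam_act LA b c)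
  also have "\<dots> = ?b (exp_dot i b (lam_act n L (A c)) + X) + ?c (exp_dot i c (lam_act n L (A b)) + Z)"
    using i lam_act_exp_dot[OF L b, of i n "A c"] lam_act_exp_dot[OF L c, of i n "A b"]
    by (simp add: additive.add[OF additive_lam_act] additive_psign_commute[OF additive_lam_act] X_def Z_def)
  finally have 1: "cong (Suc n) (lam_act n L (A (b * c)))
    (?b (exp_dot i b (lam_act n L (A c)) + X) + ?c (exp_dot i c (lam_act n L (A b)) + Z))" .
  have 2: "cong (Suc n) (T (b * c) l) (?b (exp_dot i b (T c l)) + ?c (exp_dot i c (T b l)))" if l: "l < n" "l \<noteq> i" for l
  proof -
    let ?p = "br L (as ! l)"
    have TT: "T x l = psum (\<lambda>d. sh n l (P (as[l := d, i := x]))) (lam n) ?p" for x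
      using l by (simp add: T_def list_update_swap)
    have "cong (Suc n) (psum (\<lambda>d. sh n l (P (as[l := d, i := b * c]))) (lam n) ?p)
      (psum (\<lambda>d. ?b (exp_dot i b (sh n l (P (as[l := d, i := c])))) + ?c (exp_dot i c (sh n l (P (as[l := d, i := b]))))) (lam n) ?p)"
    proof (rule cong_psum)
      fix k
      let ?as = "as[l := coeff ?p k]"
      have "homogeneous ?as ps" using as hom l L by (intro homogeneous_br) auto
      from cong_sh[OF ax_lbzD[OF P _ this i b c s] l(1)]
      show "cong (Suc n) (sh n l (P (?as[i := b * c])))
        (?b (exp_dot i b (sh n l (P (?as[i := c])))) + ?c (exp_dot i c (sh n l (P (?as[i := b])))))"
        using as i by (simp add: additive.add[OF additive_sh] additive_psign_commute[OF additive_sh] sh_exp_dot)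
    qed simp
    then show ?thesis
      unfolding TT using i by (simp add: psum_add_fun psum_psign psum_exp_dot)
  qed
  have 3: "cong (Suc n) (T (b * c) i) (?b (exp_dot i b (T c i) + X) + ?c (exp_dot i c (T b i) + Z))"
  proof -
    define G where "G = (\<lambda>d. sh n i (A d))"
    have add: "additive G"
      unfolding G_def A_def by (rule additive_comp[OF additive_sh lin_additive[OF lin as i]])
    have TT: "T x i = psum G (lam n) (br L x)" for x
      using as i by (simp add: T_def G_def A_def)
    have G: "cong (Suc n) (G (\<beta> * \<gamma>)) (psign (p1 * s) (sh n i (exp_dot i \<beta> (A \<gamma>))) + psign (p2 * (p1 + s)) (exp_dot i \<gamma> (G \<beta>)))"
      if "\<beta> \<in> part p1" "\<gamma> \<in> part p2" for \<beta> \<gamma> p1 p2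
      using cong_sh[OF LA[OF that] i] i
      by (simp add: G_def additive.add[OF additive_sh] additive_psign_commute[OF additive_sh] sh_exp_dot)
    have mult: "additive (\<lambda>x. x * d)" for d :: 'v by (simp add: additive_def algebra_simps)
    have "T (b * c) i = psum (\<lambda>\<beta>. G (\<beta> * c)) (lam n) (br L b) + psign (pb * pc) (psum (\<lambda>\<gamma>. G (\<gamma> * b)) (lam n) (br L c))"
      unfolding TT br_leibniz[OF b c]
      by (simp only: psum_add[OF add] additive_psign_commute[OF additive_psum[OF add]] psum_map_poly[OF add mult])
    also have "cong (Suc n) \<dots> (psum (\<lambda>\<beta>. ?b (sh n i (exp_dot i \<beta> (A c))) + ?c (exp_dot i c (G \<beta>))) (lam n) (br L b)
      + psign (pb * pc) (psum (\<lambda>\<gamma>. psign (pc * s) (sh n i (exp_dot i \<gamma> (A b))) + psign (pb * (pc + s)) (exp_dot i b (G \<gamma>))) (lam n) (br L c)))"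
      by (intro cong_add cong_psign cong_psum G br_even_part L b c) auto
    also have "\<dots> = (?b X + ?c (exp_dot i c (T b i))) + psign (pb * pc) (psign (pc * s) Z + psign (pb * (pc + s)) (exp_dot i b (T c i)))"
      using i by (simp add: psum_add_fun psum_psign psum_exp_dot X_def Z_def TT)
    also have "\<dots> = ?b (exp_dot i b (T c i) + X) + ?c (exp_dot i c (T b i) + Z)"
    proof -
      have "pb * pc + pc * s = pc * (pb + s)" "pb * pc + pb * (pc + s) = pb * s"
        by (cases pb; cases pc; cases s; simp)+
      then show ?thesis
        by (simp only: additive.add[OF additive_psign] psign_psign add_ac)
    qed
    finally show ?thesis .
  qed
  have th: "theta L n P (as[i := x]) = lam_act n L (A x) - (T x i + (\<Sum>l\<in>{..<n} - {i}. T x l))" for x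
    using i by (simp add: theta_def T_def A_def sum.remove[of "{..<n}" i])
  have "cong (Suc n) (theta L n P (as[i := b * c]))
    ((?b (exp_dot i b (lam_act n L (A c)) + X) + ?c (exp_dot i c (lam_act n L (A b)) + Z))
     - ((?b (exp_dot i b (T c i) + X) + ?c (exp_dot i c (T b i) + Z))
       + (\<Sum>l\<in>{..<n} - {i}. ?b (exp_dot i b (T c l)) + ?c (exp_dot i c (T b l)))))"
    unfolding th by (intro cong_diff cong_add cong_sum 1 2 3) auto
  also have "\<dots> = ?b (exp_dot i b (theta L n P (as[i := c]))) + ?c (exp_dot i c (theta L n P (as[i := b])))"
    unfolding th
    by (simp add: additive.add[OF additive_psign] additive.diff[OF additive_psign] additive.sum[OF additive_psign]
      additive.add[OF additive_exp_dot] additive.diff[OF additive_exp_dot] additive.sum[OF additive_exp_dot] sum.distrib)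
  finally show "cong (Suc n) (theta L n P (as[i := b * c]))
    (?b (exp_dot i b (theta L n P (as[i := c]))) + ?c (exp_dot i c (theta L n P (as[i := b]))))" .
qed

section \<open>From congruence in \<open>n + 1\<close> variables to equality in \<open>n\<close>
  variables\<close>

lemma elim_cong: "cong (Suc n) F G \<Longrightarrow> elim n F = elim n G"
  unfolding cong_def using additive.diff[OF additive_elim] elim_total_Suc by (metis eq_iff_diff_eq_0)

lemma elim_Sc: "elim n (Sc r P) = Sc r (elim n P)"
proof (induction P rule: mpoly_induct)
  case (lam i F)
  then show ?case
    by (cases "i = n") (simp_all add: Sc_smul elim_lam elim_lam_same total_Sc additive.minus[OF additive_Sc])
qed (simp_all add: additive.add[OF additive_Sc] additive.add[OF additive_elim] elim_const)

lemma elim_exp_dot: "F \<in> lampoly (Suc n) \<Longrightarrow> i < n \<Longrightarrow> elim n (exp_dot i b F) = exp_dot i b (elim n F)"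
  by (rule elim_commute) (auto simp: additive_exp_dot exp_dot_lam lampoly_exp_dot exp_dot_total)

lemma elim_sw:
  assumes "F \<in> lampoly (Suc n)" "Suc i < n"
  shows "elim n (subst (lam \<circ> sw i) F) = subst (lam \<circ> sw i) (elim n F)"
proof (rule elim_commute)
  fix F
  show "subst (lam \<circ> sw i) (smul (lam n) F) = smul (lam n) (subst (lam \<circ> sw i) F)"
    using subst_lam[of "lam \<circ> sw i" n F] assms(2) by (simp only: o_apply) simp
  show "F \<in> lampoly n \<Longrightarrow> subst (lam \<circ> sw i) F \<in> lampoly n" by (rule lampoly_sw[OF _ assms(2)])
  show "subst (lam \<circ> sw i) (total n F) = total n (subst (lam \<circ> sw i) F)"
    by (rule subst_rename_total[OF bij_sw[OF assms(2)]])
qed (rule additive_subst assms(1))+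

text \<open>Transport of the axioms along an operator on values, possibly from one relation to
  another; used for elimination and for scalar multiples.\<close>

lemma ax_map:
  assumes P: "ax R n k q P" and R: "\<And>F G. R F G \<Longrightarrow> S (\<phi> F) (\<phi> G)"
    and \<phi>: "additive \<phi>" "\<And>F. F \<in> lampoly k \<Longrightarrow> \<phi> F \<in> lampoly k'" "\<And>r F. \<phi> (Sc r F) = Sc r (\<phi> F)"
      "\<And>r F. hp r F \<Longrightarrow> hp r (\<phi> F)" "\<And>i F. i < n \<Longrightarrow> \<phi> (smul (lam i) F) = smul (lam i) (\<phi> F)"
      "\<And>i F. Suc i < n \<Longrightarrow> F \<in> lampoly k \<Longrightarrow> \<phi> (subst (lam \<circ> sw i) F) = subst (lam \<circ> sw i) (\<phi> F)"
      "\<And>i b F. i < n \<Longrightarrow> F \<in> lampoly k \<Longrightarrow> \<phi> (exp_dot i b F) = exp_dot i b (\<phi> F)"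
  shows "ax S n k' q (\<lambda>as. \<phi> (P as))"
proof -
  note P = axD[OF P]
  note val = ax_valD[OF P(1)]
  show ?thesis
    unfolding ax_def ax_val_def ax_lin_def ax_par_def ax_ses_def ax_sym_def ax_lbz_def
  proof (intro conjI allI impI)
    fix as :: "'v list" assume "length as = n"
    then show "\<phi> (P as) \<in> lampoly k'" by (intro \<phi> val)
  next
    fix as :: "'v list" and i a b assume A: "length as = n \<and> i < n"
    then have "S (\<phi> (P (as[i := a + b]))) (\<phi> (P (as[i := a]) + P (as[i := b])))"
      by (intro R ax_linD[OF P(2)]) auto
    then show "S (\<phi> (P (as[i := a + b]))) (\<phi> (P (as[i := a])) + \<phi> (P (as[i := b])))"
      by (simp only: additive.add[OF \<phi>(1)])
  next
    fix as :: "'v list" and i r a assume A: "length as = n \<and> i < n"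
    then have "S (\<phi> (P (as[i := scale r a]))) (\<phi> (Sc r (P (as[i := a]))))"
      by (intro R ax_linD[OF P(2)]) auto
    then show "S (\<phi> (P (as[i := scale r a]))) (Sc r (\<phi> (P (as[i := a]))))"
      by (simp only: \<phi>(3))
  next
    fix as :: "'v list" and ps assume A: "length as = n \<and> homogeneous as ps"
    then obtain F where "F \<in> lampoly k" "R F (P as)" "hp (q + (\<Sum>j<n. ps ! j + 1) + 1) F"
      using ax_parD[OF P(3)] by blast
    then show "\<exists>F\<in>lampoly k'. S F (\<phi> (P as)) \<and> hp (q + (\<Sum>j<n. ps ! j + 1) + 1) F"
      by (intro bexI[of _ "\<phi> F"] conjI R \<phi>)
  next
    fix as :: "'v list" and i assume A: "length as = n \<and> i < n"
    then have "S (\<phi> (P (as[i := D (as ! i)]))) (\<phi> (- smul (lam i) (P as)))"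
      by (intro R ax_sesD[OF P(4)]) auto
    then show "S (\<phi> (P (as[i := D (as ! i)]))) (- smul (lam i) (\<phi> (P as)))"
      using A by (simp add: additive.minus[OF \<phi>(1)] \<phi>(5))
  next
    fix as :: "'v list" and ps i assume A: "length as = n \<and> homogeneous as ps \<and> Suc i < n"
    let ?as = "as[i := as ! Suc i, Suc i := as ! i]"
    have "S (\<phi> (subst (lam \<circ> sw i) (P ?as))) (\<phi> (psign ((ps ! i + 1) * (ps ! Suc i + 1)) (P as)))"
      using A by (intro R ax_symD[OF P(5)]) auto
    moreover have "\<phi> (subst (lam \<circ> sw i) (P ?as)) = subst (lam \<circ> sw i) (\<phi> (P ?as))"
      by (rule \<phi>(6)) (use A val in auto)
    ultimately show "S (subst (lam \<circ> sw i) (\<phi> (P ?as))) (psign ((ps ! i + 1) * (ps ! Suc i + 1)) (\<phi> (P as)))"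
      by (simp only: additive_psign_commute[OF \<phi>(1)])
  next
    fix as :: "'v list" and ps i b c pb pc s
    assume A: "length as = n \<and> homogeneous as ps \<and> i < n \<and> b \<in> part pb \<and> c \<in> part pc \<and> s = q + (\<Sum>j<i. ps ! j + 1)"
    then have "S (\<phi> (P (as[i := b * c]))) (\<phi> (psign (pb * s) (exp_dot i b (P (as[i := c])))
             + psign (pc * (pb + s)) (exp_dot i c (P (as[i := b])))))"
      by (intro R ax_lbzD[OF P(6)]) auto
    then show "S (\<phi> (P (as[i := b * c]))) (psign (pb * s) (exp_dot i b (\<phi> (P (as[i := c]))))
             + psign (pc * (pb + s)) (exp_dot i c (\<phi> (P (as[i := b])))))"
      using A by (simp only: additive.add[OF \<phi>(1)] additive_psign_commute[OF \<phi>(1)] \<phi>(7) val length_list_update)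
  qed
qed

text \<open>The entrance to the basic complex: axioms valid modulo \<open>total (Suc n)\<close>
  become equalities, because elimination annihilates that image and commutes with every operator in
  the axioms.\<close>

lemma ax_elim: "ax (cong (Suc n)) n (Suc n) q Q \<Longrightarrow> ax (=) n n q (\<lambda>as. elim n (Q as))"
  by (erule ax_map)
    (simp_all add: elim_cong additive_elim lampoly_elim elim_Sc hp_elim elim_lam elim_sw elim_exp_dot)

lemma elim_theta_ax:
  assumes L: "L \<in> part 0" and P: "ax (cong n) n n q P" and lin: "ax_lin (=) n P"
  shows "ax (=) n n q (\<lambda>as. elim n (theta L n P as))"
proof (rule ax_elim)
  note P = axD[OF P]
  have "ax_lin (cong (Suc n)) n (theta L n P)" using theta_lin[OF lin] by (simp add: ax_lin_def)
  then show "ax (cong (Suc n)) n (Suc n) q (theta L n P)"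
    unfolding ax_def by (intro conjI theta_val theta_par theta_ses theta_sym theta_lbz P L lin)
qed

section \<open>The weight operator as first-order term of the Lie derivative\<close>

text \<open>\<open>L\<^sub>(\<^sub>1\<^sub>)\<close> on the coefficients plus
  \<open>d/d\<lambda>\<^sub>i\<close> after \<open>\<lambda>\<^sub>i\<close> for each variable; the
  latter is the derivative at 0 of \<open>(\<lambda>\<^sub>i + \<lambda>) F(\<lambda>\<^sub>i +
  \<lambda>)\<close>, which sesquilinearity produces from
  \<open>L\<^sub>(\<^sub>0\<^sub>) a\<^sub>i = \<partial> a\<^sub>i\<close>. Thus
  \<open>\<lambda>\<^sub>i\<close> has weight 1, and every variable adds a further 1.\<close>

definition weight_op :: "'v \<Rightarrow> nat \<Rightarrow> 'm mpoly \<Rightarrow> 'm mpoly" where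
  "weight_op L n F = modes 1 L F + (\<Sum>i<n. F + smul (lam i) (der i F))"

text \<open>The operator \<open>T\<close> on representatives: the coefficient of the parameter of
  \<open>L\<close> in the Lie derivative.\<close>

definition weight_cochain :: "'v \<Rightarrow> nat \<Rightarrow> ('v list \<Rightarrow> 'm mpoly) \<Rightarrow> 'v list \<Rightarrow> 'm mpoly" where
  "weight_cochain L n P as = weight_op L n (P as) - (\<Sum>i<n. P (as[i := coeff (br L (as ! i)) 1]))"

lemma psum_split:
  assumes F: "additive F"
  obtains q where "psum F f p = F (coeff p 0) + smul f (F (coeff p 1)) + smul f (smul f (psum F f q))"
    "\<And>k. coeff q k = coeff p (Suc (Suc k))"
proof -
  obtain q c d where q: "p = pCons c (pCons d q)" by (metis pCons_cases)
  have "psum F f p = psum F f [:c:] + psum F f (pCons 0 [:d:]) + psum F f (pCons 0 (pCons 0 q))"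
    unfolding q by (simp flip: psum_add[OF F])
  also have "\<dots> = F (coeff p 0) + smul f (F (coeff p 1)) + smul f (smul f (psum F f q))"
    by (simp add: psum_pCons[OF F] q) (simp add: psum_def smul_one)
  finally show thesis by (rule that) (simp add: q)
qed

text \<open>The term of order 0 is \<open>total n (P as)\<close>, by
  \<open>L\<^sub>(\<^sub>0\<^sub>) = \<partial>\<close> and sesquilinearity. Modulo
  \<open>total (Suc n)\<close> it equals \<open>- lam n\<close> times \<open>P as\<close>, so the
  whole expression becomes divisible by \<open>lam n\<close>.\<close>

lemma theta_Taylor:
  assumes val: "ax_val n n P" and lin: "ax_lin (=) n P" and ses: "ax_ses (cong n) n P" and as: "length as = n"
    and L0: "\<And>a. coeff (br L a) 0 = D a" and LM: "\<And>m. coeff (act L m) 0 = DM m"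
  shows "\<exists>G\<in>lampoly (Suc n). cong (Suc n) (theta L n P as)
    (smul (lam n) (weight_cochain L n P as - P as) + smul (lam n) (smul (lam n) G))"
proof -
  define F where "F = P as"
  have F: "F \<in> lampoly n" unfolding F_def by (rule ax_valD[OF val as])
  have FS: "F \<in> lampoly (Suc n)" using F by (rule lampoly_mono[rotated]) simp
  obtain G0 where G0: "G0 \<in> lampoly (Suc n)" "lam_act n L F = modes 0 L F + smul (lam n) (modes 1 L F) + smul (lam n) (smul (lam n) G0)"
    using lam_act_Taylor[OF F] by blast
  have m0: "modes 0 L F = DMm F"
    by (simp add: modes_def LM)
  have "\<exists>G\<in>lampoly (Suc n). cong (Suc n) (psum (\<lambda>c. sh n i (P (as[i := c]))) (lam n) (br L (as ! i)))
    (- smul (lam i) F + smul (lam n) (P (as[i := coeff (br L (as ! i)) 1]) - (F + smul (lam i) (der i F)))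
     + smul (lam n) (smul (lam n) G))" if i: "i < n" for i
  proof -
    let ?H = "\<lambda>c. sh n i (P (as[i := c]))" and ?F1 = "P (as[i := coeff (br L (as ! i)) 1])"
    have add: "additive ?H" by (rule additive_comp[OF additive_sh lin_additive[OF lin as i]])
    have valc: "P (as[i := c]) \<in> lampoly n" for c by (rule ax_valD[OF val]) (simp add: as)
    obtain q where q: "psum ?H (lam n) (br L (as ! i)) = ?H (D (as ! i)) + smul (lam n) (?H (coeff (br L (as ! i)) 1))
        + smul (lam n) (smul (lam n) (psum ?H (lam n) q))"
      using psum_split[OF add, of "lam n" "br L (as ! i)"] L0 by metis
    have Q: "psum ?H (lam n) q \<in> lampoly (Suc n)"
      by (intro lampoly_psum lampoly_sh valc i) simp
    have H0: "cong (Suc n) (?H (D (as ! i))) (- (smul (lam i) (sh n i F) + smul (lam n) (sh n i F)))"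
      using cong_neg_lam_sh[OF ax_sesD[OF ses as i] i] by (simp add: F_def sh_lam)
    obtain G1 where G1: "G1 \<in> lampoly (Suc n)" "sh n i F = F + smul (lam n) (der i F) + smul (lam n) (smul (lam n) G1)"
      using sh_Taylor[OF F i] by blast
    obtain G2 where G2: "G2 \<in> lampoly (Suc n)" "sh n i ?F1 = ?F1 + smul (lam n) (der i ?F1) + smul (lam n) (smul (lam n) G2)"
      using sh_Taylor[OF valc i] by blast
    \<comment> \<open>The second-order terms: the tail of the bracket, and the remainders left by
      the expansions of \<open>?F1\<close> and \<open>F\<close> after multiplication by
      \<open>lam n\<close> and by \<open>\<lambda>\<^sub>i + \<lambda>\<^sub>n\<close>.\<close>
    let ?G = "psum ?H (lam n) q + der i ?F1 + smul (lam n) G2 - smul (lam i) G1 - der i F - smul (lam n) G1"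
    have "?G \<in> lampoly (Suc n)"
      using i G1 G2 Q valc[of "coeff (br L (as ! i)) 1"] F
      by (intro lampoly_add lampoly_diff lampoly_lam lampoly_der) (auto intro: lampoly_mono[of n])
    moreover have "cong (Suc n) (psum ?H (lam n) (br L (as ! i)))
      (- (smul (lam i) (sh n i F) + smul (lam n) (sh n i F)) + smul (lam n) (sh n i ?F1) + smul (lam n) (smul (lam n) (psum ?H (lam n) q)))"
      unfolding q by (intro cong_add H0) auto
    moreover have "- (smul (lam i) (sh n i F) + smul (lam n) (sh n i F)) + smul (lam n) (sh n i ?F1) + smul (lam n) (smul (lam n) (psum ?H (lam n) q))
      = - smul (lam i) F + smul (lam n) (?F1 - (F + smul (lam i) (der i F))) + smul (lam n) (smul (lam n) ?G)"
      unfolding G1(2) G2(2)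
      by (simp add: mp.scale_right_distrib mp.scale_right_diff_distrib mp.scale_left_commute[of "lam n" "lam i"])
    ultimately show ?thesis by metis
  qed
  then obtain G where G: "\<And>i. i < n \<Longrightarrow> G i \<in> lampoly (Suc n)"
    "\<And>i. i < n \<Longrightarrow> cong (Suc n) (psum (\<lambda>c. sh n i (P (as[i := c]))) (lam n) (br L (as ! i)))
    (- smul (lam i) F + smul (lam n) (P (as[i := coeff (br L (as ! i)) 1]) - (F + smul (lam i) (der i F)))
     + smul (lam n) (smul (lam n) (G i)))" by metis
  have "cong (Suc n) (theta L n P as) (lam_act n L F - (\<Sum>i<n. - smul (lam i) F
      + smul (lam n) (P (as[i := coeff (br L (as ! i)) 1]) - (F + smul (lam i) (der i F))) + smul (lam n) (smul (lam n) (G i))))"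
    unfolding theta_def F_def[symmetric] using G by (intro cong_diff cong_sum) auto
  also have "\<dots> = total n F + smul (lam n) (weight_cochain L n P as) + smul (lam n) (smul (lam n) (G0 - (\<Sum>i<n. G i)))"
    unfolding G0(2) m0 weight_cochain_def weight_op_def F_def[symmetric] total_def
    by (simp add: sum.distrib sum_subtractf sum_negf mp.scale_right_distrib mp.scale_right_diff_distrib mp.scale_sum_right)
  also have "cong (Suc n) \<dots> (- smul (lam n) F + smul (lam n) (weight_cochain L n P as) + smul (lam n) (smul (lam n) (G0 - (\<Sum>i<n. G i))))"
  proof (intro cong_add)
    have "total n F - (- smul (lam n) F) = total (Suc n) F" by (simp add: total_Suc)
    then show "cong (Suc n) (total n F) (- smul (lam n) F)" using FS unfolding cong_def by blast
  qed auto
  finally have "cong (Suc n) (theta L n P as)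
    (smul (lam n) (weight_cochain L n P as - P as) + smul (lam n) (smul (lam n) (G0 - (\<Sum>i<n. G i))))"
    by (simp add: F_def mp.scale_right_diff_distrib)
  moreover have "G0 - (\<Sum>i<n. G i) \<in> lampoly (Suc n)"
    using G0 G by (intro lampoly_diff lampoly_sum) auto
  ultimately show ?thesis by blast
qed

lemma lampoly_weight_op: "F \<in> lampoly n \<Longrightarrow> weight_op L n F \<in> lampoly n"
  unfolding weight_op_def by (intro lampoly_add lampoly_sum lampoly_modes lampoly_lam lampoly_der) auto

lemma lampoly_weight_cochain: "ax_val n n P \<Longrightarrow> length as = n \<Longrightarrow> weight_cochain L n P as \<in> lampoly n"
  unfolding weight_cochain_def by (intro lampoly_diff lampoly_sum lampoly_weight_op) (auto simp: ax_val_def)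

text \<open>Replacing \<open>lam n\<close> by \<open>- total n\<close> in the expansion makes
  \<open>total n\<close> a common factor. The quotient is the first-order coefficient with opposite
  sign plus \<open>total n\<close> of the eliminated remainder, hence congruent to
  \<open>P - T P\<close>.\<close>

lemma elim_theta_eq_total:
  assumes "ax_val n n P" "ax_lin (=) n P" "ax_ses (cong n) n P" "length as = n"
    "\<And>a. coeff (br L a) 0 = D a" "\<And>m. coeff (act L m) 0 = DM m"
  shows "\<exists>B\<in>lampoly n. cong n B (P as - weight_cochain L n P as) \<and> total n B = elim n (theta L n P as)"
proof -
  obtain G where G: "G \<in> lampoly (Suc n)" "cong (Suc n) (theta L n P as)
    (smul (lam n) (weight_cochain L n P as - P as) + smul (lam n) (smul (lam n) G))"
    using theta_Taylor[OF assms] by blast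
  let ?F = "weight_cochain L n P as - P as" and ?G = "elim n G"
  have F: "?F \<in> lampoly n"
    using assms by (intro lampoly_diff lampoly_weight_cochain) (auto simp: ax_val_def)
  have Gl: "?G \<in> lampoly n" by (rule lampoly_elim[OF G(1)])
  have "elim n (theta L n P as) = total n (- ?F + total n ?G)"
    unfolding elim_cong[OF G(2)]
    by (simp add: additive.add[OF additive_elim] elim_lam_same elim_lampoly[OF F] additive.minus[OF additive_total] additive.diff[OF additive_total] additive.add[OF additive_total])
  moreover have "cong n (- ?F + total n ?G) (P as - weight_cochain L n P as)"
    unfolding cong_def using Gl by (intro bexI[of _ ?G]) auto
  ultimately show ?thesis
    using lampoly_add[OF lampoly_uminus[OF F] lampoly_total[OF order_refl Gl]]
    by (intro bexI[of _ "- ?F + total n ?G"]) simp_all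
qed

section \<open>Injectivity of \<open>\<partial> + \<Lambda>\<close> and division by it\<close>

lemma lookup_smul_lam:
  "Poly_Mapping.lookup (smul (lam i) R) e = (if Poly_Mapping.lookup e i = 0 then 0 else Poly_Mapping.lookup R (e - var i))"
proof (rule additive_eqI[where P = R and f = "\<lambda>R. Poly_Mapping.lookup (smul (lam i) R) e"])
  fix e' m
  have "e' + var i = e \<longleftrightarrow> Poly_Mapping.lookup e i \<noteq> 0 \<and> e' = e - var i"
  proof
    assume "Poly_Mapping.lookup e i \<noteq> 0 \<and> e' = e - var i"
    then show "e' + var i = e"
      by (intro poly_mapping_eqI) (auto simp: lookup_minus lookup_add lookup_single when_def)
  qed (auto simp: lookup_add lookup_single)
  then show "Poly_Mapping.lookup (smul (lam i) (Poly_Mapping.single e' m)) e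
    = (if Poly_Mapping.lookup e i = 0 then 0 else Poly_Mapping.lookup (Poly_Mapping.single e' m) (e - var i))"
    by (auto simp: smul_lam_single lookup_single when_def)
qed (auto simp: additive_def additive.add[OF additive_smul] lookup_add)

text \<open>
  The coefficients of \<open>R\<close> are recovered from those of \<^term>\<open>total n R\<close> by descending induction on
  the degree in \<open>\<lambda>\<^sub>0\<close>.
\<close>

lemma total_coefficients:
  assumes U: "0 \<in> U" "\<And>x y. x \<in> U \<Longrightarrow> y \<in> U \<Longrightarrow> x - y \<in> U" "\<And>x. x \<in> U \<Longrightarrow> DM x \<in> U"
    and n: "0 < n" and R: "\<And>e. Poly_Mapping.lookup (total n R) e \<in> U"
  shows "Poly_Mapping.lookup R e \<in> U"
proof -
  have Uadd: "x + y \<in> U" if "x \<in> U" "y \<in> U" for x y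
    using U(2)[OF that(1) U(2)[OF U(1) that(2)]] by simp
  have Usum: "(\<Sum>i\<in>A. f i) \<in> U" if "\<And>i. i \<in> A \<Longrightarrow> f i \<in> U" for A and f :: "nat \<Rightarrow> 'm"
    using that by (induction A rule: infinite_finite_induct) (auto intro: U(1) Uadd)
  have "finite ((\<lambda>e. Poly_Mapping.lookup e 0) ` Poly_Mapping.keys R)" by simp
  then obtain K where K: "\<And>e. e \<in> Poly_Mapping.keys R \<Longrightarrow> Poly_Mapping.lookup e 0 < K"
    unfolding finite_nat_set_iff_bounded by blast
  show ?thesis
  proof (induction "K - Poly_Mapping.lookup e 0" arbitrary: e rule: less_induct)
    case less
    show ?case
    proof (cases "Poly_Mapping.lookup e 0 < K")
      case False
      then have "Poly_Mapping.lookup R e = 0" using K[of e] by (auto simp: in_keys_iff)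
      then show ?thesis by (simp add: U)
    next
      case True
      \<comment> \<open>At this exponent \<open>total n R\<close> contains the coefficient of
        \<open>R\<close> at \<open>e\<close> once, through \<open>\<lambda>\<^sub>0\<close>; every
        other contribution is a coefficient of \<open>R\<close> whose degree in
        \<open>\<lambda>\<^sub>0\<close> is larger by one.\<close>
      let ?e = "e + var 0"
      have up: "Poly_Mapping.lookup R e' \<in> U" if "Poly_Mapping.lookup e' 0 = Suc (Poly_Mapping.lookup e 0)" for e'
        by (rule less) (use that True in auto)
      have "Poly_Mapping.lookup (total n R) ?e = DM (Poly_Mapping.lookup R ?e)
        + (\<Sum>i<n. Poly_Mapping.lookup (smul (lam i) R) ?e)"
        by (simp add: total_def lookup_add lookup_sum lookup_map additive.zero[OF additive_DM])
      also have "(\<Sum>i<n. Poly_Mapping.lookup (smul (lam i) R) ?e)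
         = Poly_Mapping.lookup R e + (\<Sum>i\<in>{..<n} - {0}. Poly_Mapping.lookup (smul (lam i) R) ?e)"
        using n by (simp add: sum.remove[of "{..<n}" 0] lookup_smul_lam lookup_add)
      finally have "Poly_Mapping.lookup R e = Poly_Mapping.lookup (total n R) ?e
         - (DM (Poly_Mapping.lookup R ?e) + (\<Sum>i\<in>{..<n} - {0}. Poly_Mapping.lookup (smul (lam i) R) ?e))"
        by simp
      also have "\<dots> \<in> U"
      proof (intro U(2) R Uadd U(3) Usum up)
        fix i assume "i \<in> {..<n} - {0}"
        then show "Poly_Mapping.lookup (smul (lam i) R) ?e \<in> U"
          unfolding lookup_smul_lam by (auto simp: U(1) lookup_minus lookup_add lookup_single intro!: up)
      qed (simp add: lookup_add)
      finally show ?thesis .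
    qed
  qed
qed

text \<open>The case \<open>U = {0}\<close>. A variable is needed: for \<open>n = 0\<close> the
  operator is \<open>\<partial>\<close> on \<open>M\<close>, which may have a kernel.\<close>

lemma total_inject: "0 < n \<Longrightarrow> total n F = total n G \<Longrightarrow> F = G"
proof -
  assume n: "0 < n" and eq: "total n F = total n G"
  have "Poly_Mapping.lookup (F - G) e \<in> {0}" for e
    by (rule total_coefficients[where n = n])
      (use n eq in \<open>auto simp: additive.zero[OF additive_DM] additive.diff[OF additive_total]\<close>)
  then show "F = G"
    by (intro poly_mapping_eqI) (simp add: lookup_minus)
qed

lemma hp_total_imp: "0 < n \<Longrightarrow> hp r (total n F) \<Longrightarrow> hp r F"
  unfolding hp_def
  by (intro allI, rule total_coefficients[where n = n and U = "partM r"])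
    (use DM_even in \<open>auto simp: M.even_endo_def M.subspace_0[OF M.subspace_part] M.subspace_diff[OF M.subspace_part]\<close>)

text \<open>\<open>total n\<close> is injective and commutes with all operators in the axioms, so
  these can be divided by it; parity descends by \<open>hp_total_imp\<close>.\<close>

lemma ax_total:
  assumes n: "0 < n" and val: "\<And>as. length as = n \<Longrightarrow> B as \<in> lampoly n" and ax: "ax (=) n n q (\<lambda>as. total n (B as))"
  shows "ax (=) n n q B"
proof -
  note Q = axD[OF ax]
  show ?thesis
    unfolding ax_def ax_val_def ax_lin_def ax_par_def ax_ses_def ax_sym_def ax_lbz_def
  proof (intro conjI allI impI)
    fix as :: "'v list" assume "length as = n"
    then show "B as \<in> lampoly n" by (rule val)
  next
    fix as :: "'v list" and i a b assume A: "length as = n \<and> i < n"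
    show "B (as[i := a + b]) = B (as[i := a]) + B (as[i := b])"
      using ax_linD(1)[OF Q(2), of as i a b] A by - (rule total_inject[OF n], simp add: additive.add[OF additive_total])
  next
    fix as :: "'v list" and i r a assume A: "length as = n \<and> i < n"
    show "B (as[i := scale r a]) = Sc r (B (as[i := a]))"
      using ax_linD(2)[OF Q(2), of as i r a] A by - (rule total_inject[OF n], simp add: total_Sc)
  next
    fix as :: "'v list" and ps assume A: "length as = n \<and> homogeneous as ps"
    then have a: "length as = n" "homogeneous as ps" by simp_all
    obtain F where "F = total n (B as)" "hp (q + (\<Sum>j<n. ps ! j + 1) + 1) F"
      by (rule ax_parD[OF Q(3) a])
    then have "hp (q + (\<Sum>j<n. ps ! j + 1) + 1) (total n (B as))"
      by (simp only:)
    then show "\<exists>F\<in>lampoly n. F = B as \<and> hp (q + (\<Sum>j<n. ps ! j + 1) + 1) F"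
      using hp_total_imp[OF n] val A by blast
  next
    fix as :: "'v list" and i assume A: "length as = n \<and> i < n"
    then show "B (as[i := D (as ! i)]) = - smul (lam i) (B as)"
      using ax_sesD[OF Q(4), of as i] by - (rule total_inject[OF n], simp add: additive.minus[OF additive_total] total_lam)
  next
    fix as :: "'v list" and ps i assume A: "length as = n \<and> homogeneous as ps \<and> Suc i < n"
    then show "subst (lam \<circ> sw i) (B (as[i := as ! Suc i, Suc i := as ! i])) = psign ((ps ! i + 1) * (ps ! Suc i + 1)) (B as)"
      using ax_symD[OF Q(5), of as ps i]
      by - (rule total_inject[OF n], simp only: additive_psign_commute[OF additive_total] subst_rename_total[OF bij_sw])
  next
    fix as :: "'v list" and ps i b c pb pc s
    assume A: "length as = n \<and> homogeneous as ps \<and> i < n \<and> b \<in> part pb \<and> c \<in> part pc \<and> s = q + (\<Sum>j<i. ps ! j + 1)"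
    then show "B (as[i := b * c]) = psign (pb * s) (exp_dot i b (B (as[i := c])))
             + psign (pc * (pb + s)) (exp_dot i c (B (as[i := b])))"
      using ax_lbzD[OF Q(6), of as ps i b pb c pc s]
      by - (rule total_inject[OF n], simp only: additive.add[OF additive_total] additive_psign_commute[OF additive_total] exp_dot_total)
  qed
qed

section \<open>The differential\<close>

lemma actx_jacobi:
  assumes a: "a \<in> part 0" and b: "b \<in> part q"
  shows "actx s a (actx t b m) = actx t b (actx s a m) + actx (s + t) (brx s a b) m"
proof -
  have "actx s a (actx t b m) - actx t b (actx s a m)
    = (\<Sum>k\<le>degree (br a b). scaleM (s ^ k) (actx (s + t) (coeff (br a b) k) m))"
    unfolding actx_def
    by (rule M.jacobi_scalars)
      (use act_jacobi[OF a b, of m] in \<open>simp_all add: additive_act act_scale_right coeff_eq_0 additive.zero[OF additive_act_left]\<close>)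
  also have "\<dots> = actx (s + t) (brx s a b) m"
    by (simp add: brx_def pev_def additive.sum[OF additive_actx_left] actx_scale)
  finally show ?thesis by (simp add: algebra_simps)
qed

lemma brx_jacobi:
  assumes a: "a \<in> part 0" and b: "b \<in> part q"
  shows "brx s a (brx t b m) = brx t b (brx s a m) + brx (s + t) (brx s a b) m"
proof -
  have "brx s a (brx t b m) - brx t b (brx s a m)
    = (\<Sum>k\<le>degree (br a b). scale (s ^ k) (brx (s + t) (coeff (br a b) k) m))"
    unfolding brx_def
    by (rule jacobi_scalars)
      (use br_jacobi[OF a b, of m] in \<open>simp_all add: additive_br br_scale_right coeff_eq_0 additive.zero[OF additive_br_left]\<close>)
  also have "\<dots> = brx (s + t) (brx s a b) m"
    by (subst (2) brx_def) (simp add: pev_def additive.sum[OF additive_brx_left] brx_scale)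
  finally show ?thesis by (simp add: algebra_simps)
qed

text \<open>The sign exponents depend on parities only. They are separated from the differential so
  that they can be compared once \<open>L\<close> is prepended to the arguments.\<close>

definition gam :: "bit \<Rightarrow> bit list \<Rightarrow> nat \<Rightarrow> bit" where
  "gam q ps i = (ps ! i + 1) * (q + (\<Sum>l<i. ps ! l + 1) + 1) + 1"

definition gam2 :: "bit \<Rightarrow> bit list \<Rightarrow> nat \<Rightarrow> nat \<Rightarrow> bit" where
  "gam2 q ps i j = q + (ps ! i + 1) * ((\<Sum>l<i. ps ! l + 1) + 1) + (ps ! j + 1) * (\<Sum>l\<in>{..<j} - {i}. ps ! l + 1)"

definition act_term :: "nat \<Rightarrow> 'v \<Rightarrow> 'm mpoly \<Rightarrow> 'm mpoly" where
  "act_term i a F = lam_act i a (subst (lam \<circ> skip i) F)"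

definition pair_subst :: "nat \<Rightarrow> nat \<Rightarrow> 'm mpoly \<Rightarrow> 'm mpoly" where
  "pair_subst i j = subst (case_nat (lam i + lam j) (lam \<circ> skip j \<circ> skip i))"

text \<open>\<open>diff_formula\<close> for polynomial-valued functions instead of cosets; only in
  this form can the differential be applied to the basic complex.\<close>

definition Dif :: "nat \<Rightarrow> bit \<Rightarrow> ('v list \<Rightarrow> 'm mpoly) \<Rightarrow> 'v list \<Rightarrow> bit list \<Rightarrow> 'm mpoly" where
  "Dif n q P as ps = (\<Sum>i\<le>n. psign (gam q ps i) (act_term i (as ! i) (P (del i as))))
     + (\<Sum>j\<le>n. \<Sum>i<j. psign (gam2 q ps i j)
        (psum (\<lambda>c. pair_subst i j (P (c # del i (del j as)))) (lam i) (br (as ! i) (as ! j))))"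

lemma diff_formula_eq: "diff_formula n q Y as ps = Dif n q (\<lambda>as. rep (Y as)) as ps"
  by (simp add: diff_formula_def Dif_def gam_def gam2_def psum_def Let_def act_term_def pair_subst_def)

section \<open>Deleting arguments, renumbering variables, and values of the differential at
  scalars\<close>

lemma length_del: "i < length xs \<Longrightarrow> length (del i xs) = length xs - 1"
  by (simp add: del_def)

lemma nth_del: "i < length xs \<Longrightarrow> l < length xs - 1 \<Longrightarrow> del i xs ! l = xs ! skip i l"
  by (simp add: del_def skip_def nth_append)

lemma skip_neq: "skip i l \<noteq> i" and skip_inj: "skip i l = skip i l' \<longleftrightarrow> l = l'"
  and skip_less: "i \<le> n \<Longrightarrow> skip i l < Suc n \<longleftrightarrow> l < n"
  by (auto simp: skip_def)

lemma skip_surj: "l \<noteq> i \<Longrightarrow> \<exists>l'. l = skip i l'"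
  by (rule exI[of _ "if l < i then l else l - 1"]) (auto simp: skip_def)

lemma del_update_same: "del i (xs[i := c]) = del i xs"
  by (simp add: del_def)

lemma del_update_skip: "i < length xs \<Longrightarrow> l < length xs - 1 \<Longrightarrow> del i (xs[skip i l := c]) = (del i xs)[l := c]"
proof -
  assume i: "i < length xs" and l: "l < length xs - 1"
  then have "skip i l < length xs" by (auto simp: skip_def)
  with i l show ?thesis
    by (intro nth_equalityI) (auto simp: length_del nth_del nth_list_update skip_inj)
qed

lemma sum_skip:
  assumes "i \<le> n"
  shows "(\<Sum>l<Suc n. f l) = f i + (\<Sum>l<n. f (skip i l))"
proof -
  have "(\<Sum>l\<in>{..<Suc n} - {i}. f l) = (\<Sum>l<n. f (skip i l))"
    by (rule sum.reindex_bij_witness[of _ "skip i" "\<lambda>l. if l < i then l else l - 1"])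
      (use assms in \<open>auto simp: skip_def\<close>)
  then show ?thesis
    using assms sum.remove[of "{..<Suc n}" i f] by (simp del: sum.lessThan_Suc)
qed

lemma ev_act_term: "ev x (act_term i a F) = actx (x i) a (ev (x \<circ> skip i) F)"
proof -
  have "ev x (subst (lam \<circ> skip i) F) = ev (x \<circ> skip i) F"
    by (rule ev_subst) (simp add: ev_lam)
  then show ?thesis by (simp add: act_term_def ev_lam_act)
qed

lemma ev_pair_subst: "ev x (pair_subst i j F) = ev (case_nat (x i + x j) (x \<circ> skip j \<circ> skip i)) F"
  unfolding pair_subst_def
  by (rule ev_subst) (auto simp: ev_lam mp.scale_left_distrib additive.add[OF additive_ev] M.scale_left_distrib split: nat.splits)

lemma ev_Sc: "ev x (Sc r F) = scaleM r (ev x F)"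
  by (induction F rule: mpoly_induct)
    (simp_all add: ev_const ev_lam Sc_smul additive.add[OF additive_ev] additive.add[OF additive_Sc] M.scale_right_distrib mult.commute)

lemma ev_pev:
  assumes "additive G" "\<And>r c. G (scale r c) = Sc r (G c)"
  shows "ev y (G (pev t p)) = (\<Sum>k\<le>degree p. scaleM (t ^ k) (ev y (G (coeff p k))))"
  by (simp add: pev_def additive.sum[OF assms(1)] additive.sum[OF additive_ev] assms(2) ev_Sc)

lemma lin_Cons:
  assumes "ax_lin (=) n P" "Suc (length bs) = n"
  shows "additive (\<lambda>c. P (c # bs))" "P (scale r c # bs) = Sc r (P (c # bs))"
  using lin_additive[OF assms(1), of "0 # bs" 0] ax_linD(2)[OF assms(1), of "0 # bs" 0] assms(2) by auto

lemma ev_theta: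
  assumes P: "ax_lin (=) n P" and as: "length as = n"
  shows "ev x (theta L n P as) = actx (x n) L (ev x (P as))
    - (\<Sum>l<n. ev (x(l := x l + x n)) (P (as[l := brx (x n) L (as ! l)])))"
proof -
  have sh: "ev x (sh n l F) = ev (x(l := x l + x n)) F" for l F
    unfolding sh_def
    by (rule ev_subst) (auto simp: ev_lam mp.scale_left_distrib additive.add[OF additive_ev] M.scale_left_distrib)
  have "ev x (psum (\<lambda>c. sh n l (P (as[l := c]))) (lam n) (br L (as ! l))) = ev (x(l := x l + x n)) (P (as[l := brx (x n) L (as ! l)]))"
    if "l < n" for l
    unfolding brx_def
    by (subst ev_pev[OF lin_additive[OF P as that] ax_linD(2)[OF P as that]], subst ev_psum[OF ev_lam]) (simp add: sh)
  then show ?thesis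
    by (simp add: theta_def additive.diff[OF additive_ev] additive.sum[OF additive_ev] ev_lam_act)
qed

lemma ev_Dif:
  assumes P: "ax_lin (=) n P" and as: "length as = Suc n"
  shows "ev x (Dif n q P as ps) = (\<Sum>i<Suc n. psign (gam q ps i) (actx (x i) (as ! i) (ev (x \<circ> skip i) (P (del i as)))))
     + (\<Sum>j<Suc n. \<Sum>i<j. psign (gam2 q ps i j)
         (ev (case_nat (x i + x j) (x \<circ> skip j \<circ> skip i)) (P (brx (x i) (as ! i) (as ! j) # del i (del j as)))))"
proof -
  have "ev x (psum (\<lambda>c. pair_subst i j (P (c # del i (del j as)))) (lam i) (br (as ! i) (as ! j)))
    = ev (case_nat (x i + x j) (x \<circ> skip j \<circ> skip i)) (P (brx (x i) (as ! i) (as ! j) # del i (del j as)))"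
    if "i < j" "j < Suc n" for i j
  proof -
    have l: "Suc (length (del i (del j as))) = n" using that as by (simp add: length_del)
    show ?thesis
      unfolding brx_def
      by (subst ev_pev[OF lin_Cons[OF P l]], subst ev_psum[OF ev_lam]) (simp add: ev_pair_subst)
  qed
  then show ?thesis
    by (simp add: Dif_def lessThan_Suc_atMost[symmetric] additive.add[OF additive_ev] additive.sum[OF additive_ev] additive_psign_commute[OF additive_ev]
        ev_act_term cong: sum.cong_simp)
qed

definition slin :: "('v \<Rightarrow> 'm) \<Rightarrow> bool" where
  "slin F \<longleftrightarrow> additive F \<and> (\<forall>r c. F (scale r c) = scaleM r (F c))"

lemma slin_sum: "(\<And>i. i \<in> A \<Longrightarrow> slin (F i)) \<Longrightarrow> slin (\<lambda>c. \<Sum>i\<in>A. F i c)"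
  by (simp add: slin_def additive_sum M.scale_sum_right)

lemma slin_add: "slin F \<Longrightarrow> slin G \<Longrightarrow> slin (\<lambda>c. F c + G c)"
  by (simp add: slin_def additive_add M.scale_right_distrib)

lemma slin_psign: "slin F \<Longrightarrow> slin (\<lambda>c. psign p (F c))"
  by (cases p) (auto simp: slin_def psign_def additive_uminus)

lemma slin_actx: "slin F \<Longrightarrow> slin (\<lambda>c. actx t a (F c))"
  by (simp add: slin_def additive_comp[OF additive_actx] actx_scale)

lemma slin_actx_left: "slin (\<lambda>c. actx t c m)"
  by (simp add: slin_def additive_actx_left actx_scale)

lemma slin_ev:
  assumes "ax_lin (=) n P" "length as = n" "i < n"
  shows "slin (\<lambda>c. ev x (P (as[i := c])))"
  using ax_linD[OF assms] by (simp add: slin_def additive_def additive.add[OF additive_ev] ev_Sc)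

lemma slin_brx: "slin F \<Longrightarrow> slin (\<lambda>c. F (brx t a c))" "slin F \<Longrightarrow> slin (\<lambda>c. F (brx t c b))"
  by (simp_all add: slin_def additive_def additive.add[OF additive_brx] additive.add[OF additive_brx_left] brx_scale)

text \<open>In each summand an argument acts, enters the bracket, or is passed on to
  \<open>P\<close>, always linearly. The check is made at scalar points, where a bracket is a single
  element and not a polynomial.\<close>

lemma Dif_lin:
  assumes P: "ax_lin (=) n P"
  shows "ax_lin (=) (Suc n) (\<lambda>as. Dif n q P as ps)"
proof -
  have main: "slin (\<lambda>c. ev x (Dif n q P (as[l := c]) ps))" if as: "length as = Suc n" and l: "l < Suc n" for as l x
  proof -
    have 1: "slin (\<lambda>c. actx (x i) (as[l := c] ! i) (ev (x \<circ> skip i) (P (del i (as[l := c])))))" if i: "i < Suc n" for i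
    proof (cases "l = i")
      case True
      then show ?thesis using as i by (simp add: del_update_same slin_actx_left)
    next
      case False
      then obtain l' where l': "l = skip i l'" using skip_surj by blast
      then have "l' < n" using l i skip_less[of i n l'] by simp
      then show ?thesis
        using False as i l' by (auto simp: del_update_skip length_del intro!: slin_actx slin_ev[OF P])
    qed
    have 2: "slin (\<lambda>c. ev y (P (brx (x i) (as[l := c] ! i) (as[l := c] ! j) # del i (del j (as[l := c])))))"
      if ij: "i < j" "j < Suc n" for i j y
    proof -
      have len: "Suc (length (del i (del j bs))) = n" if "length bs = Suc n" for bs :: "'v list"
        using that ij by (simp add: length_del)
      have F: "slin (\<lambda>c. ev y (P (c # bs)))" if "Suc (length bs) = n" for bs
        using slin_ev[OF P, of "0 # bs" 0 y] that by simp
      consider "l = j" | "l = i" | "l \<noteq> j" "l \<noteq> i" by blast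
      then show ?thesis
      proof cases
        case 1
        then show ?thesis using as ij by (auto simp: del_update_same intro!: slin_brx F len)
      next
        case 2
        have "i = skip j i" using ij by (simp add: skip_def)
        then have "del j (as[i := c]) = (del j as)[i := c]" for c
          using del_update_skip[of j as i c] as ij by simp
        then show ?thesis using 2 as ij by (auto simp: del_update_same intro!: slin_brx F len)
      next
        case 3
        then obtain l' where l': "l = skip j l'" using skip_surj by blast
        then have l'n: "l' < n" using l ij skip_less[of j n l'] by simp
        have "l' \<noteq> i" using 3 l' ij by (auto simp: skip_def)
        then obtain l'' where l'': "l' = skip i l''" using skip_surj by blast
        then have "l'' < n - 1" using l'n ij skip_less[of i "n - 1" l''] by simp
        \<comment> \<open>The index left over after deleting \<open>j\<close> and then
          \<open>i\<close> is \<open>l''\<close>; the bracket placed in front moves it to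
          \<open>Suc l''\<close>.\<close>
        then have "brx t (as[l := c] ! i) (as[l := c] ! j) # del i (del j (as[l := c]))
          = (brx t (as ! i) (as ! j) # del i (del j as))[Suc l'' := c]" for t c
          using as ij l'n l'' 3 by (simp add: l' del_update_skip length_del)
        moreover have "slin (\<lambda>c. ev y (P ((brx t (as ! i) (as ! j) # del i (del j as))[Suc l'' := c])))" for t
          by (rule slin_ev[OF P]) (use as ij \<open>l'' < n - 1\<close> in \<open>auto simp: length_del\<close>)
        ultimately show ?thesis by simp
      qed
    qed
    have "length (as[l := c]) = Suc n" for c using as by simp
    then show ?thesis
      unfolding ev_Dif[OF P \<open>\<And>c. length (as[l := c]) = Suc n\<close>]
      by (intro slin_add slin_sum slin_psign) (use 1 2 in auto)
  qed
  show ?thesis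
    unfolding ax_lin_def
  proof (intro conjI allI impI; elim conjE)
    fix as :: "'v list" and i a b assume as: "length as = Suc n" "i < Suc n"
    show "Dif n q P (as[i := a + b]) ps = Dif n q P (as[i := a]) ps + Dif n q P (as[i := b]) ps"
      by (rule ev_eqI) (use main[OF as] in \<open>simp add: slin_def additive_def additive.add[OF additive_ev, unfolded additive_def]\<close>)
  next
    fix as :: "'v list" and i r a assume as: "length as = Suc n" "i < Suc n"
    show "Dif n q P (as[i := scale r a]) ps = Sc r (Dif n q P (as[i := a]) ps)"
      by (rule ev_eqI) (use main[OF as] in \<open>simp add: slin_def ev_Sc\<close>)
  qed
qed

text \<open>
  The differential commutes with the action of the even element \<open>L\<close>; at the level of values at
  scalar arguments this is the Jacobi identity, term by term.
\<close>

lemma Dif_theta: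
  assumes L: "L \<in> part 0" and P: "ax_lin (=) n P" and as: "length as = Suc n" and hom: "homogeneous as ps"
  shows "Dif n q (theta L n P) as ps = theta L (Suc n) (\<lambda>as. Dif n q P as ps) as"
proof (rule ev_eqI)
  fix x :: "nat \<Rightarrow> 'f"
  \<comment> \<open>The value of the parameter of \<open>L\<close>. It has index
    \<open>n + 1\<close> next to \<open>n + 1\<close> arguments, and index \<open>n\<close> after
    one argument has been deleted.\<close>
  define t where "t = x (Suc n)"
  define p where "p = (\<lambda>bs y. ev y (P bs))"
  have th: "ev y (theta L n P bs) = actx (y n) L (p bs y) - (\<Sum>l<n. p (bs[l := brx (y n) L (bs ! l)]) (y(l := y l + y n)))"
    if "length bs = n" for y bs
    unfolding p_def by (rule ev_theta[OF P that])
  \<comment> \<open>The summand \<open>l\<close> of the Lie derivative is the undifferentiated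
    expression at the arguments \<open>as' l\<close> and the point \<open>x' l\<close>.\<close>
  define as' where "as' = (\<lambda>l. as[l := brx t L (as ! l)])"
  define x' where "x' = (\<lambda>l. x(l := x l + t))"
  have as'l: "length (as' l) = Suc n" for l using as by (simp add: as'_def)
  have homi: "as ! i \<in> part (ps ! i)" if "i < Suc n" for i
    using homogeneous_nth[OF hom] as that by simp
  define A where "A = (\<lambda>as x i. actx (x i) (as ! i) (p (del i as) (x \<circ> skip i)))"
  define B where "B = (\<lambda>as x i j. p (brx (x i) (as ! i) (as ! j) # del i (del j as)) (case_nat (x i + x j) (x \<circ> skip j \<circ> skip i)))"
  \<comment> \<open>Commuting \<open>L\<close> past the action of the argument \<open>i\<close>
    yields exactly the summand \<open>l = i\<close>, by the Jacobi identity of the module; the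
    remaining summands come from the arguments of \<open>P\<close>.\<close>
  have A: "actx (x i) (as ! i) (ev (x \<circ> skip i) (theta L n P (del i as)))
    = actx t L (A as x i) - (\<Sum>l<Suc n. A (as' l) (x' l) i)" if i: "i < Suc n" for i
  proof -
    have len: "length (del i as) = n" using as i by (simp add: length_del)
    have tt: "(x \<circ> skip i) n = t" using i by (simp add: skip_def t_def)
    let ?P = "p (del i as) (x \<circ> skip i)"
    have Ai: "A (as' i) (x' i) i = actx (t + x i) (brx t L (as ! i)) ?P"
    proof -
      have "x' i \<circ> skip i = x \<circ> skip i" by (auto simp: x'_def skip_neq)
      then show ?thesis
        using as i by (simp add: A_def as'_def x'_def del_update_same add.commute)
    qed
    have Al: "A (as' (skip i l)) (x' (skip i l)) i
      = actx (x i) (as ! i) (p ((del i as)[l := brx t L (del i as ! l)]) ((x \<circ> skip i)(l := (x \<circ> skip i) l + t)))"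
      if l: "l < n" for l
    proof -
      have "x' (skip i l) \<circ> skip i = (x \<circ> skip i)(l := (x \<circ> skip i) l + t)"
        by (auto simp: x'_def skip_inj fun_eq_iff)
      moreover have "x' (skip i l) i = x i" "as' (skip i l) ! i = as ! i"
        using skip_neq[of i l] by (simp_all add: x'_def as'_def)
      moreover have "del i (as' (skip i l)) = (del i as)[l := brx t L (del i as ! l)]"
        using as i l by (simp add: as'_def del_update_skip nth_del)
      ultimately show ?thesis by (simp add: A_def)
    qed
    have "actx (x i) (as ! i) (ev (x \<circ> skip i) (theta L n P (del i as)))
      = actx (x i) (as ! i) (actx t L ?P) - (\<Sum>l<n. A (as' (skip i l)) (x' (skip i l)) i)"
      unfolding th[OF len] tt
      by (simp add: additive.diff[OF additive_actx] additive.sum[OF additive_actx] Al)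
    also have "actx (x i) (as ! i) (actx t L ?P) = actx t L (A as x i) - A (as' i) (x' i) i"
      using actx_jacobi[OF L homi[OF i], of t "x i" ?P] unfolding Ai by (simp add: A_def)
    finally show ?thesis
      using sum_skip[of i n "\<lambda>l. A (as' l) (x' l) i"] i by (simp add: algebra_simps del: o_apply sum.lessThan_Suc)
  qed
  \<comment> \<open>Here the bracket of \<open>L\<close> with the bracket of the arguments
    \<open>i\<close> and \<open>j\<close> splits, by the Jacobi identity, into the summands
    \<open>l = i\<close> and \<open>l = j\<close>.\<close>
  have B: "ev (case_nat (x i + x j) (x \<circ> skip j \<circ> skip i)) (theta L n P (brx (x i) (as ! i) (as ! j) # del i (del j as)))
    = actx t L (B as x i j) - (\<Sum>l<Suc n. B (as' l) (x' l) i j)" if ij: "i < j" "j < Suc n" for i j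
  proof -
    obtain m where n: "n = Suc m" using ij by (cases n) auto
    have im: "i \<le> m" using ij n by simp
    define bs where "bs = del i (del j as)"
    define \<beta> where "\<beta> = brx (x i) (as ! i) (as ! j)"
    define z where "z = x \<circ> skip j \<circ> skip i"
    let ?y = "case_nat (x i + x j) z"
    have len: "length bs = m" using as ij n by (simp add: bs_def length_del)
    have add: "p ((c + d) # bs) y = p (c # bs) y + p (d # bs) y" for c d y
      using lin_Cons(1)[OF P, of bs] len n by (simp add: p_def additive_def additive.add[OF additive_ev])
    have tt: "?y n = t" using ij n im by (simp add: z_def skip_def t_def)
    have skipji: "skip j i = i" using ij by (simp add: skip_def)
    have Bj: "B (as' j) (x' j) i j = p (brx (x i) (as ! i) (brx t L (as ! j)) # bs) (case_nat (x i + x j + t) z)"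
    proof -
      have "x' j \<circ> skip j \<circ> skip i = z" by (auto simp: x'_def z_def skip_neq fun_eq_iff)
      then show ?thesis
        using as ij by (simp add: B_def as'_def x'_def del_update_same bs_def add.assoc)
    qed
    have Bi: "B (as' i) (x' i) i j = p (brx (t + x i) (brx t L (as ! i)) (as ! j) # bs) (case_nat (x i + x j + t) z)"
    proof -
      have "x' i (skip j (skip i k)) = z k" for k
        using skip_inj[of j "skip i k" i] skip_neq[of i k] skipji by (simp add: x'_def z_def)
      then have "x' i \<circ> skip j \<circ> skip i = z" by auto
      moreover have "del j (as' i) = (del j as)[i := brx t L (as ! i)]"
        using del_update_skip[of j as i] as ij skipji by (simp add: as'_def)
      ultimately show ?thesis
        using as ij by (simp add: B_def as'_def x'_def del_update_same bs_def add_ac)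
    qed
    have Bl: "B (as' (skip j (skip i l))) (x' (skip j (skip i l))) i j = p (\<beta> # bs[l := brx t L (bs ! l)]) (case_nat (x i + x j) (z(l := z l + t)))"
      if l: "l < m" for l
    proof -
      let ?l = "skip j (skip i l)"
      have ne: "?l \<noteq> i" "?l \<noteq> j"
        using skip_inj[of j "skip i l" i] skip_neq[of i l] skipji skip_neq[of j] by simp_all
      have sl: "skip i l < n" using l im n skip_less[of i m l] by simp
      have "x' ?l \<circ> skip j \<circ> skip i = z(l := z l + t)"
        by (auto simp: x'_def z_def skip_inj fun_eq_iff)
      moreover have "x' ?l i = x i" "x' ?l j = x j" "as' ?l ! i = as ! i" "as' ?l ! j = as ! j"
        using ne by (simp_all add: x'_def as'_def)
      moreover have "del i (del j (as' ?l)) = bs[l := brx t L (bs ! l)]"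
        using as ij l sl n by (simp add: as'_def bs_def del_update_skip length_del nth_del)
      ultimately show ?thesis by (simp add: B_def \<beta>_def)
    qed
    have "ev ?y (theta L n P (\<beta> # bs)) = actx t L (p (\<beta> # bs) ?y)
      - (\<Sum>l<Suc m. p ((\<beta> # bs)[l := brx t L ((\<beta> # bs) ! l)]) (?y(l := ?y l + t)))"
    proof -
      have "length (\<beta> # bs) = n" using len n by simp
      from th[OF this, of ?y] show ?thesis unfolding tt by (simp only: n)
    qed
    also have "(\<Sum>l<Suc m. p ((\<beta> # bs)[l := brx t L ((\<beta> # bs) ! l)]) (?y(l := ?y l + t)))
      = p (brx t L \<beta> # bs) (?y(0 := ?y 0 + t)) + (\<Sum>l<m. p (\<beta> # bs[l := brx t L (bs ! l)]) (?y(Suc l := ?y (Suc l) + t)))"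
      by (subst sum.lessThan_Suc_shift) simp
    also have "?y(0 := ?y 0 + t) = case_nat (x i + x j + t) z"
      by (auto simp: fun_eq_iff split: nat.splits)
    also have "(\<Sum>l<m. p (\<beta> # bs[l := brx t L (bs ! l)]) (?y(Suc l := ?y (Suc l) + t)))
      = (\<Sum>l<m. B (as' (skip j (skip i l))) (x' (skip j (skip i l))) i j)"
    proof (rule sum.cong)
      fix l assume "l \<in> {..<m}"
      moreover have "?y(Suc l := ?y (Suc l) + t) = case_nat (x i + x j) (z(l := z l + t))"
        by (auto simp: fun_eq_iff split: nat.splits)
      ultimately show "p (\<beta> # bs[l := brx t L (bs ! l)]) (?y(Suc l := ?y (Suc l) + t)) = B (as' (skip j (skip i l))) (x' (skip j (skip i l))) i j"
        by (simp add: Bl)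
    qed simp
    also have "p (brx t L \<beta> # bs) (case_nat (x i + x j + t) z) = B (as' j) (x' j) i j + B (as' i) (x' i) i j"
      unfolding \<beta>_def brx_jacobi[OF L homi[of i], of t "x i" "as ! j", OF less_trans[OF ij]] add Bi Bj ..
    also have "B (as' j) (x' j) i j + B (as' i) (x' i) i j + (\<Sum>l<m. B (as' (skip j (skip i l))) (x' (skip j (skip i l))) i j)
      = (\<Sum>l<Suc n. B (as' l) (x' l) i j)"
      using sum_skip[of j n "\<lambda>l. B (as' l) (x' l) i j"] sum_skip[of i m "\<lambda>l. B (as' (skip j l)) (x' (skip j l)) i j"] ij im n
      by (simp add: skipji add_ac)
    finally show ?thesis unfolding B_def \<beta>_def bs_def z_def .
  qed
  have DP: "ev y (Dif n q P bs ps) = (\<Sum>i<Suc n. psign (gam q ps i) (A bs y i)) + (\<Sum>j<Suc n. \<Sum>i<j. psign (gam2 q ps i j) (B bs y i j))"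
    if "length bs = Suc n" for bs y
    unfolding ev_Dif[OF P that] A_def B_def p_def ..
  have "ev x (theta L (Suc n) (\<lambda>as. Dif n q P as ps) as)
    = actx t L (ev x (Dif n q P as ps)) - (\<Sum>l<Suc n. ev (x' l) (Dif n q P (as' l) ps))"
    unfolding ev_theta[OF Dif_lin[OF P] as] t_def[symmetric] as'_def x'_def ..
  also have "\<dots> = (\<Sum>i<Suc n. psign (gam q ps i) (actx t L (A as x i) - (\<Sum>l<Suc n. A (as' l) (x' l) i)))
    + (\<Sum>j<Suc n. \<Sum>i<j. psign (gam2 q ps i j) (actx t L (B as x i j) - (\<Sum>l<Suc n. B (as' l) (x' l) i j)))"
  proof -
    have 1: "(\<Sum>l<Suc n. \<Sum>i<Suc n. psign (gam q ps i) (A (as' l) (x' l) i))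
      = (\<Sum>i<Suc n. psign (gam q ps i) (\<Sum>l<Suc n. A (as' l) (x' l) i))"
      by (subst sum.swap) (simp only: additive.sum[OF additive_psign])
    have 2: "(\<Sum>l<Suc n. \<Sum>j<Suc n. \<Sum>i<j. psign (gam2 q ps i j) (B (as' l) (x' l) i j))
      = (\<Sum>j<Suc n. \<Sum>i<j. psign (gam2 q ps i j) (\<Sum>l<Suc n. B (as' l) (x' l) i j))"
      by (subst sum.swap, rule sum.cong[OF refl], subst sum.swap) (simp only: additive.sum[OF additive_psign])
    show ?thesis
      by (simp only: DP[OF as] DP[OF as'l] sum.distrib 1 2 additive.add[OF additive_actx] additive.sum[OF additive_actx]
        additive_psign_commute[OF additive_actx] additive.diff[OF additive_psign] sum_subtractf) (simp only: algebra_simps)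
  qed
  also have "\<dots> = ev x (Dif n q (theta L n P) as ps)"
    unfolding ev_Dif[OF theta_lin[OF P] as] using A B by (auto intro!: arg_cong2[where f = plus] sum.cong simp del: sum.lessThan_Suc)
  finally show "ev x (Dif n q (theta L n P) as ps) = ev x (theta L (Suc n) (\<lambda>as. Dif n q P as ps) as)" by simp
qed

section \<open>Lifting cocycles to the basic complex\<close>

text \<open>Deleting the argument \<open>i\<close> leaves a gap at \<open>\<lambda>\<^sub>i\<close>,
  which the action fills, as it turns \<open>\<partial>\<close> into
  \<open>\<partial> + \<lambda>\<^sub>i\<close>. Since \<open>i \<le> n\<close>,
  \<open>skip i\<close> sends \<open>n\<close> to \<open>n + 1\<close>, so the variable to be
  eliminated goes to the variable to be eliminated, as \<open>elim_commute\<close> requires.\<close>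

lemma act_term_rules:
  assumes i: "i \<le> n"
  shows "additive (act_term i a)" "act_term i a (smul (lam n) F) = smul (lam (Suc n)) (act_term i a F)"
    "F \<in> lampoly n \<Longrightarrow> act_term i a F \<in> lampoly (Suc n)" "act_term i a (total n F) = total (Suc n) (act_term i a F)"
proof -
  have lam: "act_term i a (smul (lam l) F) = smul (lam (skip i l)) (act_term i a F)" for l F
    by (simp add: act_term_def subst_lam lam_act_lam)
  show add: "additive (act_term i a)"
    unfolding act_term_def by (rule additive_comp[OF additive_lam_act additive_subst])
  show "act_term i a (smul (lam n) F) = smul (lam (Suc n)) (act_term i a F)"
    using i by (simp add: lam skip_def)
  show "F \<in> lampoly n \<Longrightarrow> act_term i a F \<in> lampoly (Suc n)"
    unfolding act_term_def using i
    by (intro lampoly_lam_act lampoly_rename[where n = n]) (auto simp: skip_less)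
  have DM: "subst (lam \<circ> skip i) (DMm F) = DMm (subst (lam \<circ> skip i) F)"
    by (rule subst_DMm) (rule lam_comp_rename)
  have "act_term i a (DMm F) = DMm (act_term i a F) + smul (lam i) (act_term i a F)"
    unfolding act_term_def DM lam_act_DMm ..
  then show "act_term i a (total n F) = total (Suc n) (act_term i a F)"
    using sum_skip[OF i, of "\<lambda>l. smul (lam l) (act_term i a F)"]
    by (simp add: total_def additive.add[OF add] additive.sum[OF add] lam add_ac del: sum.lessThan_Suc)
qed

text \<open>The bracket carries \<open>\<lambda>\<^sub>i + \<lambda>\<^sub>j\<close>, so the
  variables handed to the cochain still add up to the sum of all of them.\<close>

lemma pair_subst_rules:
  assumes ij: "i < j" "j \<le> n"
  shows "additive (pair_subst i j)" "pair_subst i j (smul (lam n) F) = smul (lam (Suc n)) (pair_subst i j F)"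
    "F \<in> lampoly n \<Longrightarrow> pair_subst i j F \<in> lampoly (Suc n)" "pair_subst i j (total n F) = total (Suc n) (pair_subst i j F)"
proof -
  let ?\<sigma> = "case_nat (lam i + lam j) (lam \<circ> skip j \<circ> skip i) :: nat \<Rightarrow> 'f mpoly"
  obtain m where n: "n = Suc m" using ij by (cases n) auto
  have lam: "pair_subst i j (smul (lam l) F) = smul (?\<sigma> l) (pair_subst i j F)" for l F
    by (simp add: pair_subst_def subst_lam)
  show add: "additive (pair_subst i j)"
    unfolding pair_subst_def by (rule additive_subst)
  show "pair_subst i j (smul (lam n) F) = smul (lam (Suc n)) (pair_subst i j F)"
    using ij by (simp add: lam skip_def n)
  show "F \<in> lampoly n \<Longrightarrow> pair_subst i j F \<in> lampoly (Suc n)"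
    unfolding pair_subst_def
  proof (erule lampoly_subst)
    fix l and G assume "l < n" "G \<in> lampoly (Suc n)"
    moreover have "skip j (skip i l') < Suc n" if "l = Suc l'" "l < n" for l'
      using ij n that by (auto simp: skip_def)
    ultimately show "smul (?\<sigma> l) G \<in> lampoly (Suc n)"
      using ij by (cases l) (auto simp: mp.scale_left_distrib intro!: lampoly_add lampoly_lam)
  qed
  have DM: "pair_subst i j (DMm F) = DMm (pair_subst i j F)"
    unfolding pair_subst_def
    by (rule subst_DMm) (auto simp: DMm_lam mp.scale_left_distrib additive.add[OF additive_DMm] split: nat.splits)
  have "skip j i = i" using ij by (simp add: skip_def)
  then have "(\<Sum>l<Suc n. smul (lam l) G) = smul (lam j) G + (smul (lam i) G + (\<Sum>l<m. smul (lam (skip j (skip i l))) G))" for G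
  proof -
    have "(\<Sum>l<n. smul (lam (skip j l)) G) = smul (lam (skip j i)) G + (\<Sum>l<m. smul (lam (skip j (skip i l))) G)"
      unfolding n by (rule sum_skip) (use ij n in simp)
    then show ?thesis
      unfolding sum_skip[OF ij(2), of "\<lambda>l. smul (lam l) G"] \<open>skip j i = i\<close> by (rule arg_cong)
  qed
  moreover have "pair_subst i j (\<Sum>l<n. smul (lam l) F) = smul (lam i + lam j) (pair_subst i j F) + (\<Sum>l<m. smul (lam (skip j (skip i l))) (pair_subst i j F))"
    unfolding n by (subst sum.lessThan_Suc_shift) (simp add: additive.add[OF add] additive.sum[OF add] lam)
  ultimately show "pair_subst i j (total n F) = total (Suc n) (pair_subst i j F)"
    by (simp add: total_def additive.add[OF add] DM mp.scale_left_distrib add_ac del: sum.lessThan_Suc)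
qed

text \<open>The differential is built from sums, signs, powers of variables, \<open>act_term\<close>
  and \<open>pair_subst\<close>; a relation respected by these is respected by it. Graphs of
  operators, congruence, membership and equality are all instances.\<close>

lemma Dif_rel:
  assumes zero: "R 0 0" and add: "\<And>F G F' G'. R F G \<Longrightarrow> R F' G' \<Longrightarrow> R (F + F') (G + G')" and neg: "\<And>F G. R F G \<Longrightarrow> R (- F) (- G)"
    and lam: "\<And>i F G. i \<le> n \<Longrightarrow> R F G \<Longrightarrow> R (smul (lam i) F) (smul (lam i) G)"
    and act: "\<And>i F G. i \<le> n \<Longrightarrow> S F G \<Longrightarrow> R (act_term i (as ! i) F) (act_term i (as ! i) G)"
    and pair: "\<And>i j F G. i < j \<Longrightarrow> j \<le> n \<Longrightarrow> S F G \<Longrightarrow> R (pair_subst i j F) (pair_subst i j G)"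
    and P1: "\<And>i. i \<le> n \<Longrightarrow> S (P (del i as)) (Q (del i as))"
    and P2: "\<And>i j k. i < j \<Longrightarrow> j \<le> n \<Longrightarrow> S (P (coeff (br (as ! i) (as ! j)) k # del i (del j as))) (Q (coeff (br (as ! i) (as ! j)) k # del i (del j as)))"
  shows "R (Dif n q P as ps) (Dif n q Q as ps)"
proof -
  have sum: "R (sum F A) (sum G A)" if "\<And>i. i \<in> A \<Longrightarrow> R (F i) (G i)" for A and F G :: "nat \<Rightarrow> 'm mpoly"
    using that by (induction A rule: infinite_finite_induct) (auto intro: zero add)
  have psign: "R F G \<Longrightarrow> R (psign p F) (psign p G)" for p F G
    by (auto simp: psign_def neg)
  have pow: "R F G \<Longrightarrow> i \<le> n \<Longrightarrow> R (smul (lam i ^ k) F) (smul (lam i ^ k) G)" for i F G k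
    by (induction k) (auto simp: smul_mult lam)
  show ?thesis
    unfolding Dif_def psum_def
    by (intro add sum psign act pow pair P1 P2) auto
qed

lemma elim_Dif:
  assumes as: "length as = Suc n" and Q: "\<And>bs. length bs = n \<Longrightarrow> Q bs \<in> lampoly (Suc n)"
  shows "elim (Suc n) (Dif n q Q as ps) = Dif n q (\<lambda>bs. elim n (Q bs)) as ps"
proof (rule Dif_rel[where R = "\<lambda>F G. elim (Suc n) F = G" and S = "\<lambda>F G. F \<in> lampoly (Suc n) \<and> elim n F = G"])
  show "elim (Suc n) (act_term i (as ! i) F) = act_term i (as ! i) G"
    if "i \<le> n" "F \<in> lampoly (Suc n) \<and> elim n F = G" for i F G
    using elim_commute[OF act_term_rules[OF that(1)]] that by blast
  show "elim (Suc n) (pair_subst i j F) = pair_subst i j G"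
    if "i < j" "j \<le> n" "F \<in> lampoly (Suc n) \<and> elim n F = G" for i j F G
    using elim_commute[OF pair_subst_rules[OF that(1,2)]] that by blast
qed (use as Q in \<open>auto simp: additive.zero[OF additive_elim] additive.add[OF additive_elim] additive.minus[OF additive_elim]
    elim_lam length_del\<close>)

lemma total_Dif:
  assumes as: "length as = Suc n"
  shows "total (Suc n) (Dif n q Q as ps) = Dif n q (\<lambda>bs. total n (Q bs)) as ps"
proof (rule Dif_rel[where R = "\<lambda>F G. total (Suc n) F = G" and S = "\<lambda>F G. total n F = G"])
  show "total (Suc n) (act_term i (as ! i) F) = act_term i (as ! i) G" if "i \<le> n" "total n F = G" for i F G
    using act_term_rules(4)[OF that(1)] that(2) by metis
  show "total (Suc n) (pair_subst i j F) = pair_subst i j G" if "i < j" "j \<le> n" "total n F = G" for i j F G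
    using pair_subst_rules(4)[OF that(1,2)] that(3) by metis
qed (auto simp: additive.zero[OF additive_total] additive.add[OF additive_total] additive.minus[OF additive_total] total_lam)

lemma cong_Dif:
  assumes as: "length as = Suc n" and "\<And>bs. length bs = n \<Longrightarrow> cong n (P bs) (Q bs)"
  shows "cong (Suc n) (Dif n q P as ps) (Dif n q Q as ps)"
proof (rule Dif_rel[where R = "cong (Suc n)" and S = "cong n"])
  show "cong (Suc n) (act_term i (as ! i) F) (act_term i (as ! i) G)" if "i \<le> n" "cong n F G" for i F G
    using that(2) act_term_rules(1,3,4)[OF that(1)] by (rule cong_additive)
  show "cong (Suc n) (pair_subst i j F) (pair_subst i j G)" if "i < j" "j \<le> n" "cong n F G" for i j F G
    using that(3) pair_subst_rules(1,3,4)[OF that(1,2)] by (rule cong_additive)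
qed (use assms in \<open>auto simp: length_del intro: cong_add cong_uminus cong_lam\<close>)

lemma lampoly_Dif:
  assumes as: "length as = Suc n" and "\<And>bs. length bs = n \<Longrightarrow> P bs \<in> lampoly n"
  shows "Dif n q P as ps \<in> lampoly (Suc n)"
proof (rule Dif_rel[where R = "\<lambda>F G. F \<in> lampoly (Suc n)" and S = "\<lambda>F G. F \<in> lampoly n"])
  show "act_term i (as ! i) F \<in> lampoly (Suc n)" if "i \<le> n" "F \<in> lampoly n" for i F
    using that by (rule act_term_rules)
  show "pair_subst i j F \<in> lampoly (Suc n)" if "i < j" "j \<le> n" "F \<in> lampoly n" for i j F
    using that by (rule pair_subst_rules)
qed (use assms in \<open>auto simp: length_del intro: lampoly_add lampoly_uminus lampoly_lam\<close>)

lemma Dif_cong: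
  assumes as: "length as = Suc n" and "\<And>bs. length bs = n \<Longrightarrow> P bs = Q bs"
  shows "Dif n q P as ps = Dif n q Q as ps"
  by (rule Dif_rel[where S = "(=)"]) (use assms in \<open>auto simp: length_del\<close>)

lemma Dif_add: "Dif n q (\<lambda>as. P as + Q as) as ps = Dif n q P as ps + Dif n q Q as ps"
proof -
  have "psum (\<lambda>c. pair_subst i j (P (c # bs) + Q (c # bs))) f p
    = psum (\<lambda>c. pair_subst i j (P (c # bs))) f p + psum (\<lambda>c. pair_subst i j (Q (c # bs))) f p" for i j bs f and p :: "'v poly"
    unfolding pair_subst_def by (simp add: additive.add[OF additive_subst] psum_add_fun)
  then show ?thesis
    by (simp add: Dif_def additive.add[OF act_term_rules(1)[OF order_refl]] additive.add[OF additive_psign] sum.distrib)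
qed

lemma Dif_Sc: "Dif n q (\<lambda>as. Sc r (P as)) as ps = Sc r (Dif n q P as ps)"
proof -
  have "act_term i a (Sc r F) = Sc r (act_term i a F)" for i a F
    by (simp add: act_term_def subst_Sc lam_act_Sc)
  moreover have "pair_subst i j (Sc r F) = Sc r (pair_subst i j F)" for i j F
    by (simp add: pair_subst_def subst_Sc)
  moreover have "psum (\<lambda>c. Sc r (H c)) f p = Sc r (psum H f p)" for H f and p :: "'v poly"
    by (rule psum_additive[OF additive_Sc Sc_smul, symmetric])
  ultimately show ?thesis
    by (simp add: Dif_def additive.add[OF additive_Sc] additive.sum[OF additive_Sc] additive_psign_commute[OF additive_Sc])
qed

lemma cong_theta:
  assumes "cong n (P as) (Q as)"
    "\<And>i k. i < n \<Longrightarrow> cong n (P (as[i := coeff (br L (as ! i)) k])) (Q (as[i := coeff (br L (as ! i)) k]))"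
  shows "cong (Suc n) (theta L n P as) (theta L n Q as)"
  unfolding theta_def by (intro cong_diff cong_lam_act cong_sum cong_psum cong_sh) (use assms in auto)

section \<open>Basic lifts of cocycles\<close>

definition closed_mod :: "('m mpoly \<Rightarrow> 'm mpoly \<Rightarrow> bool) \<Rightarrow> nat \<Rightarrow> bit \<Rightarrow> ('v list \<Rightarrow> 'm mpoly) \<Rightarrow> bool" where
  "closed_mod R n q P \<longleftrightarrow> (\<forall>as ps. length as = Suc n \<and> homogeneous as ps \<longrightarrow> R (Dif n q P as ps) 0)"

text \<open>
  For a cocycle \<open>P\<close>, the action of \<open>L\<close> with \<open>\<lambda>\<close> replaced by \<open>- \<partial> - \<lambda>\<^sub>0 - \<dots> - \<lambda>\<^sub>n\<^sub>-\<^sub>1\<close> is well defined,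
  and divisible by \<open>\<partial> + \<lambda>\<^sub>0 + \<dots> + \<lambda>\<^sub>n\<^sub>-\<^sub>1\<close>; the quotient is a cocycle of the basic complex.
\<close>

lemma basic_lift:
  assumes L: "L \<in> part 0" and L0: "\<And>a. coeff (br L a) 0 = D a" and LM: "\<And>m. coeff (act L m) 0 = DM m"
    and P: "ax (cong n) n n q P" and lin: "ax_lin (=) n P" and closed: "closed_mod (cong (Suc n)) n q P"
  obtains B where "\<And>as. length as = n \<Longrightarrow> B as \<in> lampoly n" "\<And>as. length as = n \<Longrightarrow> cong n (B as) (P as - weight_cochain L n P as)"
    "closed_mod (=) n q B" "0 < n \<Longrightarrow> ax (=) n n q B"
proof -
  have val: "ax_val n n P" and ses: "ax_ses (cong n) n P" using axD[OF P] by blast+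
  define B where "B = (\<lambda>as. SOME B. B \<in> lampoly n \<and> cong n B (P as - weight_cochain L n P as) \<and> total n B = elim n (theta L n P as))"
  have B: "B as \<in> lampoly n \<and> cong n (B as) (P as - weight_cochain L n P as) \<and> total n (B as) = elim n (theta L n P as)"
    if "length as = n" for as
    unfolding B_def
    by (rule someI_ex) (use elim_theta_eq_total[OF val lin ses that L0 LM] in blast)
  have "closed_mod (=) n q B"
    unfolding closed_mod_def
  proof (intro allI impI, elim conjE)
    fix as ps assume as: "length as = Suc n" and hom: "homogeneous as ps"
    \<comment> \<open>Brackets with the even element \<open>L\<close> preserve the parities of the
      arguments, so closedness applies to every argument list occurring in the Lie
      derivative.\<close>
    have "cong (Suc (Suc n)) (theta L (Suc n) (\<lambda>as. Dif n q P as ps) as) (theta L (Suc n) (\<lambda>as. 0) as)"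
      by (rule cong_theta; rule closed[unfolded closed_mod_def, rule_format])
        (use as hom homogeneous_br[OF L hom] in auto)
    also have "theta L (Suc n) (\<lambda>as. 0) as = 0"
      by (simp add: theta_def additive.zero[OF additive_lam_act] additive.zero[OF additive_sh] psum_zero_fun)
    finally have 0: "elim (Suc n) (theta L (Suc n) (\<lambda>as. Dif n q P as ps) as) = 0"
      using elim_cong additive.zero[OF additive_elim] by metis
    \<comment> \<open>Closedness is proved after multiplication by \<open>total (Suc n)\<close>,
      which is injective even when \<open>n = 0\<close>; there it becomes the elimination of the Lie
      derivative of a coboundary that is congruent to 0.\<close>
    have "total (Suc n) (Dif n q B as ps) = Dif n q (\<lambda>bs. elim n (theta L n P bs)) as ps"
      unfolding total_Dif[OF as] by (rule Dif_cong[OF as]) (use B in blast)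
    also have "\<dots> = elim (Suc n) (Dif n q (theta L n P) as ps)"
      by (rule elim_Dif[OF as, symmetric]) (use theta_val[OF val] in \<open>auto simp: ax_val_def\<close>)
    also have "\<dots> = total (Suc n) 0"
      unfolding Dif_theta[OF L lin as hom] 0 by (simp add: additive.zero[OF additive_total])
    finally show "Dif n q B as ps = 0"
      by (rule total_inject[rotated]) simp
  qed
  \<comment> \<open>The axioms are known for \<open>total n\<close> of the values of
    \<open>B\<close>; dividing by it requires a variable.\<close>
  moreover have "ax (=) n n q B" if "0 < n"
  proof (rule ax_total[OF that])
    have *: "ax (=) n n q (\<lambda>as. elim n (theta L n P as))" by (rule elim_theta_ax[OF L P lin])
    have eq: "elim n (theta L n P as) = total n (B as)" if "length as = n" for as using B[OF that] by simp
    show "ax (=) n n q (\<lambda>as. total n (B as))"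
      using * unfolding ax_def ax_val_def ax_lin_def ax_par_def ax_ses_def ax_sym_def ax_lbz_def
      by (simp add: eq cong: conj_cong imp_cong)
  qed (use B in blast)
  ultimately show thesis using that B by blast
qed

section \<open>Cartan's formula\<close>

lemma subst_id: "subst lam F = F"
  by (induction F rule: mpoly_induct) (simp_all add: subst_const subst_lam additive.add[OF additive_subst])

section \<open>Moving an argument to the front\<close>

definition move_subst :: "nat \<Rightarrow> 'm mpoly \<Rightarrow> 'm mpoly" where
  "move_subst j = subst (case_nat (lam j) (lam \<circ> skip j))"

lemma move_subst_rules:
  "additive (move_subst j)" "move_subst j (const m) = const m"
  "move_subst j (smul (lam 0) F) = smul (lam j) (move_subst j F)"
  "move_subst j (smul (lam (Suc l)) F) = smul (lam (skip j l)) (move_subst j F)"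
  by (simp_all add: move_subst_def additive_subst subst_const subst_lam)

lemma sum_bit_Suc: "(\<Sum>l<Suc i. (p # ps) ! l + 1) = p + 1 + (\<Sum>l<i. ps ! l + (1::bit))"
  by (subst sum.lessThan_Suc_shift) simp

lemma homogeneous_del: "homogeneous as ps \<Longrightarrow> homogeneous (del i as) (del i ps)"
  unfolding del_def by (intro list_all2_appendI list_all2_takeI list_all2_dropI)

text \<open>The argument \<open>j\<close> is brought to the front by adjacent transpositions; each
  argument \<open>l < j\<close> that it passes contributes the product of the two opposite parities
  to the sign.\<close>

lemma sym_move:
  assumes B: "ax_sym (=) n B" and "length as = n" "homogeneous as ps" "j < n"
  shows "move_subst j (B (as ! j # del j as)) = psign ((ps ! j + 1) * (\<Sum>l<j. ps ! l + 1)) (B as)"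
  using assms(2-)
proof (induction j arbitrary: as ps)
  case 0
  have "case_nat (lam 0) (lam \<circ> skip 0) = lam"
    by (auto simp: fun_eq_iff skip_def split: nat.splits)
  moreover have "as ! 0 # del 0 as = as"
    using 0 by (cases as) (auto simp: del_def)
  ultimately show ?case by (simp add: move_subst_def subst_id)
next
  case (Suc j)
  define as' where "as' = as[j := as ! Suc j, Suc j := as ! j]"
  define ps' where "ps' = ps[j := ps ! Suc j, Suc j := ps ! j]"
  have len: "length ps = n" using Suc.prems list_all2_lengthD by metis
  have hom: "homogeneous as' ps'"
    using Suc.prems len by (auto simp: as'_def ps'_def list_all2_conv_all_nth nth_list_update)
  have nth: "as' ! j = as ! Suc j" and del: "del j as' = del (Suc j) as"
    using Suc.prems by (auto simp: as'_def length_del nth_del nth_list_update skip_def intro!: nth_equalityI)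
  have "move_subst j (B (as' ! j # del j as')) = psign ((ps' ! j + 1) * (\<Sum>l<j. ps' ! l + 1)) (B as')"
    by (rule Suc.IH) (use Suc.prems hom in \<open>simp_all add: as'_def\<close>)
  also have "ps' ! j = ps ! Suc j" using len Suc.prems by (simp add: ps'_def)
  also have "(\<Sum>l<j. ps' ! l + 1) = (\<Sum>l<j. ps ! l + 1)"
    by (rule sum.cong) (auto simp: ps'_def)
  finally have "move_subst j (B (as ! Suc j # del (Suc j) as)) = psign ((ps ! Suc j + 1) * (\<Sum>l<j. ps ! l + 1)) (B as')"
    unfolding nth del .
  then have "subst (lam \<circ> sw j) (move_subst j (B (as ! Suc j # del (Suc j) as)))
    = psign ((ps ! Suc j + 1) * (\<Sum>l<j. ps ! l + 1)) (subst (lam \<circ> sw j) (B as'))"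
    by (simp only: additive_psign_commute[OF additive_subst])
  also have "subst (lam \<circ> sw j) (B as') = psign ((ps ! j + 1) * (ps ! Suc j + 1)) (B as)"
    unfolding as'_def by (rule ax_symD[OF B]) (use Suc.prems in auto)
  also have "psign ((ps ! Suc j + 1) * (\<Sum>l<j. ps ! l + 1)) (psign ((ps ! j + 1) * (ps ! Suc j + 1)) (B as))
     = psign ((ps ! Suc j + 1) * (\<Sum>l<Suc j. ps ! l + 1)) (B as)"
    by (simp only: psign_psign sum.lessThan_Suc distrib_left mult.commute)
  also have "subst (lam \<circ> sw j) (move_subst j F) = move_subst (Suc j) F" for F
  proof -
    define s where "s = sw j"
    define \<sigma> where "\<sigma> = lam \<circ> s"
    have \<sigma>: "\<sigma> l = lam (s l)" for l by (simp add: \<sigma>_def)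
    have s: "s j = Suc j" "s (skip j l) = skip (Suc j) l" for l by (auto simp: s_def skip_def)
    have "subst \<sigma> (move_subst j F) = move_subst (Suc j) F"
    proof (induction F rule: mpoly_induct)
      case (lam i F)
      then show ?case by (cases i) (simp_all add: move_subst_rules subst_lam \<sigma> s)
    qed (simp_all add: move_subst_rules subst_const additive.add[OF additive_subst] additive.add[OF move_subst_rules(1)])
    then show ?thesis by (simp only: \<sigma>_def s_def)
  qed
  finally show ?case .
qed

text \<open>\<open>zet\<close> and \<open>kap\<close> take the value and the derivative at \<open>\<lambda>\<^sub>0 = 0\<close> and renumber the other variables.\<close>

definition zet :: "'m mpoly \<Rightarrow> 'm mpoly" where
  "zet = subst (case_nat 0 lam)"

definition kap :: "'m mpoly \<Rightarrow> 'm mpoly" where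
  "kap F = zet (der 0 F)"

lemma zet_rules:
  "additive zet" "zet (const m) = const m" "zet (smul (lam 0) F) = 0" "zet (smul (lam (Suc i)) F) = smul (lam i) (zet F)"
  by (simp_all add: zet_def additive_subst subst_const subst_lam)

lemma kap_rules:
  "additive kap" "kap (const m) = 0" "kap (smul (lam 0) F) = zet F" "kap (smul (lam (Suc i)) F) = smul (lam i) (kap F)"
  using additive.zero[OF zet_rules(1)]
  by (simp_all add: kap_def[abs_def] additive_comp[OF zet_rules(1) additive_der] der_const der_lam der_lam_same
    additive.add[OF zet_rules(1)] zet_rules)

lemma lampoly_zet: "F \<in> lampoly (Suc n) \<Longrightarrow> zet F \<in> lampoly n"
  unfolding zet_def by (erule lampoly_subst) (auto split: nat.splits intro: lampoly_lam lampoly_zero)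

lemma lampoly_kap: "F \<in> lampoly (Suc n) \<Longrightarrow> kap F \<in> lampoly n"
  unfolding kap_def by (intro lampoly_zet lampoly_der)

lemma hp_der: "hp r F \<Longrightarrow> hp r (der i F)"
  by (erule hp_additive[OF additive_der, rotated])
    (auto simp: der_single intro!: hp_single M.subspace_scale[OF M.subspace_part])

lemma hp_kap: "hp r F \<Longrightarrow> hp r (kap F)"
  unfolding kap_def zet_def by (intro hp_subst hp_der)

lemma kap_Sc: "kap (Sc r F) = Sc r (kap F)"
proof (induction F rule: mpoly_induct)
  case (lam i F)
  have "zet (Sc r F) = Sc r (zet F)" unfolding zet_def by (rule subst_Sc)
  with lam show ?case by (cases i) (simp_all add: Sc_smul kap_rules)
qed (simp_all add: kap_rules additive.add[OF kap_rules(1)] additive.add[OF additive_Sc] additive.zero[OF additive_Sc])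

lemma kap_exp_dot: "kap (exp_dot (Suc i) b F) = exp_dot i b (kap F)"
proof -
  have "zet (exp_dot (Suc i) b F) = exp_dot i b (zet F)" for b F
    unfolding zet_def
  proof (rule subst_exp_dot)
    show "j \<noteq> Suc i \<Longrightarrow> exp_dot i b (smul (case_nat 0 lam j) F) = smul (case_nat 0 lam j) (exp_dot i b F)" for j b F
      by (cases j) (auto simp: exp_dot_lam additive.zero[OF additive_exp_dot])
  qed (simp add: exp_dot_lam_same)
  then show ?thesis by (simp add: kap_def der_exp_dot)
qed

lemma kap_sw: "kap (subst (lam \<circ> sw (Suc i)) F) = subst (lam \<circ> sw i) (kap F)"
proof -
  define s where "s = sw i"
  define s' where "s' = sw (Suc i)"
  define \<sigma> where "\<sigma> = lam \<circ> s"
  define \<sigma>' where "\<sigma>' = lam \<circ> s'"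
  have \<sigma>: "smul (\<sigma> j) G = smul (lam (s j)) G" "smul (\<sigma>' j) G = smul (lam (s' j)) G" for j G
    by (simp_all add: \<sigma>_def \<sigma>'_def)
  have s: "s' 0 = 0" "s' (Suc j) = Suc (s j)" for j by (simp_all add: s_def s'_def)
  have z: "zet (subst \<sigma>' F) = subst \<sigma> (zet F)" for F
  proof (induction F rule: mpoly_induct)
    case (lam j F)
    then show ?case by (cases j) (simp_all add: zet_rules subst_lam \<sigma> s additive.zero[OF additive_subst])
  qed (simp_all add: zet_rules subst_const additive.add[OF zet_rules(1)] additive.add[OF additive_subst])
  have "kap (subst \<sigma>' F) = subst \<sigma> (kap F)"
  proof (induction F rule: mpoly_induct)
    case (lam j F)
    then show ?case by (cases j) (simp_all add: kap_rules subst_lam \<sigma> s z)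
  qed (simp_all add: kap_rules subst_const additive.add[OF kap_rules(1)] additive.add[OF additive_subst] additive.zero[OF additive_subst])
  then show ?thesis by (simp only: \<sigma>_def \<sigma>'_def s_def s'_def)
qed

section \<open>Contraction with \<open>L\<close>\<close>

text \<open>Taking the derivative at \<open>\<lambda>\<^sub>0 = 0\<close>, instead of the value
  there, selects \<open>L\<^sub>(\<^sub>1\<^sub>)\<close>, hence the weight, instead of
  \<open>L\<^sub>(\<^sub>0\<^sub>) = \<partial>\<close>.\<close>

definition contract :: "'v \<Rightarrow> ('v list \<Rightarrow> 'm mpoly) \<Rightarrow> 'v list \<Rightarrow> 'm mpoly" where
  "contract L B as = kap (B (L # as))"

text \<open>Fixing the first argument moves its opposite parity to the cochain. As \<open>L\<close>
  is even this is 1, whence \<open>q + 1\<close>.\<close>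

lemma contract_ax:
  assumes L: "L \<in> part 0" and B: "ax (=) (Suc m) (Suc m) q B"
  shows "ax (=) m m (q + 1) (contract L B)"
proof -
  note Q = axD[OF B]
  show ?thesis
    unfolding ax_def ax_val_def ax_lin_def ax_par_def ax_ses_def ax_sym_def ax_lbz_def contract_def
  proof (intro conjI allI impI)
    fix as :: "'v list" assume "length as = m"
    then show "kap (B (L # as)) \<in> lampoly m" by (intro lampoly_kap ax_valD[OF Q(1)]) simp
  next
    fix as :: "'v list" and i a b assume A: "length as = m \<and> i < m"
    then have "length (L # as) = Suc m" "Suc i < Suc m" by simp_all
    from ax_linD(1)[OF Q(2) this, of a b]
    show "kap (B (L # as[i := a + b])) = kap (B (L # as[i := a])) + kap (B (L # as[i := b]))"
      by (simp add: additive.add[OF kap_rules(1)])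
  next
    fix as :: "'v list" and i r a assume A: "length as = m \<and> i < m"
    then have "length (L # as) = Suc m" "Suc i < Suc m" by simp_all
    from ax_linD(2)[OF Q(2) this, of r a]
    show "kap (B (L # as[i := scale r a])) = Sc r (kap (B (L # as[i := a])))"
      by (simp add: kap_Sc)
  next
    fix as :: "'v list" and ps assume A: "length as = m \<and> homogeneous as ps"
    then have a: "length (L # as) = Suc m" "homogeneous (L # as) (0 # ps)" using L by simp_all
    obtain F where F: "F \<in> lampoly (Suc m)" "F = B (L # as)" "hp (q + (\<Sum>j<Suc m. (0 # ps) ! j + 1) + 1) F"
      by (rule ax_parD[OF Q(3) a])
    have "q + (\<Sum>j<Suc m. (0 # ps) ! j + 1) + 1 = q + 1 + (\<Sum>j<m. ps ! j + 1) + 1"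
      unfolding sum_bit_Suc by (simp only: add_0 add_ac)
    with F show "\<exists>F\<in>lampoly m. F = kap (B (L # as)) \<and> hp (q + 1 + (\<Sum>j<m. ps ! j + 1) + 1) F"
      using hp_kap lampoly_kap by metis
  next
    fix as :: "'v list" and i assume A: "length as = m \<and> i < m"
    then have "length (L # as) = Suc m" "Suc i < Suc m" by simp_all
    from ax_sesD[OF Q(4) this]
    show "kap (B (L # as[i := D (as ! i)])) = - smul (lam i) (kap (B (L # as)))"
      by (simp add: additive.minus[OF kap_rules(1)] kap_rules)
  next
    fix as :: "'v list" and ps i assume A: "length as = m \<and> homogeneous as ps \<and> Suc i < m"
    then have "length (L # as) = Suc m" "homogeneous (L # as) (0 # ps)" "Suc (Suc i) < Suc m" using L by simp_all
    from ax_symD[OF Q(5) this]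
    have "subst (lam \<circ> sw (Suc i)) (B (L # as[i := as ! Suc i, Suc i := as ! i])) = psign ((ps ! i + 1) * (ps ! Suc i + 1)) (B (L # as))"
      by (simp only: nth_Cons_Suc list_update.simps nat.case)
    from arg_cong[OF this, of kap]
    show "subst (lam \<circ> sw i) (kap (B (L # as[i := as ! Suc i, Suc i := as ! i]))) = psign ((ps ! i + 1) * (ps ! Suc i + 1)) (kap (B (L # as)))"
      by (simp only: kap_sw additive_psign_commute[OF kap_rules(1)])
  next
    fix as :: "'v list" and ps i b c pb pc s
    assume A: "length as = m \<and> homogeneous as ps \<and> i < m \<and> b \<in> part pb \<and> c \<in> part pc \<and> s = q + 1 + (\<Sum>j<i. ps ! j + 1)"
    have s: "s = q + (\<Sum>j<Suc i. (0 # ps) ! j + 1)"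
      unfolding sum_bit_Suc using A by (simp only: add_0 add_ac)
    have "length (L # as) = Suc m" "homogeneous (L # as) (0 # ps)" "Suc i < Suc m" "b \<in> part pb" "c \<in> part pc" using L A by simp_all
    from arg_cong[OF ax_lbzD[OF Q(6) this s], of kap]
    show "kap (B (L # as[i := b * c])) = psign (pb * s) (exp_dot i b (kap (B (L # as[i := c]))))
             + psign (pc * (pb + s)) (exp_dot i c (kap (B (L # as[i := b]))))"
      by (simp only: nth_Cons_Suc list_update.simps nat.case additive.add[OF kap_rules(1)]
        additive_psign_commute[OF kap_rules(1)] kap_exp_dot)
  qed
qed

lemma kap_act_term_0: "kap (act_term 0 L F) = modes 1 L F"
proof -
  have lam: "act_term 0 L (smul (lam i) G) = smul (lam (Suc i)) (act_term 0 L G)" for i G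
    by (simp add: act_term_def subst_lam lam_act_lam skip_def)
  show ?thesis
  proof (induction F rule: mpoly_induct)
    case (const m)
    obtain q where "psum const (lam 0) (act L m) = const (coeff (act L m) 0) + smul (lam 0) (const (coeff (act L m) 1))
        + smul (lam 0) (smul (lam 0) (psum const (lam 0) q))"
      using psum_split[OF additive_single] by metis
    then show ?case
      by (simp add: act_term_def subst_const lam_act_const additive.add[OF kap_rules(1)] kap_rules zet_rules modes_single)
  qed (simp_all add: lam kap_rules modes_lam additive.add[OF act_term_rules(1)[OF order_refl]] additive.add[OF kap_rules(1)] additive.add[OF additive_modes])
qed

lemma act_term_lam: "act_term i a (smul (lam l) F) = smul (lam (skip i l)) (act_term i a F)"
  by (simp add: act_term_def subst_lam lam_act_lam)

lemma kap_act_term: "kap (act_term (Suc i) a F) = act_term i a (kap F)"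
proof -
  have s: "skip (Suc i) 0 = 0" "skip (Suc i) (Suc l) = Suc (skip i l)" for l by (auto simp: skip_def)
  note add = additive.add[OF act_term_rules(1)[OF order_refl]]
  have zero: "act_term i a 0 = 0" for i a by (rule additive.zero[OF act_term_rules(1)[OF order_refl]])
  have const: "act_term j a (const m) = psum const (lam j) (act a m)" for j m
    by (simp add: act_term_def subst_const lam_act_const)
  have z: "zet (act_term (Suc i) a F) = act_term i a (zet F)" for F
  proof (induction F rule: mpoly_induct)
    case (const m)
    have "zet (psum const (lam (Suc i)) (act a m)) = psum (\<lambda>c. zet (const c)) (lam i) (act a m)"
      by (rule psum_additive[OF zet_rules(1)]) (rule zet_rules)
    then show ?case by (simp add: zet_rules \<open>\<And>j m. act_term j a (const m) = _\<close>)
  next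
    case (lam l F)
    then show ?case by (cases l) (simp_all add: act_term_lam s zet_rules zero)
  qed (simp_all add: add additive.add[OF zet_rules(1)])
  show ?thesis
  proof (induction F rule: mpoly_induct)
    case (const m)
    have "kap (psum const (lam (Suc i)) (act a m)) = psum (\<lambda>c. kap (const c)) (lam i) (act a m)"
      by (rule psum_additive[OF kap_rules(1)]) (rule kap_rules)
    then show ?case by (simp add: kap_rules psum_zero_fun zero \<open>\<And>j m. act_term j a (const m) = _\<close>)
  next
    case (lam l F)
    then show ?case by (cases l) (simp_all add: act_term_lam s kap_rules z)
  qed (simp_all add: add additive.add[OF kap_rules(1)])
qed

lemma pair_subst_lam: "pair_subst i j (smul (lam 0) F) = smul (lam i) (pair_subst i j F) + smul (lam j) (pair_subst i j F)"
  "pair_subst i j (smul (lam (Suc l)) F) = smul (lam (skip j (skip i l))) (pair_subst i j F)"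
  "additive (pair_subst i j)" "pair_subst i j (const m) = const m"
  by (simp_all add: pair_subst_def subst_lam mp.scale_left_distrib additive_subst subst_const)

text \<open>At \<open>\<lambda>\<^sub>0 = 0\<close> the sum of the variables of \<open>L\<close> and
  of another argument reduces to the latter, so their bracket stands in front of the list with the
  variable of the argument that it replaces.\<close>

lemma zet_pair_subst_0: "zet (pair_subst 0 (Suc j) F) = move_subst j F"
proof (induction F rule: mpoly_induct)
  case (lam l F)
  have "skip (Suc j) (skip 0 l) = Suc (skip j l)" for l by (auto simp: skip_def)
  then show ?case using lam by (cases l) (simp_all add: pair_subst_lam zet_rules move_subst_rules additive.add[OF zet_rules(1)])
qed (simp_all add: pair_subst_lam zet_rules move_subst_rules additive.add[OF zet_rules(1)] additive.add[OF pair_subst_lam(3)] additive.add[OF move_subst_rules(1)])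

text \<open>Chain rule: the first variable of \<open>F\<close> is replaced by a sum containing
  \<open>\<lambda>\<^sub>0\<close>, so the derivative in \<open>\<lambda>\<^sub>0\<close> is the
  derivative of \<open>F\<close> in its first variable.\<close>

lemma kap_pair_subst_0: "kap (pair_subst 0 (Suc j) F) = move_subst j (der 0 F)"
proof (induction F rule: mpoly_induct)
  case (lam l F)
  have "skip (Suc j) (skip 0 l) = Suc (skip j l)" for l by (auto simp: skip_def)
  then show ?case using lam
    by (cases l) (simp_all add: pair_subst_lam kap_rules move_subst_rules additive.add[OF kap_rules(1)] additive.add[OF move_subst_rules(1)]
      der_lam_same der_lam zet_pair_subst_0)
qed (simp_all add: pair_subst_lam kap_rules move_subst_rules additive.add[OF kap_rules(1)] additive.add[OF pair_subst_lam(3)] additive.add[OF move_subst_rules(1)]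
   additive.add[OF additive_der] der_const additive.zero[OF move_subst_rules(1)])

lemma move_subst_der: "move_subst j (der 0 F) = der j (move_subst j F)"
proof (induction F rule: mpoly_induct)
  case (lam l F)
  then show ?case
    by (cases l) (simp_all add: move_subst_rules der_lam_same der_lam skip_neq additive.add[OF move_subst_rules(1)])
qed (simp_all add: move_subst_rules additive.add[OF move_subst_rules(1)] additive.add[OF additive_der] der_const additive.zero[OF move_subst_rules(1)])

text \<open>When two arguments other than \<open>L\<close> are bracketed, the bracket goes in front
  and \<open>L\<close> becomes the second argument. The transposition returns \<open>L\<close> to
  the place where the contraction acts.\<close>

lemma kap_pair_subst_Suc: "kap (pair_subst (Suc i) (Suc j) (subst (lam \<circ> sw 0) F)) = pair_subst i j (kap F)"
proof -
  define \<sigma> where "\<sigma> = lam \<circ> sw 0"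
  have \<sigma>: "\<sigma> 0 = lam (Suc 0)" "\<sigma> (Suc 0) = lam 0" "\<sigma> (Suc (Suc l)) = lam (Suc (Suc l))" for l by (simp_all add: \<sigma>_def)
  have s: "skip (Suc j) (skip (Suc i) 0) = 0" "skip (Suc j) (skip (Suc i) (Suc l)) = Suc (skip j (skip i l))" for l by (auto simp: skip_def)
  have z: "zet (pair_subst (Suc i) (Suc j) (subst \<sigma> F)) = pair_subst i j (zet F)" for F
  proof (induction F rule: mpoly_induct)
    case (lam l F)
    consider "l = 0" | "l = Suc 0" | k where "l = Suc (Suc k)" by (metis not0_implies_Suc)
    then show ?case
      by cases (use lam in \<open>simp_all add: subst_lam \<sigma> pair_subst_lam s zet_rules additive.add[OF zet_rules(1)] additive.zero[OF pair_subst_lam(3)]\<close>)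
  qed (simp_all add: zet_rules subst_const pair_subst_lam additive.add[OF zet_rules(1)] additive.add[OF additive_subst] additive.add[OF pair_subst_lam(3)])
  have "kap (pair_subst (Suc i) (Suc j) (subst \<sigma> F)) = pair_subst i j (kap F)"
  proof (induction F rule: mpoly_induct)
    case (lam l F)
    consider "l = 0" | "l = Suc 0" | k where "l = Suc (Suc k)" by (metis not0_implies_Suc)
    then show ?case
      by cases (use lam in \<open>simp_all add: subst_lam \<sigma> pair_subst_lam s kap_rules additive.add[OF kap_rules(1)] z\<close>)
  qed (simp_all add: kap_rules subst_const pair_subst_lam additive.add[OF kap_rules(1)] additive.add[OF additive_subst] additive.add[OF pair_subst_lam(3)] additive.zero[OF pair_subst_lam(3)])
  then show ?thesis by (simp only: \<sigma>_def)
qed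

lemma del_Suc: "del (Suc i) (a # as) = a # del i as"
  by (simp add: del_def)

text \<open>Cartan's formula: the derivative at \<open>\<lambda>\<^sub>0 = 0\<close> of the cocycle equation with first argument \<open>L\<close>.\<close>

lemma cartan:
  assumes L: "L \<in> part 0" and L0: "\<And>a. coeff (br L a) 0 = D a"
    and B: "ax (=) (Suc m) (Suc m) q B" and closed: "closed_mod (=) (Suc m) q B"
    and as: "length as = Suc m" and hom: "homogeneous as ps"
  shows "psign q (weight_cochain L (Suc m) B as) + Dif m (q + 1) (contract L B) as ps = 0"
proof -
  let ?n = "Suc m"
  note Q = axD[OF B]
  note kadd = additive.add[OF kap_rules(1)] additive.sum[OF kap_rules(1)] additive_psign_commute[OF kap_rules(1)]
  define pb where "pb = (\<lambda>i. ps ! i + 1)"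
  define S where "S = (\<lambda>i. \<Sum>l<i. pb l)"
  have sumS: "(\<Sum>l<i. ps ! l + 1) = S i" for i by (simp add: S_def pb_def)
  have homi: "as ! i \<in> part (ps ! i)" if "i < ?n" for i using homogeneous_nth[OF hom] as that by simp
  have len: "length (L # as) = Suc ?n" using as by simp
  have "homogeneous (L # as) (0 # ps)" using hom L by simp
  then have "Dif ?n q B (L # as) (0 # ps) = 0"
    using closed len unfolding closed_mod_def by blast
  then have 0: "kap (Dif ?n q B (L # as) (0 # ps)) = 0"
    by (simp add: additive.zero[OF kap_rules(1)])
  \<comment> \<open>Prepending \<open>L\<close>, of opposite parity 1, shifts the indices by one and
    changes \<open>q\<close> into \<open>q + 1\<close> in the signs.\<close>
  have g0: "gam q (0 # ps) 0 = q"
    by (cases q) (simp_all add: gam_def)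
  have gS: "gam q (0 # ps) (Suc i) = gam (q + 1) ps i" for i
    unfolding gam_def sum_bit_Suc nth_Cons_Suc by (simp only: add_ac add_0)
  have A: "kap (\<Sum>i\<le>?n. psign (gam q (0 # ps) i) (act_term i ((L # as) ! i) (B (del i (L # as)))))
    = psign q (modes 1 L (B as)) + (\<Sum>i\<le>m. psign (gam (q + 1) ps i) (act_term i (as ! i) (contract L B (del i as))))"
    by (subst sum.atMost_Suc_shift)
      (simp add: kadd g0 gS kap_act_term_0 kap_act_term del_Suc contract_def, simp add: del_def)
  have g20: "gam2 q (0 # ps) 0 (Suc j) = q + 1 + pb j * S j" for j
  proof -
    have "(\<Sum>l\<in>{..<Suc j} - {0}. (0 # ps) ! l + 1) = S j"
      unfolding S_def pb_def
      by (rule sum.reindex_bij_witness[of _ Suc "\<lambda>l. l - 1"]) auto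
    then show ?thesis by (simp add: gam2_def pb_def)
  qed
  \<comment> \<open>The extra summand is the sign of interchanging \<open>L\<close> with the bracket
    of the arguments \<open>i\<close> and \<open>j\<close>, whose opposite parities are 1 and
    \<open>ps ! i + ps ! j + 1\<close>.\<close>
  have g2S: "gam2 q (0 # ps) (Suc i) (Suc j) + (ps ! i + ps ! j + 1) = gam2 (q + 1) ps i j" if "i < j" for i j
  proof -
    have "{..<Suc j} - {Suc i} = insert 0 (Suc ` ({..<j} - {i}))"
      by (auto simp: image_iff less_Suc_eq_0_disj)
    then have "(\<Sum>l\<in>{..<Suc j} - {Suc i}. (0 # ps) ! l + 1)
      = ((0 # ps) ! 0 + 1) + (\<Sum>l\<in>Suc ` ({..<j} - {i}). (0 # ps) ! l + 1)"
      by (simp only:) (rule sum.insert, auto)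
    also have "(\<Sum>l\<in>Suc ` ({..<j} - {i}). (0 # ps) ! l + 1) = (\<Sum>l\<in>{..<j} - {i}. ps ! l + 1)"
      by (subst sum.reindex) (simp_all only: o_def nth_Cons_Suc inj_Suc)
    finally have "(\<Sum>l\<in>{..<Suc j} - {Suc i}. (0 # ps) ! l + 1) = 1 + (\<Sum>l\<in>{..<j} - {i}. ps ! l + 1)"
      by (simp only: nth_Cons_0 add_0)
    then show ?thesis
      unfolding gam2_def sum_bit_Suc
      by (cases q; cases "ps ! i"; cases "ps ! j"; cases "\<Sum>l\<in>{..<j} - {i}. ps ! l + 1"; cases "\<Sum>l<i. ps ! l + 1") simp_all
  qed
  \<comment> \<open>Two coefficients of the bracket of \<open>L\<close> with the argument
    \<open>j\<close> contribute to first order: \<open>D (as ! j)\<close>, where sesquilinearity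
    leaves the derivative of \<open>\<lambda>\<^sub>j B\<close>, and
    \<open>L\<^sub>(\<^sub>1\<^sub>)\<close> applied to the argument. Together they give the
    \<open>j\<close>-th part of \<open>T\<close>.\<close>
  have P0: "kap (psum (\<lambda>c. pair_subst 0 (Suc j) (B (c # del j as))) (lam 0) (br L (as ! j)))
    = psign (pb j * S j) (B (as[j := coeff (br L (as ! j)) 1]) - (B as + smul (lam j) (der j (B as))))" if j: "j < ?n" for j
  proof -
    let ?a = "as ! j" and ?bs = "del j as"
    let ?F = "\<lambda>c. pair_subst 0 (Suc j) (B (c # ?bs))"
    have lbs: "Suc (length ?bs) = ?n" using as j by (simp add: length_del)
    have add: "additive ?F"
      by (rule additive_comp[OF pair_subst_lam(3) lin_Cons(1)[OF Q(2) lbs]])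
    obtain r where r: "psum ?F (lam 0) (br L ?a) = ?F (D ?a) + smul (lam 0) (?F (coeff (br L ?a) 1)) + smul (lam 0) (smul (lam 0) (psum ?F (lam 0) r))"
      using psum_split[OF add, of "lam 0" "br L ?a"] L0 by metis
    have "B (D ?a # ?bs) = - smul (lam 0) (B (?a # ?bs))"
      using ax_sesD[OF Q(4), of "?a # ?bs" 0] lbs by simp
    then have "kap (?F (D ?a)) = - (move_subst j (B (?a # ?bs)) + smul (lam j) (der j (move_subst j (B (?a # ?bs)))))"
      by (simp add: kap_pair_subst_0 additive.minus[OF additive_der] additive.minus[OF move_subst_rules(1)] der_lam_same
        additive.add[OF move_subst_rules(1)] additive.diff[OF move_subst_rules(1)] move_subst_rules move_subst_der)
    moreover have "move_subst j (B (?a # ?bs)) = psign (pb j * S j) (B as)"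
      unfolding pb_def S_def by (rule sym_move[OF Q(5) as hom j])
    moreover have "move_subst j (B (coeff (br L ?a) 1 # ?bs)) = psign (pb j * S j) (B (as[j := coeff (br L ?a) 1]))"
      using sym_move[OF Q(5) _ homogeneous_br[OF L hom, of j 1] j] as j
      unfolding pb_def S_def by (simp only: length_list_update nth_list_update_eq del_update_same)
    ultimately show ?thesis
      unfolding r
      by (simp add: kadd kap_rules zet_rules zet_pair_subst_0 additive.diff[OF additive_psign] additive.add[OF additive_psign]
        additive.minus[OF additive_psign] additive_psign_commute[OF additive_der] additive_psign_commute[OF additive_smul])
  qed
  have PS: "kap (psign (gam2 q (0 # ps) (Suc i) (Suc j)) (psum (\<lambda>c. pair_subst (Suc i) (Suc j) (B (c # L # del i (del j as)))) (lam (Suc i)) (br (as ! i) (as ! j))))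
    = psign (gam2 (q + 1) ps i j) (psum (\<lambda>c. pair_subst i j (contract L B (c # del i (del j as)))) (lam i) (br (as ! i) (as ! j)))"
    if ij: "i < j" "j < ?n" for i j
  proof -
    let ?bs = "del i (del j as)" and ?p = "br (as ! i) (as ! j)" and ?e = "ps ! i + ps ! j + 1"
    have "length (L # c # ?bs) = ?n" for c using as ij by (simp add: length_del)
    have sw: "kap (pair_subst (Suc i) (Suc j) (B (c # L # ?bs))) = psign ?e (pair_subst i j (contract L B (c # ?bs)))"
      if c: "c \<in> part (ps ! i + ps ! j)" for c
    proof -
      have "homogeneous (c # L # ?bs) ((ps ! i + ps ! j) # 0 # del i (del j ps))"
        using c L homogeneous_del[OF homogeneous_del[OF hom]] by simp
      moreover have "length (c # L # ?bs) = ?n" "Suc 0 < ?n" using as ij by (simp_all add: length_del)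
      ultimately have "subst (lam \<circ> sw 0) (B (L # c # ?bs)) = psign ((ps ! i + ps ! j + 1) * (0 + 1)) (B (c # L # ?bs))"
        using ax_symD[OF Q(5), of "c # L # ?bs" "(ps ! i + ps ! j) # 0 # del i (del j ps)" 0]
        by (simp only: nth_Cons_Suc nth_Cons_0 list_update.simps nat.case)
      then have "B (c # L # ?bs) = psign ?e (subst (lam \<circ> sw 0) (B (L # c # ?bs)))"
        by (simp only: add_0 mult_1_right psign_self)
      then show ?thesis
        by (simp only: additive_psign_commute[OF pair_subst_lam(3)] additive_psign_commute[OF kap_rules(1)] kap_pair_subst_Suc contract_def)
    qed
    have "kap (psum (\<lambda>c. pair_subst (Suc i) (Suc j) (B (c # L # ?bs))) (lam (Suc i)) ?p)
      = psum (\<lambda>c. kap (pair_subst (Suc i) (Suc j) (B (c # L # ?bs)))) (lam i) ?p"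
      by (rule psum_additive[OF kap_rules(1)]) (rule kap_rules)
    also have "\<dots> = psum (\<lambda>c. psign ?e (pair_subst i j (contract L B (c # ?bs)))) (lam i) ?p"
      unfolding psum_def
      by (intro sum.cong refl arg_cong2[where f = smul] sw br_part homi) (use ij in auto)
    also have "\<dots> = psign ?e (psum (\<lambda>c. pair_subst i j (contract L B (c # ?bs))) (lam i) ?p)"
      by (rule psum_psign)
    finally show ?thesis
      unfolding kadd by (simp only: psign_psign g2S[OF ij(1)])
  qed
  have Bt: "kap (\<Sum>j\<le>?n. \<Sum>i<j. psign (gam2 q (0 # ps) i j)
        (psum (\<lambda>c. pair_subst i j (B (c # del i (del j (L # as))))) (lam i) (br ((L # as) ! i) ((L # as) ! j))))
    = (\<Sum>j\<le>m. psign (q + 1) (B (as[j := coeff (br L (as ! j)) 1]) - (B as + smul (lam j) (der j (B as)))))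
      + (\<Sum>j\<le>m. \<Sum>i<j. psign (gam2 (q + 1) ps i j) (psum (\<lambda>c. pair_subst i j (contract L B (c # del i (del j as)))) (lam i) (br (as ! i) (as ! j))))"
  proof -
    have "kap (\<Sum>i<Suc j. psign (gam2 q (0 # ps) i (Suc j))
        (psum (\<lambda>c. pair_subst i (Suc j) (B (c # del i (del (Suc j) (L # as))))) (lam i) (br ((L # as) ! i) ((L # as) ! Suc j))))
      = psign (q + 1) (B (as[j := coeff (br L (as ! j)) 1]) - (B as + smul (lam j) (der j (B as))))
      + (\<Sum>i<j. psign (gam2 (q + 1) ps i j) (psum (\<lambda>c. pair_subst i j (contract L B (c # del i (del j as)))) (lam i) (br (as ! i) (as ! j))))"
      if j: "j < ?n" for j
    proof -
      have d: "del 0 (L # bs) = bs" for bs by (simp add: del_def)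
      have "q + 1 + pb j * S j + pb j * S j = q + 1" by (cases "pb j * S j") simp_all
      then have sgn: "psign (gam2 q (0 # ps) 0 (Suc j)) (psign (pb j * S j) X) = psign (q + 1) X" for X :: "'m mpoly"
        unfolding g20 psign_psign by (simp only:)
      show ?thesis
        unfolding sum.lessThan_Suc_shift o_def nth_Cons_0 nth_Cons_Suc del_Suc d additive.add[OF kap_rules(1)] additive.sum[OF kap_rules(1)]
      proof (rule arg_cong2[where f = plus])
        show "kap (psign (gam2 q (0 # ps) 0 (Suc j)) (psum (\<lambda>c. pair_subst 0 (Suc j) (B (c # del j as))) (lam 0) (br L (as ! j))))
          = psign (q + 1) (B (as[j := coeff (br L (as ! j)) 1]) - (B as + smul (lam j) (der j (B as))))"
          unfolding additive_psign_commute[OF kap_rules(1)] P0[OF j] sgn ..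
      qed (rule sum.cong[OF refl], rule PS[OF _ j], simp)
    qed
    then show ?thesis
      by (subst sum.atMost_Suc_shift) (simp add: additive.add[OF kap_rules(1)] additive.sum[OF kap_rules(1)] additive.zero[OF kap_rules(1)] sum.distrib
         del: sum.lessThan_Suc cong: sum.cong_simp)
  qed
  \<comment> \<open>The action of \<open>L\<close> on the value and its brackets with the arguments
    enter with opposite signs, as in \<open>weight_cochain\<close>.\<close>
  have W: "psign q (modes 1 L (B as)) + (\<Sum>j\<le>m. psign (q + 1) (B (as[j := coeff (br L (as ! j)) 1]) - (B as + smul (lam j) (der j (B as)))))
    = psign q (weight_cochain L ?n B as)"
  proof -
    have "psign (q + 1) X = - psign q X" for X :: "'m mpoly" by (cases q) (simp_all add: psign_def)
    then show ?thesis
      by (simp add: weight_cochain_def weight_op_def additive.diff[OF additive_psign] additive.add[OF additive_psign]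
        additive.sum[OF additive_psign] sum_negf sum_subtractf sum.distrib lessThan_Suc_atMost del: sum.lessThan_Suc)
  qed
  from 0 show ?thesis
    unfolding W[symmetric] Dif_def additive.add[OF kap_rules(1)] A Bt by (simp only: add_ac)
qed

section \<open>Canonical representatives; cocycles and coboundaries among representatives\<close>

lemma cong_elim:
  assumes "F \<in> lampoly (Suc m)" shows "cong (Suc m) F (elim m F)"
  using assms
proof (induction rule: lampoly_induct)
  case (lam i F)
  have E: "elim m F \<in> lampoly (Suc m)" using lampoly_elim[OF lam(2)] by (rule lampoly_mono[rotated]) simp
  show ?case
  proof (cases "i = m")
    case True
    have "cong (Suc m) (smul (lam m) F) (smul (lam m) (elim m F))"
      by (rule cong_lam) (use lam in auto)
    also have "cong (Suc m) \<dots> (- total m (elim m F))"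
      unfolding cong_def by (rule bexI[OF _ E]) (simp add: total_Suc)
    finally show ?thesis using True by (simp add: elim_lam_same)
  next
    case False
    then show ?thesis using lam by (simp add: elim_lam cong_lam)
  qed
qed (auto simp: elim_const additive.add[OF additive_elim] intro: cong_add)

lemma ax_cong_of_eq:
  assumes "ax (=) n n q P" shows "ax (cong n) n n q P"
proof -
  note P = axD[OF assms]
  have eq: "cong n F G" if "F = G" for F G using that by simp
  have "ax_par (cong n) n n q P"
    using P(3) unfolding ax_par_def by blast
  moreover have "ax_sym (cong n) n P"
    unfolding ax_sym_def by (intro allI impI eq, elim conjE, rule ax_symD[OF P(5)]; assumption)
  moreover have "ax_lbz (cong n) n q P"
    unfolding ax_lbz_def by (intro allI impI eq, elim conjE, rule ax_lbzD[OF P(6)]; assumption)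
  ultimately show ?thesis
    using P(1,2,4) by (simp add: ax_def ax_lin_def ax_ses_def)
qed

text \<open>Eliminating the last variable picks one representative from each class, and it depends
  linearly on the class; linearity up to congruence thus becomes equality. In degree 0 there is no
  linearity to arrange.\<close>

lemma canonical_rep:
  assumes P: "ax (cong n) n n q P"
  obtains P' where "ax (cong n) n n q P'" "ax_lin (=) n P'" "\<And>as. length as = n \<Longrightarrow> cong n (P as) (P' as)"
proof (cases n)
  case 0
  then show ?thesis using that[OF P] by (simp add: ax_lin_def)
next
  case (Suc m)
  define P' where "P' = (\<lambda>as. elim m (P as))"
  have val: "P as \<in> lampoly (Suc m)" if "length as = n" for as
    using ax_valD[OF axD(1)[OF P] that] Suc by simp
  have *: "P' as \<in> lampoly n \<and> cong n (P as) (P' as)" if "length as = n" for as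
    unfolding P'_def Suc using cong_elim[OF val[OF that]] lampoly_mono[OF _ lampoly_elim[OF val[OF that]], of "Suc m"] by simp
  have "ax_lin (=) n P'"
    unfolding ax_lin_def P'_def
  proof (intro conjI allI impI; elim conjE)
    fix as :: "'v list" and i a b assume as: "length as = n" "i < n"
    show "elim m (P (as[i := a + b])) = elim m (P (as[i := a])) + elim m (P (as[i := b]))"
      using elim_cong[of m] ax_linD(1)[OF axD(2)[OF P] as] unfolding Suc additive.add[OF additive_elim, symmetric] by blast
  next
    fix as :: "'v list" and i r a assume as: "length as = n" "i < n"
    show "elim m (P (as[i := scale r a])) = Sc r (elim m (P (as[i := a])))"
      using elim_cong[of m] ax_linD(2)[OF axD(2)[OF P] as] unfolding Suc elim_Sc[symmetric] by blast
  qed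
  with * ax_cong[OF P *] show ?thesis using that[of P'] by blast
qed

lemma ax_add:
  assumes P: "ax (cong n) n n q P" and Q: "ax (cong n) n n q Q"
  shows "ax (cong n) n n q (\<lambda>as. P as + Q as)"
proof -
  note P = axD[OF P] and Q = axD[OF Q]
  show ?thesis
    unfolding ax_def ax_val_def ax_lin_def ax_par_def ax_ses_def ax_sym_def ax_lbz_def
  proof (intro conjI allI impI)
    fix as :: "'v list" assume "length as = n" then show "P as + Q as \<in> lampoly n" by (intro lampoly_add ax_valD[OF P(1)] ax_valD[OF Q(1)])
  next
    fix as :: "'v list" and i a b assume A: "length as = n \<and> i < n"
    then show "cong n (P (as[i := a + b]) + Q (as[i := a + b])) ((P (as[i := a]) + Q (as[i := a])) + (P (as[i := b]) + Q (as[i := b])))"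
      using cong_add[OF ax_linD(1)[OF P(2), of as i a b] ax_linD(1)[OF Q(2), of as i a b]] by (simp add: add_ac)
  next
    fix as :: "'v list" and i r a assume A: "length as = n \<and> i < n"
    then show "cong n (P (as[i := scale r a]) + Q (as[i := scale r a])) (Sc r (P (as[i := a]) + Q (as[i := a])))"
      using cong_add[OF ax_linD(2)[OF P(2), of as i r a] ax_linD(2)[OF Q(2), of as i r a]] by (simp add: additive.add[OF additive_Sc])
  next
    fix as :: "'v list" and ps assume A: "length as = n \<and> homogeneous as ps"
    let ?r = "q + (\<Sum>j<n. ps ! j + 1) + 1"
    from A have a: "length as = n" "homogeneous as ps" by blast+
    obtain F where F: "F \<in> lampoly n" "cong n F (P as)" "hp ?r F" by (rule ax_parD[OF P(3) a])
    obtain G where G: "G \<in> lampoly n" "cong n G (Q as)" "hp ?r G" by (rule ax_parD[OF Q(3) a])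
    show "\<exists>H\<in>lampoly n. cong n H (P as + Q as) \<and> hp ?r H"
      by (intro bexI[of _ "F + G"] conjI cong_add hp_add lampoly_add F G)
  next
    fix as :: "'v list" and i assume A: "length as = n \<and> i < n"
    then show "cong n (P (as[i := D (as ! i)]) + Q (as[i := D (as ! i)])) (- smul (lam i) (P as + Q as))"
      using cong_add[OF ax_sesD[OF P(4), of as i] ax_sesD[OF Q(4), of as i]] by (simp add: mp.scale_right_distrib)
  next
    fix as :: "'v list" and ps i assume A: "length as = n \<and> homogeneous as ps \<and> Suc i < n"
    then have a: "length as = n" "homogeneous as ps" "Suc i < n" by blast+
    from cong_add[OF ax_symD[OF P(5) a] ax_symD[OF Q(5) a]]
    show "cong n (subst (lam \<circ> sw i) (P (as[i := as ! Suc i, Suc i := as ! i]) + Q (as[i := as ! Suc i, Suc i := as ! i])))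
      (psign ((ps ! i + 1) * (ps ! Suc i + 1)) (P as + Q as))"
      by (simp only: additive.add[OF additive_subst] additive.add[OF additive_psign])
  next
    fix as :: "'v list" and ps i b c pb pc s
    assume A: "length as = n \<and> homogeneous as ps \<and> i < n \<and> b \<in> part pb \<and> c \<in> part pc \<and> s = q + (\<Sum>j<i. ps ! j + 1)"
    then have a: "length as = n" "homogeneous as ps" "i < n" "b \<in> part pb" "c \<in> part pc" "s = q + (\<Sum>j<i. ps ! j + 1)" by blast+
    from cong_add[OF ax_lbzD[OF P(6) a] ax_lbzD[OF Q(6) a]]
    show "cong n (P (as[i := b * c]) + Q (as[i := b * c])) (psign (pb * s) (exp_dot i b (P (as[i := c]) + Q (as[i := c])))
             + psign (pc * (pb + s)) (exp_dot i c (P (as[i := b]) + Q (as[i := b]))))"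
      by (simp only: additive.add[OF additive_exp_dot] additive.add[OF additive_psign] add_ac)
  qed
qed

lemma exp_dot_Sc: "exp_dot i b (Sc r F) = Sc r (exp_dot i b F)"
proof (induction F arbitrary: b rule: mpoly_induct)
  case (lam j F)
  then show ?case
    by (cases "j = i") (simp_all add: Sc_smul exp_dot_lam exp_dot_lam_same additive.add[OF additive_Sc])
qed (simp_all add: exp_dot_const dot_scale_right additive.add[OF additive_Sc] additive.add[OF additive_exp_dot])

lemma hp_Sc: "hp r F \<Longrightarrow> hp r (Sc c F)"
  by (simp add: Sc_eq_smul hp_smul)

lemma Sc_Sc: "Sc a (Sc b F) = Sc b (Sc a F)"
  by (simp add: Sc_eq_smul mp.scale_left_commute)

lemma ax_Sc: "ax (cong n) n n q P \<Longrightarrow> ax (cong n) n n q (\<lambda>as. Sc x (P as))"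
  by (erule ax_map[where \<phi> = "Sc x"])
    (simp_all only: cong_Sc additive_Sc lampoly_Sc Sc_Sc[of x] hp_Sc Sc_smul subst_Sc exp_dot_Sc)

lemma closed_mod_add:
  "closed_mod (cong (Suc n)) n q P \<Longrightarrow> closed_mod (cong (Suc n)) n q Q \<Longrightarrow> closed_mod (cong (Suc n)) n q (\<lambda>as. P as + Q as)"
  unfolding closed_mod_def Dif_add using cong_add[of "Suc n" _ 0 _ 0] by simp

lemma closed_mod_Sc: "closed_mod (cong (Suc n)) n q P \<Longrightarrow> closed_mod (cong (Suc n)) n q (\<lambda>as. Sc r (P as))"
  unfolding closed_mod_def Dif_Sc using cong_Sc[of "Suc n" _ 0 r] by (simp add: additive.zero[OF additive_Sc])

definition cocyc :: "nat \<Rightarrow> bit \<Rightarrow> ('v list \<Rightarrow> 'm mpoly) \<Rightarrow> bool" where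
  "cocyc n q P \<longleftrightarrow> ax (cong n) n n q P \<and> closed_mod (cong (Suc n)) n q P"

text \<open>In degree 0 only the zero class is a coboundary. Above it, the comparison is made on
  homogeneous arguments, where the signs in \<open>Dif\<close> are determined.\<close>

definition cobound :: "nat \<Rightarrow> bit \<Rightarrow> ('v list \<Rightarrow> 'm mpoly) \<Rightarrow> bool" where
  "cobound n q P \<longleftrightarrow> (case n of 0 \<Rightarrow> cong 0 (P []) 0
     | Suc m \<Rightarrow> \<exists>X. ax (cong m) m m (q + 1) X \<and>
         (\<forall>as ps. length as = n \<and> homogeneous as ps \<longrightarrow> cong n (Dif m (q + 1) X as ps) (P as)))"

lemma cocyc_add: "cocyc n q P \<Longrightarrow> cocyc n q Q \<Longrightarrow> cocyc n q (\<lambda>as. P as + Q as)"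
  by (simp add: cocyc_def ax_add closed_mod_add)

lemma cocyc_Sc: "cocyc n q P \<Longrightarrow> cocyc n q (\<lambda>as. Sc r (P as))"
  by (simp add: cocyc_def ax_Sc closed_mod_Sc)

lemma cobound_add:
  assumes "cobound n q P" "cobound n q Q" shows "cobound n q (\<lambda>as. P as + Q as)"
proof (cases n)
  case 0
  then show ?thesis using assms cong_add[of 0 _ 0 _ 0] by (simp add: cobound_def)
next
  case (Suc m)
  from assms obtain X Z where "ax (cong m) m m (q + 1) X" "ax (cong m) m m (q + 1) Z"
    "\<And>as ps. length as = n \<Longrightarrow> homogeneous as ps \<Longrightarrow> cong n (Dif m (q + 1) X as ps) (P as)"
    "\<And>as ps. length as = n \<Longrightarrow> homogeneous as ps \<Longrightarrow> cong n (Dif m (q + 1) Z as ps) (Q as)"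
    unfolding cobound_def Suc nat.case by metis
  then show ?thesis
    unfolding cobound_def Suc nat.case
    by (intro exI[of _ "\<lambda>as. X as + Z as"] conjI ax_add allI impI) (auto simp: Dif_add intro: cong_add)
qed

lemma cobound_Sc:
  assumes "cobound n q P" shows "cobound n q (\<lambda>as. Sc r (P as))"
proof (cases n)
  case 0
  then show ?thesis using assms cong_Sc[of 0 _ 0 r] by (simp add: cobound_def additive.zero[OF additive_Sc])
next
  case (Suc m)
  from assms obtain X where "ax (cong m) m m (q + 1) X"
    "\<And>as ps. length as = n \<Longrightarrow> homogeneous as ps \<Longrightarrow> cong n (Dif m (q + 1) X as ps) (P as)"
    unfolding cobound_def Suc nat.case by metis
  then show ?thesis
    unfolding cobound_def Suc nat.case
    by (intro exI[of _ "\<lambda>as. Sc r (X as)"] conjI ax_Sc allI impI) (auto simp: Dif_Sc intro: cong_Sc)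
qed

lemma cocyc_cong:
  assumes "cocyc n q P" "\<And>as. length as = n \<Longrightarrow> Q as \<in> lampoly n \<and> cong n (P as) (Q as)"
  shows "cocyc n q Q"
  unfolding cocyc_def
proof
  show "ax (cong n) n n q Q" using assms by (auto simp: cocyc_def intro: ax_cong)
  show "closed_mod (cong (Suc n)) n q Q"
    unfolding closed_mod_def
  proof (intro allI impI)
    fix as ps assume A: "length as = Suc n \<and> homogeneous as ps"
    then have "cong (Suc n) (Dif n q Q as ps) (Dif n q P as ps)"
      by (intro cong_Dif) (use assms(2) cong_sym in auto)
    also have "cong (Suc n) \<dots> 0" using assms(1) A by (simp add: cocyc_def closed_mod_def)
    finally show "cong (Suc n) (Dif n q Q as ps) 0" .
  qed
qed

section \<open>The weight operator on classes\<close>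

text \<open>The coefficient of \<open>\<lambda>\<close> in \<open>L\<^sub>\<lambda> (\<partial> m) =
  (\<lambda> + \<partial>) (L\<^sub>\<lambda> m)\<close>, together with
  \<open>L\<^sub>(\<^sub>0\<^sub>) = \<partial>\<close>: applying \<open>\<partial>\<close> raises
  the weight by 1.\<close>

lemma modes_DMm:
  assumes LM: "\<And>m. coeff (act L m) 0 = DM m"
  shows "modes 1 L (DMm F) = DMm (modes 1 L F) + DMm F"
proof (induction F rule: mpoly_induct)
  case (const m)
  have "coeff (act L (DM m)) 1 = DM m + DM (coeff (act L m) 1)"
    by (simp add: act_D_right lam_plus_def coeff_map_poly additive.zero[OF additive_DM] LM)
  then show ?case by (simp add: DMm_const modes_single add.commute flip: single_add)
qed (simp_all add: DMm_lam modes_lam additive.add[OF additive_DMm] additive.add[OF additive_modes] mp.scale_right_distrib add_ac)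

lemma additive_weight_op: "additive (weight_op L n)"
  unfolding weight_op_def
  by (intro additive_add additive_modes additive_sum additive_id additive_comp[OF additive_smul additive_der])

lemma weight_op_lam: "j < n \<Longrightarrow> weight_op L n (smul (lam j) F) = smul (lam j) (weight_op L n F) + smul (lam j) F"
proof -
  assume j: "j < n"
  have "(\<Sum>i<n. smul (lam j) F + smul (lam i) (der i (smul (lam j) F)))
    = (\<Sum>i<n. smul (lam j) (F + smul (lam i) (der i F)) + (if i = j then smul (lam j) F else 0))"
    by (rule sum.cong) (auto simp: der_lam der_lam_same mp.scale_right_distrib mp.scale_left_commute)
  also have "\<dots> = smul (lam j) (\<Sum>i<n. F + smul (lam i) (der i F)) + smul (lam j) F"
    using j by (simp add: sum.distrib mp.scale_sum_right mp.scale_right_distrib)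
  finally show ?thesis
    by (simp add: weight_op_def modes_lam mp.scale_right_distrib add_ac)
qed

text \<open>Both \<open>\<partial>\<close> and every \<open>\<lambda>\<^sub>i\<close> have weight 1,
  so \<open>total\<close> shifts weights by 1. In particular its image is invariant, and the weight
  operator acts on classes.\<close>

lemma weight_op_total:
  assumes "\<And>m. coeff (act L m) 0 = DM m"
  shows "weight_op L n (total n F) = total n (weight_op L n F + F)"
proof -
  have "weight_op L n (DMm F) = DMm (weight_op L n F) + DMm F"
    by (simp add: weight_op_def modes_DMm[OF assms, unfolded One_nat_def] der_DMm additive.add[OF additive_DMm] additive.sum[OF additive_DMm] DMm_lam add_ac)
  then show ?thesis
    by (simp add: total_def additive.add[OF additive_weight_op] additive.sum[OF additive_weight_op] weight_op_lam
      additive.add[OF additive_DMm] mp.scale_right_distrib sum.distrib add_ac)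
qed

lemma cong_weight_op:
  assumes LM: "\<And>m. coeff (act L m) 0 = DM m" and "cong n F G"
  shows "cong n (weight_op L n F) (weight_op L n G)"
proof -
  from assms obtain R where "R \<in> lampoly n" "F - G = total n R" by (auto simp: cong_def)
  then show ?thesis
    unfolding cong_def additive.diff[OF additive_weight_op, symmetric]
    by (intro bexI[of _ "weight_op L n R + R"]) (simp_all add: weight_op_total[OF LM] lampoly_add lampoly_weight_op)
qed

text \<open>\<open>T\<close> read off at arguments that are eigenvectors of
  \<open>L\<^sub>(\<^sub>1\<^sub>)\<close>: their total weight \<open>s\<close> is subtracted from
  the weight of the value.\<close>

definition shifted_weight :: "'v \<Rightarrow> nat \<Rightarrow> 'f \<Rightarrow> 'm mpoly \<Rightarrow> 'm mpoly" where
  "shifted_weight L n s F = weight_op L n F - Sc s F"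

lemma weight_cochain_eigen:
  assumes "ax_lin (=) n P" "length as = n" "\<And>i. i < n \<Longrightarrow> coeff (br L (as ! i)) 1 = scale (\<delta> i) (as ! i)"
  shows "weight_cochain L n P as = shifted_weight L n (\<Sum>i<n. \<delta> i) (P as)"
proof -
  have "P (as[i := coeff (br L (as ! i)) 1]) = Sc (\<delta> i) (P as)" if "i < n" for i
    using ax_linD(2)[OF assms(1,2) that, of "\<delta> i" "as ! i"] assms(2,3) that by simp
  moreover have "Sc (\<Sum>i<n. \<delta> i) F = (\<Sum>i<n. Sc (\<delta> i) F)" for F
  proof -
    have "additive (\<lambda>r. smul (Poly_Mapping.single 0 r) F)"
      by (rule additive_comp[OF additive_smul_left]) (simp add: additive_def single_add)
    from additive.sum[OF this, of \<delta> "{..<n}"] show ?thesis by (simp only: Sc_eq_smul)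
  qed
  ultimately show ?thesis by (simp add: weight_cochain_def shifted_weight_def)
qed

lemma psign_Sc: "psign p F = Sc (if p = 0 then 1 else - 1) F"
  by (rule additive_eqI[OF additive_psign additive_Sc]) (auto simp: psign_def single_uminus)

text \<open>
  \<open>T (T - 1)\<close> maps cocycles to coboundaries, where \<open>T\<close> is the weight operator; \<open>T\<close> acts on the values on
  generators through \<^const>\<open>shifted_weight\<close>.
\<close>

lemma weight_operator_step:
  assumes L: "L \<in> part 0" and L0: "\<And>a. coeff (br L a) 0 = D a" and LM: "\<And>m. coeff (act L m) 0 = DM m"
    and P: "cocyc n q P"
  shows "\<exists>Q. cocyc n q Q \<and> cobound n q Q \<and>
    (\<forall>as \<delta>. length as = n \<longrightarrow> (\<forall>i<n. coeff (br L (as ! i)) 1 = scale (\<delta> i) (as ! i)) \<longrightarrow>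
      cong n (Q as) (shifted_weight L n (\<Sum>i<n. \<delta> i) (shifted_weight L n (\<Sum>i<n. \<delta> i) (P as) - P as)))"
proof -
  have csw: "cong n (shifted_weight L n s F) (shifted_weight L n s G)" if "cong n F G" for s F G
    unfolding shifted_weight_def by (intro cong_diff cong_weight_op[OF LM] cong_Sc that)
  have addsw: "additive (shifted_weight L n s)" for s
    unfolding shifted_weight_def by (intro additive_diff additive_weight_op additive_Sc)
  obtain P' where P': "ax (cong n) n n q P'" "ax_lin (=) n P'" "\<And>as. length as = n \<Longrightarrow> cong n (P as) (P' as)"
    using P canonical_rep unfolding cocyc_def by blast
  have "cocyc n q P'"
    by (rule cocyc_cong[OF P]) (use P' ax_valD[OF axD(1)[OF P'(1)]] in blast)
  then have closed': "closed_mod (cong (Suc n)) n q P'" by (simp add: cocyc_def)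
  obtain B where B: "\<And>as. length as = n \<Longrightarrow> B as \<in> lampoly n" "\<And>as. length as = n \<Longrightarrow> cong n (B as) (P' as - weight_cochain L n P' as)"
    "closed_mod (=) n q B" "0 < n \<Longrightarrow> ax (=) n n q B"
    using basic_lift[OF L L0 LM P'(1,2) closed'] by blast
  have BP: "cong n (B as) (P as - shifted_weight L n (\<Sum>i<n. \<delta> i) (P as))"
    if "length as = n" "\<And>i. i < n \<Longrightarrow> coeff (br L (as ! i)) 1 = scale (\<delta> i) (as ! i)" for as \<delta>
  proof -
    have "cong n (B as) (P' as - shifted_weight L n (\<Sum>i<n. \<delta> i) (P' as))"
      using B(2)[OF that(1)] weight_cochain_eigen[OF P'(2) that] by simp
    also have "cong n \<dots> (P as - shifted_weight L n (\<Sum>i<n. \<delta> i) (P as))"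
      by (intro cong_diff csw cong_sym[OF P'(3)] that)
    finally show ?thesis .
  qed
  show ?thesis
  proof (cases n)
    case 0
    have ax0: "ax (cong n) n n q (\<lambda>as. Sc 0 (P' as))" by (rule ax_Sc[OF P'(1)])
    have Sc0: "Sc 0 F = 0" for F by (simp add: Sc_eq_smul)
    \<comment> \<open>There is no contraction in degree 0. Instead, the cocycle equation at the
      argument \<open>L\<close> says that \<open>L\<close> annihilates \<open>B []\<close>, so
      \<open>T (T - 1)\<close> already gives the zero class. The zero function is written as
      \<open>Sc 0\<close> of a cocycle in order to inherit the axioms.\<close>
    have "Dif 0 q B [L] [0] = 0"
      using B(3) L unfolding closed_mod_def 0 by simp
    then have "psign (gam q [0] 0) (act_term 0 L (B [])) = 0"
      by (simp add: Dif_def del_def)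
    then have "act_term 0 L (B []) = 0" by (metis psign_0 psign_self)
    then have "modes 1 L (B []) = 0"
      using kap_act_term_0[of L "B []"] by (simp add: additive.zero[OF kap_rules(1)])
    then have W0: "shifted_weight L 0 0 (B []) = 0" by (simp add: shifted_weight_def weight_op_def Sc0)
    show ?thesis
    proof (intro exI[of _ "\<lambda>as. Sc 0 (P' as)"] conjI allI impI)
      show "cocyc n q (\<lambda>as. Sc 0 (P' as))"
        by (rule cocyc_Sc) fact
      show "cobound n q (\<lambda>as. Sc 0 (P' as))" by (simp add: cobound_def 0 Sc0)
      fix as :: "'v list" and \<delta> assume as: "length as = n"
      then have "as = []" using 0 by simp
      have "cong n (shifted_weight L n 0 (B [])) (shifted_weight L n 0 (P [] - shifted_weight L n 0 (P [])))"
        by (rule csw) (use BP[of "[]" "\<lambda>_. 0"] 0 in simp)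
      moreover have "shifted_weight L n 0 (P [] - shifted_weight L n 0 (P [])) = - shifted_weight L n 0 (shifted_weight L n 0 (P []) - P [])"
        by (simp add: additive.diff[OF addsw])
      ultimately have "cong n 0 (- shifted_weight L n 0 (shifted_weight L n 0 (P []) - P []))"
        using W0 0 by simp
      from cong_uminus[OF this]
      show "cong n (Sc 0 (P' as)) (shifted_weight L n (\<Sum>i<n. \<delta> i) (shifted_weight L n (\<Sum>i<n. \<delta> i) (P as) - P as))"
        using \<open>as = []\<close> 0 by (simp add: Sc0)
    qed
  next
    case (Suc m)
    then have B4: "ax (=) n n q B" using B(4) by simp
    have Blin: "ax_lin (=) n B" by (rule axD(2)[OF B4])
    have Bc: "cocyc n q B"
      unfolding cocyc_def using B(3) by (auto simp: closed_mod_def intro: ax_cong_of_eq[OF B4])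
    then have Bcl: "closed_mod (cong (Suc n)) n q B" by (simp add: cocyc_def)
    \<comment> \<open>A second lift, now of the basic cocycle \<open>B\<close>: \<open>C\<close>
      represents \<open>B - T B\<close>.\<close>
    obtain C where C: "\<And>as. length as = n \<Longrightarrow> C as \<in> lampoly n" "\<And>as. length as = n \<Longrightarrow> cong n (C as) (B as - weight_cochain L n B as)"
      "closed_mod (=) n q C" "0 < n \<Longrightarrow> ax (=) n n q C"
      using basic_lift[OF L L0 LM ax_cong_of_eq[OF B4] Blin Bcl] by blast
    then have C4: "ax (=) n n q C" using Suc by simp
    have Cc: "cocyc n q C"
      unfolding cocyc_def using C(3) by (auto simp: closed_mod_def intro: ax_cong_of_eq[OF C4])
    \<comment> \<open>\<open>C - B\<close> is congruent to \<open>- T B\<close>. In this form it is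
      visibly a cocycle, being a combination of two cocycles, while Cartan's formula shows that
      \<open>- T B\<close> is a coboundary.\<close>
    define Q where "Q = (\<lambda>as. C as + Sc (- 1) (B as))"
    have m1: "Sc (- 1) F = - F" for F
      using psign_Sc[of 1 F] by (simp add: psign_one)
    have Qw: "cong n (Q as) (- weight_cochain L n B as)" if "length as = n" for as
      using cong_diff[OF C(2)[OF that] cong_refl[of n "B as"]] by (simp add: Q_def m1)
    show ?thesis
    proof (intro exI[of _ Q] conjI allI impI)
      show "cocyc n q Q" unfolding Q_def by (intro cocyc_add cocyc_Sc Bc Cc)
      show "cobound n q Q"
        unfolding cobound_def Suc nat.case
      proof (intro exI conjI allI impI)
        let ?c = "if q = 0 then 1 else - 1"
        have "ax (=) m m (q + 1) (contract L B)"
          by (rule contract_ax[OF L]) (use B4 Suc in simp)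
        then show "ax (cong m) m m (q + 1) (\<lambda>as. Sc ?c (contract L B as))"
          by (intro ax_Sc ax_cong_of_eq)
        fix as ps assume A: "length as = Suc m \<and> homogeneous as ps"
        then have "psign q (weight_cochain L (Suc m) B as) + Dif m (q + 1) (contract L B) as ps = 0"
          by (intro cartan[OF L L0]) (use B4 B(3) Suc in auto)
        then have "psign q (psign q (weight_cochain L (Suc m) B as) + Dif m (q + 1) (contract L B) as ps) = 0"
          by simp
        moreover have "Dif m (q + 1) (\<lambda>as. Sc ?c (contract L B as)) as ps = psign q (Dif m (q + 1) (contract L B) as ps)"
          by (simp only: Dif_Sc psign_Sc)
        ultimately have "Dif m (q + 1) (\<lambda>as. Sc ?c (contract L B as)) as ps = - weight_cochain L (Suc m) B as"
          unfolding additive.add[OF additive_psign] psign_self by (simp only: eq_neg_iff_add_eq_0 add.commute)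
        then show "cong (Suc m) (Dif m (q + 1) (\<lambda>as. Sc ?c (contract L B as)) as ps) (Q as)"
          using cong_sym[OF Qw[of as]] A Suc by simp
      qed
      fix as \<delta> assume as: "length as = n" and "\<forall>i<n. coeff (br L (as ! i)) 1 = scale (\<delta> i) (as ! i)"
      then have eig: "\<And>i. i < n \<Longrightarrow> coeff (br L (as ! i)) 1 = scale (\<delta> i) (as ! i)" by blast
      let ?W = "shifted_weight L n (\<Sum>i<n. \<delta> i)"
      have "cong n (Q as) (- weight_cochain L n B as)" by (rule Qw[OF as])
      also have "\<dots> = - ?W (B as)" using weight_cochain_eigen[OF Blin as eig] by simp
      also have "cong n \<dots> (- ?W (P as - ?W (P as)))" by (intro cong_uminus csw BP as eig)
      also have "\<dots> = ?W (?W (P as) - P as)" by (simp add: additive.diff[OF addsw])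
      finally show "cong n (Q as) (?W (?W (P as) - P as))" .
    qed
  qed
qed

section \<open>Finite dimensionality\<close>

lemma homogeneous_components: "length ps = length as \<Longrightarrow> homogeneous (map2 component ps as) ps"
  by (simp add: list_all2_conv_all_nth component_in_part)

lemma map2_component: "homogeneous as ps \<Longrightarrow> map2 component ps as = as"
  by (auto simp: list_all2_conv_all_nth component_same intro!: nth_equalityI)

lemma finite_parities: "finite {ps :: bit list. length ps = n}"
proof -
  have "(UNIV :: bit set) = {0, 1}" by (auto intro: bit.exhaust)
  then have "finite (UNIV :: bit set)" by (metis finite.emptyI finite.insertI)
  from finite_lists_length_eq[OF this, of n] show ?thesis by simp
qed

lemma lin_zero:
  assumes "ax_lin (=) n P" "length as = n" "i < n" "as ! i = 0"
  shows "P as = 0"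
  using additive.zero[OF lin_additive[OF assms(1-3)]] assms(2-4) by (metis list_update_id)

text \<open>For homogeneous arguments a wrong list of parities produces a zero component, and the
  summand vanishes by linearity; only \<open>ps\<close> survives. Linearity is exact for a canonical
  representative, to which \<open>P\<close> is congruent.\<close>

lemma Dif_homogeneous_sum:
  assumes P: "ax (cong n) n n q P" and as: "length as = Suc n" and hom: "homogeneous as ps"
  shows "cong (Suc n) (\<Sum>rs\<in>{rs. length rs = Suc n}. Dif n q P (map2 component rs as) rs) (Dif n q P as ps)"
proof -
  obtain P' where P': "ax_lin (=) n P'" "\<And>as. length as = n \<Longrightarrow> cong n (P as) (P' as)"
    using canonical_rep[OF P] by blast
  have psl: "length ps = Suc n" using hom as list_all2_lengthD by metis
  have zero: "cong (Suc n) (Dif n q P (map2 component rs as) rs) 0" if rs: "length rs = Suc n" "rs \<noteq> ps" for rs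
  proof -
    obtain i where i: "i < Suc n" "rs ! i \<noteq> ps ! i" using rs psl by (metis nth_equalityI)
    have "as ! i \<in> part (ps ! i)" using homogeneous_nth[OF hom] as i by simp
    then have "map2 component rs as ! i = 0" using i rs as component_other[of "as ! i" "ps ! i" "rs ! i"] by simp
    then have "Dif n q P' (map2 component rs as) rs = 0"
      by (intro lin_zero[OF Dif_lin[OF P'(1)], where i = i]) (use i rs as in simp_all)
    moreover have "cong (Suc n) (Dif n q P (map2 component rs as) rs) (Dif n q P' (map2 component rs as) rs)"
      by (rule cong_Dif) (use rs as P' in simp_all)
    ultimately show ?thesis by simp
  qed
  have "(\<Sum>rs\<in>{rs. length rs = Suc n}. Dif n q P (map2 component rs as) rs)
    = Dif n q P as ps + (\<Sum>rs\<in>{rs. length rs = Suc n} - {ps}. Dif n q P (map2 component rs as) rs)"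
    using sum.remove[OF finite_parities, of ps "Suc n" "\<lambda>rs. Dif n q P (map2 component rs as) rs"] psl
    by (simp add: map2_component[OF hom])
  also have "cong (Suc n) \<dots> (Dif n q P as ps + (\<Sum>rs\<in>{rs. length rs = Suc n} - {ps}. 0))"
    by (intro cong_add cong_refl cong_sum zero) auto
  finally show ?thesis by simp
qed

lemma cocycles_rep:
  assumes "Y \<in> cocycles n q"
  shows "cocyc n q (\<lambda>as. rep (Y as))" "coset n (\<lambda>as. rep (Y as)) = Y"
proof -
  have Y: "Y \<in> cochains n q" and d: "differential n q Y = cochain_zero (Suc n)"
    using assms by (simp_all add: cocycles_def)
  show "coset n (\<lambda>as. rep (Y as)) = Y" by (rule cochains_rep[OF Y])
  have ax: "ax (cong n) n n q (\<lambda>as. rep (Y as))" by (rule cochains_rep[OF Y])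
  have val: "rep (Y bs) \<in> lampoly n" if "length bs = n" for bs
    using ax_valD[OF axD(1)[OF ax] that] .
  have "cong (Suc n) (Dif n q (\<lambda>as. rep (Y as)) as ps) 0" if as: "length as = Suc n" "homogeneous as ps" for as ps
  proof -
    let ?S = "\<Sum>rs\<in>{rs. length rs = Suc n}. Dif n q (\<lambda>as. rep (Y as)) (map2 component rs as) rs"
    have "cls (Suc n) ?S = cls (Suc n) 0"
      using fun_cong[OF d, of as] as by (simp add: differential_def cochain_zero_def diff_formula_eq)
    moreover have "?S \<in> lampoly (Suc n)"
      by (intro lampoly_sum lampoly_Dif val) (use as in auto)
    ultimately have "cong (Suc n) ?S 0" by (simp add: cls_eq_iff)
    with Dif_homogeneous_sum[OF ax as] show ?thesis using cong_sym cong_trans by blast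
  qed
  with ax show "cocyc n q (\<lambda>as. rep (Y as))" by (simp add: cocyc_def closed_mod_def)
qed

lemma differential_coset:
  assumes P: "ax (cong n) n n q P" and as: "length as = Suc n"
    and Q: "\<And>as ps. length as = Suc n \<Longrightarrow> homogeneous as ps \<Longrightarrow> cong (Suc n) (Dif n q P as ps) (Q as)"
  shows "differential n q (coset n P) as = cls (Suc n) (\<Sum>rs\<in>{rs. length rs = Suc n}. Q (map2 component rs as))"
proof -
  have val: "P as \<in> lampoly n" if "length as = n" for as
    using ax_valD[OF axD(1)[OF P] that] .
  have r: "rep (coset n P bs) \<in> lampoly n" "cong n (rep (coset n P bs)) (P bs)" if "length bs = n" for bs
    using rep_cls[OF val[OF that]] that by (simp_all add: coset_def)
  have d: "cong (Suc n) (Dif n q (\<lambda>as. rep (coset n P as)) (map2 component rs as) rs) (Q (map2 component rs as))"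
    if "length rs = Suc n" for rs
  proof -
    have "cong (Suc n) (Dif n q (\<lambda>as. rep (coset n P as)) (map2 component rs as) rs) (Dif n q P (map2 component rs as) rs)"
      by (rule cong_Dif) (use that as r in simp_all)
    also have "cong (Suc n) \<dots> (Q (map2 component rs as))"
      by (rule Q) (use that as in \<open>simp_all add: homogeneous_components\<close>)
    finally show ?thesis .
  qed
  have "cls (Suc n) (\<Sum>rs\<in>{rs. length rs = Suc n}. Dif n q (\<lambda>as. rep (coset n P as)) (map2 component rs as) rs)
      = cls (Suc n) (\<Sum>rs\<in>{rs. length rs = Suc n}. Q (map2 component rs as))"
    by (subst cls_eq_iff) (use as r d in \<open>auto intro!: lampoly_sum cong_sum lampoly_Dif\<close>)
  then show ?thesis by (simp add: differential_def as diff_formula_eq)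
qed

lemma coset_cocycles:
  assumes "cocyc n q P"
  shows "coset n P \<in> cocycles n q"
proof -
  have ax: "ax (cong n) n n q P" and "closed_mod (cong (Suc n)) n q P" using assms by (simp_all add: cocyc_def)
  then have "cong (Suc n) (Dif n q P as ps) 0" if "length as = Suc n" "homogeneous as ps" for as ps
    using that by (simp add: closed_mod_def)
  then have "differential n q (coset n P) as = cochain_zero (Suc n) as" if "length as = Suc n" for as
    using differential_coset[OF ax that, of "\<lambda>_. 0"] that by (simp add: cochain_zero_def)
  then have "differential n q (coset n P) = cochain_zero (Suc n)"
    by (intro ext) (simp add: differential_def cochain_zero_def)
  then show ?thesis using coset_cochains[OF ax] by (simp add: cocycles_def)
qed

text \<open>The arguments are split into even and odd parts one after the other, from the left;
  \<open>k\<close> counts those already split.\<close>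

lemma expand_components:
  assumes P: "ax_lin (cong n) n P" and as: "length as = n" and k: "k \<le> n"
  shows "cong n (P as) (\<Sum>rs\<in>{rs. length rs = k}. P (map2 component rs (take k as) @ drop k as))"
  using k
proof (induction k)
  case 0
  have "{rs :: bit list. length rs = 0} = {[]}" by auto
  then show ?case by simp
next
  case (Suc k)
  let ?f = "\<lambda>k rs. P (map2 component rs (take k as) @ drop k as)"
  have split: "cong n (?f k rs) (?f (Suc k) (rs @ [0]) + ?f (Suc k) (rs @ [1]))" if rs: "length rs = k" for rs
  proof -
    let ?bs = "map2 component rs (take k as) @ drop k as"
    have len: "length ?bs = n" and kn: "k < n" using rs as Suc.prems by simp_all
    have upd: "?bs[k := component r (as ! k)] = map2 component (rs @ [r]) (take (Suc k) as) @ drop (Suc k) as" for r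
      using rs as kn by (auto simp: list_update_append take_Suc_conv_app_nth min_def Cons_nth_drop_Suc[symmetric])
    have same: "?bs[k := as ! k] = ?bs"
      using rs as kn by (auto simp: list_update_append min_def Cons_nth_drop_Suc[symmetric])
    show ?thesis
      using ax_linD(1)[OF P len kn, of "component 0 (as ! k)" "component 1 (as ! k)"]
      unfolding component_sum upd same .
  qed
  have "cong n (P as) (\<Sum>rs\<in>{rs. length rs = k}. ?f k rs)" using Suc by simp
  also have "cong n \<dots> (\<Sum>rs\<in>{rs. length rs = k}. ?f (Suc k) (rs @ [0]) + ?f (Suc k) (rs @ [1]))"
    by (rule cong_sum) (use split in simp)
  also have "\<dots> = (\<Sum>rs\<in>{rs. length rs = Suc k}. ?f (Suc k) rs)"
  proof -
    have "{rs :: bit list. length rs = Suc k} = (\<lambda>rs. rs @ [0]) ` {rs. length rs = k} \<union> (\<lambda>rs. rs @ [1]) ` {rs. length rs = k}"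
      by (auto simp: length_Suc_conv_rev intro: bit.exhaust) 
    moreover have "(\<Sum>rs\<in>(\<lambda>rs. rs @ [0]) ` {rs. length rs = k} \<union> (\<lambda>rs. rs @ [1]) ` {rs. length rs = k}. ?f (Suc k) rs)
      = (\<Sum>rs\<in>(\<lambda>rs. rs @ [0]) ` {rs. length rs = k}. ?f (Suc k) rs) + (\<Sum>rs\<in>(\<lambda>rs. rs @ [1]) ` {rs. length rs = k}. ?f (Suc k) rs)"
      by (rule sum.union_disjoint) (auto simp: finite_parities)
    ultimately show ?thesis
      by (simp only: sum.distrib sum.reindex inj_on_def append1_eq_conv simp_thms o_def) (simp add: sum.reindex inj_on_def)
  qed
  finally show ?case .
qed

lemma coset_coboundaries:
  assumes P: "ax (cong n) n n q P" and b: "cobound n q P"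
  shows "coset n P \<in> coboundaries n q"
proof (cases n)
  case 0
  then have "cong 0 (P []) 0" using b by (simp add: cobound_def)
  moreover have "P [] \<in> lampoly 0" using ax_valD[OF axD(1)[OF P]] 0 by simp
  ultimately have "coset n P = cochain_zero 0"
    by (intro ext) (auto simp: coset_def cochain_zero_def 0 cls_eq_iff)
  then show ?thesis by (simp add: coboundaries_def 0)
next
  case (Suc m)
  obtain X where X: "ax (cong m) m m (q + 1) X"
    and d: "\<And>as ps. length as = n \<Longrightarrow> homogeneous as ps \<Longrightarrow> cong n (Dif m (q + 1) X as ps) (P as)"
    using b unfolding cobound_def Suc nat.case by blast
  have "coset n P as = differential m (q + 1) (coset m X) as" for as
  proof (cases "length as = n")
    case True
    have "cong n (P as) (\<Sum>rs\<in>{rs. length rs = n}. P (map2 component rs as))"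
      using expand_components[OF axD(2)[OF P] True order_refl] True by simp
    moreover have "P as \<in> lampoly n" by (rule ax_valD[OF axD(1)[OF P] True])
    ultimately have "cls n (P as) = cls n (\<Sum>rs\<in>{rs. length rs = n}. P (map2 component rs as))"
      by (simp add: cls_eq_iff)
    also have "\<dots> = differential m (q + 1) (coset m X) as"
      using differential_coset[OF X _ d[unfolded Suc], of as] True Suc by simp
    finally show ?thesis using True by (simp add: coset_def)
  qed (simp add: coset_def differential_def Suc)
  then have "coset n P = differential m (q + 1) (coset m X)" by blast
  then show ?thesis
    using coset_cochains[OF X] by (simp add: coboundaries_def Suc)
qed

lemma cochain_add_coset:
  assumes "ax_val n n P" "ax_val n n Q"
  shows "cochain_add n (coset n P) (coset n Q) = coset n (\<lambda>as. P as + Q as)"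
proof
  fix as
  show "cochain_add n (coset n P) (coset n Q) as = coset n (\<lambda>as. P as + Q as) as"
  proof (cases "length as = n")
    case True
    note r = rep_cls[OF ax_valD[OF assms(1) True]] rep_cls[OF ax_valD[OF assms(2) True]]
    have "cls n (rep (cls n (P as)) + rep (cls n (Q as))) = cls n (P as + Q as)"
      using r by (subst cls_eq_iff) (auto intro: lampoly_add cong_add)
    then show ?thesis using True by (simp add: cochain_add_def coset_def)
  qed (simp add: cochain_add_def coset_def)
qed

text \<open>Different \<open>b\<close> may have the same coset, so the coefficient of a cochain is
  the sum of \<open>d\<close> over its fibre.\<close>

lemma lincomb_coset:
  assumes fin: "finite Bs" and val: "\<And>b. b \<in> Bs \<Longrightarrow> ax_val n n (R b)"
  shows "lincomb n (\<lambda>Y. \<Sum>b\<in>{b \<in> Bs. coset n (R b) = Y}. d b) ((\<lambda>b. coset n (R b)) ` Bs)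
    = coset n (\<lambda>as. \<Sum>b\<in>Bs. Sc (d b) (R b as))"
proof
  fix as
  let ?c = "\<lambda>Y. \<Sum>b\<in>{b \<in> Bs. coset n (R b) = Y}. d b" and ?S = "(\<lambda>b. coset n (R b)) ` Bs"
  show "lincomb n ?c ?S as = coset n (\<lambda>as. \<Sum>b\<in>Bs. Sc (d b) (R b as)) as"
  proof (cases "length as = n")
    case True
    have Scs: "Sc (sum d A) F = (\<Sum>b\<in>A. Sc (d b) F)" for A F
    proof -
      have "additive (\<lambda>r. smul (Poly_Mapping.single 0 r) F)"
        by (rule additive_comp[OF additive_smul_left]) (simp add: additive_def single_add)
      from additive.sum[OF this, of d A] show ?thesis by (simp only: Sc_eq_smul)
    qed
    have r: "rep (coset n (R b) as) \<in> lampoly n" "cong n (rep (coset n (R b) as)) (R b as)" if "b \<in> Bs" for b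
      using rep_cls[OF ax_valD[OF val[OF that] True]] True by (simp_all add: coset_def)
    have "(\<Sum>Y\<in>?S. Sc (?c Y) (rep (Y as))) = (\<Sum>Y\<in>?S. \<Sum>b\<in>{b \<in> Bs. coset n (R b) = Y}. Sc (d b) (rep (coset n (R b) as)))"
      by (simp add: Scs)
    also have "\<dots> = (\<Sum>b\<in>Bs. Sc (d b) (rep (coset n (R b) as)))"
      by (rule sum.group) (use fin in auto)
    finally have eq: "(\<Sum>Y\<in>?S. Sc (?c Y) (rep (Y as))) = (\<Sum>b\<in>Bs. Sc (d b) (rep (coset n (R b) as)))" .
    have "cls n (\<Sum>Y\<in>?S. Sc (?c Y) (rep (Y as))) = cls n (\<Sum>b\<in>Bs. Sc (d b) (R b as))"
      unfolding eq by (subst cls_eq_iff) (auto intro!: cong_sum lampoly_sum cong_Sc lampoly_Sc r)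
    then show ?thesis using True by (simp add: lincomb_def coset_def)
  qed (simp add: lincomb_def coset_def)
qed

section \<open>Words in the generators, and cochains determined by their values on
  generators\<close>

definition word :: "(nat \<Rightarrow> 'v) \<Rightarrow> (nat \<times> nat) list \<Rightarrow> 'v" where
  "word u w = prod_list (map (\<lambda>(i, k). (D ^^ k) (u i)) w)"

lemma word_simps: "word u [] = 1" "word u ((i, k) # w) = (D ^^ k) (u i) * word u w"
  by (simp_all add: word_def)

lemma generators_part: "differential_polynomials N par u \<Longrightarrow> i < N \<Longrightarrow> u i \<in> part (par i)"
  by (simp add: differential_polynomials_def)

lemma words_span:
  assumes "differential_polynomials N par u"
  shows "span (word u ` {w. set w \<subseteq> {..<N} \<times> UNIV}) = UNIV"
proof (intro set_eqI iffI UNIV_I)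
  fix v
  have "free_eval u ` {f. \<forall>w\<in>Poly_Mapping.keys f. set w \<subseteq> {..<N} \<times> UNIV} = UNIV"
    using assms by (simp add: differential_polynomials_def Let_def)
  then have "v \<in> free_eval u ` {f. \<forall>w\<in>Poly_Mapping.keys f. set w \<subseteq> {..<N} \<times> UNIV}" by (simp only: UNIV_I)
  then obtain f where f: "\<forall>w\<in>Poly_Mapping.keys f. set w \<subseteq> {..<N} \<times> UNIV" "v = free_eval u f"
    by blast
  show "v \<in> span (word u ` {w. set w \<subseteq> {..<N} \<times> UNIV})"
    unfolding f(2) free_eval_def word_def[symmetric]
    by (intro span_sum span_scale span_base) (use f(1) in auto)
qed

lemma D_pow_part: "a \<in> part p \<Longrightarrow> (D ^^ k) a \<in> part p"
  by (induction k) (auto intro: D_part)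

lemma word_part:
  assumes "differential_polynomials N par u" "set w \<subseteq> {..<N} \<times> UNIV"
  shows "\<exists>p. word u w \<in> part p"
  using assms(2)
proof (induction w)
  case Nil
  show ?case using one_part by (auto simp: word_simps)
next
  case (Cons x w)
  then obtain i k p where "x = (i, k)" "i < N" "word u w \<in> part p" by (cases x) auto
  from mult_part[OF D_pow_part[OF generators_part[OF assms(1) this(2)]] this(3), of k] this(1)
  show ?case by (simp only: word_simps) blast
qed

text \<open>By sesquilinearity and the Leibniz rules, cochains are determined by their values on generators.\<close>

lemma zero_on_generators:
  assumes u: "differential_polynomials N par u" and P: "ax (cong n) n n q P"
    and z: "\<And>I. length I = n \<Longrightarrow> set I \<subseteq> {..<N} \<Longrightarrow> cong n (P (map u I)) 0"
    and as: "length as = n"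
  shows "cong n (P as) 0"
proof -
  note P = axD[OF P]
  define Mon where "Mon = word u ` {w. set w \<subseteq> {..<N} \<times> UNIV}"
  define U where "U = u ` {..<N}"
  have UMon: "U \<subseteq> Mon"
  proof
    fix x assume "x \<in> U"
    then obtain i where "i < N" "x = u i" by (auto simp: U_def)
    then have "x = word u [(i, 0)]" "set [(i, 0)] \<subseteq> {..<N} \<times> UNIV" by (simp_all add: word_simps)
    then show "x \<in> Mon" unfolding Mon_def by blast
  qed
  have hom: "\<exists>ps. homogeneous as ps" if "set as \<subseteq> Mon" for as
    using that
  proof (induction as)
    case (Cons a as)
    then obtain ps where "homogeneous as ps" by auto
    moreover obtain w where "a = word u w" "set w \<subseteq> {..<N} \<times> UNIV" using Cons.prems by (auto simp: Mon_def)
    then obtain p where "a \<in> part p" using word_part[OF u] by blast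
    ultimately have "homogeneous (a # as) (p # ps)" by simp
    then show ?case by blast
  qed auto
  \<comment> \<open>The arguments before position \<open>j\<close> are words and those from
    \<open>j\<close> on are generators; one more generator is replaced by an arbitrary word at each
    step.\<close>
  have step1: "cong n (P as) 0" if "j \<le> n" "length as = n" "\<And>l. l < j \<Longrightarrow> as ! l \<in> Mon" "\<And>l. j \<le> l \<Longrightarrow> l < n \<Longrightarrow> as ! l \<in> U" for j as
    using that
  proof (induction j arbitrary: as)
    case 0
    then have "as \<in> lists U" by (auto simp: in_lists_conv_set in_set_conv_nth)
    then obtain I where "I \<in> lists {..<N}" "as = map u I" unfolding U_def lists_image by blast
    with z[of I] 0 show ?case by (auto simp: in_lists_conv_set)
  next
    case (Suc j)
    have j: "j < n" using Suc.prems by simp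
    have letter: "cong n (P (as[j := (D ^^ k) (u i)])) 0" if "i < N" for i k
    proof (induction k)
      case 0
      show ?case
        by (rule Suc.IH) (use Suc.prems that in \<open>auto simp: nth_list_update U_def\<close>)
    next
      case (Suc k)
      have "cong n (P (as[j := (D ^^ Suc k) (u i)])) (- smul (lam j) (P (as[j := (D ^^ k) (u i)])))"
        using ax_sesD[OF P(4), of "as[j := (D ^^ k) (u i)]" j] Suc.prems j \<open>length as = n\<close> by simp
      also have "cong n \<dots> (- smul (lam j) 0)" by (intro cong_uminus cong_lam Suc.IH j)
      finally show ?case by simp
    qed
    have "set as \<subseteq> Mon"
    proof
      fix x assume "x \<in> set as"
      then obtain l where "l < n" "x = as ! l" using Suc.prems(2) by (auto simp: in_set_conv_nth)
      then show "x \<in> Mon" using Suc.prems(3,4)[of l] UMon by (cases "l < Suc j") auto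
    qed
    then obtain ps where ps: "homogeneous as ps" using hom by blast
    have words: "cong n (P (as[j := word u w])) 0" if "set w \<subseteq> {..<N} \<times> UNIV" for w
      using that
    proof (induction w)
      case Nil
      \<comment> \<open>The empty word: the Leibniz rule for \<open>1 * 1\<close> makes
        \<open>F\<close> congruent to \<open>F + F\<close>.\<close>
      define F where "F = P (as[j := 1])"
      have "cong n (P (as[j := 1 * 1])) (psign (0 * (q + (\<Sum>l<j. ps ! l + 1))) (exp_dot j 1 F) + psign (0 * (0 + (q + (\<Sum>l<j. ps ! l + 1)))) (exp_dot j 1 F))"
        unfolding F_def by (rule ax_lbzD[OF P(6) Suc.prems(2) ps j one_part one_part refl])
      then have "cong n F (F + F)" by (simp add: exp_dot_one F_def)
      from cong_diff[OF this cong_refl[of n F]] have "cong n 0 F" by simp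
      then show ?case using cong_sym by (simp add: word_simps F_def)
    next
      case (Cons x w)
      then obtain i k where x: "x = (i, k)" "i < N" by (cases x) auto
      obtain p where p: "word u w \<in> part p" using Cons.prems word_part[OF u, of w] by auto
      let ?b = "(D ^^ k) (u i)" and ?s = "q + (\<Sum>l<j. ps ! l + 1)"
      have b: "?b \<in> part (par i)" by (rule D_pow_part[OF generators_part[OF u x(2)]])
      have "cong n (P (as[j := ?b * word u w])) (psign (par i * ?s) (exp_dot j ?b (P (as[j := word u w])))
         + psign (p * (par i + ?s)) (exp_dot j (word u w) (P (as[j := ?b]))))"
        by (rule ax_lbzD[OF P(6) Suc.prems(2) ps j b p refl])
      also have "cong n \<dots> (psign (par i * ?s) (exp_dot j ?b 0) + psign (p * (par i + ?s)) (exp_dot j (word u w) 0))"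
        by (intro cong_add cong_psign cong_exp_dot letter x j Cons.IH) (use Cons.prems in auto)
      finally show ?case by (simp add: x word_simps additive.zero[OF additive_exp_dot])
    qed
    obtain w where "set w \<subseteq> {..<N} \<times> UNIV" "as ! j = word u w" using Suc.prems(3)[of j] by (auto simp: Mon_def)
    with words[of w] show ?case by (metis list_update_id)
  qed
  \<comment> \<open>Linearity passes from words to arbitrary arguments in the first \<open>j\<close>
    positions.\<close>
  have step2: "cong n (P as) 0" if "j \<le> n" "length as = n" "\<And>l. j \<le> l \<Longrightarrow> l < n \<Longrightarrow> as ! l \<in> Mon" for j as
    using that
  proof (induction j arbitrary: as)
    case 0
    then show ?case by (intro step1[of n]) auto
  next
    case (Suc j)
    have j: "j < n" using Suc.prems by simp
    have "as ! j \<in> span Mon" unfolding Mon_def words_span[OF u] by simp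
    then have "cong n (P (as[j := as ! j])) 0"
    proof (induction rule: span_induct)
      case (step v)
      show ?case by (rule Suc.IH) (use Suc.prems step in \<open>auto simp: nth_list_update\<close>)
    next
      case base
      show ?case
        unfolding subspace_def mem_Collect_eq
      proof (intro conjI ballI allI, unfold mem_Collect_eq)
        show "cong n (P (as[j := x + y])) 0" if "cong n (P (as[j := x])) 0" "cong n (P (as[j := y])) 0" for x y
          using cong_trans[OF ax_linD(1)[OF P(2) Suc.prems(2) j] cong_add[OF that]] by simp
        show s: "cong n (P (as[j := scale r x])) 0" if "cong n (P (as[j := x])) 0" for r x
          using cong_trans[OF ax_linD(2)[OF P(2) Suc.prems(2) j] cong_Sc[OF that]] by (simp add: additive.zero[OF additive_Sc])
        show "cong n (P (as[j := 0])) 0"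
        proof -
          have "cong n (P (as[j := scale 0 0])) (Sc 0 (P (as[j := 0])))" by (rule ax_linD(2)[OF P(2) Suc.prems(2) j])
          then show ?thesis by (simp add: Sc_eq_smul)
        qed
      qed
    qed
    then show ?case by simp
  qed
  show ?thesis by (rule step2[of n]) (use as in auto)
qed

section \<open>Eigenvectors of the weight operator and reduction to two eigenvalues\<close>

sublocale mv: vector_space Sc
  by unfold_locales
    (simp_all add: Sc_eq_smul mp.scale_right_distrib single_add mp.scale_left_distrib mult_single smul_one flip: smul_mult)

lemma span_UN_finite:
  assumes "F \<in> mv.span (\<Union>s. X s)"
  shows "\<exists>\<Omega>. finite \<Omega> \<and> F \<in> mv.span (\<Union>s\<in>\<Omega>. X s)"
  using assms
proof (induction rule: mv.span_induct_alt)
  case base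
  then show ?case by (auto intro: mv.span_zero)
next
  case (step c x y)
  then obtain s \<Omega> where s: "x \<in> X s" "finite \<Omega>" "y \<in> mv.span (\<Union>s\<in>\<Omega>. X s)" by blast
  have "y \<in> mv.span (\<Union>s\<in>insert s \<Omega>. X s)" using s(3) mv.span_mono[of "\<Union>s\<in>\<Omega>. X s" "\<Union>s\<in>insert s \<Omega>. X s"] by auto
  moreover have "x \<in> mv.span (\<Union>s\<in>insert s \<Omega>. X s)" using s(1) by (auto intro: mv.span_base)
  ultimately show ?case using s(2) by (intro exI[of _ "insert s \<Omega>"]) (auto intro: mv.span_add mv.span_scale)
qed

lemma additive_shifted_weight: "additive (shifted_weight L n s)"
  unfolding shifted_weight_def by (intro additive_diff additive_weight_op additive_Sc)

lemma weight_op_Sc: "weight_op L n (Sc r F) = Sc r (weight_op L n F)"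
proof -
  have m: "modes 1 L (Sc r F) = Sc r (modes 1 L F)"
    by (rule additive_eqI[OF additive_comp[OF additive_modes additive_Sc] additive_comp[OF additive_Sc additive_modes]])
      (simp add: modes_single act_scale_right coeff_map_poly)
  have d: "smul (lam i) (der i (Sc r F)) = Sc r (smul (lam i) (der i F))" for i
  proof -
    have "der i (Sc r F) = Sc r (der i F)"
      by (rule additive_eqI[OF additive_comp[OF additive_der additive_Sc] additive_comp[OF additive_Sc additive_der]])
        (simp add: der_single mult.commute)
    then show ?thesis by (simp add: Sc_smul)
  qed
  show ?thesis
    by (simp only: weight_op_def m d additive.add[OF additive_Sc] additive.sum[OF additive_Sc])
qed

text \<open>
  The cohomology is finite-dimensional if \<open>M[\<lambda>\<^sub>0, \<dots>, \<lambda>\<^sub>n\<^sub>-\<^sub>1]\<close> is spanned by finite sets of eigenvectors of the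
  weight operator, one for each eigenvalue: up to a coboundary, the values of a cocycle on generators
  lie in the sum of two weight spaces.
\<close>

lemma finite_dim_of_weight_spaces:
  assumes L: "L \<in> part 0" and L0: "\<And>a. coeff (br L a) 0 = D a" and LM: "\<And>m. coeff (act L m) 0 = DM m"
    and u: "differential_polynomials N par u" and \<Delta>: "\<And>i. i < N \<Longrightarrow> coeff (br L (u i)) 1 = scale (\<Delta> i) (u i)"
    and X_fin: "\<And>s. finite (X s)"
    and X_eig: "\<And>s x. x \<in> X s \<Longrightarrow> weight_op L n x = Sc s x" and X_span: "lampoly n \<subseteq> mv.span (\<Union>s. X s)"
  shows "finite_dim_cohomology n"
  unfolding finite_dim_cohomology_def
proof
  fix q
  \<comment> \<open>The tuples of generators at which cochains are tested; \<open>\<delta>\<close>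
    is the total weight of a tuple.\<close>
  define II where "II = {I. length I = n \<and> set I \<subseteq> {..<N}}"
  have II: "finite II"
    unfolding II_def using finite_lists_length_eq[of "{..<N}" n] by (simp add: conj_commute)
  define \<delta> where "\<delta> = (\<lambda>I. \<Sum>i<n. \<Delta> (I ! i))"
  \<comment> \<open>Possible values at the tuple \<open>I\<close> when the eigenvalues of
    \<open>T\<close> lie in \<open>\<Omega>\<close>: an eigenvalue \<open>\<tau>\<close> means
    weight \<open>\<tau> + \<delta> I\<close> of the value.\<close>
  define E where "E = (\<lambda>I \<Omega>. mv.span (\<Union>\<tau>\<in>\<Omega>. X (\<tau> + \<delta> I)))"
  define H where "H = (\<lambda>\<Omega> P. \<forall>I\<in>II. \<exists>F\<in>E I \<Omega>. cong n F (P (map u I)))"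
  have E_Sc: "F \<in> E I \<Omega> \<Longrightarrow> Sc r F \<in> E I \<Omega>" for F I \<Omega> r
    unfolding E_def by (rule mv.span_scale)
  have val: "P (map u I) \<in> lampoly n" if "cocyc n q P" "I \<in> II" for P I
    using that ax_valD[OF axD(1)] by (auto simp: cocyc_def II_def)
  have csw: "cong n (shifted_weight L n s F) (shifted_weight L n s G)" if "cong n F G" for s F G
    unfolding shifted_weight_def by (intro cong_diff cong_weight_op[OF LM] cong_Sc that)
  have start: "\<exists>\<Omega>. finite \<Omega> \<and> H \<Omega> P" if P: "cocyc n q P" for P
  proof -
    have "\<exists>\<Omega>. finite \<Omega> \<and> P (map u I) \<in> mv.span (\<Union>s\<in>\<Omega>. X s)" if "I \<in> II" for I
      using span_UN_finite X_span val[OF P that] by blast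
    then obtain W where W: "\<And>I. I \<in> II \<Longrightarrow> finite (W I) \<and> P (map u I) \<in> mv.span (\<Union>s\<in>W I. X s)" by metis
    define \<Omega> where "\<Omega> = (\<Union>I\<in>II. (\<lambda>s. s - \<delta> I) ` W I)"
    have "finite \<Omega>" unfolding \<Omega>_def using II W by blast
    moreover have "H \<Omega> P"
      unfolding H_def
    proof
      fix I assume I: "I \<in> II"
      have "(\<Union>s\<in>W I. X s) \<subseteq> (\<Union>\<tau>\<in>\<Omega>. X (\<tau> + \<delta> I))"
      proof
        fix x assume "x \<in> (\<Union>s\<in>W I. X s)"
        then obtain s where s: "s \<in> W I" "x \<in> X s" by blast
        then have "s - \<delta> I \<in> \<Omega>" "x \<in> X ((s - \<delta> I) + \<delta> I)" using I by (auto simp: \<Omega>_def)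
        then show "x \<in> (\<Union>\<tau>\<in>\<Omega>. X (\<tau> + \<delta> I))" by blast
      qed
      then have "P (map u I) \<in> E I \<Omega>" unfolding E_def using W[OF I] mv.span_mono by blast
      then show "\<exists>F\<in>E I \<Omega>. cong n F (P (map u I))" by blast
    qed
    ultimately show ?thesis by blast
  qed
  \<comment> \<open>Induction on the eigenvalues other than 0 and 1; each is removed at the cost of
    a coboundary.\<close>
  have reduce: "\<exists>R B. cocyc n q R \<and> H {0, 1} R \<and> cocyc n q B \<and> cobound n q B \<and> (\<forall>as. length as = n \<longrightarrow> cong n (P as) (R as + B as))"
    if "finite \<Omega>" "0 \<notin> \<Omega>" "1 \<notin> \<Omega>" "cocyc n q P" "H ({0, 1} \<union> \<Omega>) P" for \<Omega> P
    using that
  proof (induction \<Omega> arbitrary: P rule: finite_induct)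
    case empty
    \<comment> \<open>Its multiple by 0 serves as the zero coboundary.\<close>
    obtain Q where Q: "cocyc n q Q" "cobound n q Q"
      using weight_operator_step[OF L L0 LM empty.prems(3)] by metis
    have "Sc 0 F = 0" for F by (rule mv.scale_zero_left)
    then show ?case
      using empty.prems cocyc_Sc[OF Q(1), of 0] cobound_Sc[OF Q(2), of 0]
      by (intro exI[of _ P] exI[of _ "\<lambda>as. Sc 0 (Q as)"]) simp
  next
    case (insert w \<Omega>)
    \<comment> \<open>The value of \<open>T (T - 1)\<close> at the eigenvalue \<open>w\<close>,
      nonzero because \<open>w\<close> is neither 0 nor 1. Hence \<open>P2\<close>, which is
      \<open>T (T - 1) - c\<close> applied to \<open>P\<close>, has lost the eigenvalue
      \<open>w\<close>; as \<open>Q\<close> is a coboundary, \<open>P\<close> equals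
      \<open>- (1 / c)\<close> times \<open>P2\<close> up to a coboundary.\<close>
    define c where "c = w * (w - 1)"
    have c: "c \<noteq> 0" using insert.prems by (auto simp: c_def)
    obtain Q where Q: "cocyc n q Q" "cobound n q Q"
      "\<forall>as \<delta>. length as = n \<longrightarrow> (\<forall>i<n. coeff (br L (as ! i)) 1 = scale (\<delta> i) (as ! i)) \<longrightarrow>
        cong n (Q as) (shifted_weight L n (\<Sum>i<n. \<delta> i) (shifted_weight L n (\<Sum>i<n. \<delta> i) (P as) - P as))"
      using weight_operator_step[OF L L0 LM insert.prems(3)] by (elim exE conjE)
    define P2 where "P2 = (\<lambda>as. Q as + Sc (- c) (P as))"
    have P2: "cocyc n q P2"
      unfolding P2_def by (intro cocyc_add cocyc_Sc Q insert.prems)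
    have "H ({0, 1} \<union> \<Omega>) P2"
      unfolding H_def
    proof
      fix I assume I: "I \<in> II"
      obtain F where F: "F \<in> E I ({0, 1} \<union> insert w \<Omega>)" "cong n F (P (map u I))"
        using insert.prems(4) I by (auto simp: H_def)
      let ?W = "shifted_weight L n (\<delta> I)"
      define Z where "Z = (\<lambda>F. ?W (?W F - F) + Sc (- c) F)"
      have Zadd: "additive Z"
        unfolding Z_def
        by (intro additive_add additive_Sc additive_comp[OF additive_shifted_weight] additive_diff additive_shifted_weight additive_id)
      have ZSc: "Z (Sc r F) = Sc r (Z F)" for r F
        by (simp add: Z_def shifted_weight_def weight_op_Sc additive.diff[OF additive_weight_op] mv.scale_right_diff_distrib
          mv.scale_right_distrib mult.commute)
      have "cong n (Q (map u I)) (?W (?W (P (map u I)) - P (map u I)))"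
        unfolding \<delta>_def
      proof (rule Q(3)[rule_format])
        show "length (map u I) = n" using I by (simp add: II_def)
        fix i assume i: "i < n"
        then have "I ! i \<in> set I" using I by (simp add: II_def)
        then have "I ! i < N" using I by (auto simp: II_def)
        with \<Delta> i I show "coeff (br L (map u I ! i)) 1 = scale (\<Delta> (I ! i)) (map u I ! i)" by (simp add: II_def)
      qed
      from cong_add[OF this cong_refl]
      have "cong n (P2 (map u I)) (Z (P (map u I)))" unfolding P2_def Z_def .
      moreover have "cong n (Z F) (Z (P (map u I)))"
        unfolding Z_def by (intro cong_add csw cong_diff cong_Sc F)
      ultimately have "cong n (Z F) (P2 (map u I))" using cong_trans cong_sym by blast
      moreover have "Z F \<in> E I ({0, 1} \<union> \<Omega>)"
        using F(1) unfolding E_def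
      proof (induction rule: mv.span_induct_alt)
        case base
        then show ?case by (simp add: additive.zero[OF Zadd] mv.span_zero)
      next
        case (step r x y)
        then obtain \<tau> where \<tau>: "\<tau> \<in> {0, 1} \<union> insert w \<Omega>" "x \<in> X (\<tau> + \<delta> I)" by blast
        have Wx: "?W (Sc r x) = Sc r (Sc \<tau> x)" for r
          using X_eig[OF \<tau>(2)] by (simp add: shifted_weight_def weight_op_Sc mv.scale_left_distrib mv.scale_right_distrib mult.commute)
        then have "?W x = Sc \<tau> x" using Wx[of 1] by simp
        then have Zx: "Z x = Sc (\<tau> * (\<tau> - 1) - c) x"
          by (simp add: Z_def additive.diff[OF additive_shifted_weight] Wx algebra_simps mv.scale_left_diff_distrib mv.scale_left_distrib)
        have "Z x \<in> mv.span (\<Union>\<tau>\<in>{0, 1} \<union> \<Omega>. X (\<tau> + \<delta> I))"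
        proof (cases "\<tau> = w")
          case True
          then show ?thesis by (simp add: Zx c_def mv.span_zero)
        next
          case False
          then show ?thesis unfolding Zx using \<tau> by (intro mv.span_scale mv.span_base) auto
        qed
        then show ?case
          using step by (auto simp: additive.add[OF Zadd] ZSc intro: mv.span_add mv.span_scale)
      qed
      ultimately show "\<exists>F\<in>E I ({0, 1} \<union> \<Omega>). cong n F (P2 (map u I))" by blast
    qed
    with insert.IH[OF _ _ P2] insert.prems obtain R B where RB: "cocyc n q R" "H {0, 1} R" "cocyc n q B" "cobound n q B"
      "\<And>as. length as = n \<Longrightarrow> cong n (P2 as) (R as + B as)" by auto
    let ?R = "\<lambda>as. Sc (- (1 / c)) (R as)" and ?B = "\<lambda>as. Sc (1 / c) (Q as) + Sc (- (1 / c)) (B as)"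
    have "H {0, 1} ?R"
      unfolding H_def using RB(2) E_Sc cong_Sc unfolding H_def by blast
    moreover have "cong n (P as) (?R as + ?B as)" if "length as = n" for as
    proof -
      have "P as = Sc (1 / c) (Q as) + Sc (- (1 / c)) (P2 as)"
        using c by (simp add: P2_def mv.scale_right_distrib mv.scale_right_diff_distrib)
      also have "cong n \<dots> (Sc (1 / c) (Q as) + Sc (- (1 / c)) (R as + B as))"
        by (intro cong_add cong_refl cong_Sc RB(5) that)
      finally show ?thesis by (simp add: mv.scale_right_distrib algebra_simps)
    qed
    ultimately show ?case
      by (intro exI[of _ ?R] exI[of _ ?B] conjI allI impI cocyc_add cocyc_Sc cobound_add cobound_Sc RB Q) auto
  qed
  \<comment> \<open>Families of values indexed by tuples of generators, with pointwise
    operations.\<close>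
  interpret fv: vector_space "\<lambda>r f I. Sc r (f I)"
    by unfold_locales (auto simp: fun_eq_iff mv.scale_right_distrib mv.scale_left_distrib)
  \<comment> \<open>The families with eigenvalues 0 and 1 that are realised by a cocycle. They lie
    in the span of the finite set \<open>G\<close>, and a finite spanning subset of \<open>K\<close>
    yields the required cocycles.\<close>
  define K where "K = {g. (\<forall>I. if I \<in> II then g I \<in> E I {0, 1} else g I = 0) \<and> (\<exists>R. cocyc n q R \<and> (\<forall>I\<in>II. cong n (g I) (R (map u I))))}"
  define G where "G = (\<Union>I\<in>II. (\<lambda>x J. if J = I then x else 0) ` (\<Union>\<tau>\<in>{0, 1}. X (\<tau> + \<delta> I)))"
  have "finite G" unfolding G_def using II X_fin by auto
  moreover have "K \<subseteq> fv.span G"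
  proof
    fix g assume g: "g \<in> K"
    \<comment> \<open>Families supported at a single tuple; every member of \<open>K\<close> is a
      finite sum of these.\<close>
    have one: "(\<lambda>J. if J = I then x else 0) \<in> fv.span G" if I: "I \<in> II" and x: "x \<in> E I {0, 1}" for I x
      using x unfolding E_def
    proof (induction rule: mv.span_induct_alt)
      case base
      have "(\<lambda>J. if J = I then 0 else 0 :: 'm mpoly) = 0" by auto
      then show ?case using fv.span_zero by simp
    next
      case (step c x y)
      have "(\<lambda>J. if J = I then x else 0) \<in> G" unfolding G_def using I step(1) by blast
      then have "(\<lambda>J. Sc c (if J = I then x else 0)) + (\<lambda>J. if J = I then y else 0) \<in> fv.span G"
        by (rule fv.span_add[OF fv.span_scale[OF fv.span_base] step(2)])
      moreover have "(\<lambda>J. Sc c (if J = I then x else 0)) + (\<lambda>J. if J = I then y else 0) = (\<lambda>J. if J = I then Sc c x + y else 0)"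
        by (auto simp: fun_eq_iff)
      ultimately show ?case by simp
    qed
    have "g = (\<Sum>I\<in>II. (\<lambda>J. if J = I then g I else 0))"
    proof
      fix J
      have "(\<Sum>I\<in>II. (\<lambda>J. if J = I then g I else 0)) J = (\<Sum>I\<in>II. if J = I then g I else 0)"
        by (induction II rule: infinite_finite_induct) auto
      then show "g J = (\<Sum>I\<in>II. (\<lambda>J. if J = I then g I else 0)) J"
        using g II by (auto simp: K_def)
    qed
    also have "\<dots> \<in> fv.span G"
      by (intro fv.span_sum one) (use g in \<open>auto simp: K_def\<close>)
    finally show "g \<in> fv.span G" .
  qed
  ultimately obtain Bs where Bs: "finite Bs" "Bs \<subseteq> K" "K \<subseteq> fv.span Bs"
    using fv.finite_spanning_subset by metis
  have "\<forall>b\<in>Bs. \<exists>R. cocyc n q R \<and> (\<forall>I\<in>II. cong n (b I) (R (map u I)))"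
    using Bs(2) by (auto simp: K_def)
  then obtain R where R: "\<And>b. b \<in> Bs \<Longrightarrow> cocyc n q (R b)" "\<And>b I. b \<in> Bs \<Longrightarrow> I \<in> II \<Longrightarrow> cong n (b I) (R b (map u I))"
    by metis
  have Rax: "ax (cong n) n n q (R b)" if "b \<in> Bs" for b using R(1)[OF that] by (simp add: cocyc_def)
  let ?S = "(\<lambda>b. coset n (R b)) ` Bs"
  show "\<exists>S. finite S \<and> S \<subseteq> cocycles n q \<and> (\<forall>Y\<in>cocycles n q. \<exists>c. \<exists>B\<in>coboundaries n q. Y = cochain_add n (lincomb n c S) B)"
  proof (intro exI[of _ ?S] conjI ballI)
    show "finite ?S" using Bs by simp
    show "?S \<subseteq> cocycles n q" using coset_cocycles R(1) by blast
    fix Y assume Y: "Y \<in> cocycles n q"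
    define P where "P = (\<lambda>as. rep (Y as))"
    have P: "cocyc n q P" "coset n P = Y" unfolding P_def by (rule cocycles_rep[OF Y])+
    obtain \<Omega> where \<Omega>: "finite \<Omega>" "H \<Omega> P" using start[OF P(1)] by blast
    have "H ({0, 1} \<union> (\<Omega> - {0, 1})) P"
      unfolding H_def
    proof
      fix I assume "I \<in> II"
      moreover have "E I \<Omega> \<subseteq> E I ({0, 1} \<union> (\<Omega> - {0, 1}))"
        unfolding E_def by (rule mv.span_mono) auto
      ultimately show "\<exists>F\<in>E I ({0, 1} \<union> (\<Omega> - {0, 1})). cong n F (P (map u I))"
        using \<Omega>(2) unfolding H_def by blast
    qed
    then obtain R0 B where RB: "cocyc n q R0" "H {0, 1} R0" "cocyc n q B" "cobound n q B"
      "\<And>as. length as = n \<Longrightarrow> cong n (P as) (R0 as + B as)"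
      using reduce[of "\<Omega> - {0, 1}" P] \<Omega>(1) P(1) by auto
    obtain g0 where g0: "\<And>I. I \<in> II \<Longrightarrow> g0 I \<in> E I {0, 1} \<and> cong n (g0 I) (R0 (map u I))"
      using RB(2) unfolding H_def by metis
    define g where "g = (\<lambda>I. if I \<in> II then g0 I else 0)"
    have "g \<in> K" unfolding K_def using g0 RB(1) by (auto simp: g_def)
    then have "g \<in> fv.span Bs" using Bs(3) by blast
    then obtain d where d: "g = (\<Sum>b\<in>Bs. (\<lambda>I. Sc (d b) (b I)))"
      unfolding fv.span_finite[OF Bs(1)] by auto
    have gI: "g I = (\<Sum>b\<in>Bs. Sc (d b) (b I))" for I
      unfolding d by (induction Bs rule: infinite_finite_induct) auto
    define LR where "LR = (\<lambda>as. \<Sum>b\<in>Bs. Sc (d b) (R b as))"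
    have ax_sum: "ax (cong n) n n q (\<lambda>as. \<Sum>b\<in>A. Sc (d b) (R b as))" if "A \<subseteq> Bs" for A
      using finite_subset[OF that Bs(1)] that
    proof (induction A rule: finite_induct)
      case empty
      have "(\<lambda>as. Sc 0 (P as)) = (\<lambda>as. 0)" by (auto simp: mv.scale_zero_left)
      then show ?case using ax_Sc[of n q P 0] P(1) by (simp add: cocyc_def)
    next
      case (insert b A)
      then show ?case using ax_add[OF ax_Sc[OF Rax[of b], of "d b"]] by simp
    qed
    then have LRax: "ax (cong n) n n q LR" unfolding LR_def by blast
    have R0ax: "ax (cong n) n n q R0" and Bax: "ax (cong n) n n q B" using RB by (simp_all add: cocyc_def)
    have LRR: "cong n (LR as) (R0 as)" if as: "length as = n" for as
    proof -
      \<comment> \<open>The two cocycles agree on generators by the choice of \<open>d\<close>, so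
        their difference vanishes everywhere.\<close>
      have "cong n (LR as + Sc (- 1) (R0 as)) 0"
      proof (rule zero_on_generators[OF u ax_add[OF LRax ax_Sc[OF R0ax, of "- 1"]] _ as])
        fix I assume "length I = n" "set I \<subseteq> {..<N}"
        then have I: "I \<in> II" by (simp add: II_def)
        have "cong n (LR (map u I)) (g I)"
          unfolding LR_def gI by (intro cong_sum cong_Sc cong_sym[OF R(2)] I)
        also have "cong n (g I) (R0 (map u I))" using g0 I by (simp add: g_def)
        finally have "cong n (LR (map u I)) (R0 (map u I))" .
        from cong_diff[OF this cong_refl[of n "R0 (map u I)"]]
        show "cong n (LR (map u I) + Sc (- 1) (R0 (map u I))) 0" by (simp add: mv.scale_minus_left)
      qed
      from cong_add[OF this cong_refl[of n "R0 as"]] show ?thesis by (simp add: mv.scale_minus_left)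
    qed
    have "Y = coset n (\<lambda>as. LR as + B as)"
      unfolding P(2)[symmetric]
    proof (rule coset_cong)
      fix as :: "'v list" assume as: "length as = n"
      have "cong n (P as) (R0 as + B as)" by (rule RB(5)[OF as])
      also have "cong n \<dots> (LR as + B as)" by (intro cong_add cong_sym[OF LRR] cong_refl as)
      finally show "P as \<in> lampoly n \<and> cong n (P as) (LR as + B as)"
        using P(1) as ax_valD[OF axD(1)] unfolding cocyc_def by blast
    qed
    also have "\<dots> = cochain_add n (coset n LR) (coset n B)"
      by (rule cochain_add_coset[symmetric]) (use axD(1)[OF LRax] axD(1)[OF Bax] in auto)
    also have "coset n LR = lincomb n (\<lambda>Y. \<Sum>b\<in>{b \<in> Bs. coset n (R b) = Y}. d b) ?S"
      unfolding LR_def by (rule lincomb_coset[symmetric]) (use Bs axD(1)[OF Rax] in auto)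
    finally show "\<exists>c. \<exists>B\<in>coboundaries n q. Y = cochain_add n (lincomb n c ?S) B"
      using coset_coboundaries[OF Bax RB(4)] by blast
  qed
qed

section \<open>Weights of words and of generators of the module\<close>

lemma weight_br_D: "(\<And>a. coeff (br L a) 0 = D a) \<Longrightarrow> coeff (br L a) 1 = scale r a \<Longrightarrow> coeff (br L (D a)) 1 = scale (r + 1) (D a)"
  using D_even by (simp add: br_D_right lam_plus_def coeff_map_poly additive.zero[OF additive_D] even_endo_def scale_left_distrib)

lemma weight_br_D_pow: "(\<And>a. coeff (br L a) 0 = D a) \<Longrightarrow> coeff (br L a) 1 = scale r a \<Longrightarrow> coeff (br L ((D ^^ k) a)) 1 = scale (r + of_nat k) ((D ^^ k) a)"
proof (induction k)
  case (Suc k)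
  from weight_br_D[OF Suc.prems(1) Suc.IH[OF Suc.prems]] show ?case by (simp add: add_ac)
qed simp

lemma weight_act_DM: "(\<And>m. coeff (act L m) 0 = DM m) \<Longrightarrow> coeff (act L m) 1 = scaleM r m \<Longrightarrow> coeff (act L (DM m)) 1 = scaleM (r + 1) (DM m)"
  using DM_even by (simp add: act_D_right lam_plus_def coeff_map_poly additive.zero[OF additive_DM] M.even_endo_def M.scale_left_distrib)

lemma weight_act_DM_pow: "(\<And>m. coeff (act L m) 0 = DM m) \<Longrightarrow> coeff (act L m) 1 = scaleM r m \<Longrightarrow> coeff (act L ((DM ^^ k) m)) 1 = scaleM (r + of_nat k) ((DM ^^ k) m)"
proof (induction k)
  case (Suc k)
  from weight_act_DM[OF Suc.prems(1) Suc.IH[OF Suc.prems]] show ?case by (simp add: add_ac)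
qed simp

text \<open>\<open>L\<^sub>(\<^sub>1\<^sub>)\<close> is an even derivation, so weights add under
  multiplication.\<close>

lemma weight_br_mult:
  assumes "b \<in> part p" "c \<in> part q" "coeff (br L b) 1 = scale r b" "coeff (br L c) 1 = scale s c"
  shows "coeff (br L (b * c)) 1 = scale (r + s) (b * c)"
proof -
  have cp: "coeff (psign p P) k = psign p (coeff P k)" for p k and P :: "'v poly" by (cases p) (simp_all add: psign_def)
  have "coeff (br L (b * c)) 1 = scale r b * c + psign (p * q) (scale s c * b)"
    by (simp only: br_leibniz[OF assms(1,2)] coeff_add cp coeff_map_poly mult_zero_left assms)
  also have "psign (p * q) (scale s c * b) = scale s (psign (p * q) (c * b))"
    by (cases "p * q") (simp_all add: psign_def scale_mult_left)
  also have "\<dots> = scale s (b * c)"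
    using mult_supercomm[OF assms(1,2)] by simp
  finally show ?thesis by (simp add: scale_mult_left scale_left_distrib distrib_right)
qed

lemma weight_br_one: "coeff (br L 1) 1 = scale 0 1"
proof -
  have "br L (1 * 1) = map_poly (\<lambda>x. x * 1) (br L 1) + psign (0 * 0) (map_poly (\<lambda>x. x * 1) (br L 1))"
    by (rule br_leibniz[OF one_part one_part])
  then have "br L 1 = 0" by simp
  then show ?thesis by simp
qed

lemma weight_word:
  assumes u: "differential_polynomials N par u" and L0: "\<And>a. coeff (br L a) 0 = D a"
    and \<Delta>: "\<And>i. i < N \<Longrightarrow> coeff (br L (u i)) 1 = scale (\<Delta> i) (u i)" and w: "set w \<subseteq> {..<N} \<times> UNIV"
  shows "coeff (br L (word u w)) 1 = scale (wsum \<Delta> w) (word u w)"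
  using w
proof (induction w)
  case Nil
  then show ?case using weight_br_one by (simp add: word_simps wsum_def)
next
  case (Cons a w)
  then obtain i k where a: "a = (i, k)" "i < N" by (cases a) auto
  obtain p where p: "word u w \<in> part p" using word_part[OF u, of w] Cons.prems by auto
  have "coeff (br L ((D ^^ k) (u i) * word u w)) 1 = scale (\<Delta> i + of_nat k + wsum \<Delta> w) ((D ^^ k) (u i) * word u w)"
    by (rule weight_br_mult[OF D_pow_part[OF generators_part[OF u a(2)]] p weight_br_D_pow[OF L0 \<Delta>[OF a(2)]]])
      (use Cons in auto)
  then show ?case by (simp add: a word_simps wsum_def)
qed

lemma weight_act_dot:
  assumes "L \<in> part 0" "b \<in> part p" "coeff (br L b) 1 = scale r b" "coeff (act L m) 1 = scaleM s m"
  shows "coeff (act L (dot b m)) 1 = scaleM (r + s) (dot b m)"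
proof -
  have "coeff (\<Sum>k\<le>degree (br L b). monom (dot (coeff (br L b) k) m) k) 1 = dot (coeff (br L b) 1) m"
    by (simp add: coeff_sum coeff_eq_0 additive.zero[OF additive_dot_left])
  then show ?thesis
    using act_dot[OF assms(1,2), of m] assms(3,4)
    by (simp add: coeff_map_poly additive.zero[OF additive_dot] dot_scale_left dot_scale_right M.scale_left_distrib)
qed

lemma weight_op_single:
  assumes "coeff (act L m) 1 = scaleM r m"
  shows "weight_op L n (Poly_Mapping.single e m) = Sc (of_nat ((\<Sum>i<n. Poly_Mapping.lookup e i) + n) + r) (Poly_Mapping.single e m)"
proof -
  have sd: "smul (lam i) (der i (Poly_Mapping.single e m)) = Sc (of_nat (Poly_Mapping.lookup e i)) (Poly_Mapping.single e m)" for i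
  proof (cases "Poly_Mapping.lookup e i = 0")
    case False
    then have "e - var i + var i = e"
      by (intro poly_mapping_eqI) (auto simp: lookup_minus lookup_add lookup_single when_def)
    then show ?thesis by (simp add: der_single smul_lam_single)
  qed (simp add: der_single)
  have "(\<Sum>i<n. Poly_Mapping.single e m + smul (lam i) (der i (Poly_Mapping.single e m)))
    = (\<Sum>i<n. Sc (of_nat (Poly_Mapping.lookup e i + 1)) (Poly_Mapping.single e m))"
    by (rule sum.cong) (simp_all only: sd of_nat_add of_nat_1 mv.scale_left_distrib mv.scale_one add.commute)
  also have "\<dots> = Sc (of_nat ((\<Sum>i<n. Poly_Mapping.lookup e i) + n)) (Poly_Mapping.single e m)"
    by (simp only: mv.scale_sum_left[symmetric] of_nat_sum[symmetric] sum.distrib) simp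
  moreover have "modes 1 L (Poly_Mapping.single e m) = Sc r (Poly_Mapping.single e m)"
    by (simp only: modes_single assms map_single M.scale_zero_right)
  ultimately show ?thesis
    by (simp only: weight_op_def mv.scale_left_distrib add.commute)
qed

lemma span_dot:
  assumes "a \<in> span A" "m \<in> M.span B"
  shows "dot a m \<in> M.span {dot x y | x y. x \<in> A \<and> y \<in> B}"
proof -
  have 1: "dot x m \<in> M.span {dot x y | x y. x \<in> A \<and> y \<in> B}" if x: "x \<in> A" for x
    using assms(2)
  proof (induction rule: M.span_induct_alt)
    case (step c y z)
    then have "dot x y \<in> {dot x y | x y. x \<in> A \<and> y \<in> B}" using x by blast
    from M.span_add[OF M.span_scale[OF M.span_base[OF this], of c] step(2)]
    show ?case by (simp add: dot_add_right dot_scale_right)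
  qed (simp add: additive.zero[OF additive_dot] M.span_zero)
  show ?thesis
    using assms(1)
  proof (induction rule: span_induct_alt)
    case (step c x z)
    from M.span_add[OF M.span_scale[OF 1[OF step(1)], of c] step(2)]
    show ?case by (simp add: dot_add_left dot_scale_left)
  qed (simp add: additive.zero[OF additive_dot_left] M.span_zero)
qed

lemma span_DM_pow:
  assumes "m \<in> M.span B" shows "(DM ^^ k) m \<in> M.span ((DM ^^ k) ` B)"
proof -
  have add: "(DM ^^ k) (x + y) = (DM ^^ k) x + (DM ^^ k) y" for x y
    using additive_funpow[OF additive_DM, of k] by (simp add: additive_def)
  have scale: "(DM ^^ k) (scaleM r x) = scaleM r ((DM ^^ k) x)" for r x
    using DM_even by (induction k) (simp_all add: M.even_endo_def)
  have zero: "(DM ^^ k) 0 = 0" using scale[of 0 0] by simp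
  show ?thesis
    using assms by (induction rule: M.span_induct_alt) (auto simp: add scale zero intro: M.span_zero M.span_add M.span_scale M.span_base)
qed

text \<open>By diagonalizability each generator is a finite sum of eigenvectors; all these
  eigenvectors together generate as well.\<close>

lemma finite_eigen_generators:
  assumes fg: differentially_finitely_generated and eig: "M.span {m. \<exists>\<Delta>. coeff (act L m) 1 = scaleM \<Delta> m} = UNIV"
    and u: "differential_polynomials N par u"
  shows "\<exists>\<Gamma>. finite \<Gamma> \<and> (\<forall>m\<in>\<Gamma>. \<exists>\<Delta>. coeff (act L m) 1 = scaleM \<Delta> m) \<and>
    M.span {dot (word u w) ((DM ^^ k) m) | w k m. set w \<subseteq> {..<N} \<times> UNIV \<and> m \<in> \<Gamma>} = UNIV"
proof -
  obtain r g where g: "\<And>m. \<exists>K (a :: nat \<Rightarrow> nat \<Rightarrow> 'v). m = (\<Sum>j<(r::nat). \<Sum>k\<le>K. dot (a j k) ((DM ^^ k) (g j)))"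
    using fg unfolding differentially_finitely_generated_def by blast
  let ?E = "{m. \<exists>\<Delta>. coeff (act L m) 1 = scaleM \<Delta> m}"
  have "\<exists>T. finite T \<and> T \<subseteq> ?E \<and> g j \<in> M.span T" for j
  proof -
    have "g j \<in> M.span ?E" using eig by simp
    then obtain t c where t: "g j = (\<Sum>a\<in>t. scaleM (c a) a)" "finite t" "t \<subseteq> ?E"
      by (subst (asm) M.span_explicit) blast
    have "g j \<in> M.span t"
      unfolding t(1) by (intro M.span_sum M.span_scale M.span_base)
    with t(2,3) show ?thesis by blast
  qed
  then have "\<forall>j. \<exists>T. finite T \<and> T \<subseteq> ?E \<and> g j \<in> M.span T" ..
  from choice[OF this] obtain T where "\<forall>j. finite (T j) \<and> T j \<subseteq> ?E \<and> g j \<in> M.span (T j)" by (rule exE)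
  note T = spec[OF this]
  define \<Gamma> where "\<Gamma> = (\<Union>j<r. T j)"
  let ?B = "{dot (word u w) ((DM ^^ k) m) | w k m. set w \<subseteq> {..<N} \<times> UNIV \<and> m \<in> \<Gamma>}"
  have "dot a ((DM ^^ k) (g j)) \<in> M.span ?B" if "j < r" for a k j
  proof -
    have "T j \<subseteq> \<Gamma>" using that by (auto simp: \<Gamma>_def)
    then have "g j \<in> M.span \<Gamma>" using T[of j] M.span_mono by blast
    then have "dot a ((DM ^^ k) (g j)) \<in> M.span {dot x y | x y. x \<in> word u ` {w. set w \<subseteq> {..<N} \<times> UNIV} \<and> y \<in> (DM ^^ k) ` \<Gamma>}"
      by (intro span_dot span_DM_pow) (simp_all add: words_span[OF u])
    moreover have "{dot x y | x y. x \<in> word u ` {w. set w \<subseteq> {..<N} \<times> UNIV} \<and> y \<in> (DM ^^ k) ` \<Gamma>} \<subseteq> ?B" by blast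
    ultimately show ?thesis using M.span_mono by blast
  qed
  then have "m \<in> M.span ?B" for m
    using g[of m] by (metis (no_types, lifting) M.span_sum lessThan_iff)
  moreover have "finite \<Gamma>" "\<forall>m\<in>\<Gamma>. \<exists>\<Delta>. coeff (act L m) 1 = scaleM \<Delta> m"
    using T by (auto simp: \<Gamma>_def)
  ultimately show ?thesis by blast
qed

text \<open>The rational and the real form of positivity are treated together: \<open>\<phi>\<close>
  is an additive embedding, preserving 1, of an archimedean ordered field in which the weights
  \<open>\<omega>\<close> are positive.\<close>

lemma finite_dim_cohomology_of_positive_weights:
  fixes \<omega> :: "nat \<Rightarrow> 'k::archimedean_field" and \<phi> :: "'k \<Rightarrow> 'f"
  assumes L: "virasoro_element L" and u: "differential_polynomials N par u"
    and \<Delta>: "\<And>i. i < N \<Longrightarrow> has_conformal_weight L (u i) (\<Delta> i)"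
    and M: "conformal_module L" and fg: differentially_finitely_generated
    and \<phi>: "\<And>x y. \<phi> (x + y) = \<phi> x + \<phi> y" "\<phi> 1 = 1" "inj \<phi>"
    and \<omega>: "\<And>i. i < N \<Longrightarrow> \<omega> i > 0" "\<And>i. i < N \<Longrightarrow> \<Delta> i = \<phi> (\<omega> i)"
  shows "finite_dim_cohomology n"
proof -
  have Le: "L \<in> part 0" and L0: "\<And>a. coeff (br L a) 0 = D a" using L by (simp_all add: virasoro_element_def)
  have LM: "\<And>m. coeff (act L m) 0 = DM m" and eig: "M.span {m. \<exists>\<Delta>. coeff (act L m) 1 = scaleM \<Delta> m} = UNIV"
    using M by (simp_all add: conformal_module_def)
  have \<Delta>u: "coeff (br L (u i)) 1 = scale (\<Delta> i) (u i)" if "i < N" for i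
    using \<Delta>[OF that] by (simp add: has_conformal_weight_def)
  obtain \<Gamma> where \<Gamma>: "finite \<Gamma>" "\<And>m. m \<in> \<Gamma> \<Longrightarrow> \<exists>\<Delta>. coeff (act L m) 1 = scaleM \<Delta> m"
    "M.span {dot (word u w) ((DM ^^ k) m) | w k m. set w \<subseteq> {..<N} \<times> UNIV \<and> m \<in> \<Gamma>} = UNIV"
    using finite_eigen_generators[OF fg eig u] by blast
  obtain \<gamma> where \<gamma>: "\<And>m. m \<in> \<Gamma> \<Longrightarrow> coeff (act L m) 1 = scaleM (\<gamma> m) m" using \<Gamma>(2) by metis
  define A where "A = (\<lambda>s. {(e, w, k). Poly_Mapping.keys e \<subseteq> {..<n} \<and> set w \<subseteq> {..<N} \<times> UNIV \<and>
    of_nat ((\<Sum>i<n. Poly_Mapping.lookup e i) + n + k) + wsum \<Delta> w = s})"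
  \<comment> \<open>The eigenvectors are monomials in the variables times a word times a derivative
    of a generator \<open>m\<close>. The set \<open>A\<close> counts the weight without that of
    \<open>m\<close>, hence the index \<open>s - \<gamma> m\<close>.\<close>
  define X where "X = (\<lambda>s. \<Union>m\<in>\<Gamma>. (\<lambda>(e, w, k). Poly_Mapping.single e (dot (word u w) ((DM ^^ k) m))) ` A (s - \<gamma> m))"
  have wt: "coeff (act L (dot (word u w) ((DM ^^ k) m))) 1 = scaleM (wsum \<Delta> w + (\<gamma> m + of_nat k)) (dot (word u w) ((DM ^^ k) m))"
    if w: "set w \<subseteq> {..<N} \<times> UNIV" and m: "m \<in> \<Gamma>" for w k m
  proof -
    obtain p where "word u w \<in> part p" using word_part[OF u w] by blast
    then show ?thesis
      by (rule weight_act_dot[OF Le _ weight_word[OF u L0 \<Delta>u w] weight_act_DM_pow[OF LM \<gamma>[OF m]]])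
  qed
  show ?thesis
  proof (rule finite_dim_of_weight_spaces[where X = X, OF Le L0 LM u \<Delta>u])
    show "finite (X s)" for s
      unfolding X_def A_def using \<Gamma>(1) finite_weight[where \<phi> = \<phi>, OF \<phi> \<omega>] by (intro finite_UN_I finite_imageI) auto
    show "weight_op L n x = Sc s x" if xX: "x \<in> X s" for x s
    proof -
      obtain m e w k where x: "m \<in> \<Gamma>" "(e, w, k) \<in> A (s - \<gamma> m)" "x = Poly_Mapping.single e (dot (word u w) ((DM ^^ k) m))"
        using xX by (auto simp: X_def)
      then have w: "set w \<subseteq> {..<N} \<times> UNIV" and s: "of_nat ((\<Sum>i<n. Poly_Mapping.lookup e i) + n + k) + wsum \<Delta> w = s - \<gamma> m"
        by (auto simp: A_def)
      have "of_nat ((\<Sum>i<n. Poly_Mapping.lookup e i) + n) + (wsum \<Delta> w + (\<gamma> m + of_nat k)) = s"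
        using s by (simp add: algebra_simps)
      with weight_op_single[OF wt[OF w x(1)], of n e k] show ?thesis unfolding x(3) by simp
    qed
    show "lampoly n \<subseteq> mv.span (\<Union>s. X s)"
    proof
      fix F assume F: "F \<in> lampoly n"
      have "Poly_Mapping.single e m \<in> mv.span (\<Union>s. X s)" if e: "Poly_Mapping.keys e \<subseteq> {..<n}" for e m
      proof -
        have "m \<in> M.span {dot (word u w) ((DM ^^ k) m) | w k m. set w \<subseteq> {..<N} \<times> UNIV \<and> m \<in> \<Gamma>}"
          using \<Gamma>(3) by simp
        then show ?thesis
        proof (induction rule: M.span_induct_alt)
          case base
          then show ?case by (simp add: mv.span_zero)
        next
          case (step c x y)
          then obtain w k m where x: "x = dot (word u w) ((DM ^^ k) m)" "set w \<subseteq> {..<N} \<times> UNIV" "m \<in> \<Gamma>" by blast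
          define s where "s = of_nat ((\<Sum>i<n. Poly_Mapping.lookup e i) + n + k) + wsum \<Delta> w + \<gamma> m"
          have "(e, w, k) \<in> A (s - \<gamma> m)" using e x(2) by (simp add: A_def s_def)
          then have "Poly_Mapping.single e x \<in> X s" unfolding X_def x(1) using x(3) by force
          then have "Poly_Mapping.single e x \<in> (\<Union>s. X s)" by blast
          from mv.span_add[OF mv.span_scale[OF mv.span_base[OF this], of c] step(2)] show ?case by (simp add: single_add)
        qed
      qed
      then have "(\<Sum>e\<in>Poly_Mapping.keys F. Poly_Mapping.single e (Poly_Mapping.lookup F e)) \<in> mv.span (\<Union>s. X s)"
        using F by (intro mv.span_sum) (auto simp: lampoly_def)
      then show "F \<in> mv.span (\<Union>s. X s)" by (simp flip: poly_mapping_eq_sum_single)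
    qed
  qed
qed

end

theorem theorem3p29:
  fixes scale :: "'f::field_char_0 \<Rightarrow> 'v::ring_1 \<Rightarrow> 'v" and part :: "bit \<Rightarrow> 'v set"
    and D :: "'v \<Rightarrow> 'v" and br :: "'v \<Rightarrow> 'v \<Rightarrow> 'v poly"
    and scaleM :: "'f \<Rightarrow> 'm::ab_group_add \<Rightarrow> 'm" and partM :: "bit \<Rightarrow> 'm set"
    and DM :: "'m \<Rightarrow> 'm" and act :: "'v \<Rightarrow> 'm \<Rightarrow> 'm poly" and dot :: "'v \<Rightarrow> 'm \<Rightarrow> 'm"
    and L :: 'v and N :: nat and par :: "nat \<Rightarrow> bit" and u :: "nat \<Rightarrow> 'v" and \<Delta> :: "nat \<Rightarrow> 'f"
  assumes "pva scale part D br"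
    and "pva.virasoro_element scale part D br L"
    and "pva.differential_polynomials scale part D N par u"
    and "\<forall>i<N. pva.has_conformal_weight scale br L (u i) (\<Delta> i)"
    and "positive_scalars (\<Delta> ` {..<N})"
    and "pva_module scale part D br scaleM partM DM act dot"
    and "pva_module.conformal_module scaleM DM act L"
    and "pva_module.differentially_finitely_generated DM dot"
  shows "\<forall>n. pva_module.finite_dim_cohomology scale part D br scaleM partM DM act dot n"
proof
  fix n
  interpret pva_module scale part D br scaleM partM DM act dot by fact
  show "finite_dim_cohomology n"
    using assms(5) unfolding positive_scalars_def
  proof
    assume "\<forall>x\<in>\<Delta> ` {..<N}. \<exists>r::rat. r > 0 \<and> x = of_rat r"
    then have "\<forall>i\<in>{..<N}. \<exists>r::rat. r > 0 \<and> \<Delta> i = of_rat r" by blast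
    from bchoice[OF this] obtain \<omega> :: "nat \<Rightarrow> rat"
      where "\<And>i. i < N \<Longrightarrow> \<omega> i > 0" "\<And>i. i < N \<Longrightarrow> \<Delta> i = of_rat (\<omega> i)" by auto
    then show ?thesis
      by (intro finite_dim_cohomology_of_positive_weights[OF assms(2,3) _ assms(7,8), where \<phi> = of_rat and \<omega> = \<omega>])
        (use assms(4) in \<open>auto simp: of_rat_add inj_def\<close>)
  next
    assume "\<exists>\<iota>::real \<Rightarrow> 'f. \<iota> 1 = 1 \<and> (\<forall>r s. \<iota> (r + s) = \<iota> r + \<iota> s) \<and> (\<forall>r s. \<iota> (r * s) = \<iota> r * \<iota> s)
        \<and> (\<forall>x\<in>\<Delta> ` {..<N}. \<exists>r>0. x = \<iota> r)"
    then obtain \<iota> :: "real \<Rightarrow> 'f" where \<iota>: "\<iota> 1 = 1" "\<And>r s. \<iota> (r + s) = \<iota> r + \<iota> s" "\<And>r s. \<iota> (r * s) = \<iota> r * \<iota> s"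
      and "\<forall>x\<in>\<Delta> ` {..<N}. \<exists>r>0. x = \<iota> r" by blast
    then have "\<forall>i\<in>{..<N}. \<exists>r>0. \<Delta> i = \<iota> r" by blast
    from bchoice[OF this] obtain \<omega> :: "nat \<Rightarrow> real"
      where \<omega>: "\<And>i. i < N \<Longrightarrow> \<omega> i > 0" "\<And>i. i < N \<Longrightarrow> \<Delta> i = \<iota> (\<omega> i)" by auto
    have "x = 0" if "\<iota> x = 0" for x
    proof (rule ccontr)
      assume "x \<noteq> 0"
      then have "\<iota> x * \<iota> (1 / x) = 1" using \<iota>(1) \<iota>(3)[of x "1 / x"] by simp
      with that show False by simp
    qed
    moreover have "\<iota> (x - y) = \<iota> x - \<iota> y" for x y
      using \<iota>(2)[of "x - y" y] by simp
    ultimately have "inj \<iota>"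
      by (metis injI eq_iff_diff_eq_0)
    then show ?thesis
      by (intro finite_dim_cohomology_of_positive_weights[OF assms(2,3) _ assms(7,8), where \<phi> = \<iota> and \<omega> = \<omega>])
        (use assms(4) \<iota> \<omega> in auto)
  qed
qed

end
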